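(* For $k\ge 3$, there exist $\zeta>0$ and $c>0$ such that for all $n$, \[|\mathcal I_1^*(n,\zeta)|\le 2^{\binom nk}+\exp_2\!\Big[(1-c)\tbinom nk\Big]+\sum_{i=1}^{k-2}\exp_2\!\Big[i(1-c)\tbinom n{k-1}\Big]|\mathcal I(n-i)|+\exp_2\!\Big[\tfrac k2(1-c)\tbinom n{k-1}\Big]|\mathcal I(n-k)|+\exp_2\!\Big[\tbinom nk-cn\Big].\] For $k=2$, there exist $\zeta>0$ and $c>0$ such that for all $n$, \[|\mathcal I_1^*(n,\zeta)|\le 2^{\binom nk}+2\exp_2\!\Big[(1-c)\tbinom nk\Big]+\exp_2\!\Big[\tfrac k2(1-c)\tbinom n{k-1}\Big]|\mathcal I(n-k)|.\]
   Context: $\exp_2[t]=2^t$. Clauses are conjunctions of $k$ literals ($x$ or $\overline x$) on $k$ distinct variables; a formula is a set of clauses. Minimal: every clause $C$ has a witness, an assignment satisfying $C$ and no other clause. $\mathcal I(n)$ is the set of minimal $k$-SAT formulae on variables $x_1,\dots,x_n$. For a formula $\Phi$ on $n$ variables and literal $v$, $m(v)$ is the number of occurrences of $v$ in $\Phi$. $\Phi$ is $\zeta$-nearly monotone if it has at most $\zeta n^k$ clauses containing a negative literal; $\zeta$-sparsely minimal if it is minimal and every clause has a witness with fewer than $\zeta n$ variables set to $1$; positive-dominant if $m(x)\ge m(\overline x)$ for every variable $x$; $\zeta'$-dense if every variable is used by at least $\zeta'\binom{n-1}{k-1}$ clauses. $\mathcal I_1^*(n,\zeta)$ is the set of minimal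 $k$-SAT formulae on $n$ variables that are $\zeta$-nearly monotone, $\zeta$-sparsely minimal, positive-dominant and $\frac1{10k}$-dense. *)

theory Defs
  imports Complex_Main
begin

datatype literal = Pos (var: nat) | Neg (var: nat)

type_synonym clause = "literal set"
type_synonym formula = "clause set"
type_synonym assignment = "nat \<Rightarrow> bool"

fun lit_true :: "assignment \<Rightarrow> literal \<Rightarrow> bool" where
  "lit_true a (Pos x) = a x"
| "lit_true a (Neg x) = (\<not> a x)"

text \<open>The variables of a formula on \<open>n\<close> variables are \<open>1, \<dots>, n\<close>. Injectivity of \<open>var\<close> on a
  clause says that its \<open>k\<close> literals are on \<open>k\<close> distinct variables.\<close>

definition clauses :: "nat \<Rightarrow> nat \<Rightarrow> clause set" where
  "clauses k n = {C. finite C \<and> card C = k \<and> inj_on var C \<and> var ` C \<subseteq> {1..n}}"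

definition formulae :: "nat \<Rightarrow> nat \<Rightarrow> formula set" where
  "formulae k n = Pow (clauses k n)"

text \<open>Clauses are conjunctions of literals.\<close>

definition satisfies :: "assignment \<Rightarrow> clause \<Rightarrow> bool" where
  "satisfies a C \<longleftrightarrow> (\<forall>l\<in>C. lit_true a l)"

definition witness :: "formula \<Rightarrow> clause \<Rightarrow> assignment \<Rightarrow> bool" where
  "witness \<Phi> C a \<longleftrightarrow> satisfies a C \<and> (\<forall>D\<in>\<Phi>. D \<noteq> C \<longrightarrow> \<not> satisfies a D)"

definition minimal :: "formula \<Rightarrow> bool" where
  "minimal \<Phi> \<longleftrightarrow> (\<forall>C\<in>\<Phi>. \<exists>a. witness \<Phi> C a)"

definition minimal_formulae :: "nat \<Rightarrow> nat \<Rightarrow> formula set" where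
  "minimal_formulae k n = {\<Phi> \<in> formulae k n. minimal \<Phi>}"

definition occurrences :: "formula \<Rightarrow> literal \<Rightarrow> nat" where
  "occurrences \<Phi> v = card {C \<in> \<Phi>. v \<in> C}"

definition nearly_monotone :: "nat \<Rightarrow> nat \<Rightarrow> real \<Rightarrow> formula \<Rightarrow> bool" where
  "nearly_monotone k n \<zeta> \<Phi> \<longleftrightarrow> real (card {C \<in> \<Phi>. \<exists>x. Neg x \<in> C}) \<le> \<zeta> * real n ^ k"

definition sparsely_minimal :: "nat \<Rightarrow> real \<Rightarrow> formula \<Rightarrow> bool" where
  "sparsely_minimal n \<zeta> \<Phi> \<longleftrightarrow> minimal \<Phi> \<and>
     (\<forall>C\<in>\<Phi>. \<exists>a. witness \<Phi> C a \<and> real (card {x \<in> {1..n}. a x}) < \<zeta> * real n)"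

definition positive_dominant :: "nat \<Rightarrow> formula \<Rightarrow> bool" where
  "positive_dominant n \<Phi> \<longleftrightarrow> (\<forall>x\<in>{1..n}. occurrences \<Phi> (Pos x) \<ge> occurrences \<Phi> (Neg x))"

definition dense_formula :: "nat \<Rightarrow> nat \<Rightarrow> real \<Rightarrow> formula \<Rightarrow> bool" where
  "dense_formula k n \<zeta> \<Phi> \<longleftrightarrow>
     (\<forall>x\<in>{1..n}. real (card {C \<in> \<Phi>. x \<in> var ` C}) \<ge> \<zeta> * real ((n - 1) choose (k - 1)))"

definition I1_star :: "nat \<Rightarrow> nat \<Rightarrow> real \<Rightarrow> formula set" where
  "I1_star k n \<zeta> = {\<Phi> \<in> minimal_formulae k n.
     nearly_monotone k n \<zeta> \<Phi> \<and> sparsely_minimal n \<zeta> \<Phi> \<and> positive_dominant n \<Phi> \<and>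
     dense_formula k n (1 / (10 * real k)) \<Phi>}"

definition exp2 :: "real \<Rightarrow> real" where
  "exp2 t = 2 powr t"

lemma finite_clauses: "finite (clauses k n)"
proof (rule finite_subset)
  have "l \<in> Pos ` {1..n} \<union> Neg ` {1..n}" if "var l \<in> {1..n}" for l
    using that by (cases l) auto
  then show "clauses k n \<subseteq> Pow (Pos ` {1..n} \<union> Neg ` {1..n})"
    unfolding clauses_def by blast
qed simp

lemma finite_minimal_formulae: "finite (minimal_formulae k n)"
  by (simp add: minimal_formulae_def formulae_def finite_clauses)

end

theory Submission
  imports Defs "HOL-Real_Asymp.Real_Asymp" "HOL-Library.Disjoint_Sets" "HOL-Library.Ramsey"
begin

text \<open>
  A clause with negated variables \<open>S\<close> and positive variables \<open>T\<close> rules out every positive clause \<open>C \<supseteq> T\<close>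
  such that each \<open>x \<in> S\<close> has a positive clause \<open>{x} \<union> Q\<close> with \<open>Q \<subseteq> C\<close>. If for some \<open>S\<close> a positive
  proportion of all \<open>k\<close>-sets is ruled out, the formula is one of \<open>exp2 ((1 - c) * (n choose k))\<close>;
  sparsity of witnesses makes the choice of the clauses with negative literals cheap.
  Otherwise, if some variable has a large negative link, if the common intersection of the positive
  links of some \<open>S\<close> is atypically thin, or if there is a clause with only negative literals, then the
  positive links of \<open>i \<le> k - 2\<close> (or of all \<open>k\<close>) of the variables involved are confined to an
  exponentially small proportion of the possible links; deleting these variables leaves a minimal
  formula on \<open>n - i\<close> variables. A clause with only negative literals whose links are pairwise
  incompatible costs \<open>k / 2\<close> links rather than \<open>k\<close>, because pairwise related \<open>k\<close>-tuples number at most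
  the \<open>k / 2\<close>-th power of the relation.
  In the remaining formulae every set \<open>T\<close> carrying a typical clause \<open>(S, T)\<close> with \<open>card S = i\<close> rules
  out of the order of \<open>n ^ i\<close> positive clauses, much more than the description of its clauses costs,
  and every atypical pair \<open>(S, T')\<close> saves of the order of \<open>n\<close>; one such set or pair already gains a
  factor \<open>exp2 (c * n)\<close>. For \<open>k = 2\<close> this gain is absorbed by the number of unate formulae on
  \<open>n - 2\<close> variables.
\<close>

section \<open>Counting families of subsets\<close>

lemma real_card_mono: "finite B \<Longrightarrow> A \<subseteq> B \<Longrightarrow> real (card A) \<le> real (card B)"
  by (simp add: card_mono)

lemma real_surj_card_le: "finite A \<Longrightarrow> B \<subseteq> f ` A \<Longrightarrow> real (card B) \<le> real (card A)"
  by (simp add: surj_card_le)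

lemma card_le_card_add: "finite B \<Longrightarrow> finite C \<Longrightarrow> A \<subseteq> B \<union> C \<Longrightarrow> card A \<le> card B + card C"
  by (meson card_Un_le card_mono finite_UnI order_trans)

lemma real_card_UN_le: "finite I \<Longrightarrow> real (card (\<Union>i\<in>I. A i)) \<le> (\<Sum>i\<in>I. real (card (A i)))"
  unfolding of_nat_sum[symmetric] of_nat_le_iff by (rule card_UN_le)

lemma real_card_UN_le_mult:
  assumes "finite I" "\<And>i. i \<in> I \<Longrightarrow> real (card (A i)) \<le> b" "real (card I) \<le> m" "b \<ge> 0"
  shows "real (card (\<Union>i\<in>I. A i)) \<le> m * b"
proof -
  have "real (card (\<Union>i\<in>I. A i)) \<le> (\<Sum>i\<in>I. real (card (A i)))"
    by (rule real_card_UN_le[OF assms(1)])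
  also have "\<dots> \<le> real (card I) * b" by (rule sum_bounded_above[OF assms(2)])
  also have "\<dots> \<le> m * b" using assms(3,4) by (rule mult_right_mono)
  finally show ?thesis .
qed

lemma real_card_le_Pow:
  assumes "finite X" "A \<subseteq> Pow X" "real (card X) \<le> x"
  shows "real (card A) \<le> 2 powr x"
proof -
  have "real (card A) \<le> real (card (Pow X))" using assms by (intro real_card_mono) auto
  also have "\<dots> = 2 powr real (card X)" using assms(1) by (simp add: card_Pow powr_realpow)
  also have "\<dots> \<le> 2 powr x" using assms(3) by simp
  finally show ?thesis .
qed

lemma card_image_Un_le:
  assumes "finite G" shows "card ((\<lambda>F. f F \<union> g F) ` G) \<le> card (f ` G) * card (g ` G)"
proof -
  have "(\<lambda>F. f F \<union> g F) ` G \<subseteq> (\<lambda>(A, B). A \<union> B) ` (f ` G \<times> g ` G)" by auto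
  then have "card ((\<lambda>F. f F \<union> g F) ` G) \<le> card (f ` G \<times> g ` G)"
    using assms by (intro surj_card_le) auto
  then show ?thesis by (simp add: card_cartesian_product)
qed

lemma card_image_UN_le:
  assumes "finite J" "finite G"
  shows "card ((\<lambda>F. \<Union>j\<in>J. p j F) ` G) \<le> (\<Prod>j\<in>J. card (p j ` G))"
  using assms(1)
proof (induction J rule: finite_induct)
  case empty
  then show ?case by (cases "G = {}") (auto simp: image_constant_conv)
next
  case (insert i J)
  have "card ((\<lambda>F. \<Union>j\<in>insert i J. p j F) ` G)
      \<le> card (p i ` G) * card ((\<lambda>F. \<Union>j\<in>J. p j F) ` G)"
    using card_image_Un_le[OF assms(2), of "p i" "\<lambda>F. \<Union>j\<in>J. p j F"] by simp
  also have "\<dots> \<le> card (p i ` G) * (\<Prod>j\<in>J. card (p j ` G))"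
    by (rule mult_left_mono[OF insert.IH]) simp
  finally show ?case using insert.hyps by simp
qed

lemma card_eq_sum_fibres:
  assumes "finite G" "finite P" "a ` G \<subseteq> P" shows "card G = (\<Sum>p\<in>P. card {F\<in>G. a F = p})"
  using sum.group[OF assms, of "\<lambda>_. 1::nat"] by simp

lemma card_fibres_le:
  assumes "finite G" "inj_on (\<lambda>F. (a F, b F)) G"
    and "\<And>N. N \<in> a ` G \<Longrightarrow> real (card (b ` {F\<in>G. a F = N})) \<le> m"
  shows "real (card G) \<le> real (card (a ` G)) * m"
proof -
  let ?Z = "SIGMA N:a ` G. b ` {F\<in>G. a F = N}"
  have "card G \<le> card ?Z"
    by (rule card_inj_on_le[OF assms(2)]) (use assms(1) in auto)
  also have "\<dots> = (\<Sum>N\<in>a ` G. card (b ` {F\<in>G. a F = N}))"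
    using assms(1) by (intro card_SigmaI) auto
  finally have "real (card G) \<le> (\<Sum>N\<in>a ` G. real (card (b ` {F\<in>G. a F = N})))"
    by (simp only: of_nat_sum[symmetric] of_nat_le_iff)
  also have "\<dots> \<le> real (card (a ` G)) * m" by (rule sum_bounded_above[OF assms(3)])
  finally show ?thesis .
qed

lemma finite_nsets [simp]: "finite V \<Longrightarrow> finite (nsets V r)"
  by (rule finite_imp_finite_nsets)

lemma real_choose_mono: "m \<le> n \<Longrightarrow> real (m choose r) \<le> real (n choose r)"
  by (simp add: binomial_right_mono)

lemma choose_le_power: "n choose r \<le> n ^ r"
  by (cases "r \<le> n") (simp_all add: binomial_le_pow binomial_eq_0)

lemma real_choose_le_power: "real (n choose r) \<le> real n ^ r"
  using choose_le_power[of n r] by (metis of_nat_le_iff of_nat_power)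

lemma power_eq_powr_log: "n \<ge> 1 \<Longrightarrow> real n ^ k = 2 powr (real k * log 2 (real n))"
  by (subst mult.commute) (simp add: powr_powr[symmetric] powr_realpow)

lemma real_card_nsets_subset_le:
  assumes "finite V" "A \<subseteq> nsets V r" shows "real (card A) \<le> real (card V) ^ r"
proof -
  have "real (card A) \<le> real (card (nsets V r))" using assms by (intro real_card_mono) auto
  also have "\<dots> \<le> real (card V) ^ r" unfolding card_nsets by (rule real_choose_le_power)
  finally show ?thesis .
qed

lemma power_one_plus_le_3:
  fixes x :: real
  assumes "0 \<le> x" "real m * x \<le> 1" shows "(1 + x) ^ m \<le> 3"
proof -
  have "(1 + x) ^ m \<le> exp x ^ m" using assms(1) by (intro power_mono exp_ge_add_one_self) auto
  also have "\<dots> = exp (real m * x)" by (simp add: exp_of_nat_mult)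
  also have "\<dots> \<le> exp 1" using assms(2) by simp
  also have "\<dots> \<le> 3" by (rule exp_le)
  finally show ?thesis .
qed

lemma sum_power_card_Pow:
  fixes l :: "'b :: comm_semiring_1"
  assumes "finite X" shows "(\<Sum>Y\<in>Pow X. l ^ card Y) = (1 + l) ^ card X"
  using prod_add[OF assms, of "\<lambda>_. l" "\<lambda>_. 1"] by (simp add: add.commute)

lemma card_subsets_of_card_le:
  assumes "finite X"
  shows "card {Y. Y \<subseteq> X \<and> card Y \<le> q} \<le> (card X + 1) ^ q"
proof (induction q)
  case 0
  have "{Y. Y \<subseteq> X \<and> card Y \<le> 0} = {{}}" using assms finite_subset by fastforce
  then show ?case by simp
next
  case (Suc q)
  let ?small = "\<lambda>q. {Y. Y \<subseteq> X \<and> card Y \<le> q}"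
  have fin: "finite (?small q)" using assms by simp
  have "?small (Suc q) \<subseteq> ?small q \<union> (\<lambda>(Y, x). insert x Y) ` (?small q \<times> X)"
  proof
    fix Y assume Y: "Y \<in> ?small (Suc q)"
    show "Y \<in> ?small q \<union> (\<lambda>(Y, x). insert x Y) ` (?small q \<times> X)"
    proof (cases "Y = {}")
      case False
      then obtain y where y: "y \<in> Y" by auto
      then have "(Y - {y}, y) \<in> ?small q \<times> X"
        using Y finite_subset[OF _ assms, of Y] by (auto simp: card_Diff_singleton)
      moreover have "Y = (\<lambda>(Y, x). insert x Y) (Y - {y}, y)" using y by auto
      ultimately show ?thesis by blast
    qed auto
  qed
  then have "card (?small (Suc q)) \<le> card (?small q) + card ((\<lambda>(Y, x). insert x Y) ` (?small q \<times> X))"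
    using fin assms by (intro card_le_card_add) auto
  also have "\<dots> \<le> card (?small q) + card (?small q \<times> X)"
    using fin assms by (intro add_left_mono card_image_le) auto
  also have "\<dots> = card (?small q) * (card X + 1)" by (simp add: card_cartesian_product)
  also have "\<dots> \<le> (card X + 1) ^ q * (card X + 1)" using Suc by (intro mult_right_mono) auto
  finally show ?case by (simp add: algebra_simps)
qed

lemma card_subsets_split:
  assumes "finite X" "B \<subseteq> X"
  shows "card {Y. Y \<subseteq> X \<and> P (Y \<inter> B) (Y - B)} = (\<Sum>Z\<in>Pow B. card {Y. Y \<subseteq> X - B \<and> P Z Y})"
proof -
  let ?S = "SIGMA Z:Pow B. {Y. Y \<subseteq> X - B \<and> P Z Y}"
  have "bij_betw (\<lambda>Y. (Y \<inter> B, Y - B)) {Y. Y \<subseteq> X \<and> P (Y \<inter> B) (Y - B)} ?S"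
  proof (rule bij_betw_byWitness[where f' = "\<lambda>(Z, Y). Z \<union> Y"])
    have "P ((Z \<union> Y) \<inter> B) (Z \<union> Y - B)" if "Z \<subseteq> B" "Y \<subseteq> X - B" "P Z Y" for Z Y
    proof -
      have "(Z \<union> Y) \<inter> B = Z" "Z \<union> Y - B = Y" using that by auto
      then show ?thesis using that(3) by simp
    qed
    then show "(\<lambda>(Z, Y). Z \<union> Y) ` ?S \<subseteq> {Y. Y \<subseteq> X \<and> P (Y \<inter> B) (Y - B)}" using assms(2) by auto
  qed auto
  then have "card {Y. Y \<subseteq> X \<and> P (Y \<inter> B) (Y - B)} = card ?S" by (rule bij_betw_same_card)
  also have "\<dots> = (\<Sum>Z\<in>Pow B. card {Y. Y \<subseteq> X - B \<and> P Z Y})"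
    using assms finite_subset[OF assms(2,1)] by (intro card_SigmaI) auto
  finally show ?thesis .
qed

lemma card_sublevel_le:
  fixes f :: "'a \<Rightarrow> nat" and l t :: real
  assumes "finite A" "0 < l" "l \<le> 1"
  shows "real (card {y\<in>A. real (f y) \<le> t}) \<le> (\<Sum>y\<in>A. l ^ f y) * l powr (- t)"
proof -
  let ?L = "{y\<in>A. real (f y) \<le> t}"
  have "real (card ?L) * l powr t = (\<Sum>y\<in>?L. l powr t)" by simp
  also have "\<dots> \<le> (\<Sum>y\<in>?L. l ^ f y)"
    using assms(2,3) by (intro sum_mono) (auto simp: powr_realpow[symmetric] intro: powr_mono')
  also have "\<dots> \<le> (\<Sum>y\<in>A. l ^ f y)" using assms by (intro sum_mono2) auto
  finally show ?thesis using assms(2) by (simp add: powr_minus field_simps)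
qed

text \<open>The factor that makes Markov's inequality for the weights \<open>l ^ card Y\<close>, with
  \<open>l = min (e / 4) (1 / 2)\<close>, yield \<open>card_thin_subsets\<close>.\<close>

definition thin :: "real \<Rightarrow> real" where
  "thin e = e / 2 / log 2 (1 / min (e / 4) (1 / 2))"

lemma thin_pos: assumes "e > 0" shows "thin e > 0"
proof -
  have "log 2 (1 / min (e / 4) (1 / 2)) > 0"
    using assms by (subst zero_less_log_cancel_iff) (auto simp: field_simps min_def)
  then show ?thesis using assms by (simp add: thin_def)
qed

lemma card_thin_subsets:
  assumes "e > 0" "finite X" "real (card X) \<le> M"
  shows "real (card {Y. Y \<subseteq> X \<and> real (card Y) \<le> thin e * M}) \<le> 2 powr (e * M)"
proof -
  define l :: real where "l = min (e / 4) (1 / 2)"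
  have l: "0 < l" "l \<le> 1 / 2" "l \<le> e / 4" using assms by (auto simp: l_def)
  have weight_le: "(1 + l) ^ card X \<le> 2 powr (e / 2 * M)"
  proof -
    have "1 + l \<le> exp l" by (rule exp_ge_add_one_self)
    also have "l \<le> e / 2 * (1 / 2)" using l(3) by simp
    also have "\<dots> \<le> e / 2 * ln 2"
      using assms(1) ln_le_minus_one[of "1 / 2 :: real"] by (intro mult_left_mono) (auto simp: ln_div)
    finally have "1 + l \<le> 2 powr (e / 2)" by (simp add: powr_def)
    then have "(1 + l) ^ card X \<le> (2 powr (e / 2)) ^ card X" using l(1) by (intro power_mono) auto
    also have "\<dots> = 2 powr (e / 2 * real (card X))" by (simp add: powr_power mult.commute)
    also have "\<dots> \<le> 2 powr (e / 2 * M)"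
      using assms(1,3) by (intro powr_mono mult_left_mono) auto
    finally show ?thesis .
  qed
  have penalty: "l powr (- (thin e * M)) = 2 powr (e / 2 * M)"
  proof -
    have "log 2 (1 / l) > 0" using l by (subst zero_less_log_cancel_iff) (auto simp: field_simps)
    then have "e / 2 * M = - log 2 (1 / l) * (- (thin e * M))"
      by (simp add: thin_def l_def[symmetric])
    moreover have "l = 2 powr (- log 2 (1 / l))" using l by (simp add: log_divide powr_minus)
    ultimately show ?thesis by (metis powr_powr)
  qed
  have "real (card {Y\<in>Pow X. real (card Y) \<le> thin e * M})
      \<le> (\<Sum>Y\<in>Pow X. l ^ card Y) * l powr (- (thin e * M))"
    using assms(2) l by (intro card_sublevel_le) auto
  also have "\<dots> \<le> 2 powr (e / 2 * M) * 2 powr (e / 2 * M)"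
    unfolding penalty sum_power_card_Pow[OF assms(2)] using weight_le by (intro mult_right_mono) auto
  also have "\<dots> = 2 powr (e * M)" by (simp add: powr_add[symmetric] mult.commute)
  finally show ?thesis by (simp add: Pow_def)
qed

lemma card_nearly_within:
  assumes "e > 0" "finite X" "real (card X) \<le> M"
  shows "real (card {Y. Y \<subseteq> X \<and> real (card (Y - Z)) \<le> thin e * M})
    \<le> 2 powr (real (card (X \<inter> Z)) + e * M)"
proof -
  have "{Y. Y \<subseteq> X \<and> real (card (Y - Z)) \<le> thin e * M}
      = {Y. Y \<subseteq> X \<and> real (card (Y - X \<inter> Z)) \<le> thin e * M}"
    by (intro Collect_cong conj_cong arg_cong[where f = "\<lambda>A. real (card A) \<le> _"]) auto
  then have "real (card {Y. Y \<subseteq> X \<and> real (card (Y - Z)) \<le> thin e * M})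
      = (\<Sum>_\<in>Pow (X \<inter> Z). real (card {Y. Y \<subseteq> X - X \<inter> Z \<and> real (card Y) \<le> thin e * M}))"
    using card_subsets_split[OF assms(2), of "X \<inter> Z" "\<lambda>_ Y. real (card Y) \<le> thin e * M"] by simp
  also have "\<dots> \<le> (\<Sum>_\<in>Pow (X \<inter> Z). 2 powr (e * M))"
  proof (intro sum_mono card_thin_subsets[OF assms(1)])
    have "card (X - X \<inter> Z) \<le> card X" using assms(2) by (intro card_mono) auto
    then show "real (card (X - X \<inter> Z)) \<le> M" using assms(3) by linarith
  qed (use assms(2) in simp)
  also have "\<dots> = 2 powr (real (card (X \<inter> Z)) + e * M)"
    using assms(2) by (simp add: card_Pow powr_add powr_realpow del: Pow_Int_eq)
  finally show ?thesis .
qed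

lemma card_avoiding:
  fixes g :: real
  assumes "finite X" "B \<subseteq> X" "\<And>Z. Z \<subseteq> B \<Longrightarrow> f Z \<subseteq> X - B"
  shows "real (card {Y. Y \<subseteq> X \<and> Y \<inter> f (Y \<inter> B) = {} \<and> g \<le> real (card (f (Y \<inter> B)))})
    \<le> 2 powr (real (card X) - g)"
proof -
  have finB: "finite B" by (rule finite_subset[OF assms(2,1)])
  have card_X: "real (card X) = real (card B) + real (card (X - B))"
    using assms(1,2) finB by (simp add: card_Diff_subset card_mono of_nat_diff)
  have fibre: "real (card {Y. Y \<subseteq> X - B \<and> Y \<inter> f Z = {} \<and> g \<le> real (card (f Z))})
      \<le> 2 powr (real (card (X - B)) - g)" if Z: "Z \<in> Pow B" for Z
  proof (cases "g \<le> real (card (f Z))")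
    case True
    have "f Z \<subseteq> X - B" using assms(3) Z by auto
    then have "real (card (X - B - f Z)) = real (card (X - B)) - real (card (f Z))"
      using assms(1) by (simp add: card_Diff_subset finite_subset card_mono of_nat_diff)
    then show ?thesis using assms(1) True by (intro real_card_le_Pow[of "X - B - f Z"]) auto
  qed simp
  have "{Y. Y \<subseteq> X \<and> Y \<inter> f (Y \<inter> B) = {} \<and> g \<le> real (card (f (Y \<inter> B)))}
      = {Y. Y \<subseteq> X \<and> (Y - B) \<inter> f (Y \<inter> B) = {} \<and> g \<le> real (card (f (Y \<inter> B)))}"
  proof (intro Collect_cong conj_cong refl)
    fix Y
    have "f (Y \<inter> B) \<inter> B = {}" using assms(3)[of "Y \<inter> B"] by blast
    then show "Y \<inter> f (Y \<inter> B) = {} \<longleftrightarrow> (Y - B) \<inter> f (Y \<inter> B) = {}" by blast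
  qed
  then have "real (card {Y. Y \<subseteq> X \<and> Y \<inter> f (Y \<inter> B) = {} \<and> g \<le> real (card (f (Y \<inter> B)))})
      = (\<Sum>Z\<in>Pow B. real (card {Y. Y \<subseteq> X - B \<and> Y \<inter> f Z = {} \<and> g \<le> real (card (f Z))}))"
    using card_subsets_split[OF assms(1,2), of "\<lambda>Z Y. Y \<inter> f Z = {} \<and> g \<le> real (card (f Z))"] by simp
  also have "\<dots> \<le> real (card (Pow B)) * 2 powr (real (card (X - B)) - g)"
    by (rule sum_bounded_above[OF fibre])
  also have "\<dots> = 2 powr (real (card X) - g)"
    using finB by (simp add: card_X card_Pow powr_realpow[symmetric] powr_add[symmetric] algebra_simps)
  finally show ?thesis .
qed

lemma card_block_constraints:
  fixes g :: real
  assumes "finite I" "finite X" "\<forall>p\<in>I. B p \<subseteq> X" "disjoint_family_on B I"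
    and "\<forall>p\<in>I. real (card {Y. Y \<subseteq> B p \<and> P p Y}) \<le> 2 powr (real (card (B p)) - g)"
  shows "real (card {Y. Y \<subseteq> X \<and> (\<forall>p\<in>I. P p (Y \<inter> B p))}) \<le> 2 powr (real (card X) - g * real (card I))"
  using assms
proof (induction I arbitrary: X rule: finite_induct)
  case empty
  then show ?case by (simp add: card_Pow[unfolded Pow_def] powr_realpow)
next
  case (insert i I)
  let ?block = "{Z. Z \<subseteq> B i \<and> P i Z}"
  let ?rest = "{Y. Y \<subseteq> X - B i \<and> (\<forall>p\<in>I. P p (Y \<inter> B p))}"
  have Bi: "B i \<subseteq> X" "finite (B i)" using insert.prems(1,2) finite_subset by auto
  have disjoint: "B p \<inter> B i = {}" if "p \<in> I" for p
    using insert.prems(3) insert.hyps(2) that by (auto simp: disjoint_family_on_def)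
  have IH: "real (card ?rest) \<le> 2 powr (real (card (X - B i)) - g * real (card I))"
  proof (rule insert.IH)
    show "\<forall>p\<in>I. B p \<subseteq> X - B i" using insert.prems(2) disjoint by blast
    show "disjoint_family_on B I" using insert.prems(3) by (auto simp: disjoint_family_on_def)
  qed (use insert.prems in auto)
  have "{Y. Y \<subseteq> X \<and> (\<forall>p\<in>insert i I. P p (Y \<inter> B p))}
      = {Y. Y \<subseteq> X \<and> P i (Y \<inter> B i) \<and> (\<forall>p\<in>I. P p ((Y - B i) \<inter> B p))}"
  proof -
    have "(Y - B i) \<inter> B p = Y \<inter> B p" if "p \<in> I" for p Y using disjoint[OF that] by blast
    then show ?thesis by auto
  qed
  then have "card {Y. Y \<subseteq> X \<and> (\<forall>p\<in>insert i I. P p (Y \<inter> B p))}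
      = (\<Sum>Z\<in>Pow (B i). card {Y. Y \<subseteq> X - B i \<and> P i Z \<and> (\<forall>p\<in>I. P p (Y \<inter> B p))})"
    using card_subsets_split[OF insert.prems(1) Bi(1),
        of "\<lambda>Z Y. P i Z \<and> (\<forall>p\<in>I. P p (Y \<inter> B p))"] by simp
  also have "\<dots> = (\<Sum>Z\<in>Pow (B i). if P i Z then card ?rest else 0)"
    by (intro sum.cong refl) auto
  also have "\<dots> = card ?block * card ?rest" using Bi(2) by (simp add: sum.If_cases Int_def)
  finally have "real (card {Y. Y \<subseteq> X \<and> (\<forall>p\<in>insert i I. P p (Y \<inter> B p))})
      = real (card ?block) * real (card ?rest)" by simp
  also have "\<dots> \<le> 2 powr (real (card (B i)) - g) * 2 powr (real (card (X - B i)) - g * real (card I))"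
    using insert.prems(4) IH by (intro mult_mono) auto
  also have "\<dots> = 2 powr (real (card X) - g * real (card (insert i I)))"
  proof -
    have "card X = card (B i) + card (X - B i)"
      using insert.prems(1) Bi card_mono[of X "B i"] by (simp add: card_Diff_subset)
    then show ?thesis using insert.hyps by (simp add: powr_add[symmetric] algebra_simps)
  qed
  finally show ?case .
qed

text \<open>Subsets of \<open>S \<times> K\<close> code families of \<open>i = card S\<close> subsets of \<open>K\<close>. Weighting the full pattern at a
  point by \<open>1 / 2\<close> leaves \<open>2 ^ i - 1 / 2\<close> of the \<open>2 ^ i\<close> patterns, a gain of \<open>2 * tuple_gain i\<close> per
  point, half of which pays for passing from the weighted sum to the number of families.\<close>

definition tuple_gain :: "nat \<Rightarrow> real" where
  "tuple_gain i = - log 2 (1 - 1 / 2 ^ (i + 1)) / 2"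

lemma tuple_gain_base_bounds: "0 < 1 - 1 / (2::real) ^ (i + 1)" "1 - 1 / (2::real) ^ (i + 1) < 1"
  using one_less_power[of "2::real" "i + 1"] by (auto simp: field_simps)

lemma tuple_gain_pos: "tuple_gain i > 0"
proof -
  have "log 2 (1 - 1 / 2 ^ (i + 1)) < 0"
    using tuple_gain_base_bounds[of i] by (subst log_less_zero_cancel_iff) auto
  then show ?thesis by (simp add: tuple_gain_def)
qed

lemma tuple_gain_antimono:
  assumes "i \<le> j" shows "tuple_gain j \<le> tuple_gain i"
proof -
  have "1 / (2::real) ^ (j + 1) \<le> 1 / 2 ^ (i + 1)"
    using assms by (intro divide_left_mono power_increasing) auto
  then have "log 2 (1 - 1 / 2 ^ (i + 1)) \<le> log 2 (1 - 1 / 2 ^ (j + 1))"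
    using tuple_gain_base_bounds(1)[of i] tuple_gain_base_bounds(1)[of j] by (subst log_le_cancel_iff) auto
  then show ?thesis by (simp add: tuple_gain_def)
qed

lemma sum_power_card_full_fibres:
  fixes u :: real
  assumes "finite S" "finite K" "Q \<subseteq> K"
  shows "(\<Sum>Y\<in>Pow (S \<times> K). u ^ card {q\<in>Q. \<forall>x\<in>S. (x, q) \<in> Y})
    = (2 ^ card S - 1 + u) ^ card Q * (2 ^ card S) ^ card (K - Q)"
proof -
  let ?w = "\<lambda>q Z. if q \<in> Q \<and> Z = S then u else 1"
  have pattern_sum: "(\<Sum>Z\<in>Pow S. ?w q Z) = (if q \<in> Q then 2 ^ card S - 1 + u else 2 ^ card S)" for q
  proof -
    have "(\<Sum>Z\<in>Pow S. ?w q Z) = ?w q S + (\<Sum>Z\<in>Pow S - {S}. ?w q Z)"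
      using assms(1) by (intro sum.remove) auto
    also have "(\<Sum>Z\<in>Pow S - {S}. ?w q Z) = (\<Sum>Z\<in>Pow S - {S}. 1)" by (intro sum.cong) auto
    finally show ?thesis using assms(1) by (simp add: card_Diff_singleton card_Pow of_nat_diff)
  qed
  have "(\<Sum>Y\<in>Pow (S \<times> K). u ^ card {q\<in>Q. \<forall>x\<in>S. (x, q) \<in> Y})
      = (\<Sum>f\<in>PiE K (\<lambda>_. Pow S). \<Prod>q\<in>K. ?w q (f q))"
  proof (rule sum.reindex_bij_witness[where i = "\<lambda>f. {(x, q). q \<in> K \<and> x \<in> f q}"
        and j = "\<lambda>Y. \<lambda>q\<in>K. {x. (x, q) \<in> Y}"])
    fix Y assume Y: "Y \<in> Pow (S \<times> K)"
    have "(\<Prod>q\<in>K. ?w q ((\<lambda>q\<in>K. {x. (x, q) \<in> Y}) q)) = (\<Prod>q\<in>K. if q \<in> {q\<in>Q. \<forall>x\<in>S. (x, q) \<in> Y} then u else 1)"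
      using Y by (intro prod.cong) auto
    also have "\<dots> = u ^ card {q\<in>Q. \<forall>x\<in>S. (x, q) \<in> Y}"
      using assms(2,3) by (subst prod.If_cases) (auto intro!: arg_cong[where f = "\<lambda>A. u ^ card A"])
    finally show "(\<Prod>q\<in>K. ?w q ((\<lambda>q\<in>K. {x. (x, q) \<in> Y}) q)) = u ^ card {q\<in>Q. \<forall>x\<in>S. (x, q) \<in> Y}" .
  qed (auto simp: PiE_iff restrict_def fun_eq_iff extensional_def)
  also have "\<dots> = (\<Prod>q\<in>K. \<Sum>Z\<in>Pow S. ?w q Z)"
    using assms(1,2) by (intro prod_sum_PiE[symmetric]) auto
  also have "\<dots> = (\<Prod>q\<in>K. if q \<in> Q then 2 ^ card S - 1 + u else 2 ^ card S)"
    by (simp only: pattern_sum)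
  also have "\<dots> = (2 ^ card S - 1 + u) ^ card Q * (2 ^ card S) ^ card (K - Q)"
    using assms(2,3) by (simp add: prod.If_cases Int_absorb1 Diff_eq)
  finally show ?thesis .
qed

lemma card_thin_intersections:
  assumes "finite S" "finite K" "Q \<subseteq> K"
  shows "real (card {Y. Y \<subseteq> S \<times> K \<and>
      real (card {q\<in>Q. \<forall>x\<in>S. (x, q) \<in> Y}) \<le> tuple_gain (card S) * real (card Q)})
    \<le> 2 powr (real (card S) * real (card K) - tuple_gain (card S) * real (card Q))"
proof -
  let ?i = "card S" and ?g = "tuple_gain (card S)" and ?q = "real (card Q)"
  let ?full = "\<lambda>Y. card {q\<in>Q. \<forall>x\<in>S. (x, q) \<in> Y}"
  define base :: real where "base = 1 - 1 / 2 ^ (?i + 1)"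
  have base: "base = 2 powr (- 2 * ?g)"
    using tuple_gain_base_bounds(1)[of ?i] by (simp add: tuple_gain_def base_def)
  have split: "2 ^ ?i - 1 + 1 / 2 = base * 2 ^ ?i" by (simp add: base_def field_simps)
  have "(\<Sum>Y\<in>Pow (S \<times> K). (1 / 2 :: real) ^ ?full Y)
      = base ^ card Q * ((2 ^ ?i) ^ card Q * (2 ^ ?i) ^ card (K - Q))"
    unfolding sum_power_card_full_fibres[OF assms] split by (simp add: power_mult_distrib)
  also have "(2 ^ ?i) ^ card Q * (2 ^ ?i) ^ card (K - Q) = (2 ^ ?i :: real) ^ card K"
    using card_mono[OF assms(2,3)] finite_subset[OF assms(3,2)] assms(3)
    by (simp add: power_add[symmetric] card_Diff_subset)
  also have "\<dots> = 2 powr (real ?i * real (card K))"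
    by (simp add: powr_realpow[symmetric] powr_powr)
  also have "base ^ card Q = 2 powr (- 2 * ?g * ?q)" by (simp add: base powr_power mult.commute)
  finally have weights: "(\<Sum>Y\<in>Pow (S \<times> K). (1 / 2 :: real) ^ ?full Y)
      = 2 powr (- 2 * ?g * ?q) * 2 powr (real ?i * real (card K))" .
  have "real (card {Y\<in>Pow (S \<times> K). real (?full Y) \<le> ?g * ?q})
      \<le> (\<Sum>Y\<in>Pow (S \<times> K). (1 / 2) ^ ?full Y) * (1 / 2) powr (- (?g * ?q))"
    using assms(1,2) by (intro card_sublevel_le) auto
  also have "(1 / 2 :: real) powr (- (?g * ?q)) = 2 powr (?g * ?q)"
    by (simp add: powr_divide powr_minus_divide)
  also have "(\<Sum>Y\<in>Pow (S \<times> K). (1 / 2) ^ ?full Y) * 2 powr (?g * ?q)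
      = 2 powr (real ?i * real (card K) - ?g * ?q)"
    unfolding weights powr_add[symmetric] by (simp add: algebra_simps)
  finally show ?thesis by (simp add: Pow_def)
qed

lemma card_separating_sets:
  assumes "finite V" "T \<subseteq> V" "S \<subseteq> V" "S \<inter> T = {}"
  shows "card {A. A \<subseteq> V \<and> T \<subseteq> A \<and> S \<inter> A = {}} = 2 ^ (card V - card T - card S)"
proof -
  have "bij_betw (\<lambda>A. A \<union> T) (Pow (V - T - S)) {A. A \<subseteq> V \<and> T \<subseteq> A \<and> S \<inter> A = {}}"
    by (rule bij_betw_byWitness[where f' = "\<lambda>A. A - T"]) (use assms in auto)
  then have "card {A. A \<subseteq> V \<and> T \<subseteq> A \<and> S \<inter> A = {}} = 2 ^ card (V - T - S)"
    using assms(1) by (simp add: bij_betw_same_card[symmetric] card_Pow)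
  moreover have "S \<subseteq> V - T" "finite S" "finite T" using assms by (auto intro: finite_subset)
  ultimately show ?thesis using assms(2) by (simp add: card_Diff_subset)
qed

lemma exists_ge_average:
  fixes f :: "'b \<Rightarrow> real"
  assumes "finite A" "A \<noteq> {}" "real (card A) * c \<le> sum f A"
  shows "\<exists>x\<in>A. c \<le> f x"
proof (rule ccontr)
  assume "\<not> (\<exists>x\<in>A. c \<le> f x)"
  then have "sum f A < real (card A) * c"
    using assms(1,2) by (intro sum_bounded_above_strict) (auto simp: card_gt_0_iff)
  then show False using assms(3) by simp
qed

lemma exists_separating:
  assumes "finite V" "finite Z"
    and "\<And>z. z \<in> Z \<Longrightarrow> T z \<subseteq> V \<and> S z \<subseteq> V \<and> S z \<inter> T z = {} \<and> card (T z) + card (S z) = k"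
  shows "\<exists>A\<subseteq>V. real (card Z) / 2 ^ k \<le> real (card {z\<in>Z. T z \<subseteq> A \<and> S z \<inter> A = {}})"
proof -
  let ?sep = "\<lambda>A z. T z \<subseteq> A \<and> S z \<inter> A = {}"
  have count: "real (card {A\<in>Pow V. ?sep A z}) = 2 ^ card V / 2 ^ k" if z: "z \<in> Z" for z
  proof -
    note z = assms(3)[OF z]
    have fin: "finite (T z)" "finite (S z)" using z finite_subset[OF _ assms(1)] by auto
    then have "k = card (T z \<union> S z)" using z by (subst card_Un_disjoint) auto
    also have "\<dots> \<le> card V" using assms(1) z by (intro card_mono) auto
    finally have "k \<le> card V" .
    moreover have "card {A\<in>Pow V. ?sep A z} = 2 ^ (card V - card (T z) - card (S z))"
      using card_separating_sets[OF assms(1), of "T z" "S z"] z by simp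
    moreover have "card V - card (T z) - card (S z) = card V - k" using z by linarith
    ultimately have "card {A\<in>Pow V. ?sep A z} = 2 ^ (card V - k)" by simp
    then have "real (card {A\<in>Pow V. ?sep A z}) = 2 ^ (card V - k)" by simp
    also have "\<dots> = 2 ^ card V / 2 ^ k" using \<open>k \<le> card V\<close> by (intro power_diff) auto
    finally show ?thesis .
  qed
  have "real (card (Pow V)) * (real (card Z) / 2 ^ k) = (\<Sum>z\<in>Z. real (card {A\<in>Pow V. ?sep A z}))"
    using assms(1) count by (simp add: card_Pow)
  also have "\<dots> = (\<Sum>z\<in>Z. \<Sum>A\<in>Pow V. if ?sep A z then 1 else 0)"
    using assms(1) by (simp add: sum.If_cases Int_def)
  also have "\<dots> = (\<Sum>A\<in>Pow V. \<Sum>z\<in>Z. if ?sep A z then 1 else 0)" by (rule sum.swap)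
  also have "\<dots> = (\<Sum>A\<in>Pow V. real (card {z\<in>Z. ?sep A z}))"
    using assms(2) by (simp add: sum.If_cases Int_def)
  finally have "\<exists>A\<in>Pow V. real (card Z) / 2 ^ k \<le> real (card {z\<in>Z. ?sep A z})"
    using assms(1) by (intro exists_ge_average) auto
  then show ?thesis by blast
qed

lemma exists_containing:
  assumes "finite V" "finite A" "A \<noteq> {}" "\<And>p. p \<in> A \<Longrightarrow> Y p \<subseteq> V \<and> card (Y p) = m"
    and "2 * real m \<le> real (card V)" "V \<noteq> {}"
  shows "\<exists>W\<subseteq>V. real (card A) / 2 ^ (m + 2) \<le> real (card {p\<in>A. Y p \<subseteq> W}) \<and>
    real (card V) / 2 ^ (m + 2) \<le> real (card (V - W))"
proof -
  let ?n = "real (card V)" and ?a = "real (card A)"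
  let ?Z = "SIGMA p:A. V - Y p"
  obtain W where W: "W \<subseteq> V"
    and "real (card ?Z) / 2 ^ (m + 1) \<le> real (card {z\<in>?Z. Y (fst z) \<subseteq> W \<and> {snd z} \<inter> W = {}})"
    using exists_separating[of V ?Z "\<lambda>z. Y (fst z)" "\<lambda>z. {snd z}" "m + 1"] assms(1,2,4) by auto
  moreover have "{z\<in>?Z. Y (fst z) \<subseteq> W \<and> {snd z} \<inter> W = {}} = {p\<in>A. Y p \<subseteq> W} \<times> (V - W)" by auto
  moreover have "?a * (?n / 2) \<le> real (card ?Z)"
  proof -
    have "card (V - Y p) = card V - m" if "p \<in> A" for p
      using assms(1) assms(4)[OF that] by (simp add: card_Diff_subset finite_subset[of "Y p" V])
    then have "card ?Z = card A * (card V - m)" using assms(1,2) by (simp add: card_SigmaI)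
    moreover have "?n / 2 \<le> real (card V - m)" using assms(5) by simp
    ultimately show ?thesis using mult_left_mono[of "?n / 2" "real (card V - m)" ?a] by simp
  qed
  ultimately have product: "?a * ?n / 2 ^ (m + 2) \<le> real (card {p\<in>A. Y p \<subseteq> W}) * real (card (V - W))"
    by (simp add: card_cartesian_product divide_simps mult_ac)
  have pos: "?a > 0" "?n > 0" using assms(1-3,6) by (auto simp: card_gt_0_iff)
  have "real (card {p\<in>A. Y p \<subseteq> W}) * real (card (V - W)) \<le> real (card {p\<in>A. Y p \<subseteq> W}) * ?n"
    using assms(1) by (intro mult_left_mono real_card_mono) auto
  then have "?a / 2 ^ (m + 2) * ?n \<le> real (card {p\<in>A. Y p \<subseteq> W}) * ?n" using product by simp
  then have "?a / 2 ^ (m + 2) \<le> real (card {p\<in>A. Y p \<subseteq> W})" using pos(2) by (rule mult_right_le_imp_le)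
  moreover have "real (card {p\<in>A. Y p \<subseteq> W}) * real (card (V - W)) \<le> real (card (V - W)) * ?a"
    using assms(2) by (subst mult.commute) (intro mult_left_mono real_card_mono, auto)
  then have "?n / 2 ^ (m + 2) * ?a \<le> real (card (V - W)) * ?a" using product by (simp add: mult.commute)
  then have "?n / 2 ^ (m + 2) \<le> real (card (V - W))" using pos(1) by (rule mult_right_le_imp_le)
  ultimately show ?thesis using W by blast
qed

lemma greedy_independent_set:
  assumes "finite A" and "\<And>x y. conf x y \<Longrightarrow> conf y x"
    and "\<And>x. x \<in> A \<Longrightarrow> conf x x" and "\<And>x. x \<in> A \<Longrightarrow> card {y\<in>A. conf x y} \<le> d"
  shows "\<exists>I\<subseteq>A. (\<forall>x\<in>I. \<forall>y\<in>I. x \<noteq> y \<longrightarrow> \<not> conf x y) \<and> card A \<le> d * card I"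
  using assms(1,3,4)
proof (induction "card A" arbitrary: A rule: less_induct)
  case less
  show ?case
  proof (cases "A = {}")
    case False
    then obtain a where a: "a \<in> A" by auto
    let ?N = "{y\<in>A. conf a y}"
    have aN: "a \<in> ?N" using a less.prems by auto
    have lt: "card (A - ?N) < card A" using a aN less.prems(1) by (intro psubset_card_mono) auto
    have "card {y\<in>A - ?N. conf x y} \<le> d" if "x \<in> A - ?N" for x
    proof -
      have "card {y\<in>A - ?N. conf x y} \<le> card {y\<in>A. conf x y}"
        using less.prems(1) by (intro card_mono) auto
      then show ?thesis using less.prems(3)[of x] that by force
    qed
    then obtain I where I: "I \<subseteq> A - ?N" "\<forall>x\<in>I. \<forall>y\<in>I. x \<noteq> y \<longrightarrow> \<not> conf x y"
        "card (A - ?N) \<le> d * card I"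
      using less.hyps[OF lt] less.prems by blast
    have "finite I" using I(1) less.prems(1) finite_subset by blast
    moreover have "a \<notin> I" using I(1) aN by blast
    moreover have "card A = card ?N + card (A - ?N)"
      using less.prems(1) by (subst card_Un_disjoint[symmetric]) (auto intro: arg_cong[of _ _ card])
    ultimately have "card A \<le> d * card (insert a I)" using I(3) less.prems(3)[OF a] by simp
    moreover have "\<forall>x\<in>insert a I. \<forall>y\<in>insert a I. x \<noteq> y \<longrightarrow> \<not> conf x y"
      using I assms(2) by blast
    moreover have "insert a I \<subseteq> A" using I a by blast
    ultimately show ?thesis by blast
  qed auto
qed

lemma sum_card_joins_le:
  assumes "finite Ts" "\<And>T. T \<in> Ts \<Longrightarrow> finite (G T)"
    and "\<And>T R. T \<in> Ts \<Longrightarrow> R \<in> G T \<Longrightarrow> R \<inter> T = {} \<and> finite (R \<union> T) \<and> card (R \<union> T) = r"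
  shows "(\<Sum>T\<in>Ts. card (G T)) \<le> 2 ^ r * card (\<Union>T\<in>Ts. (\<lambda>R. R \<union> T) ` G T)"
proof -
  let ?J = "\<Union>T\<in>Ts. (\<lambda>R. R \<union> T) ` G T"
  have J: "finite C" "card C = r" if "C \<in> ?J" for C using that assms(3) by auto
  have finJ: "finite ?J" using assms(1,2) by simp
  have "(\<Sum>T\<in>Ts. card (G T)) = card (SIGMA T:Ts. G T)" using assms(1,2) by (intro card_SigmaI[symmetric]) auto
  also have "\<dots> \<le> card (SIGMA C:?J. Pow C)"
  proof (rule card_inj_on_le[where f = "\<lambda>(T, R). (R \<union> T, T)"])
    show "inj_on (\<lambda>(T, R). (R \<union> T, T)) (SIGMA T:Ts. G T)"
    proof (rule inj_onI, clarsimp)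
      fix T R R' assume "T \<in> Ts" "R \<in> G T" "R' \<in> G T" "R \<union> T = R' \<union> T"
      moreover from this have "R \<inter> T = {}" "R' \<inter> T = {}" using assms(3) by blast+
      ultimately show "R = R'" by blast
    qed
    show "(\<lambda>(T, R). (R \<union> T, T)) ` (SIGMA T:Ts. G T) \<subseteq> (SIGMA C:?J. Pow C)" by auto
    show "finite (SIGMA C:?J. Pow C)" using finJ J by (intro finite_SigmaI) auto
  qed
  also have "\<dots> = (\<Sum>C\<in>?J. card (Pow C))" using finJ J by (intro card_SigmaI) auto
  also have "\<dots> = 2 ^ r * card ?J" using J by (simp add: card_Pow)
  finally show ?thesis .
qed

lemma exists_heavy_layer:
  fixes m :: real
  assumes "finite Ts" "\<And>T. T \<in> Ts \<Longrightarrow> finite (G T)" "\<And>T R. T \<in> Ts \<Longrightarrow> R \<in> G T \<Longrightarrow> h R \<le> i"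
    and "\<And>T. T \<in> Ts \<Longrightarrow> m \<le> real (card (G T))"
  shows "\<exists>a\<le>i. real (card Ts) * m / real (Suc i) \<le> real (\<Sum>T\<in>Ts. card {R\<in>G T. h R = a})"
proof -
  have layers: "card (G T) = (\<Sum>a\<le>i. card {R\<in>G T. h R = a})" if "T \<in> Ts" for T
    using assms(2,3) that by (intro card_eq_sum_fibres) auto
  have "real (card {..i}) * (real (card Ts) * m / real (Suc i)) = (\<Sum>T\<in>Ts. m)" by simp
  also have "\<dots> \<le> (\<Sum>T\<in>Ts. real (card (G T)))" using assms(4) by (intro sum_mono)
  also have "\<dots> = (\<Sum>T\<in>Ts. \<Sum>a\<le>i. real (card {R\<in>G T. h R = a}))" by (intro sum.cong) (simp_all add: layers)
  also have "\<dots> = (\<Sum>a\<le>i. real (\<Sum>T\<in>Ts. card {R\<in>G T. h R = a}))" by (subst sum.swap) simp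
  finally have "\<exists>a\<in>{..i}. real (card Ts) * m / real (Suc i) \<le> real (\<Sum>T\<in>Ts. card {R\<in>G T. h R = a})"
    by (intro exists_ge_average) auto
  then show ?thesis by auto
qed

section \<open>Degrees and cliques in families of sets\<close>

definition nbrs :: "'a set \<Rightarrow> 'a set set \<Rightarrow> 'a set \<Rightarrow> 'a set" where
  "nbrs V D Y = {v\<in>V - Y. insert v Y \<in> D}"

abbreviation deg :: "'a set \<Rightarrow> 'a set set \<Rightarrow> 'a set \<Rightarrow> nat" where
  "deg V D Y \<equiv> card (nbrs V D Y)"

lemma finite_nbrs [simp]: "finite V \<Longrightarrow> finite (nbrs V D Y)"
  by (simp add: nbrs_def)

lemma deg_le: "finite V \<Longrightarrow> deg V D Y \<le> card V"
  by (intro card_mono) (auto simp: nbrs_def)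

lemma sum_deg:
  assumes "finite V" "D \<subseteq> nsets V (Suc s)"
  shows "(\<Sum>Y\<in>nsets V s. deg V D Y) = Suc s * card D"
proof -
  have finD: "finite D" using assms finite_subset finite_nsets by blast
  have "bij_betw (\<lambda>(Y, v). (insert v Y, v)) (SIGMA Y:nsets V s. nbrs V D Y) (SIGMA C:D. C)"
    by (rule bij_betw_byWitness[where f' = "\<lambda>(C, v). (C - {v}, v)"])
       (use assms in \<open>auto simp: nsets_def nbrs_def insert_absorb subset_iff\<close>)
  then have "card (SIGMA Y:nsets V s. nbrs V D Y) = card (SIGMA C:D. C)" by (rule bij_betw_same_card)
  moreover have "card (SIGMA Y:nsets V s. nbrs V D Y) = (\<Sum>Y\<in>nsets V s. deg V D Y)"
    using assms(1) by (intro card_SigmaI) auto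
  moreover have "card (SIGMA C:D. C) = (\<Sum>C\<in>D. card C)"
    using assms finD by (intro card_SigmaI) (auto simp: nsets_def)
  moreover have "(\<Sum>C\<in>D. card C) = (\<Sum>C\<in>D. Suc s)"
    using assms by (intro sum.cong) (auto simp: nsets_def)
  ultimately show ?thesis by (simp add: mult.commute)
qed

lemma card_high_deg:
  assumes "finite V" "D \<subseteq> nsets V (Suc s)"
  shows "real (card {Y\<in>nsets V s. t < real (deg V D Y)}) * t \<le> real (Suc s) * real (card D)"
proof -
  let ?H = "{Y\<in>nsets V s. t < real (deg V D Y)}"
  have "real (card ?H) * t \<le> (\<Sum>Y\<in>?H. real (deg V D Y))" by (rule sum_bounded_below) auto
  also have "\<dots> \<le> (\<Sum>Y\<in>nsets V s. real (deg V D Y))" using assms(1) by (intro sum_mono2) auto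
  also have "\<dots> = real (Suc s) * real (card D)" using sum_deg[OF assms] by (metis of_nat_mult of_nat_sum)
  finally show ?thesis .
qed

lemma card_high_deg_ge:
  fixes n :: real
  assumes "finite V" "D \<subseteq> nsets V (Suc s)" "real (card V) \<le> n" "0 < n" "0 \<le> c"
    and "2 * c * n ^ Suc s \<le> real (Suc s) * real (card D)"
  shows "c * n ^ s \<le> real (card {Y\<in>nsets V s. c * n < real (deg V D Y)})"
proof -
  let ?H = "{Y\<in>nsets V s. c * n < real (deg V D Y)}"
  have "2 * c * n ^ Suc s \<le> (\<Sum>Y\<in>nsets V s. real (deg V D Y))"
    using sum_deg[OF assms(1,2)] assms(6) by (metis of_nat_mult of_nat_sum)
  also have "\<dots> = (\<Sum>Y\<in>nsets V s - ?H. real (deg V D Y)) + (\<Sum>Y\<in>?H. real (deg V D Y))"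
    using assms(1) by (intro sum.subset_diff) auto
  also have "\<dots> \<le> real (card (nsets V s - ?H)) * (c * n) + real (card ?H) * n"
  proof (intro add_mono sum_bounded_above)
    show "real (deg V D Y) \<le> n" for Y using deg_le[OF assms(1), of D Y] assms(3) by linarith
  qed auto
  also have "\<dots> \<le> n ^ s * (c * n) + real (card ?H) * n"
  proof (intro add_right_mono mult_right_mono)
    have "real (card (nsets V s - ?H)) \<le> real (card V) ^ s"
      by (rule real_card_nsets_subset_le[OF assms(1)]) auto
    also have "\<dots> \<le> n ^ s" using assms(3) by (intro power_mono) auto
    finally show "real (card (nsets V s - ?H)) \<le> n ^ s" .
  qed (use assms(4,5) in auto)
  finally have "(c * n ^ s) * n \<le> real (card ?H) * n" by (simp add: algebra_simps)
  then show ?thesis using assms(4) by simp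
qed

definition cliques :: "'a set \<Rightarrow> 'a set set \<Rightarrow> nat \<Rightarrow> 'a set set" where
  "cliques V A r = {Q\<in>nsets V r. \<forall>t\<in>Q. Q - {t} \<in> A}"

lemma cliques_subset: "cliques V A r \<subseteq> nsets V r"
  by (auto simp: cliques_def)

lemma finite_cliques [simp]: "finite V \<Longrightarrow> finite (cliques V A r)"
  by (simp add: cliques_def)

lemma nsets_subset_of_clique:
  assumes "T \<in> cliques V D (Suc m)" shows "nsets T m \<subseteq> D"
proof
  fix Y assume Y: "Y \<in> nsets T m"
  have T: "finite T" "card T = Suc m" "\<forall>t\<in>T. T - {t} \<in> D"
    using assms by (auto simp: cliques_def nsets_def)
  then have "card (T - Y) = 1" using Y by (auto simp: nsets_def card_Diff_subset)
  then obtain t where "T - Y = {t}" by (auto simp: card_1_singleton_iff)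
  then have "t \<in> T" "Y = T - {t}" using Y by (auto simp: nsets_def)
  then show "Y \<in> D" using T(3) by simp
qed

lemma card_cliques_low_degree:
  assumes "finite V" "B \<subseteq> nsets V m" "s \<le> m" "t \<ge> 0"
  shows "real (card {T\<in>cliques V B (Suc m). nsets T (Suc s) \<subseteq> D \<and>
      (\<exists>Y\<in>nsets T s. real (deg V D Y) \<le> t)}) \<le> 2 ^ m * t * real (card B)"
proof -
  let ?G = "{T\<in>cliques V B (Suc m). nsets T (Suc s) \<subseteq> D \<and> (\<exists>Y\<in>nsets T s. real (deg V D Y) \<le> t)}"
  let ?low = "\<lambda>A. {Y\<in>Pow A. real (deg V D Y) \<le> t}"
  have B: "finite A" "card A = m" if "A \<in> B" for A using assms(2) that by (auto simp: nsets_def)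
  have finB: "finite B" using assms(1,2) finite_subset finite_nsets by blast
  have "?G \<subseteq> (\<Union>A\<in>B. \<Union>Y\<in>?low A. (\<lambda>v. insert v A) ` nbrs V D Y)"
  proof
    fix T assume T: "T \<in> ?G"
    then obtain Y where Y: "Y \<in> nsets T s" "real (deg V D Y) \<le> t" by blast
    have Tk: "T \<subseteq> V" "card T = Suc m" using T by (auto simp: cliques_def nsets_def)
    then have "Y \<noteq> T" using Y assms(3) by (auto simp: nsets_def)
    then obtain v where v: "v \<in> T" "v \<notin> Y" using Y(1) by (auto simp: nsets_def)
    have "insert v Y \<in> nsets T (Suc s)" using v Y by (auto simp: nsets_def)
    then have "v \<in> nbrs V D Y" using T v Tk(1) by (auto simp: nbrs_def)
    moreover have "T - {v} \<in> B" "Y \<in> ?low (T - {v})" using T Y v by (auto simp: cliques_def nsets_def)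
    moreover have "T = insert v (T - {v})" using v by auto
    ultimately show "T \<in> (\<Union>A\<in>B. \<Union>Y\<in>?low A. (\<lambda>v. insert v A) ` nbrs V D Y)" by blast
  qed
  then have "real (card ?G) \<le> real (card (\<Union>A\<in>B. \<Union>Y\<in>?low A. (\<lambda>v. insert v A) ` nbrs V D Y))"
    using finB B(1) assms(1) by (intro real_card_mono) auto
  also have "\<dots> \<le> real (card B) * (2 ^ m * t)"
  proof (rule real_card_UN_le_mult[OF finB])
    fix A assume A: "A \<in> B"
    show "real (card (\<Union>Y\<in>?low A. (\<lambda>v. insert v A) ` nbrs V D Y)) \<le> 2 ^ m * t"
    proof (rule real_card_UN_le_mult)
      fix Y assume "Y \<in> ?low A"
      moreover have "card ((\<lambda>v. insert v A) ` nbrs V D Y) \<le> deg V D Y"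
        using assms(1) by (intro card_image_le) simp
      ultimately show "real (card ((\<lambda>v. insert v A) ` nbrs V D Y)) \<le> t" by auto
    next
      have "real (card (?low A)) \<le> real (card (Pow A))" using B(1)[OF A] by (intro real_card_mono) auto
      then show "real (card (?low A)) \<le> 2 ^ m" using B[OF A] by (simp add: card_Pow)
    qed (use B(1)[OF A] assms(4) in auto)
  qed (use assms(4) in auto)
  finally show ?thesis by (simp add: mult_ac)
qed

lemma card_high_deg_le_power:
  assumes "finite V" "D \<subseteq> nsets V (Suc s)" "0 < \<epsilon>" "0 \<le> x"
    and "real (card D) \<le> x * \<epsilon> / real (Suc s) * real (card V) ^ Suc s"
  shows "real (card {Y\<in>nsets V s. \<epsilon> * real (card V) < real (deg V D Y)}) \<le> x * real (card V) ^ s"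
proof (cases "card V = 0")
  case True
  then have "deg V D Y = 0" for Y using assms(1) by (simp add: nbrs_def)
  then show ?thesis using True assms(4) by simp
next
  case False
  let ?high = "{Y\<in>nsets V s. \<epsilon> * real (card V) < real (deg V D Y)}"
  have "real (card ?high) * (\<epsilon> * real (card V)) \<le> real (Suc s) * real (card D)"
    by (rule card_high_deg[OF assms(1,2)])
  also have "\<dots> \<le> real (Suc s) * (x * \<epsilon> / real (Suc s) * real (card V) ^ Suc s)"
    by (rule mult_left_mono[OF assms(5)]) simp
  also have "\<dots> = (x * real (card V) ^ s) * (\<epsilon> * real (card V))" by (simp add: field_simps)
  finally show ?thesis using assms(3) False by (simp add: mult_le_cancel_right)
qed

lemma exists_few_cliques_above:
  fixes e :: real
  assumes "e > 0" "s \<le> m"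
  shows "\<exists>\<xi>>0. \<forall>(V::'a set) D B. finite V \<longrightarrow> D \<subseteq> nsets V s \<longrightarrow> B \<subseteq> nsets V m \<longrightarrow>
    real (card D) \<le> \<xi> * real (card V) ^ s \<longrightarrow>
    real (card {T\<in>cliques V B (Suc m). nsets T s \<subseteq> D}) \<le> e * real (card V) * real (card B)"
  using assms
proof (induction s arbitrary: e)
  case 0
  have "real (card {T\<in>cliques V B (Suc m). nsets T 0 \<subseteq> D}) \<le> e * real (card V) * real (card B)"
    if "finite V" "D \<subseteq> nsets V 0" "real (card D) \<le> 1 / 2 * real (card V) ^ 0" for V :: "'a set" and D B
  proof -
    have "finite D" using that(1,2) finite_subset finite_nsets by blast
    moreover have "card D = 0" using that(3) by simp
    ultimately show ?thesis using 0 by simp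
  qed
  then show ?case by (intro exI[of _ "1 / 2"]) simp
next
  case (Suc s)
  define \<epsilon> where "\<epsilon> = e / 2 / 2 ^ m"
  have \<epsilon>: "\<epsilon> > 0" using Suc.prems by (simp add: \<epsilon>_def)
  obtain x where x: "x > 0" and IH: "\<And>(V::'a set) D B. \<lbrakk>finite V; D \<subseteq> nsets V s; B \<subseteq> nsets V m;
      real (card D) \<le> x * real (card V) ^ s\<rbrakk> \<Longrightarrow>
      real (card {T\<in>cliques V B (Suc m). nsets T s \<subseteq> D}) \<le> e / 2 * real (card V) * real (card B)"
    using Suc.IH[of "e / 2"] Suc.prems by auto
  have "real (card {T\<in>cliques V B (Suc m). nsets T (Suc s) \<subseteq> D}) \<le> e * real (card V) * real (card B)"
    if V: "finite V" and D: "D \<subseteq> nsets V (Suc s)" and B: "B \<subseteq> nsets V m"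
      and D_small: "real (card D) \<le> x * \<epsilon> / real (Suc s) * real (card V) ^ Suc s"
    for V :: "'a set" and D B
  proof -
    let ?n = "real (card V)"
    define high where "high = {Y\<in>nsets V s. \<epsilon> * ?n < real (deg V D Y)}"
    let ?low = "{T\<in>cliques V B (Suc m). nsets T (Suc s) \<subseteq> D \<and> (\<exists>Y\<in>nsets T s. real (deg V D Y) \<le> \<epsilon> * ?n)}"
    have high: "real (card high) \<le> x * ?n ^ s"
      unfolding high_def using V D \<epsilon> x D_small by (intro card_high_deg_le_power) auto
    have "{T\<in>cliques V B (Suc m). nsets T (Suc s) \<subseteq> D}
        \<subseteq> {T\<in>cliques V B (Suc m). nsets T s \<subseteq> high} \<union> ?low"
      by (auto simp: high_def cliques_def nsets_def not_less)
    then have "card {T\<in>cliques V B (Suc m). nsets T (Suc s) \<subseteq> D}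
        \<le> card {T\<in>cliques V B (Suc m). nsets T s \<subseteq> high} + card ?low"
      using V by (intro card_le_card_add) auto
    moreover have "real (card {T\<in>cliques V B (Suc m). nsets T s \<subseteq> high}) \<le> e / 2 * ?n * real (card B)"
      using high by (intro IH[OF V _ B]) (auto simp: high_def)
    moreover have "real (card ?low) \<le> 2 ^ m * (\<epsilon> * ?n) * real (card B)"
      using Suc.prems \<epsilon> by (intro card_cliques_low_degree[OF V B]) auto
    moreover have "2 ^ m * (\<epsilon> * ?n) * real (card B) = e / 2 * ?n * real (card B)" by (simp add: \<epsilon>_def)
    ultimately show ?thesis by linarith
  qed
  moreover have "x * \<epsilon> / real (Suc s) > 0" using x \<epsilon> by simp
  ultimately show ?case by blast
qed

definition clique_bound :: "'a set \<Rightarrow> nat \<Rightarrow> real \<Rightarrow> real \<Rightarrow> bool" where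
  "clique_bound V k e \<xi> \<longleftrightarrow> (\<forall>m<k. \<forall>D\<subseteq>nsets V m. real (card D) \<le> \<xi> * real (card V) ^ m \<longrightarrow>
     real (card (cliques V D (Suc m))) \<le> e * real (card V) * real (card D))"

lemma exists_clique_bound:
  assumes "e > 0" shows "\<exists>\<xi>>0. \<forall>V::'a set. finite V \<longrightarrow> clique_bound V k e \<xi>"
proof (induction k)
  case 0
  show ?case by (auto simp: clique_bound_def intro: exI[of _ 1])
next
  case (Suc k)
  then obtain x where x: "x > 0" "\<And>V::'a set. finite V \<Longrightarrow> clique_bound V k e x" by blast
  obtain y where y: "y > 0" "\<And>(V::'a set) D B. \<lbrakk>finite V; D \<subseteq> nsets V k; B \<subseteq> nsets V k;
      real (card D) \<le> y * real (card V) ^ k\<rbrakk> \<Longrightarrow>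
      real (card {T\<in>cliques V B (Suc k). nsets T k \<subseteq> D}) \<le> e * real (card V) * real (card B)"
    using exists_few_cliques_above[OF assms order_refl[of k], where ?'a = 'a] by blast
  have "clique_bound V (Suc k) e (min x y)" if V: "finite V" for V :: "'a set"
    unfolding clique_bound_def
  proof (intro allI impI)
    fix m D
    assume m: "m < Suc k" and D: "D \<subseteq> nsets V m" "real (card D) \<le> min x y * real (card V) ^ m"
    have D_small: "real (card D) \<le> x * real (card V) ^ m" "real (card D) \<le> y * real (card V) ^ m"
      using D(2) mult_right_mono[of "min x y" x "real (card V) ^ m"]
        mult_right_mono[of "min x y" y "real (card V) ^ m"] by auto
    show "real (card (cliques V D (Suc m))) \<le> e * real (card V) * real (card D)"
    proof (cases "m < k")
      case True
      then show ?thesis using x(2)[OF V] D(1) D_small(1) unfolding clique_bound_def by blast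
    next
      case False
      then have "m = k" using m by simp
      moreover have "{T\<in>cliques V D (Suc m). nsets T m \<subseteq> D} = cliques V D (Suc m)"
        using nsets_subset_of_clique by blast
      ultimately show ?thesis using y(2)[OF V _ _ _, of D D] D(1) D_small(2) by simp
    qed
  qed
  then show ?case using x(1) y(1) by (intro exI[of _ "min x y"]) auto
qed

definition mixed :: "'a set \<Rightarrow> 'a set set \<Rightarrow> nat \<Rightarrow> 'a set set" where
  "mixed V A r = nsets V r - cliques V A r - cliques V (- A) r"

lemma mixed_between_cliques:
  assumes "finite V" "r \<ge> 1" "Q1 \<in> cliques V A r" "Q0 \<in> cliques V (- A) r"
  shows "\<exists>Q\<in>mixed V A r. Q \<subseteq> Q1 \<union> Q0"
proof -
  let ?C = "{Q\<in>cliques V A r. Q \<subseteq> Q1 \<union> Q0}"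
  have "Q1 \<in> ?C" using assms by auto
  moreover have "\<forall>Q. Q \<in> ?C \<longrightarrow> card (Q \<inter> Q0) < Suc (card Q0)"
    using assms(4) by (auto simp: cliques_def nsets_def less_Suc_eq_le intro: card_mono)
  ultimately obtain Q where Q: "Q \<in> ?C"
    and closest: "\<And>Q'. Q' \<in> ?C \<Longrightarrow> card (Q' \<inter> Q0) \<le> card (Q \<inter> Q0)"
    using ex_has_greatest_nat[of "\<lambda>Q. Q \<in> ?C" Q1 "\<lambda>Q. card (Q \<inter> Q0)" "Suc (card Q0)"] by blast
  have Q_r: "Q \<subseteq> V" "card Q = r" "finite Q" and Q0_r: "Q0 \<subseteq> V" "card Q0 = r" "finite Q0"
    using Q assms(4) by (auto simp: cliques_def nsets_def)
  obtain q where "q \<in> Q0" using Q0_r(2) assms(2) by fastforce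
  then have "Q0 \<notin> cliques V A r" using assms(4) by (auto simp: cliques_def)
  then have "Q \<noteq> Q0" using Q by auto
  then obtain a b where a: "a \<in> Q" "a \<notin> Q0" and b: "b \<in> Q0" "b \<notin> Q"
    using Q_r(2,3) Q0_r(2,3) by (metis card_subset_eq subsetI)
  let ?Q = "insert b (Q - {a})"
  have "card (Q - {a}) = r - 1" using a(1) Q_r by simp
  then have Q'_r: "?Q \<in> nsets V r" using b Q_r Q0_r assms(2) by (auto simp: nsets_def)
  have "?Q \<inter> Q0 = insert b (Q \<inter> Q0)" using a b by auto
  then have "card (?Q \<inter> Q0) > card (Q \<inter> Q0)" using b Q_r(3) by simp
  then have "?Q \<notin> ?C" using closest by force
  moreover have sub: "?Q \<subseteq> Q1 \<union> Q0" using Q b by auto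
  ultimately have "?Q \<notin> cliques V A r" by blast
  moreover have "?Q \<notin> cliques V (- A) r"
  proof -
    have "?Q - {b} \<in> A" using Q a b by (auto simp: cliques_def)
    then show ?thesis by (auto simp: cliques_def)
  qed
  ultimately show ?thesis using Q'_r sub unfolding mixed_def by blast
qed

lemma card_mixed:
  fixes V :: "'a set"
  assumes "finite V" "r \<ge> 1"
  shows "real (card (cliques V A r)) * real (card (cliques V (- A) r))
    \<le> real (card (mixed V A r)) * ((real (card V) + 1) ^ r * 16 ^ r)"
proof -
  let ?small = "{Y. Y \<subseteq> V \<and> card Y \<le> r}"
  let ?pairs = "\<lambda>(Q, Y). Pow (Q \<union> Y) \<times> Pow (Q \<union> Y)"
  have fin: "finite (mixed V A r)" "finite ?small" using assms(1) by (auto simp: mixed_def)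
  have "cliques V A r \<times> cliques V (- A) r \<subseteq> (\<Union>p\<in>mixed V A r \<times> ?small. ?pairs p)"
  proof clarify
    fix Q1 Q0 assume Q: "Q1 \<in> cliques V A r" "Q0 \<in> cliques V (- A) r"
    obtain C where C: "C \<in> mixed V A r" "C \<subseteq> Q1 \<union> Q0" using mixed_between_cliques[OF assms Q] by blast
    have r: "Q1 \<subseteq> V" "card Q1 = r" "Q0 \<subseteq> V" "card Q0 = r" "finite C" "card C = r"
      using Q C by (auto simp: cliques_def mixed_def nsets_def)
    have "card (Q1 \<union> Q0 - C) = card (Q1 \<union> Q0) - card C" using C(2) r(5) by (intro card_Diff_subset)
    also have "\<dots> \<le> r" using card_Un_le[of Q1 Q0] r by linarith
    finally have "(C, Q1 \<union> Q0 - C) \<in> mixed V A r \<times> ?small" using C(1) r by auto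
    moreover have "(Q1, Q0) \<in> ?pairs (C, Q1 \<union> Q0 - C)" by auto
    ultimately show "(Q1, Q0) \<in> (\<Union>p\<in>mixed V A r \<times> ?small. ?pairs p)" by blast
  qed
  then have "real (card (cliques V A r \<times> cliques V (- A) r))
      \<le> real (card (\<Union>p\<in>mixed V A r \<times> ?small. ?pairs p))"
    using fin assms(1) by (intro real_card_mono) (auto simp: mixed_def nsets_def dest: finite_subset)
  also have "\<dots> \<le> real (card (mixed V A r)) * (real (card V) + 1) ^ r * 16 ^ r"
  proof (rule real_card_UN_le_mult)
    fix p assume p: "p \<in> mixed V A r \<times> ?small"
    obtain C Y where CY: "p = (C, Y)" "finite C" "card C = r" "finite Y" "card Y \<le> r"
      using p finite_subset[OF _ assms(1)] by (auto simp: mixed_def nsets_def)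
    have "card (?pairs p) = 4 ^ card (C \<union> Y)"
      using CY by (simp add: card_cartesian_product card_Pow power_mult_distrib[symmetric])
    also have "\<dots> \<le> 4 ^ (2 * r)"
      using card_Un_le[of C Y] CY by (intro power_increasing) auto
    also have "\<dots> = 16 ^ r" by (simp add: power_mult)
    finally show "real (card (?pairs p)) \<le> 16 ^ r" by simp
  next
    have "card ?small \<le> (card V + 1) ^ r" by (rule card_subsets_of_card_le[OF assms(1)])
    then have "real (card ?small) \<le> real ((card V + 1) ^ r)" by (simp only: of_nat_le_iff)
    then show "real (card (mixed V A r \<times> ?small)) \<le> real (card (mixed V A r)) * (real (card V) + 1) ^ r"
      by (simp add: card_cartesian_product mult_left_mono add.commute)
  qed (use fin in auto)
  finally show ?thesis by (simp add: card_cartesian_product mult.assoc)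
qed

section \<open>Tuples that are pairwise related\<close>

lemma card_triangles_le:
  assumes "finite R"
  shows "real (card {(x, y, z). (x, y) \<in> R \<and> (y, z) \<in> R \<and> (x, z) \<in> R})
    \<le> 2 * real (card R) powr (3 / 2)"
proof (cases "R = {}")
  case False
  define r where "r = real (card R)"
  have r: "r > 0" using False assms by (simp add: r_def card_gt_0_iff)
  have fin: "finite (R `` {y})" for y using assms by simp
  define heavy where "heavy = {y\<in>Domain R. sqrt r < real (card (R `` {y}))}"
  have fin_heavy: "finite heavy" using assms by (simp add: heavy_def finite_Domain)
  have heavy: "real (card heavy) \<le> sqrt r"
  proof -
    have "real (card heavy) * sqrt r \<le> (\<Sum>y\<in>heavy. real (card (R `` {y})))"
      by (rule sum_bounded_below) (auto simp: heavy_def)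
    also have "\<dots> = real (card (SIGMA y:heavy. R `` {y}))"
      using fin_heavy fin by (subst card_SigmaI) auto
    also have "\<dots> \<le> r" unfolding r_def using assms by (intro real_card_mono) auto
    also have "\<dots> = sqrt r * sqrt r" using r by simp
    finally show ?thesis using r by (simp only: mult_le_cancel_right) auto
  qed
  define light where "light = (SIGMA p:{p\<in>R. snd p \<notin> heavy}. R `` {snd p})"
  have fin_light: "finite light" unfolding light_def using assms fin by auto
  have light: "real (card light) \<le> r * sqrt r"
  proof -
    have "real (card light) = (\<Sum>p\<in>{p\<in>R. snd p \<notin> heavy}. real (card (R `` {snd p})))"
      unfolding light_def using assms fin by (subst card_SigmaI) auto
    also have "\<dots> \<le> real (card {p\<in>R. snd p \<notin> heavy}) * sqrt r"
    proof (rule sum_bounded_above)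
      fix p assume "p \<in> {p\<in>R. snd p \<notin> heavy}"
      then show "real (card (R `` {snd p})) \<le> sqrt r"
        using r by (cases "R `` {snd p} = {}") (auto simp: heavy_def not_less)
    qed
    also have "\<dots> \<le> r * sqrt r" unfolding r_def using assms by (intro mult_right_mono real_card_mono) auto
    finally show ?thesis .
  qed
  have "card {(x, y, z). (x, y) \<in> R \<and> (y, z) \<in> R \<and> (x, z) \<in> R} \<le> card (Inl ` light \<union> Inr ` (R \<times> heavy))"
    by (rule card_inj_on_le[where
          f = "\<lambda>(x, y, z). if y \<in> heavy then Inr ((x, z), y) else Inl ((x, y), z)"])
       (use assms fin_light fin_heavy in \<open>auto simp: light_def inj_on_def split: if_splits\<close>)
  also have "\<dots> \<le> card light + card (R \<times> heavy)"
    using fin_light assms fin_heavy by (intro order_trans[OF card_Un_le] add_mono card_image_le) auto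
  finally have "real (card {(x, y, z). (x, y) \<in> R \<and> (y, z) \<in> R \<and> (x, z) \<in> R})
      \<le> real (card light) + r * real (card heavy)"
    by (simp only: card_cartesian_product r_def of_nat_mult[symmetric] of_nat_add[symmetric] of_nat_le_iff)
  also have "\<dots> \<le> r * sqrt r + r * sqrt r" using light heavy r by (intro add_mono mult_left_mono) auto
  also have "\<dots> = 2 * (r powr 1 * r powr (1 / 2))" using r by (simp add: powr_half_sqrt)
  also have "\<dots> = 2 * r powr (3 / 2)" unfolding powr_add[symmetric] by simp
  finally show ?thesis by (simp add: r_def)
qed (simp add: case_prod_unfold)

definition related_tuples :: "'a set \<Rightarrow> 'b set \<Rightarrow> ('b \<times> 'b) set \<Rightarrow> ('a \<Rightarrow> 'b) set" where
  "related_tuples S D R = {f\<in>S \<rightarrow>\<^sub>E D. pairwise (\<lambda>x y. (f x, f y) \<in> R) S}"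

lemma finite_related_tuples: "finite S \<Longrightarrow> finite D \<Longrightarrow> finite (related_tuples S D R)"
  unfolding related_tuples_def by (auto intro: finite_subset[of _ "S \<rightarrow>\<^sub>E D"] finite_PiE)

lemma card_related_tuples_3:
  assumes "finite R" "card S = 3"
  shows "real (card (related_tuples S D R)) \<le> 2 * real (card R) powr (3 / 2)"
proof -
  let ?triangles = "{(x, y, z). (x, y) \<in> R \<and> (y, z) \<in> R \<and> (x, z) \<in> R}"
  obtain a b c where S: "S = {a, b, c}" "a \<noteq> b" "a \<noteq> c" "b \<noteq> c"
    using assms(2) by (auto simp: card_3_iff)
  have "?triangles \<subseteq> (\<lambda>((x, y), (_, z)). (x, y, z)) ` (R \<times> R)" by force
  then have "finite ?triangles" by (rule finite_subset) (use assms(1) in simp)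
  then have "card (related_tuples S D R) \<le> card ?triangles"
    by (intro card_inj_on_le[where f = "\<lambda>f. (f a, f b, f c)"])
       (use S in \<open>auto simp: related_tuples_def pairwise_def inj_on_def PiE_iff
          intro!: extensionalityI[of _ "{a, b, c}"]\<close>)
  then show ?thesis using card_triangles_le[OF assms(1)] by linarith
qed

lemma card_related_tuples_remove2:
  assumes "finite R" "finite S" "finite D" "a \<in> S" "b \<in> S" "a \<noteq> b"
  shows "card (related_tuples S D R) \<le> card R * card (related_tuples (S - {a, b}) D R)"
proof -
  let ?S = "S - {a, b}"
  have "card (related_tuples S D R) \<le> card (R \<times> related_tuples ?S D R)"
  proof (rule card_inj_on_le[where f = "\<lambda>f. ((f a, f b), restrict f ?S)"])
    show "inj_on (\<lambda>f. ((f a, f b), restrict f ?S)) (related_tuples S D R)"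
    proof (rule inj_onI)
      fix f g
      assume fg: "f \<in> related_tuples S D R" "g \<in> related_tuples S D R"
        "((f a, f b), restrict f ?S) = ((g a, g b), restrict g ?S)"
      show "f = g"
      proof (rule extensionalityI[of _ S])
        fix x assume "x \<in> S"
        then consider "x = a" | "x = b" | "x \<in> ?S" by auto
        then show "f x = g x" by cases (use fg in \<open>auto simp: restrict_def fun_eq_iff, metis\<close>)
      qed (use fg in \<open>auto simp: related_tuples_def PiE_iff\<close>)
    qed
    show "finite (R \<times> related_tuples ?S D R)" using assms(1-3) by (simp add: finite_related_tuples)
  qed (use assms(4-6) in \<open>auto simp: related_tuples_def pairwise_def PiE_iff split: if_splits\<close>)
  then show ?thesis by (simp add: card_cartesian_product)
qed

lemma card_related_tuples:
  assumes "finite D" "R \<subseteq> D \<times> D" "finite S" "card S \<ge> 2"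
  shows "real (card (related_tuples S D R)) \<le> 2 * real (card R) powr (real (card S) / 2)"
proof (cases "R = {}")
  case True
  obtain a b where "a \<in> S" "b \<in> S" "a \<noteq> b" using assms(3,4) card_le_Suc0_iff_eq[of S] by fastforce
  then have "related_tuples S D R = {}" using True by (auto simp: related_tuples_def pairwise_def)
  then show ?thesis by simp
next
  case False
  have finR: "finite R" using assms(1,2) finite_subset by blast
  let ?r = "real (card R)"
  have r: "?r > 0" using False finR by (simp add: card_gt_0_iff)
  have "card S \<noteq> 1" using assms(4) by simp
  then show ?thesis using assms(3)
  proof (induction "card S" arbitrary: S rule: less_induct)
    case less
    consider (empty) "S = {}" | (three) "card S = 3" | (other) "card S \<ge> 2" "card S \<noteq> 3"
      using less.prems by (cases "card S = 0") auto
    then show ?case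
    proof cases
      case empty
      then show ?thesis using r by (simp add: related_tuples_def pairwise_def)
    next
      case three
      then show ?thesis using card_related_tuples_3[OF finR three] by simp
    next
      case other
      obtain a b where ab: "a \<in> S" "b \<in> S" "a \<noteq> b"
        using other(1) less.prems(2) card_le_Suc0_iff_eq[of S] by fastforce
      let ?S = "S - {a, b}"
      have card_S': "card ?S = card S - 2" using ab less.prems(2) by (simp add: card_Diff_subset)
      have "real (card (related_tuples S D R)) \<le> ?r * real (card (related_tuples ?S D R))"
        using card_related_tuples_remove2[OF finR less.prems(2) assms(1) ab]
        by (simp only: of_nat_mult[symmetric] of_nat_le_iff)
      also have "\<dots> \<le> ?r * (2 * ?r powr (real (card ?S) / 2))"
        using other less.prems card_S' by (intro mult_left_mono less.hyps) auto
      also have "\<dots> = 2 * (?r powr 1 * ?r powr (real (card ?S) / 2))" by simp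
      also have "\<dots> = 2 * ?r powr (1 + real (card ?S) / 2)" by (simp only: powr_add)
      also have "1 + real (card ?S) / 2 = real (card S) / 2"
        using card_S' other(1) by (simp add: field_simps of_nat_diff)
      finally show ?thesis .
    qed
  qed
qed

section \<open>Pairs of dense families with few common supersets\<close>

definition large_sets :: "'a set filter" where
  "large_sets = inf (filtercomap card at_top) (principal {V. finite V})"

lemma eventually_large_sets_iff:
  "eventually P large_sets \<longleftrightarrow> (\<exists>N. \<forall>V. finite V \<longrightarrow> N \<le> card V \<longrightarrow> P V)"
  by (auto simp: large_sets_def eventually_inf_principal eventually_filtercomap_at_top_linorder)

lemma eventually_large_sets_finite: "\<forall>\<^sub>F V in large_sets. finite V"
  by (simp add: eventually_large_sets_iff)

lemma eventually_large_sets_card: "eventually P sequentially \<Longrightarrow> \<forall>\<^sub>F V in large_sets. P (card V)"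
  by (auto simp: eventually_large_sets_iff eventually_sequentially)

lemma eventually_large_sets_ge: "\<forall>\<^sub>F V in large_sets. x \<le> real (card V)"
  by (rule eventually_large_sets_card) real_asymp

lemma eventually_large_sets_Diff:
  assumes "eventually P large_sets"
  shows "\<forall>\<^sub>F V in large_sets. \<forall>X. finite X \<longrightarrow> card X \<le> m \<longrightarrow> P (V - X)"
proof -
  obtain N where N: "\<And>V. finite V \<Longrightarrow> N \<le> card V \<Longrightarrow> P V"
    using assms by (auto simp: eventually_large_sets_iff)
  have "P (V - X)" if "finite V" "N + m \<le> card V" "finite X" "card X \<le> m" for V X
    using that diff_card_le_card_Diff[of X V] by (intro N) auto
  then show ?thesis unfolding eventually_large_sets_iff by blast
qed

definition common :: "'a set \<Rightarrow> nat \<Rightarrow> 'a set set \<Rightarrow> 'a set set \<Rightarrow> 'a set set" where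
  "common V r L L' = {C\<in>nsets V (Suc r). (\<exists>Q\<in>L. Q \<subseteq> C) \<and> (\<exists>Q\<in>L'. Q \<subseteq> C)}"

definition dense_pairs :: "'a set \<Rightarrow> nat \<Rightarrow> real \<Rightarrow> real \<Rightarrow> ('a set set \<times> 'a set set) set" where
  "dense_pairs V r a b = {(L, L'). L \<subseteq> nsets V r \<and> L' \<subseteq> nsets V r \<and>
     a \<le> real (card L) \<and> a \<le> real (card L') \<and> real (card (common V r L L')) \<le> b}"

lemma finite_common [simp]: "finite V \<Longrightarrow> finite (common V r L L')"
  by (simp add: common_def)

lemma dense_pairs_subset: "dense_pairs V r a b \<subseteq> Pow (nsets V r) \<times> Pow (nsets V r)"
  by (auto simp: dense_pairs_def)

lemma finite_dense_pairs [simp]: "finite V \<Longrightarrow> finite (dense_pairs V r a b)"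
  by (rule finite_subset[OF dense_pairs_subset]) simp

lemma dense_pairs_mono: "a' \<le> a \<Longrightarrow> b \<le> b' \<Longrightarrow> dense_pairs V r a b \<subseteq> dense_pairs V r a' b'"
  by (auto simp: dense_pairs_def)

lemma card_outside_cliques:
  assumes "finite V" "L \<subseteq> nsets V (Suc s)" "t \<ge> 0"
  shows "real (card (L - cliques V A (Suc s)))
    \<le> real (card V) ^ s * t + real (card {T\<in>nsets V s - A. t < real (deg V L T)}) * real (card V)"
proof -
  let ?B = "nsets V s - A" and ?high = "{T\<in>nsets V s - A. t < real (deg V L T)}"
  have finB: "finite ?B" using assms(1) by simp
  have "L - cliques V A (Suc s) \<subseteq> (\<lambda>(T, v). insert v T) ` (SIGMA T:?B. nbrs V L T)"
  proof
    fix Q assume Q: "Q \<in> L - cliques V A (Suc s)"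
    then have Qk: "Q \<subseteq> V" "finite Q" "card Q = Suc s" using assms(2) by (auto simp: nsets_def)
    obtain t where t: "t \<in> Q" "Q - {t} \<notin> A" using Q assms(2) by (auto simp: cliques_def)
    then have "(Q - {t}, t) \<in> (SIGMA T:?B. nbrs V L T)"
      using Q Qk by (auto simp: nsets_def nbrs_def insert_absorb)
    moreover have "Q = (\<lambda>(T, v). insert v T) (Q - {t}, t)" using t by auto
    ultimately show "Q \<in> (\<lambda>(T, v). insert v T) ` (SIGMA T:?B. nbrs V L T)" by blast
  qed
  then have "real (card (L - cliques V A (Suc s))) \<le> real (card (SIGMA T:?B. nbrs V L T))"
    using assms(1) by (intro real_surj_card_le) auto
  also have "\<dots> = (\<Sum>T\<in>?B. real (deg V L T))" using assms(1) by (subst card_SigmaI) auto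
  also have "\<dots> = (\<Sum>T\<in>?B - ?high. real (deg V L T)) + (\<Sum>T\<in>?high. real (deg V L T))"
    using finB by (intro sum.subset_diff) auto
  also have "\<dots> \<le> real (card (?B - ?high)) * t + real (card ?high) * real (card V)"
    using deg_le[OF assms(1)] by (intro add_mono sum_bounded_above) (auto simp: not_less)
  also have "\<dots> \<le> real (card V) ^ s * t + real (card ?high) * real (card V)"
    using assms(3) by (intro add_right_mono mult_right_mono real_card_nsets_subset_le[OF assms(1)]) auto
  finally show ?thesis .
qed

lemma card_times_minus_diagonal_ge:
  assumes "finite A" "finite B"
  shows "card A * card B \<le> card {(a, b). a \<in> A \<and> b \<in> B \<and> a \<noteq> b} + card A"
proof -
  let ?D = "{(a, b). a \<in> A \<and> b \<in> B \<and> a \<noteq> b}"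
  have "finite ?D" by (rule finite_subset[of _ "A \<times> B"]) (use assms in auto)
  then have "card (A \<times> B) \<le> card ?D + card ((\<lambda>a. (a, a)) ` A)"
    using assms by (intro card_le_card_add) auto
  also have "\<dots> \<le> card ?D + card A" using card_image_le[OF assms(1)] by simp
  finally show ?thesis by (simp add: card_cartesian_product)
qed

lemma card_common_above:
  assumes "finite V" "T \<in> nsets V s" "t \<ge> 2" "t < real (deg V L T)" "t < real (deg V L' T)"
  shows "t\<^sup>2 / 8 \<le> real (card {C\<in>common V (Suc s) L L'. T \<subseteq> C})"
proof -
  let ?N = "nbrs V L T" and ?N' = "nbrs V L' T"
  let ?C = "{C\<in>common V (Suc s) L L'. T \<subseteq> C}"
  let ?P = "{(a, b). a \<in> ?N \<and> b \<in> ?N' \<and> a \<noteq> b}"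
  have T: "T \<subseteq> V" "finite T" "card T = s" using assms(2) by (auto simp: nsets_def)
  have "?P \<subseteq> (\<Union>C\<in>?C. (C - T) \<times> (C - T))"
  proof clarify
    fix a b assume ab: "a \<in> ?N" "b \<in> ?N'" "a \<noteq> b"
    let ?D = "insert a (insert b T)"
    have "?D \<in> nsets V (Suc (Suc s))" using ab T by (auto simp: nsets_def nbrs_def)
    moreover have "insert a T \<in> L" "insert b T \<in> L'" using ab by (auto simp: nbrs_def)
    ultimately have "?D \<in> ?C" unfolding common_def by blast
    moreover have "(a, b) \<in> (?D - T) \<times> (?D - T)" using ab by (auto simp: nbrs_def)
    ultimately show "(a, b) \<in> (\<Union>C\<in>?C. (C - T) \<times> (C - T))" by blast
  qed
  then have "real (card ?P) \<le> real (card (\<Union>C\<in>?C. (C - T) \<times> (C - T)))"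
    using assms(1) by (intro real_card_mono) (auto simp: common_def nsets_def)
  also have "\<dots> \<le> real (card ?C) * 4"
  proof (rule real_card_UN_le_mult)
    fix C assume "C \<in> ?C"
    then have "card (C - T) = 2" using T by (auto simp: common_def nsets_def card_Diff_subset)
    then show "real (card ((C - T) \<times> (C - T))) \<le> 4" by (simp add: card_cartesian_product)
  qed (use assms(1) in auto)
  finally have pairs_le: "real (card ?P) \<le> 4 * real (card ?C)" by simp
  have "t * (t / 2) \<le> real (card ?N) * (real (card ?N') - 1)"
    using assms(3-5) by (intro mult_mono) auto
  also have "\<dots> = real (card ?N * card ?N') - real (card ?N)" by (simp add: algebra_simps)
  also have "\<dots> \<le> real (card ?P)"
    using card_times_minus_diagonal_ge[of ?N ?N'] assms(1) by (simp flip: of_nat_add of_nat_mult)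
  finally show ?thesis using pairs_le by (simp add: power2_eq_square)
qed

lemma card_doubly_high_deg:
  assumes "finite V" "t \<ge> 2"
  shows "real (card {T\<in>nsets V s. t < real (deg V L T) \<and> t < real (deg V L' T)}) * (t\<^sup>2 / 8)
    \<le> 2 ^ (s + 2) * real (card (common V (Suc s) L L'))"
proof -
  let ?H = "{T\<in>nsets V s. t < real (deg V L T) \<and> t < real (deg V L' T)}"
  let ?C = "common V (Suc s) L L'"
  have C: "finite C" "card C = s + 2" if "C \<in> ?C" for C using that by (auto simp: common_def nsets_def)
  have "real (card ?H) * (t\<^sup>2 / 8) \<le> (\<Sum>T\<in>?H. real (card {C\<in>?C. T \<subseteq> C}))"
    using assms by (intro sum_bounded_below card_common_above) auto
  also have "\<dots> = real (card (SIGMA T:?H. {C\<in>?C. T \<subseteq> C}))"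
    using assms(1) by (subst card_SigmaI) auto
  also have "\<dots> \<le> real (card (SIGMA C:?C. Pow C))"
    using assms(1) C(1)
    by (intro of_nat_mono card_inj_on_le[where f = "\<lambda>(T, C). (C, T)"]) (auto simp: inj_on_def)
  also have "\<dots> = (\<Sum>C\<in>?C. real (card (Pow C)))" using assms(1) C(1) by (subst card_SigmaI) auto
  also have "\<dots> = 2 ^ (s + 2) * real (card ?C)" using C by (simp add: card_Pow)
  finally show ?thesis .
qed

text \<open>With \<open>A\<close> the sets of high degree towards \<open>L\<close>, few members of \<open>A\<close> have high degree towards
  \<open>L'\<close>; so the two families are essentially confined to the cliques of \<open>A\<close> and of its complement.\<close>

lemma dense_pairs_nearly_cliques:
  fixes V :: "'a set"
  assumes "finite V" "L \<subseteq> nsets V (Suc s)" "L' \<subseteq> nsets V (Suc s)" "\<delta> > 0" "\<delta> * real (card V) \<ge> 2"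
    and few_common: "real (card (common V (Suc s) L L')) \<le> \<delta> ^ 3 / 2 ^ (s + 5) * real (card V) ^ Suc (Suc s)"
    and A: "A = {T\<in>nsets V s. \<delta> * real (card V) < real (deg V L T)}"
  shows "real (card (L - cliques V A (Suc s))) \<le> 2 * \<delta> * real (card V) ^ Suc s"
    and "real (card (L' - cliques V (- A) (Suc s))) \<le> 2 * \<delta> * real (card V) ^ Suc s"
proof -
  let ?n = "real (card V)"
  have n: "?n > 0" using assms(5) by (cases "card V = 0") auto
  let ?H = "{T\<in>nsets V s. \<delta> * ?n < real (deg V L T) \<and> \<delta> * ?n < real (deg V L' T)}"
  have "real (card ?H) * ((\<delta> * ?n)\<^sup>2 / 8) \<le> 2 ^ (s + 2) * real (card (common V (Suc s) L L'))"
    by (rule card_doubly_high_deg[OF assms(1,5)])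
  also have "\<dots> \<le> 2 ^ (s + 2) * (\<delta> ^ 3 / 2 ^ (s + 5) * ?n ^ Suc (Suc s))"
    by (rule mult_left_mono[OF few_common]) simp
  also have "\<dots> = (\<delta> * ?n ^ s) * ((\<delta> * ?n)\<^sup>2 / 8)"
    by (simp add: power_add power2_eq_square power3_eq_cube)
  finally have few_high: "real (card ?H) \<le> \<delta> * ?n ^ s"
    using n assms(4) by (simp add: mult_le_cancel_right divide_le_cancel)
  have "real (card (L - cliques V A (Suc s))) \<le> ?n ^ s * (\<delta> * ?n)
      + real (card {T\<in>nsets V s - A. \<delta> * ?n < real (deg V L T)}) * ?n"
    using assms(5) by (intro card_outside_cliques[OF assms(1,2)]) simp
  also have "{T\<in>nsets V s - A. \<delta> * ?n < real (deg V L T)} = {}" by (auto simp: A)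
  also have "?n ^ s * (\<delta> * ?n) + real (card ({} :: 'a set set)) * ?n \<le> 2 * \<delta> * ?n ^ Suc s"
    using assms(4) by simp
  finally show "real (card (L - cliques V A (Suc s))) \<le> 2 * \<delta> * ?n ^ Suc s" .
  have "{T\<in>nsets V s - - A. \<delta> * ?n < real (deg V L' T)} = ?H" by (auto simp: A)
  then have "real (card (L' - cliques V (- A) (Suc s))) \<le> ?n ^ s * (\<delta> * ?n) + real (card ?H) * ?n"
    using card_outside_cliques[OF assms(1,3), of "\<delta> * ?n" "- A"] assms(5) by simp
  also have "\<dots> \<le> ?n ^ s * (\<delta> * ?n) + (\<delta> * ?n ^ s) * ?n"
    using few_high by (intro add_left_mono mult_right_mono) auto
  finally show "real (card (L' - cliques V (- A) (Suc s))) \<le> 2 * \<delta> * ?n ^ Suc s" by (simp add: algebra_simps)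
qed

definition nearly_cliques :: "'a set \<Rightarrow> nat \<Rightarrow> real \<Rightarrow> 'a set set \<Rightarrow> 'a set set set" where
  "nearly_cliques V r t A = {L. L \<subseteq> nsets V r \<and> real (card (L - cliques V A r)) \<le> t * real (card V) ^ r}"

definition balanced :: "'a set \<Rightarrow> nat \<Rightarrow> real \<Rightarrow> 'a set set set" where
  "balanced V r d = {A. A \<subseteq> nsets V (r - 1) \<and>
     d * real (card V) ^ r \<le> real (card (cliques V A r)) \<and>
     d * real (card V) ^ r \<le> real (card (cliques V (- A) r))}"

lemma finite_nearly_cliques [simp]: "finite V \<Longrightarrow> finite (nearly_cliques V r t A)"
  by (simp add: nearly_cliques_def)

lemma finite_balanced [simp]: "finite V \<Longrightarrow> finite (balanced V r d)"
  by (simp add: balanced_def)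

lemma card_nearly_cliques:
  assumes "finite V" "e > 0"
  shows "real (card (nearly_cliques V r (thin e) A))
    \<le> 2 powr (real (card (cliques V A r)) + e * real (card V) ^ r)"
proof -
  have "nsets V r \<inter> cliques V A r = cliques V A r" using cliques_subset[of V A r] by auto
  then show ?thesis
    using card_nearly_within[OF assms(2) finite_nsets[OF assms(1), of r], of "real (card V) ^ r"
      "cliques V A r"]
    by (simp add: nearly_cliques_def choose_le_power)
qed

lemma dense_pairs_subset_nearly_cliques:
  assumes "finite V" "\<delta> > 0" "2 * \<delta> \<le> t" "2 * \<delta> \<le> d / 2" "\<delta> * real (card V) \<ge> 2"
  shows "dense_pairs V (Suc s) (d * real (card V) ^ Suc s) (\<delta> ^ 3 / 2 ^ (s + 5) * real (card V) ^ Suc (Suc s))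
    \<subseteq> (\<Union>A\<in>balanced V (Suc s) (d / 2). nearly_cliques V (Suc s) t A \<times> nearly_cliques V (Suc s) t (- A))"
proof clarify
  let ?N = "real (card V) ^ Suc s"
  fix L L'
  assume "(L, L') \<in> dense_pairs V (Suc s) (d * ?N) (\<delta> ^ 3 / 2 ^ (s + 5) * real (card V) ^ Suc (Suc s))"
  then have sub: "L \<subseteq> nsets V (Suc s)" "L' \<subseteq> nsets V (Suc s)"
    and dense: "d * ?N \<le> real (card L)" "d * ?N \<le> real (card L')"
    and few: "real (card (common V (Suc s) L L')) \<le> \<delta> ^ 3 / 2 ^ (s + 5) * real (card V) ^ Suc (Suc s)"
    by (auto simp: dense_pairs_def)
  define A where "A = {T\<in>nsets V s. \<delta> * real (card V) < real (deg V L T)}"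
  note near = dense_pairs_nearly_cliques[OF assms(1) sub assms(2,5) few A_def]
  have many_cliques: "d / 2 * ?N \<le> real (card (cliques V B (Suc s)))"
    if "M \<subseteq> nsets V (Suc s)" "d * ?N \<le> real (card M)" "real (card (M - cliques V B (Suc s))) \<le> 2 * \<delta> * ?N"
    for M B
  proof -
    have "finite M" using that(1) assms(1) finite_subset finite_nsets by metis
    then have "card M \<le> card (M - cliques V B (Suc s)) + card (cliques V B (Suc s))"
      using assms(1) by (intro card_le_card_add) auto
    moreover have "2 * \<delta> * ?N \<le> d / 2 * ?N" by (rule mult_right_mono[OF assms(4)]) simp
    ultimately show ?thesis using that(2,3) by (simp add: field_simps)
  qed
  have "2 * \<delta> * ?N \<le> t * ?N" by (rule mult_right_mono[OF assms(3)]) simp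
  then have "L \<in> nearly_cliques V (Suc s) t A" "L' \<in> nearly_cliques V (Suc s) t (- A)"
    using sub near unfolding nearly_cliques_def by auto
  moreover have "A \<in> balanced V (Suc s) (d / 2)"
    using many_cliques[OF sub(1) dense(1) near(1)] many_cliques[OF sub(2) dense(2) near(2)]
    by (auto simp: balanced_def A_def)
  ultimately show "(L, L') \<in> (\<Union>A\<in>balanced V (Suc s) (d / 2).
      nearly_cliques V (Suc s) t A \<times> nearly_cliques V (Suc s) t (- A))" by blast
qed

lemma card_cliques_balanced:
  assumes "finite V" "r \<ge> 1" "d > 0" "card V \<ge> 1" "A \<in> balanced V r d"
  shows "real (card (cliques V A r)) + real (card (cliques V (- A) r))
    \<le> real (card V choose r) - d\<^sup>2 / 32 ^ r * real (card V) ^ r"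
proof -
  let ?n = "real (card V)" and ?C1 = "cliques V A r" and ?C0 = "cliques V (- A) r"
  have n: "?n \<ge> 1" using assms(4) by simp
  have "(d * ?n ^ r) * (d * ?n ^ r) \<le> real (card ?C1) * real (card ?C0)"
    using assms(3,5) by (intro mult_mono) (auto simp: balanced_def)
  also have "\<dots> \<le> real (card (mixed V A r)) * ((?n + 1) ^ r * 16 ^ r)" by (rule card_mixed[OF assms(1,2)])
  also have "\<dots> \<le> real (card (mixed V A r)) * ((2 * ?n) ^ r * 16 ^ r)"
    using n by (intro mult_left_mono mult_right_mono power_mono) auto
  also have "(2 * ?n) ^ r * 16 ^ r = (2 * 16) ^ r * ?n ^ r" by (simp only: power_mult_distrib mult_ac)
  finally have "(d\<^sup>2 * ?n ^ r) * ?n ^ r \<le> (real (card (mixed V A r)) * 32 ^ r) * ?n ^ r"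
    by (simp add: power2_eq_square mult_ac)
  then have "d\<^sup>2 * ?n ^ r \<le> real (card (mixed V A r)) * 32 ^ r"
    using n by (simp only: mult_le_cancel_right) auto
  then have mixed: "d\<^sup>2 / 32 ^ r * ?n ^ r \<le> real (card (mixed V A r))" by (simp add: field_simps)
  have disjoint: "?C1 \<inter> ?C0 = {}"
  proof -
    have "Q \<notin> ?C0" if "Q \<in> ?C1" for Q
      using that assms(2) by (cases "Q = {}") (auto simp: cliques_def nsets_def)
    then show ?thesis by blast
  qed
  have "nsets V r = mixed V A r \<union> (?C1 \<union> ?C0)" using cliques_subset[of V _ r] by (auto simp: mixed_def)
  moreover have "card (mixed V A r \<union> (?C1 \<union> ?C0)) = card (mixed V A r) + (card ?C1 + card ?C0)"
  proof -
    have "mixed V A r \<inter> (?C1 \<union> ?C0) = {}" "finite (mixed V A r)" using assms(1) by (auto simp: mixed_def)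
    then show ?thesis using assms(1) disjoint by (simp add: card_Un_disjoint)
  qed
  ultimately have "card V choose r = card (mixed V A r) + (card ?C1 + card ?C0)" by (metis card_nsets)
  then show ?thesis using mixed by simp
qed

lemma card_dense_pairs_le:
  assumes "finite V" "d > 0" "c = (d / 2)\<^sup>2 / 32 ^ Suc s"
    and "\<delta> > 0" "2 * \<delta> \<le> thin (c / 8)" "2 * \<delta> \<le> d / 2" "\<delta> * real (card V) \<ge> 2" "c * real (card V) \<ge> 8"
  shows "real (card (dense_pairs V (Suc s) (d * real (card V) ^ Suc s)
      (\<delta> ^ 3 / 2 ^ (s + 5) * real (card V) ^ Suc (Suc s))))
    \<le> 2 powr (real (card V choose Suc s) - c / 2 * real (card V) ^ Suc s)"
proof -
  let ?n = "real (card V)" and ?r = "Suc s"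
  let ?near = "\<lambda>A. nearly_cliques V ?r (thin (c / 8)) A"
  have c: "c > 0" using assms(2,3) by simp
  have n: "card V \<ge> 1" using assms(8) by (cases "card V = 0") auto
  have near_pairs: "real (card (?near A \<times> ?near (- A)))
      \<le> 2 powr (real (card V choose ?r) - 3 / 4 * c * ?n ^ ?r)"
    if A: "A \<in> balanced V ?r (d / 2)" for A
  proof -
    have "real (card (?near A \<times> ?near (- A))) \<le> 2 powr (real (card (cliques V A ?r)) + c / 8 * ?n ^ ?r) *
        2 powr (real (card (cliques V (- A) ?r)) + c / 8 * ?n ^ ?r)"
      unfolding card_cartesian_product of_nat_mult
      using assms(1) c by (intro mult_mono card_nearly_cliques) auto
    also have "\<dots> \<le> 2 powr (real (card V choose ?r) - 3 / 4 * c * ?n ^ ?r)"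
      unfolding powr_add[symmetric]
    proof (rule powr_mono)
      have "real (card (cliques V A ?r)) + real (card (cliques V (- A) ?r))
          \<le> real (card V choose ?r) - c * ?n ^ ?r"
        unfolding assms(3) using assms(2) by (intro card_cliques_balanced[OF assms(1) _ _ n A]) auto
      then show "real (card (cliques V A ?r)) + c / 8 * ?n ^ ?r
          + (real (card (cliques V (- A) ?r)) + c / 8 * ?n ^ ?r)
          \<le> real (card V choose ?r) - 3 / 4 * c * ?n ^ ?r" by linarith
    qed simp
    finally show ?thesis .
  qed
  have few_balanced: "real (card (balanced V ?r (d / 2))) \<le> 2 powr (c / 8 * ?n ^ ?r)"
  proof (rule real_card_le_Pow[of "nsets V s"])
    have "real (card (nsets V s)) \<le> 1 * ?n ^ s" using real_choose_le_power by simp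
    also have "\<dots> \<le> (c / 8 * ?n) * ?n ^ s" using assms(8) by (intro mult_right_mono) auto
    finally show "real (card (nsets V s)) \<le> c / 8 * ?n ^ ?r" by simp
  qed (use assms(1) in \<open>auto simp: balanced_def\<close>)
  have "real (card (dense_pairs V ?r (d * ?n ^ ?r) (\<delta> ^ 3 / 2 ^ (s + 5) * ?n ^ Suc ?r)))
      \<le> real (card (\<Union>A\<in>balanced V ?r (d / 2). ?near A \<times> ?near (- A)))"
    using assms(1) by (intro real_card_mono dense_pairs_subset_nearly_cliques[OF assms(1,4-7)]) auto
  also have "\<dots> \<le> 2 powr (c / 8 * ?n ^ ?r) * 2 powr (real (card V choose ?r) - 3 / 4 * c * ?n ^ ?r)"
    using near_pairs few_balanced assms(1) by (intro real_card_UN_le_mult) auto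
  also have "\<dots> \<le> 2 powr (real (card V choose ?r) - c / 2 * ?n ^ ?r)"
    unfolding powr_add[symmetric] using c by (intro powr_mono) auto
  finally show ?thesis .
qed

lemma exists_few_dense_pairs:
  assumes "d > 0" "r \<ge> 1"
  shows "\<exists>\<gamma>>0. \<exists>c>0. \<forall>\<^sub>F V::'a set in large_sets.
    real (card (dense_pairs V r (d * real (card V) ^ r) (\<gamma> * real (card V) ^ Suc r)))
      \<le> 2 powr (real (card V choose r) - c * real (card V) ^ r)"
proof -
  obtain s where s: "r = Suc s" using assms(2) by (cases r) auto
  define c where "c = (d / 2)\<^sup>2 / 32 ^ Suc s"
  define \<delta> where "\<delta> = min (thin (c / 8) / 2) (d / 4)"
  have c: "c > 0" using assms(1) by (simp add: c_def)
  then have \<delta>: "\<delta> > 0" "2 * \<delta> \<le> thin (c / 8)" "2 * \<delta> \<le> d / 2"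
    using thin_pos[of "c / 8"] assms(1) by (auto simp: \<delta>_def)
  have "\<forall>\<^sub>F V::'a set in large_sets. real (card (dense_pairs V (Suc s) (d * real (card V) ^ Suc s)
        (\<delta> ^ 3 / 2 ^ (s + 5) * real (card V) ^ Suc (Suc s))))
      \<le> 2 powr (real (card V choose Suc s) - c / 2 * real (card V) ^ Suc s)"
    using eventually_large_sets_finite eventually_large_sets_ge[of "2 / \<delta>"]
      eventually_large_sets_ge[of "8 / c"]
  proof eventually_elim
    case (elim V)
    then have "\<delta> * real (card V) \<ge> 2" "c * real (card V) \<ge> 8" using c \<delta>(1) by (auto simp: field_simps)
    then show ?case by (rule card_dense_pairs_le[OF elim(1) assms(1) c_def \<delta>])
  qed
  moreover have "\<delta> ^ 3 / 2 ^ (s + 5) > 0" "c / 2 > 0" using \<delta> c by auto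
  ultimately show ?thesis unfolding s by blast
qed

lemma exists_few_dense_pairs_Diff:
  assumes "d > 0" "r \<ge> 1"
  shows "\<exists>\<gamma>>0. \<exists>c>0. \<forall>\<^sub>F V::'a set in large_sets. \<forall>X\<subseteq>V. card X \<le> m \<longrightarrow>
    real (card (dense_pairs (V - X) r (d * real (card V) ^ r) (\<gamma> * real (card V) ^ Suc r)))
      \<le> 2 powr (real (card V choose r) - c * real (card V) ^ r)"
proof -
  obtain \<gamma> c where \<gamma>: "\<gamma> > 0" and c: "c > 0" and few: "\<forall>\<^sub>F V::'a set in large_sets.
      real (card (dense_pairs V r (d * real (card V) ^ r) (\<gamma> * real (card V) ^ Suc r)))
      \<le> 2 powr (real (card V choose r) - c * real (card V) ^ r)"
    using exists_few_dense_pairs[OF assms] by blast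
  have "\<forall>\<^sub>F V::'a set in large_sets. \<forall>X\<subseteq>V. card X \<le> m \<longrightarrow>
    real (card (dense_pairs (V - X) r (d * real (card V) ^ r) (\<gamma> / 2 ^ Suc r * real (card V) ^ Suc r)))
      \<le> 2 powr (real (card V choose r) - c / 2 ^ r * real (card V) ^ r)"
    using eventually_large_sets_Diff[OF few, of m] eventually_large_sets_finite
      eventually_large_sets_ge[of "2 * real m"]
  proof eventually_elim
    case (elim V)
    show ?case
    proof (intro allI impI)
      fix X assume X: "X \<subseteq> V" "card X \<le> m"
      let ?n = "real (card V)" and ?u = "real (card (V - X))"
      have finX: "finite X" by (rule finite_subset[OF X(1) elim(2)])
      have u: "?u \<le> ?n" "?n / 2 \<le> ?u"
        using X elim(2,3) finX card_mono[OF elim(2) X(1)] by (auto simp: card_Diff_subset of_nat_diff)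
      have u_pow: "?u ^ j \<le> ?n ^ j" "?n ^ j / 2 ^ j \<le> ?u ^ j" for j
        using u power_mono[of ?u ?n j] power_mono[of "?n / 2" ?u j] by (auto simp: power_divide)
      have thresholds: "d * ?u ^ r \<le> d * ?n ^ r" "\<gamma> / 2 ^ Suc r * ?n ^ Suc r \<le> \<gamma> * ?u ^ Suc r"
        using mult_left_mono[OF u_pow(1)[of r], of d] mult_left_mono[OF u_pow(2)[of "Suc r"], of \<gamma>] assms(1) \<gamma>
        by simp_all
      have "real (card (dense_pairs (V - X) r (d * ?n ^ r) (\<gamma> / 2 ^ Suc r * ?n ^ Suc r)))
          \<le> real (card (dense_pairs (V - X) r (d * ?u ^ r) (\<gamma> * ?u ^ Suc r)))"
        using elim(2) by (intro real_card_mono dense_pairs_mono thresholds) auto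
      also have "\<dots> \<le> 2 powr (real (card (V - X) choose r) - c * ?u ^ r)"
        using elim(1) finX X(2) by blast
      also have "\<dots> \<le> 2 powr (real (card V choose r) - c / 2 ^ r * ?n ^ r)"
      proof (intro powr_mono diff_mono)
        show "real (card (V - X) choose r) \<le> real (card V choose r)"
          using elim(2) by (intro real_choose_mono card_mono) auto
        show "c / 2 ^ r * ?n ^ r \<le> c * ?u ^ r" using mult_left_mono[OF u_pow(2)[of r], of c] c by simp
      qed simp
      finally show "real (card (dense_pairs (V - X) r (d * ?n ^ r) (\<gamma> / 2 ^ Suc r * ?n ^ Suc r)))
          \<le> 2 powr (real (card V choose r) - c / 2 ^ r * ?n ^ r)" .
    qed
  qed
  moreover have "\<gamma> / 2 ^ Suc r > 0" "c / 2 ^ r > 0" using \<gamma> c by auto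
  ultimately show ?thesis by blast
qed

section \<open>Formulae as families of signed pairs\<close>

text \<open>A clause is coded by the pair of the set of its negated and the set of its positive variables, an
  assignment by the set \<open>W\<close> of variables set to one.\<close>

type_synonym 'a form = "('a set \<times> 'a set) set"

definition signed_pairs :: "nat \<Rightarrow> 'a set \<Rightarrow> 'a form" where
  "signed_pairs k V = {(S, T). S \<inter> T = {} \<and> S \<union> T \<in> nsets V k}"

definition satisfied :: "'a set \<Rightarrow> 'a set \<times> 'a set \<Rightarrow> bool" where
  "satisfied W p \<longleftrightarrow> snd p \<subseteq> W \<and> fst p \<inter> W = {}"

definition witness_set :: "'a form \<Rightarrow> 'a set \<times> 'a set \<Rightarrow> 'a set \<Rightarrow> bool" where
  "witness_set F p W \<longleftrightarrow> satisfied W p \<and> (\<forall>q\<in>F. q \<noteq> p \<longrightarrow> \<not> satisfied W q)"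

definition minimal_forms :: "nat \<Rightarrow> 'a set \<Rightarrow> 'a form set" where
  "minimal_forms k V = {F. F \<subseteq> signed_pairs k V \<and> (\<forall>p\<in>F. \<exists>W\<subseteq>V. witness_set F p W)}"

definition sparse_forms :: "nat \<Rightarrow> 'a set \<Rightarrow> real \<Rightarrow> 'a form set" where
  "sparse_forms k V s = {F. F \<subseteq> signed_pairs k V \<and>
     (\<forall>p\<in>F. \<exists>W\<subseteq>V. real (card W) < s \<and> witness_set F p W)}"

definition pos_clauses :: "'a form \<Rightarrow> 'a set set" where
  "pos_clauses F = {C. ({}, C) \<in> F}"

definition neg_clauses :: "'a form \<Rightarrow> 'a form" where
  "neg_clauses F = {p\<in>F. fst p \<noteq> {}}"

definition pos_link :: "'a form \<Rightarrow> 'a \<Rightarrow> 'a set set" where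
  "pos_link F x = {Q. x \<notin> Q \<and> insert x Q \<in> pos_clauses F}"

definition neg_link :: "'a form \<Rightarrow> 'a \<Rightarrow> 'a set set" where
  "neg_link F x = {Q. ({x}, Q) \<in> F}"

lemma signed_pairsD:
  assumes "(S, T) \<in> signed_pairs k V"
  shows "S \<subseteq> V" "T \<subseteq> V" "finite S" "finite T" "S \<inter> T = {}" "card S + card T = k"
  using assms by (auto simp: signed_pairs_def nsets_def card_Un_disjoint)

lemma finite_signed_pairs [simp]: "finite V \<Longrightarrow> finite (signed_pairs k V)"
  by (rule finite_subset[of _ "Pow V \<times> Pow V"]) (auto simp: signed_pairs_def nsets_def)

lemma finite_sparse_forms [simp]: "finite V \<Longrightarrow> finite (sparse_forms k V s)"
  by (rule finite_subset[of _ "Pow (signed_pairs k V)"]) (auto simp: sparse_forms_def)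

lemma finite_minimal_forms [simp]: "finite V \<Longrightarrow> finite (minimal_forms k V)"
  by (rule finite_subset[of _ "Pow (signed_pairs k V)"]) (auto simp: minimal_forms_def)

lemma sparse_forms_subset: "F \<in> sparse_forms k V s \<Longrightarrow> F \<subseteq> signed_pairs k V"
  by (simp add: sparse_forms_def)

lemma sparse_forms_minimal_forms: "sparse_forms k V s \<subseteq> minimal_forms k V"
  unfolding sparse_forms_def minimal_forms_def by blast

lemma sparse_forms_mono: "s \<le> s' \<Longrightarrow> sparse_forms k V s \<subseteq> sparse_forms k V s'"
  unfolding sparse_forms_def by (blast intro: order_less_le_trans)

lemma neg_clauses_Un_pos_clauses: "neg_clauses F \<union> Pair {} ` pos_clauses F = F"
  by (auto simp: neg_clauses_def pos_clauses_def)

lemma inj_neg_clauses_pos_clauses: "inj_on (\<lambda>F. (neg_clauses F, pos_clauses F)) A"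
  by (rule inj_onI) (metis (no_types, lifting) neg_clauses_Un_pos_clauses Pair_inject)

lemma pos_clauses_subset: "F \<subseteq> signed_pairs k V \<Longrightarrow> pos_clauses F \<subseteq> nsets V k"
  by (auto simp: pos_clauses_def signed_pairs_def)

lemma pos_link_subset:
  assumes "F \<subseteq> signed_pairs k V" shows "pos_link F x \<subseteq> nsets (V - {x}) (k - 1)"
proof
  fix Q assume "Q \<in> pos_link F x"
  then have "x \<notin> Q" "insert x Q \<in> nsets V k"
    using pos_clauses_subset[OF assms] by (auto simp: pos_link_def)
  then show "Q \<in> nsets (V - {x}) (k - 1)" by (auto simp: nsets_def)
qed

lemma neg_link_subset:
  assumes "F \<subseteq> signed_pairs k V" shows "neg_link F x \<subseteq> nsets (V - {x}) (k - 1)"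
proof
  fix Q assume "Q \<in> neg_link F x"
  then have "({x}, Q) \<in> signed_pairs k V" using assms by (auto simp: neg_link_def)
  then show "Q \<in> nsets (V - {x}) (k - 1)" by (auto simp: signed_pairs_def nsets_def)
qed

lemma satisfied_Int: "p \<in> signed_pairs k V \<Longrightarrow> satisfied (W \<inter> V) p \<longleftrightarrow> satisfied W p"
  by (auto simp: satisfied_def signed_pairs_def nsets_def)

lemma card_sparse_monotone_forms:
  assumes "finite V" shows "card {F\<in>sparse_forms k V s. neg_clauses F = {}} \<le> 2 ^ (card V choose k)"
proof -
  let ?M = "{F\<in>sparse_forms k V s. neg_clauses F = {}}"
  have "card ?M \<le> card (Pow (nsets V k))"
  proof (rule card_inj_on_le)
    show "inj_on pos_clauses ?M"
      using inj_neg_clauses_pos_clauses[of ?M] by (auto simp: inj_on_def)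
    show "pos_clauses ` ?M \<subseteq> Pow (nsets V k)" using pos_clauses_subset sparse_forms_subset by blast
  qed (use assms in simp)
  then show ?thesis using assms by (simp add: card_Pow)
qed

definition split_clause :: "clause \<Rightarrow> nat set \<times> nat set" where
  "split_clause C = ({x. Neg x \<in> C}, {x. Pos x \<in> C})"

definition join_clause :: "nat set \<times> nat set \<Rightarrow> clause" where
  "join_clause p = Neg ` fst p \<union> Pos ` snd p"

lemma join_clause_split_clause [simp]: "join_clause (split_clause C) = C"
proof (rule set_eqI)
  show "l \<in> join_clause (split_clause C) \<longleftrightarrow> l \<in> C" for l
    by (cases l) (auto simp: join_clause_def split_clause_def)
qed

lemma split_clause_join_clause [simp]: "split_clause (join_clause p) = p"
  by (auto simp: join_clause_def split_clause_def prod_eq_iff)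

lemma inj_split_clause: "inj split_clause"
  by (metis injI join_clause_split_clause)

lemma inj_join_clause: "inj join_clause"
  by (metis injI split_clause_join_clause)

lemma var_image_join_clause: "var ` join_clause p = fst p \<union> snd p"
  by (auto simp: join_clause_def image_Un image_image)

lemma join_clause_in_clauses_iff: "join_clause p \<in> clauses k n \<longleftrightarrow> p \<in> signed_pairs k {1..n}"
proof
  obtain S T where p: "p = (S, T)" by (cases p)
  assume C: "join_clause p \<in> clauses k n"
  then have "S \<union> T \<subseteq> {1..n}" by (simp add: clauses_def var_image_join_clause p)
  moreover have "card (S \<union> T) = k"
    using C card_image[of var "join_clause p"] by (simp add: clauses_def var_image_join_clause p)
  moreover have "S \<inter> T = {}"
  proof (rule ccontr)
    assume "S \<inter> T \<noteq> {}"
    then obtain x where "Neg x \<in> join_clause p" "Pos x \<in> join_clause p" by (auto simp: join_clause_def p)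
    then show False using C inj_onD[of var "join_clause p" "Neg x" "Pos x"] by (auto simp: clauses_def)
  qed
  moreover have "finite (S \<union> T)" using calculation(1) by (rule finite_subset) simp
  ultimately show "p \<in> signed_pairs k {1..n}"
    by (simp add: p signed_pairs_def nsets_def)
next
  obtain S T where p: "p = (S, T)" by (cases p)
  assume "p \<in> signed_pairs k {1..n}"
  note ST = signed_pairsD[OF this[unfolded p]]
  have inj: "inj_on var (join_clause p)" using ST(5) by (auto simp: inj_on_def join_clause_def p)
  moreover have "card (join_clause p) = k"
    using card_image[OF inj] ST by (simp add: var_image_join_clause p card_Un_disjoint)
  ultimately show "join_clause p \<in> clauses k n"
    using ST by (simp add: clauses_def var_image_join_clause p) (simp add: join_clause_def)
qed

lemma split_clause_in_signed_pairs: "C \<in> clauses k n \<Longrightarrow> split_clause C \<in> signed_pairs k {1..n}"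
  using join_clause_in_clauses_iff[of "split_clause C"] by simp

lemma satisfies_join_clause: "satisfies a (join_clause p) \<longleftrightarrow> satisfied {x. a x} p"
  by (auto simp: satisfies_def satisfied_def join_clause_def ball_Un)

lemma witness_join_clause:
  "witness (join_clause ` F) (join_clause p) a \<longleftrightarrow> witness_set F p {x. a x}"
  using inj_join_clause by (auto simp: witness_def witness_set_def satisfies_join_clause inj_eq)

lemma join_clause_image_minimal:
  assumes "F \<in> minimal_forms k {1..n}" shows "join_clause ` F \<in> minimal_formulae k n"
proof -
  have "join_clause ` F \<subseteq> clauses k n"
    using assms by (auto simp: minimal_forms_def join_clause_in_clauses_iff)
  moreover have "\<exists>a. witness (join_clause ` F) (join_clause p) a" if "p \<in> F" for p
  proof -
    obtain W where "witness_set F p W" using assms \<open>p \<in> F\<close> by (auto simp: minimal_forms_def)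
    then have "witness (join_clause ` F) (join_clause p) (\<lambda>x. x \<in> W)" by (simp add: witness_join_clause)
    then show ?thesis by blast
  qed
  ultimately show ?thesis by (simp add: minimal_formulae_def formulae_def minimal_def)
qed

lemma split_clause_image_sparse:
  assumes "\<Phi> \<in> minimal_formulae k n" "sparsely_minimal n z \<Phi>"
  shows "split_clause ` \<Phi> \<in> sparse_forms k {1..n} (z * real n)"
proof -
  let ?F = "split_clause ` \<Phi>"
  have sub: "?F \<subseteq> signed_pairs k {1..n}"
    using assms(1) split_clause_in_signed_pairs by (auto simp: minimal_formulae_def formulae_def)
  have \<Phi>: "join_clause ` ?F = \<Phi>" by (simp add: image_image)
  have "\<exists>W\<subseteq>{1..n}. real (card W) < z * real n \<and> witness_set ?F p W" if p: "p \<in> ?F" for p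
  proof -
    obtain a where a: "witness \<Phi> (join_clause p) a" "real (card {x\<in>{1..n}. a x}) < z * real n"
      using assms(2) p unfolding sparsely_minimal_def by (metis \<Phi> imageI)
    then have "witness_set ?F p {x. a x}" by (metis \<Phi> witness_join_clause)
    then have "witness_set ?F p ({x. a x} \<inter> {1..n})"
      using sub p satisfied_Int unfolding witness_set_def by blast
    moreover have "{x. a x} \<inter> {1..n} = {x\<in>{1..n}. a x}" by auto
    ultimately show ?thesis using a(2) by (intro exI[of _ "{x\<in>{1..n}. a x}"]) auto
  qed
  then show ?thesis using sub by (simp add: sparse_forms_def)
qed

lemma minimal_forms_image:
  assumes "inj_on h V" "F \<in> minimal_forms k V"
  shows "map_prod (image h) (image h) ` F \<in> minimal_forms k (h ` V)"
proof -
  let ?h = "map_prod (image h) (image h)"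
  have sub: "S \<subseteq> V" "T \<subseteq> V" "S \<inter> T = {}" "S \<union> T \<in> nsets V k" if "(S, T) \<in> F" for S T
    using assms(2) that by (auto simp: minimal_forms_def signed_pairs_def nsets_def)
  have "?h p \<in> signed_pairs k (h ` V)" if "p \<in> F" for p
  proof -
    obtain S T where p: "p = (S, T)" by (cases p)
    note ST = sub[OF that[unfolded p]]
    have "h ` S \<inter> h ` T = {}" using ST(1-3) assms(1) by (metis image_empty inj_on_image_Int)
    moreover have "h ` S \<union> h ` T \<in> nsets (h ` V) k"
      using ST(4) assms(1) unfolding image_Un[symmetric]
      by (auto simp: nsets_def card_image inj_on_subset)
    ultimately show ?thesis by (simp add: p signed_pairs_def)
  qed
  moreover have "\<exists>W\<subseteq>h ` V. witness_set (?h ` F) (?h p) W" if p: "p \<in> F" for p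
  proof -
    obtain W where W: "W \<subseteq> V" "witness_set F p W" using assms(2) p by (auto simp: minimal_forms_def)
    have "satisfied (h ` W) (?h q) \<longleftrightarrow> satisfied W q" if "q \<in> F" for q
    proof -
      obtain S T where q: "q = (S, T)" by (cases q)
      note ST = sub[OF that[unfolded q]]
      have "h ` T \<subseteq> h ` W \<longleftrightarrow> T \<subseteq> W" using ST(2) W(1) inj_on_image_mem_iff[OF assms(1)]
        unfolding image_subset_iff by blast
      moreover have "h ` S \<inter> h ` W = h ` (S \<inter> W)" using ST(1) W(1) assms(1) by (simp add: inj_on_image_Int)
      ultimately show ?thesis by (simp add: q satisfied_def)
    qed
    then have "witness_set (?h ` F) (?h p) (h ` W)" using W(2) p by (auto simp: witness_set_def)
    then show ?thesis using W(1) by blast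
  qed
  ultimately show ?thesis by (auto simp: minimal_forms_def)
qed

lemma card_minimal_forms_le:
  assumes "finite V" shows "card (minimal_forms k V) \<le> card (minimal_formulae k (card V))"
proof -
  obtain h where "bij_betw h V {1..card V}"
    using finite_same_card_bij[OF assms, of "{1..card V}"] by auto
  then have h: "inj_on h V" "h ` V = {1..card V}" by (auto simp: bij_betw_def)
  let ?g = "\<lambda>p. join_clause (map_prod (image h) (image h) p)"
  have "inj_on ?g (signed_pairs k V)"
  proof (rule inj_onI)
    fix p q assume pq: "p \<in> signed_pairs k V" "q \<in> signed_pairs k V" "?g p = ?g q"
    obtain S T S' T' where ST: "p = (S, T)" "q = (S', T')" by (cases p, cases q)
    have "h ` S = h ` S'" "h ` T = h ` T'" using injD[OF inj_join_clause pq(3)] by (auto simp: ST)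
    then show "p = q"
      using inj_on_image_eq_iff[OF h(1)] pq(1,2) signed_pairsD(1,2) by (metis ST)
  qed
  then have "inj_on (image ?g) (minimal_forms k V)"
    by (rule inj_on_subset[OF inj_on_image_Pow]) (auto simp: minimal_forms_def)
  moreover have "image ?g ` minimal_forms k V \<subseteq> minimal_formulae k (card V)"
    using join_clause_image_minimal minimal_forms_image[OF h(1)] unfolding h(2) image_image[symmetric]
    by blast
  ultimately show ?thesis using finite_minimal_formulae by (rule card_inj_on_le)
qed

section \<open>Sparse witnesses\<close>

text \<open>Witnesses with few ones make formulae cheap to describe: if \<open>W\<close> is the set of ones of a witness of
  \<open>(S, T)\<close>, then every other \<open>S'\<close> with \<open>(S', T)\<close> in the formula meets \<open>W\<close>. Families with this
  property are few.\<close>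

definition loose_families :: "'a set \<Rightarrow> nat \<Rightarrow> real \<Rightarrow> 'a set set set" where
  "loose_families V i s = {A. A \<subseteq> nsets V i \<and>
     (\<forall>S\<in>A. \<exists>W\<subseteq>V. real (card W) < s \<and> S \<inter> W = {} \<and> (\<forall>S'\<in>A. S' \<noteq> S \<longrightarrow> S' \<inter> W \<noteq> {}))}"

definition neg_sides :: "'a form \<Rightarrow> 'a set \<Rightarrow> 'a set \<Rightarrow> 'a set set" where
  "neg_sides F X T = {S. S \<inter> X = {} \<and> (S \<union> X, T) \<in> F}"

lemma finite_loose_families [simp]: "finite V \<Longrightarrow> finite (loose_families V i s)"
  by (rule finite_subset[of _ "Pow (nsets V i)"]) (auto simp: loose_families_def)

lemma neg_sides_loose:
  assumes "F \<in> sparse_forms k V s"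
  shows "neg_sides F X T \<in> loose_families V (k - card T - card X) s"
proof -
  have "neg_sides F X T \<subseteq> nsets V (k - card T - card X)"
  proof
    fix S assume S: "S \<in> neg_sides F X T"
    then have "(S \<union> X, T) \<in> signed_pairs k V"
      using sparse_forms_subset[OF assms] by (auto simp: neg_sides_def)
    note ST = signed_pairsD[OF this]
    have "card (S \<union> X) = card S + card X" using S ST(3) by (simp add: card_Un_disjoint neg_sides_def)
    then show "S \<in> nsets V (k - card T - card X)" using ST by (auto simp: nsets_def)
  qed
  moreover have "\<exists>W\<subseteq>V. real (card W) < s \<and> S \<inter> W = {} \<and> (\<forall>S'\<in>neg_sides F X T. S' \<noteq> S \<longrightarrow> S' \<inter> W \<noteq> {})"
    if S: "S \<in> neg_sides F X T" for S
  proof -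
    obtain W where W: "W \<subseteq> V" "real (card W) < s" "witness_set F (S \<union> X, T) W"
      using S assms by (auto simp: neg_sides_def sparse_forms_def)
    have "S' \<inter> W \<noteq> {}" if "S' \<in> neg_sides F X T" "S' \<noteq> S" for S'
    proof -
      have "S' \<union> X \<noteq> S \<union> X" using S that by (auto simp: neg_sides_def)
      then have "\<not> satisfied W (S' \<union> X, T)" using W(3) that by (auto simp: witness_set_def neg_sides_def)
      then show ?thesis using W(3) by (auto simp: witness_set_def satisfied_def)
    qed
    then show ?thesis using W by (intro exI[of _ W]) (auto simp: witness_set_def satisfied_def)
  qed
  ultimately show ?thesis by (auto simp: loose_families_def)
qed

lemma card_nsets_meeting:
  assumes "finite V" "W \<subseteq> V"
  shows "real (card {S\<in>nsets V (Suc i). S \<inter> W \<noteq> {}}) \<le> real (card W) * real (card V) ^ i"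
proof -
  have "{S\<in>nsets V (Suc i). S \<inter> W \<noteq> {}} \<subseteq> (\<lambda>(w, Y). insert w Y) ` (W \<times> nsets V i)"
  proof
    fix S assume "S \<in> {S\<in>nsets V (Suc i). S \<inter> W \<noteq> {}}"
    then obtain x where "S \<in> nsets V (Suc i)" "x \<in> S" "x \<in> W" by blast
    then have "(x, S - {x}) \<in> W \<times> nsets V i" "S = (\<lambda>(w, Y). insert w Y) (x, S - {x})"
      by (auto simp: nsets_def)
    then show "S \<in> (\<lambda>(w, Y). insert w Y) ` (W \<times> nsets V i)" by blast
  qed
  then have "real (card {S\<in>nsets V (Suc i). S \<inter> W \<noteq> {}}) \<le> real (card (W \<times> nsets V i))"
    using assms finite_subset[OF assms(2,1)] by (intro real_surj_card_le) auto
  also have "\<dots> \<le> real (card W) * real (card V) ^ i"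
    using real_choose_le_power[of "card V" i] by (simp add: card_cartesian_product mult_left_mono)
  finally show ?thesis .
qed

lemma loose_family_subset_meeting:
  assumes "A \<in> loose_families V i s" "A \<noteq> {}"
  obtains S W where "S \<in> nsets V i" "W \<subseteq> V" "real (card W) < s"
    "A \<subseteq> insert S {S'\<in>nsets V i. S' \<inter> W \<noteq> {}}"
proof -
  obtain S where S: "S \<in> A" using assms(2) by auto
  then have "\<exists>W\<subseteq>V. real (card W) < s \<and> S \<inter> W = {} \<and> (\<forall>S'\<in>A. S' \<noteq> S \<longrightarrow> S' \<inter> W \<noteq> {})"
    using assms(1) by (simp add: loose_families_def)
  then obtain W where "W \<subseteq> V" "real (card W) < s" "\<forall>S'\<in>A. S' \<noteq> S \<longrightarrow> S' \<inter> W \<noteq> {}"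
    by (elim exE conjE)
  moreover have "A \<subseteq> nsets V i" using assms(1) by (simp add: loose_families_def)
  ultimately show ?thesis using S by (intro that[of S W]) auto
qed

lemma card_loose_family_le:
  assumes "finite V" "A \<in> loose_families V (Suc i) s" "s \<ge> 0"
  shows "real (card A) \<le> 1 + s * real (card V) ^ i"
proof (cases "A = {}")
  case False
  obtain S W where "S \<in> nsets V (Suc i)" and W: "W \<subseteq> V" "real (card W) < s"
    and sub: "A \<subseteq> insert S {S'\<in>nsets V (Suc i). S' \<inter> W \<noteq> {}}"
    by (rule loose_family_subset_meeting[OF assms(2) False])
  have "card A \<le> Suc (card {S'\<in>nsets V (Suc i). S' \<inter> W \<noteq> {}})"
    using card_mono[OF _ sub] assms(1) by (simp add: card_insert_if split: if_splits)
  then have "real (card A) \<le> 1 + real (card {S'\<in>nsets V (Suc i). S' \<inter> W \<noteq> {}})" by simp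
  also have "\<dots> \<le> 1 + real (card W) * real (card V) ^ i" using card_nsets_meeting[OF assms(1) W(1)] by simp
  also have "\<dots> \<le> 1 + s * real (card V) ^ i" using W(2) by (intro add_left_mono mult_right_mono) auto
  finally show ?thesis .
qed (use assms in simp)

lemma card_loose_families_le_meeting:
  assumes "finite V" "s \<ge> 0"
  shows "real (card (loose_families V (Suc i) s))
    \<le> 1 + real (card V) ^ Suc i * real (card {W. W \<subseteq> V \<and> real (card W) \<le> s})
      * 2 powr (1 + s * real (card V) ^ i)"
proof -
  let ?n = "real (card V)" and ?meeting = "\<lambda>W. {S\<in>nsets V (Suc i). S \<inter> W \<noteq> {}}"
  let ?Ws = "{W. W \<subseteq> V \<and> real (card W) \<le> s}"
  let ?U = "\<Union>p\<in>nsets V (Suc i) \<times> ?Ws. Pow (insert (fst p) (?meeting (snd p)))"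
  have "loose_families V (Suc i) s \<subseteq> insert {} ?U"
  proof
    fix A assume A: "A \<in> loose_families V (Suc i) s"
    show "A \<in> insert {} ?U"
    proof (cases "A = {}")
      case False
      obtain S W where "S \<in> nsets V (Suc i)" "W \<subseteq> V" "real (card W) < s" "A \<subseteq> insert S (?meeting W)"
        by (rule loose_family_subset_meeting[OF A False])
      then show ?thesis by (intro insertI2 UN_I[of "(S, W)"]) auto
    qed simp
  qed
  then have "card (loose_families V (Suc i) s) \<le> card (insert {} ?U)"
    using assms(1) by (intro card_mono) auto
  also have "\<dots> \<le> Suc (card ?U)" by (rule card_insert_le_m1) auto
  finally have "real (card (loose_families V (Suc i) s)) \<le> 1 + real (card ?U)" by simp
  also have "real (card ?U) \<le> ?n ^ Suc i * real (card ?Ws) * 2 powr (1 + s * ?n ^ i)"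
  proof (rule real_card_UN_le_mult)
    fix p assume p: "p \<in> nsets V (Suc i) \<times> ?Ws"
    have "real (card (?meeting (snd p))) \<le> real (card (snd p)) * ?n ^ i"
      using p by (intro card_nsets_meeting[OF assms(1)]) auto
    also have "\<dots> \<le> s * ?n ^ i" using p by (intro mult_right_mono) auto
    finally show "real (card (Pow (insert (fst p) (?meeting (snd p))))) \<le> 2 powr (1 + s * ?n ^ i)"
      using assms(1) by (intro real_card_le_Pow[OF _ order_refl]) (auto simp: card_insert_if)
  next
    have "real (card (nsets V (Suc i) \<times> ?Ws)) = real (card V choose Suc i) * real (card ?Ws)"
      by (simp add: card_cartesian_product)
    also have "\<dots> \<le> ?n ^ Suc i * real (card ?Ws)" by (rule mult_right_mono[OF real_choose_le_power]) simp
    finally show "real (card (nsets V (Suc i) \<times> ?Ws)) \<le> ?n ^ Suc i * real (card ?Ws)" .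
  qed (use assms(1) in auto)
  finally show ?thesis by simp
qed

lemma card_loose_families_le:
  assumes "finite V" "e > 0" "0 \<le> z" "z \<le> thin (e / 4)" "z \<le> e / 4" "card V \<ge> 1"
    and large: "2 + real (Suc i) * log 2 (real (card V)) \<le> e / 2 * real (card V)"
  shows "real (card (loose_families V (Suc i) (z * real (card V)))) \<le> 2 powr (e * real (card V) ^ Suc i)"
proof -
  let ?n = "real (card V)" and ?N = "real (card V) ^ Suc i"
  let ?Ws = "{W. W \<subseteq> V \<and> real (card W) \<le> z * ?n}"
  have n: "?n \<ge> 1" "?n \<le> ?N" using assms(6) by (auto simp: self_le_power)
  have e_quarter: "e / 4 > 0" using assms(2) by simp
  have few_W: "real (card ?Ws) \<le> 2 powr (e / 4 * ?N)"
  proof -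
    have "z * ?n \<le> thin (e / 4) * ?n" using assms(4) by (intro mult_right_mono) auto
    then have "real (card ?Ws) \<le> real (card {W. W \<subseteq> V \<and> real (card W) \<le> thin (e / 4) * ?n})"
      using assms(1) by (intro real_card_mono) auto
    also have "\<dots> \<le> 2 powr (e / 4 * ?n)" by (rule card_thin_subsets[OF e_quarter assms(1) order_refl])
    also have "\<dots> \<le> 2 powr (e / 4 * ?N)" using e_quarter n by (intro powr_mono mult_left_mono) auto
    finally show ?thesis .
  qed
  have "z * ?n * ?n ^ i \<le> e / 4 * ?n * ?n ^ i" using assms(5) by (intro mult_right_mono) auto
  then have meeting: "z * ?n * ?n ^ i \<le> e / 4 * ?N" by simp
  have "real (card (loose_families V (Suc i) (z * ?n)))
      \<le> 1 + ?N * real (card ?Ws) * 2 powr (1 + z * ?n * ?n ^ i)"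
    using assms(1,3) by (intro card_loose_families_le_meeting) auto
  also have "\<dots> \<le> 1 + ?N * 2 powr (e / 4 * ?N) * 2 powr (1 + e / 4 * ?N)"
    using few_W by (intro add_left_mono mult_mono mult_left_mono powr_mono meeting add_left_mono) auto
  also have "\<dots> = 1 + ?N * 2 powr (1 + e / 2 * ?N)"
    by (simp add: powr_add[symmetric] mult.assoc algebra_simps)
  also have "\<dots> \<le> 2 * (?N * 2 powr (1 + e / 2 * ?N))"
  proof -
    have "1 * 1 \<le> ?N * 2 powr (1 + e / 2 * ?N)"
      using n(1) assms(2) by (intro mult_mono ge_one_powr_ge_zero one_le_power) auto
    then show ?thesis by simp
  qed
  also have "\<dots> = 2 powr (2 + real (Suc i) * log 2 ?n + e / 2 * ?N)"
    unfolding power_eq_powr_log[OF assms(6)] by (simp add: powr_add)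
  also have "\<dots> \<le> 2 powr (e * ?N)"
  proof (rule powr_mono)
    have "e / 2 * ?n \<le> e / 2 * ?N" using n assms(2) by (intro mult_left_mono) auto
    then show "2 + real (Suc i) * log 2 ?n + e / 2 * ?N \<le> e * ?N" using large by simp
  qed simp
  finally show ?thesis .
qed

locale sparse_setting =
  fixes k :: nat and V :: "'a set" and s e :: real
  assumes finite_V: "finite V" and k_ge_2: "2 \<le> k" and e_pos: "0 < e"
    and card_V_ge: "real k ^ 2 \<le> e * real (card V)"
    and few_loose_families:
      "1 \<le> j \<Longrightarrow> j \<le> k \<Longrightarrow> real (card (loose_families V j s)) \<le> 2 powr (e * real (card V) ^ j)"

lemma sparse_setting_mono:
  assumes "sparse_setting k V s e" "e \<le> e'" shows "sparse_setting k V s e'"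
proof -
  interpret sparse_setting k V s e by (rule assms(1))
  have exponent_le: "e * real (card V) ^ j \<le> e' * real (card V) ^ j" for j
    using assms(2) by (rule mult_right_mono) simp
  show ?thesis
  proof
    show "real (card (loose_families V j s)) \<le> 2 powr (e' * real (card V) ^ j)" if "1 \<le> j" "j \<le> k" for j
      using few_loose_families[OF that] exponent_le[of j] by (meson order_trans powr_mono one_le_numeral)
  qed (use finite_V k_ge_2 e_pos card_V_ge assms(2) exponent_le[of 1] in auto)
qed

lemma eventually_sparse_setting:
  assumes "e > 0" "2 \<le> k"
  shows "\<exists>\<zeta>>0. \<forall>\<^sub>F V::'a set in large_sets. sparse_setting k V (\<zeta> * real (card V)) e"
proof -
  define \<zeta> where "\<zeta> = min (thin (e / 4)) (e / 4)"
  have \<zeta>: "\<zeta> > 0" "\<zeta> \<le> thin (e / 4)" "\<zeta> \<le> e / 4" using thin_pos[of "e / 4"] assms(1) by (auto simp: \<zeta>_def)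
  have "\<forall>\<^sub>F V::'a set in large_sets. 2 + real k * log 2 (real (card V)) \<le> e / 2 * real (card V)"
    using assms(1) by (intro eventually_large_sets_card) real_asymp
  then have "\<forall>\<^sub>F V::'a set in large_sets. sparse_setting k V (\<zeta> * real (card V)) e"
    using eventually_large_sets_finite eventually_large_sets_ge[of 1]
      eventually_large_sets_ge[of "real k ^ 2 / e"]
  proof eventually_elim
    case (elim V)
    have "real (card (loose_families V j (\<zeta> * real (card V)))) \<le> 2 powr (e * real (card V) ^ j)"
      if j: "1 \<le> j" "j \<le> k" for j
    proof -
      obtain i where i: "j = Suc i" using j(1) by (cases j) auto
      have "real (Suc i) * log 2 (real (card V)) \<le> real k * log 2 (real (card V))"
        using j i elim(3) by (intro mult_right_mono) auto
      then show ?thesis unfolding i using elim \<zeta> assms(1) by (intro card_loose_families_le) auto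
    qed
    then show ?case using elim assms by unfold_locales (auto simp: field_simps)
  qed
  then show ?thesis using \<zeta>(1) by blast
qed

section \<open>Deleting variables\<close>

definition clauses_over :: "'a form \<Rightarrow> 'a set \<Rightarrow> 'a set \<Rightarrow> 'a form" where
  "clauses_over F X T = {p\<in>F. X \<subseteq> fst p \<and> snd p = T}"

lemma card_clauses_over_image_le:
  assumes "finite V" "G \<subseteq> sparse_forms k V s"
  shows "card ((\<lambda>F. clauses_over F X T) ` G) \<le> card (loose_families V (k - card T - card X) s)"
proof (rule surj_card_le)
  show "(\<lambda>F. clauses_over F X T) ` G
      \<subseteq> image (\<lambda>S. (S \<union> X, T)) ` loose_families V (k - card T - card X) s"
  proof (rule image_subsetI)
    fix F assume "F \<in> G"
    have "p \<in> clauses_over F X T \<longleftrightarrow> p \<in> (\<lambda>S. (S \<union> X, T)) ` neg_sides F X T" for p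
    proof
      assume "p \<in> clauses_over F X T"
      then have "p = (fst p - X \<union> X, T)" "fst p - X \<in> neg_sides F X T"
        by (auto simp: clauses_over_def neg_sides_def Un_absorb2 prod_eq_iff)
      then show "p \<in> (\<lambda>S. (S \<union> X, T)) ` neg_sides F X T" by (rule image_eqI)
    qed (auto simp: clauses_over_def neg_sides_def)
    then have "clauses_over F X T = (\<lambda>S. (S \<union> X, T)) ` neg_sides F X T" by blast
    then show "clauses_over F X T \<in> image (\<lambda>S. (S \<union> X, T)) ` loose_families V (k - card T - card X) s"
      using neg_sides_loose[of F k V s X T] assms(2) \<open>F \<in> G\<close> by blast
  qed
qed (use assms(1) in simp)

lemma sum_by_card_le:
  fixes f :: "nat \<Rightarrow> real"
  assumes "finite A" "finite I" "\<And>T. T \<in> A \<Longrightarrow> card T \<in> I"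
    and "\<And>t. t \<in> I \<Longrightarrow> real (card {T\<in>A. card T = t}) * f t \<le> b"
  shows "(\<Sum>T\<in>A. f (card T)) \<le> real (card I) * b"
proof -
  have "(\<Sum>T\<in>A. f (card T)) = (\<Sum>t\<in>I. \<Sum>T\<in>{T\<in>A. card T = t}. f (card T))"
    using assms by (subst sum.group) auto
  also have "\<dots> = (\<Sum>t\<in>I. real (card {T\<in>A. card T = t}) * f t)" by (intro sum.cong) auto
  also have "\<dots> \<le> real (card I) * b" using assms by (intro sum_bounded_above)
  finally show ?thesis .
qed

definition core :: "'a set \<Rightarrow> 'a form \<Rightarrow> 'a form" where
  "core X F = {p\<in>F. (fst p \<union> snd p) \<inter> X = {}}"

definition pos_links_at :: "'a set \<Rightarrow> 'a form \<Rightarrow> ('a \<times> 'a set) set" where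
  "pos_links_at X F = {(x, Q). x \<in> X \<and> Q \<in> pos_link F x \<and> Q \<inter> X = {}}"

definition neg_links_at :: "'a set \<Rightarrow> 'a form \<Rightarrow> ('a \<times> 'a set) set" where
  "neg_links_at X F = {(x, Q). x \<in> X \<and> Q \<in> neg_link F x \<and> Q \<inter> X = {}}"

definition remainder :: "'a set \<Rightarrow> 'a form \<Rightarrow> 'a form" where
  "remainder X F = {(S, T). (S, T) \<in> F \<and> (S \<union> T) \<inter> X \<noteq> {} \<and>
     \<not> (S = {} \<and> card (T \<inter> X) = 1) \<and> \<not> (card S = 1 \<and> T \<inter> X = {})}"

lemma core_minimal: assumes "F \<in> minimal_forms k V" shows "core X F \<in> minimal_forms k (V - X)"
proof -
  have "core X F \<subseteq> signed_pairs k (V - X)"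
  proof
    fix p assume p: "p \<in> core X F"
    then have "p \<in> signed_pairs k V" using assms by (auto simp: core_def minimal_forms_def)
    then show "p \<in> signed_pairs k (V - X)" using p by (auto simp: core_def signed_pairs_def nsets_def)
  qed
  moreover have "\<exists>W\<subseteq>V - X. witness_set (core X F) p W" if p: "p \<in> core X F" for p
  proof -
    obtain W where W: "W \<subseteq> V" "witness_set F p W" using p assms by (auto simp: core_def minimal_forms_def)
    have "satisfied (W - X) q \<longleftrightarrow> satisfied W q" if "q \<in> core X F" for q
      using that by (auto simp: core_def satisfied_def)
    then have "witness_set (core X F) p (W - X)" using W(2) p by (auto simp: witness_set_def core_def)
    then show ?thesis using W(1) by blast
  qed
  ultimately show ?thesis by (auto simp: minimal_forms_def)
qed

lemma form_from_parts:
  "F = core X F \<union> remainder X F \<union> (\<lambda>(x, Q). ({}, insert x Q)) ` pos_links_at X F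
    \<union> (\<lambda>(x, Q). ({x}, Q)) ` neg_links_at X F" (is "_ = ?R")
proof
  show "?R \<subseteq> F"
    by (auto simp: core_def remainder_def pos_links_at_def neg_links_at_def pos_link_def
        pos_clauses_def neg_link_def)
  show "F \<subseteq> ?R"
  proof
    fix p assume p: "p \<in> F"
    obtain S T where ST: "p = (S, T)" by (cases p)
    consider (avoiding) "p \<in> core X F \<union> remainder X F" | (pos_link) "S = {}" "card (T \<inter> X) = 1"
      | (neg_link) "card S = 1" "(S \<union> T) \<inter> X \<noteq> {}" "T \<inter> X = {}"
      using p by (auto simp: ST core_def remainder_def)
    then show "p \<in> ?R"
    proof cases
      case pos_link
      then obtain x where x: "T \<inter> X = {x}" by (auto simp: card_1_singleton_iff)
      then have T: "T = insert x (T - {x})" by auto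
      then have "(x, T - {x}) \<in> pos_links_at X F"
        using x p pos_link(1) by (auto simp: ST pos_links_at_def pos_link_def pos_clauses_def)
      then have "p \<in> (\<lambda>(x, Q). ({}, insert x Q)) ` pos_links_at X F"
        using T pos_link(1) by (intro image_eqI[of _ _ "(x, T - {x})"]) (auto simp: ST)
      then show ?thesis by blast
    next
      case neg_link
      then obtain x where "S = {x}" by (auto simp: card_1_singleton_iff)
      then have "p \<in> (\<lambda>(x, Q). ({x}, Q)) ` neg_links_at X F"
        using p neg_link by (intro image_eqI[of _ _ "(x, T)"]) (auto simp: ST neg_links_at_def neg_link_def)
      then show ?thesis by blast
    qed blast
  qed
qed

lemma pos_links_at_subset:
  assumes "F \<subseteq> signed_pairs k V" shows "pos_links_at X F \<subseteq> X \<times> nsets (V - X) (k - 1)"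
  using pos_link_subset[OF assms] by (fastforce simp: pos_links_at_def nsets_def)

lemma remainder_decomposition:
  assumes "finite V" "F \<subseteq> signed_pairs k V"
  shows "remainder X F = Pair {} ` {C\<in>pos_clauses F. 2 \<le> card (C \<inter> X)}
    \<union> (\<Union>p\<in>{{}} \<times> {T. T \<subseteq> V \<and> T \<inter> X \<noteq> {} \<and> card T < k}. clauses_over F (fst p) (snd p))
    \<union> (\<Union>p\<in>(\<lambda>x. {x}) ` X \<times> {T. T \<subseteq> V \<and> T \<inter> X = {} \<and> card T + 1 < k}. clauses_over F (fst p) (snd p))"
    (is "_ = ?P1 \<union> ?P2 \<union> ?P3")
proof (rule set_eqI)
  fix p :: "'a set \<times> 'a set"
  obtain S T where p: "p = (S, T)" by (cases p)
  show "p \<in> remainder X F \<longleftrightarrow> p \<in> ?P1 \<union> ?P2 \<union> ?P3"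
  proof (cases "p \<in> F")
    case False
    then show ?thesis unfolding p by (auto simp: remainder_def clauses_over_def pos_clauses_def)
  next
    case True
    note ST = signed_pairsD[OF subsetD[OF assms(2) True[unfolded p]]]
    have in_P1: "p \<in> ?P1 \<longleftrightarrow> S = {} \<and> 2 \<le> card (T \<inter> X)"
      using True unfolding p by (auto simp: pos_clauses_def)
    have in_P2: "p \<in> ?P2 \<longleftrightarrow> T \<inter> X \<noteq> {} \<and> 1 \<le> card S"
      using True ST(2,6) unfolding p by (auto simp: clauses_over_def)
    have in_P3: "p \<in> ?P3 \<longleftrightarrow> S \<inter> X \<noteq> {} \<and> T \<inter> X = {} \<and> 2 \<le> card S"
      using True ST(2,6) unfolding p by (auto simp: clauses_over_def)
    have in_remainder: "p \<in> remainder X F \<longleftrightarrow> (S \<inter> X \<noteq> {} \<or> T \<inter> X \<noteq> {}) \<and>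
        \<not> (S = {} \<and> card (T \<inter> X) = 1) \<and> \<not> (card S = 1 \<and> T \<inter> X = {})"
      using True unfolding p by (auto simp: remainder_def)
    show ?thesis
    proof (cases "S = {}")
      case True
      have "T \<inter> X \<noteq> {} \<and> card (T \<inter> X) \<noteq> 1 \<longleftrightarrow> 2 \<le> card (T \<inter> X)"
      proof -
        have "T \<inter> X = {} \<longleftrightarrow> card (T \<inter> X) = 0" using ST(4) by simp
        then show ?thesis by arith
      qed
      then show ?thesis unfolding Un_iff in_P1 in_P2 in_P3 in_remainder using True by simp
    next
      case False
      then have "1 \<le> card S" using ST(3) by (simp add: Suc_le_eq card_gt_0_iff)
      then have "card S \<noteq> 1 \<longleftrightarrow> 2 \<le> card S" by auto
      then show ?thesis unfolding Un_iff in_P1 in_P2 in_P3 in_remainder using False \<open>1 \<le> card S\<close> by blast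
    qed
  qed
qed

lemma card_forms_le_by_parts:
  assumes "finite V" "X \<subseteq> V" "G \<subseteq> minimal_forms k V" "m \<ge> 0"
    and "\<And>F0. real (card ((\<lambda>F. (pos_links_at X F, neg_links_at X F)) ` {F\<in>G. core X F = F0})) \<le> m"
  shows "real (card G) \<le> real (card (minimal_formulae k (card V - card X))) * m
      * real (card (remainder X ` G))"
proof -
  have finG: "finite G" using finite_subset[OF assms(3)] assms(1) by simp
  let ?links = "\<lambda>F. (pos_links_at X F, neg_links_at X F)"
  let ?b = "\<lambda>F. (?links F, remainder X F)"
  have "real (card G) \<le> real (card (core X ` G)) * (m * real (card (remainder X ` G)))"
  proof (rule card_fibres_le[OF finG, where b = ?b])
    show "inj_on (\<lambda>F. (core X F, ?b F)) G"
    proof (rule inj_onI)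
      fix F F' assume "(core X F, ?b F) = (core X F', ?b F')"
      then show "F = F'" using form_from_parts[of F X] form_from_parts[of F' X] by simp
    qed
    fix F0
    let ?H = "{F\<in>G. core X F = F0}"
    have "card (?b ` ?H) \<le> card (?links ` ?H \<times> remainder X ` G)"
      using finG by (intro card_mono) auto
    then have "real (card (?b ` ?H)) \<le> real (card (?links ` ?H)) * real (card (remainder X ` G))"
      by (simp only: card_cartesian_product of_nat_mult[symmetric] of_nat_le_iff)
    also have "\<dots> \<le> m * real (card (remainder X ` G))" using assms(5) by (intro mult_right_mono) auto
    finally show "real (card (?b ` ?H)) \<le> m * real (card (remainder X ` G))" .
  qed
  also have "\<dots> \<le> real (card (minimal_formulae k (card V - card X))) * (m * real (card (remainder X ` G)))"
  proof (rule mult_right_mono)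
    have "card (core X ` G) \<le> card (minimal_forms k (V - X))"
      using core_minimal[OF subsetD[OF assms(3)]] assms(1) by (intro card_mono) auto
    also have "\<dots> \<le> card (minimal_formulae k (card (V - X)))"
      using assms(1) by (intro card_minimal_forms_le) simp
    also have "card (V - X) = card V - card X"
      using assms(1,2) by (simp add: card_Diff_subset finite_subset)
    finally show "real (card (core X ` G)) \<le> real (card (minimal_formulae k (card V - card X)))" by simp
  qed (use assms(4) in simp)
  finally show ?thesis by (simp add: mult.assoc)
qed

definition deletion_bound :: "nat \<Rightarrow> nat \<Rightarrow> nat \<Rightarrow> real \<Rightarrow> real \<Rightarrow> real" where
  "deletion_bound k n i r \<delta> = real (card (minimal_formulae k (n - i))) *
     2 powr (r * real (n choose (k - 1)) - \<delta> * real n ^ (k - 1))"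

lemma deletion_bound_nonneg: "0 \<le> deletion_bound k n i r \<delta>"
  by (simp add: deletion_bound_def)

lemma deletion_bound_antimono: "\<delta> \<le> \<delta>' \<Longrightarrow> deletion_bound k n i r \<delta>' \<le> deletion_bound k n i r \<delta>"
  unfolding deletion_bound_def
  by (intro mult_left_mono powr_mono diff_left_mono mult_right_mono) auto

context sparse_setting
begin

abbreviation n :: real where "n \<equiv> real (card V)"

lemma one_le_card_V: "1 \<le> card V"
proof -
  have "0 < real k ^ 2" using k_ge_2 by simp
  also have "\<dots> \<le> e * n" by (rule card_V_ge)
  finally show ?thesis by (cases "card V = 0") auto
qed

lemma one_le_n: "1 \<le> n"
  using one_le_card_V by simp

lemma power_n_pred: "n ^ (k - 1) = n * n ^ (k - 2)"
proof -
  have "k - 1 = Suc (k - 2)" using k_ge_2 by simp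
  then show ?thesis by simp
qed

lemma k_square_power_le: "real k ^ 2 * n ^ (k - 2) \<le> e * n ^ (k - 1)"
  using mult_right_mono[OF card_V_ge, of "n ^ (k - 2)"] unfolding power_n_pred by (simp add: mult.assoc)

lemma sparse_forms_finite: "G \<subseteq> sparse_forms k V s \<Longrightarrow> finite G"
  using finite_subset[of G "sparse_forms k V s"] finite_V by simp

lemma card_clauses_over_families_le:
  assumes "finite J" "G \<subseteq> sparse_forms k V s" "\<And>p. p \<in> J \<Longrightarrow> card (snd p) + card (fst p) < k"
  shows "real (card ((\<lambda>F. \<Union>p\<in>J. clauses_over F (fst p) (snd p)) ` G))
    \<le> 2 powr (\<Sum>p\<in>J. e * n ^ (k - card (snd p) - card (fst p)))"
proof -
  let ?m = "\<lambda>p. k - card (snd p) - card (fst p)"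
  have "real (card ((\<lambda>F. \<Union>p\<in>J. clauses_over F (fst p) (snd p)) ` G))
      \<le> real (\<Prod>p\<in>J. card ((\<lambda>F. clauses_over F (fst p) (snd p)) ` G))"
    using card_image_UN_le[OF assms(1) sparse_forms_finite[OF assms(2)]] by (simp only: of_nat_le_iff)
  also have "\<dots> \<le> (\<Prod>p\<in>J. 2 powr (e * n ^ ?m p))"
    unfolding of_nat_prod
  proof (rule prod_mono, safe)
    fix X T assume "(X, T) \<in> J"
    then have m: "1 \<le> ?m (X, T)" "?m (X, T) \<le> k" using assms(3)[of "(X, T)"] by auto
    have "real (card ((\<lambda>F. clauses_over F X T) ` G)) \<le> real (card (loose_families V (?m (X, T)) s))"
      using card_clauses_over_image_le[OF finite_V assms(2)] by simp
    also have "\<dots> \<le> 2 powr (e * n ^ ?m (X, T))" by (rule few_loose_families[OF m])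
    finally show "real (card ((\<lambda>F. clauses_over F (fst (X, T)) (snd (X, T))) ` G))
        \<le> 2 powr (e * n ^ ?m (X, T))"
      by simp
  qed simp
  also have "\<dots> = 2 powr (\<Sum>p\<in>J. e * n ^ ?m p)" using assms(1) by (simp add: powr_sum)
  finally show ?thesis .
qed

lemma card_clauses_over_products_le:
  assumes "finite X" "finite Y" "G \<subseteq> sparse_forms k V s"
    and "\<And>A. A \<in> X \<Longrightarrow> card A = c" "\<And>T. T \<in> Y \<Longrightarrow> card T + c < k" "real (card X) \<le> x" "0 \<le> b"
    and "\<And>t. t + c < k \<Longrightarrow> real (card {T\<in>Y. card T = t}) * n ^ (k - t - c) \<le> b"
  shows "real (card ((\<lambda>F. \<Union>p\<in>X \<times> Y. clauses_over F (fst p) (snd p)) ` G)) \<le> 2 powr (x * real k * e * b)"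
proof -
  have layers: "(\<Sum>T\<in>Y. n ^ (k - card T - c)) \<le> real k * b"
  proof -
    have "(\<Sum>T\<in>Y. n ^ (k - card T - c)) \<le> real (card {..<k - c}) * b"
      using assms(2,5,8) by (intro sum_by_card_le) force+
    also have "\<dots> \<le> real k * b" using assms(7) by (intro mult_right_mono) auto
    finally show ?thesis .
  qed
  have "(\<Sum>p\<in>X \<times> Y. e * n ^ (k - card (snd p) - card (fst p))) = (\<Sum>A\<in>X. \<Sum>T\<in>Y. e * n ^ (k - card T - card A))"
    by (simp only: sum.cartesian_product case_prod_unfold)
  also have "\<dots> = (\<Sum>A\<in>X. e * (\<Sum>T\<in>Y. n ^ (k - card T - c)))"
    using assms(4) by (intro sum.cong) (auto simp: sum_distrib_left)
  also have "\<dots> \<le> real (card X) * (e * (real k * b))"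
    using layers e_pos by (intro sum_bounded_above mult_left_mono) auto
  also have "\<dots> \<le> x * (e * (real k * b))" using assms(6,7) e_pos by (intro mult_right_mono) auto
  finally have exponent: "(\<Sum>p\<in>X \<times> Y. e * n ^ (k - card (snd p) - card (fst p))) \<le> x * real k * e * b"
    by (simp add: mult_ac)
  have "real (card ((\<lambda>F. \<Union>p\<in>X \<times> Y. clauses_over F (fst p) (snd p)) ` G))
      \<le> 2 powr (\<Sum>p\<in>X \<times> Y. e * n ^ (k - card (snd p) - card (fst p)))"
    using assms(1-5) by (intro card_clauses_over_families_le) auto
  also have "\<dots> \<le> 2 powr (x * real k * e * b)" by (intro powr_mono exponent) simp
  finally show ?thesis .
qed

lemma card_sets_of_card_times_power_le:
  assumes "Y \<subseteq> Pow V" "t + c < k"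
  shows "real (card {T\<in>Y. card T = t}) * n ^ (k - t - c) \<le> n ^ (k - c)"
proof -
  have "{T\<in>Y. card T = t} \<subseteq> nsets V t"
    using assms(1) finite_subset[OF _ finite_V] by (auto simp: nsets_def)
  then have "real (card {T\<in>Y. card T = t}) * n ^ (k - t - c) \<le> n ^ t * n ^ (k - t - c)"
    by (intro mult_right_mono real_card_nsets_subset_le[OF finite_V]) auto
  also have "\<dots> = n ^ (k - c)" using assms(2) by (simp add: power_add[symmetric])
  finally show ?thesis .
qed

lemma neg_clauses_eq_UN_clauses_over:
  assumes "F \<subseteq> signed_pairs k V"
  shows "neg_clauses F = (\<Union>p\<in>{{}} \<times> {T. T \<subseteq> V \<and> card T < k}. clauses_over F (fst p) (snd p))"
proof (rule set_eqI)
  fix p :: "'a set \<times> 'a set"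
  obtain S T where p: "p = (S, T)" by (cases p)
  show "p \<in> neg_clauses F \<longleftrightarrow>
      p \<in> (\<Union>p\<in>{{}} \<times> {T. T \<subseteq> V \<and> card T < k}. clauses_over F (fst p) (snd p))"
  proof (cases "p \<in> F")
    case True
    note ST = signed_pairsD[OF subsetD[OF assms True[unfolded p]]]
    then have "S \<noteq> {} \<longleftrightarrow> card T < k" by (auto simp: card_gt_0_iff[symmetric])
    then show ?thesis using True ST(2) unfolding p by (auto simp: neg_clauses_def clauses_over_def)
  qed (auto simp: p neg_clauses_def clauses_over_def)
qed

lemma card_neg_clauses_image_le:
  assumes "G \<subseteq> sparse_forms k V s"
  shows "real (card (neg_clauses ` G)) \<le> 2 powr (real k * e * n ^ k)"
proof -
  let ?Y = "{T. T \<subseteq> V \<and> card T < k}"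
  have "neg_clauses ` G = (\<lambda>F. \<Union>p\<in>{{}} \<times> ?Y. clauses_over F (fst p) (snd p)) ` G"
    by (rule image_cong[OF refl neg_clauses_eq_UN_clauses_over[OF sparse_forms_subset[OF subsetD[OF assms]]]])
  moreover have "real (card ((\<lambda>F. \<Union>p\<in>{{}} \<times> ?Y. clauses_over F (fst p) (snd p)) ` G))
      \<le> 2 powr (1 * real k * e * n ^ k)"
  proof (rule card_clauses_over_products_le[where c = 0])
    show "real (card {T\<in>?Y. card T = t}) * n ^ (k - t - 0) \<le> n ^ k" if "t + 0 < k" for t
      using card_sets_of_card_times_power_le[of ?Y t 0] that by auto
  qed (use finite_V assms in auto)
  ultimately show ?thesis by simp
qed

lemma card_nsets_meeting_twice:
  assumes "X \<subseteq> V" "card X \<le> k"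
  shows "real (card {C\<in>nsets V k. 2 \<le> card (C \<inter> X)}) \<le> e * n ^ (k - 1)"
proof -
  let ?D = "{C\<in>nsets V k. 2 \<le> card (C \<inter> X)}"
  have finX: "finite X" by (rule finite_subset[OF assms(1) finite_V])
  have "?D \<subseteq> (\<lambda>(x, y, Y). insert x (insert y Y)) ` (X \<times> X \<times> nsets V (k - 2))"
  proof
    fix C assume C: "C \<in> ?D"
    then have Ck: "C \<subseteq> V" "finite C" "card C = k" by (auto simp: nsets_def)
    obtain x y where xy: "x \<in> C \<inter> X" "y \<in> C \<inter> X" "x \<noteq> y"
      using C Ck(2) card_le_Suc0_iff_eq[of "C \<inter> X"] by fastforce
    have "C - {x, y} \<in> nsets V (k - 2)" using Ck xy by (auto simp: nsets_def card_Diff_subset)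
    moreover have "C = insert x (insert y (C - {x, y}))" using xy by auto
    ultimately show "C \<in> (\<lambda>(x, y, Y). insert x (insert y Y)) ` (X \<times> X \<times> nsets V (k - 2))"
      using xy by (intro image_eqI[of _ _ "(x, y, C - {x, y})"]) auto
  qed
  then have "real (card ?D) \<le> real (card (X \<times> X \<times> nsets V (k - 2)))"
    using finX finite_V by (intro real_surj_card_le) auto
  also have "\<dots> = real (card X) ^ 2 * real (card V choose (k - 2))"
    by (simp add: card_cartesian_product power2_eq_square)
  also have "\<dots> \<le> real k ^ 2 * n ^ (k - 2)"
    using assms(2) real_choose_le_power by (intro mult_mono power_mono) auto
  also have "\<dots> \<le> e * n ^ (k - 1)" by (rule k_square_power_le)
  finally show ?thesis .
qed

lemma card_sets_meeting_times_power_le: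
  assumes "X \<subseteq> V" "card X \<le> k" "t < k"
  shows "real (card {T\<in>{T. T \<subseteq> V \<and> T \<inter> X \<noteq> {} \<and> card T < k}. card T = t}) * n ^ (k - t)
      \<le> real k * n ^ (k - 1)"
    (is "real (card ?Y) * _ \<le> _")
proof (cases t)
  case 0
  have "T = {}" if "T \<subseteq> V" "card T = 0" for T using that finite_subset[OF that(1) finite_V] by simp
  then have "?Y = {}" using 0 by auto
  then show ?thesis by (simp only: card.empty) simp
next
  case (Suc i)
  have "?Y \<subseteq> {T\<in>nsets V (Suc i). T \<inter> X \<noteq> {}}"
    using finite_subset[OF _ finite_V] Suc by (auto simp: nsets_def)
  then have "real (card ?Y) \<le> real (card {T\<in>nsets V (Suc i). T \<inter> X \<noteq> {}})"
    using finite_V by (intro real_card_mono) auto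
  also have "\<dots> \<le> real (card X) * n ^ i" by (rule card_nsets_meeting[OF finite_V assms(1)])
  also have "\<dots> \<le> real k * n ^ i" using assms(2) by (intro mult_right_mono) auto
  finally have "real (card ?Y) * n ^ (k - t) \<le> real k * n ^ i * n ^ (k - t)" by (rule mult_right_mono) simp
  also have "\<dots> = real k * n ^ (i + (k - t))" by (simp add: power_add)
  also have "i + (k - t) = k - 1" using assms(3) Suc by simp
  finally show ?thesis .
qed

lemma card_remainder_image_le:
  assumes "G \<subseteq> sparse_forms k V s" "X \<subseteq> V" "card X \<le> k"
  shows "real (card (remainder X ` G)) \<le> 2 powr (3 * real k ^ 2 * e * n ^ (k - 1))"
proof -
  let ?Y2 = "{T. T \<subseteq> V \<and> T \<inter> X \<noteq> {} \<and> card T < k}" and ?Y3 = "{T. T \<subseteq> V \<and> T \<inter> X = {} \<and> card T + 1 < k}"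
  let ?P1 = "\<lambda>F. Pair {} ` {C\<in>pos_clauses F. 2 \<le> card (C \<inter> X)} :: 'a form"
  let ?P2 = "\<lambda>F. \<Union>p\<in>{{}} \<times> ?Y2. clauses_over F (fst p) (snd p)"
  let ?P3 = "\<lambda>F. \<Union>p\<in>(\<lambda>x. {x}) ` X \<times> ?Y3. clauses_over F (fst p) (snd p)"
  let ?E = "e * n ^ (k - 1)"
  have finG: "finite G" by (rule sparse_forms_finite[OF assms(1)])
  have finX: "finite X" by (rule finite_subset[OF assms(2) finite_V])
  have sub: "F \<subseteq> signed_pairs k V" if "F \<in> G" for F using that assms(1) sparse_forms_subset by blast
  have P1: "real (card (?P1 ` G)) \<le> 2 powr ?E"
  proof (rule real_card_le_Pow[of "Pair {} ` {C\<in>nsets V k. 2 \<le> card (C \<inter> X)}"])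
    show "?P1 ` G \<subseteq> Pow (Pair {} ` {C\<in>nsets V k. 2 \<le> card (C \<inter> X)})"
      using pos_clauses_subset[OF sub] by blast
    show "real (card (Pair {} ` {C\<in>nsets V k. 2 \<le> card (C \<inter> X)} :: 'a form)) \<le> ?E"
      using card_nsets_meeting_twice[OF assms(2,3)] by (simp add: card_image inj_on_def)
  qed (use finite_V in simp)
  have P2: "real (card (?P2 ` G)) \<le> 2 powr (1 * real k * e * (real k * n ^ (k - 1)))"
  proof (rule card_clauses_over_products_le[where c = 0])
    show "real (card {T\<in>?Y2. card T = t}) * n ^ (k - t - 0) \<le> real k * n ^ (k - 1)" if "t + 0 < k" for t
      using card_sets_meeting_times_power_le[OF assms(2,3), of t] that by simp
  qed (use finite_V assms(1) in auto)
  have P3: "real (card (?P3 ` G)) \<le> 2 powr (real k * real k * e * n ^ (k - 1))"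
  proof (rule card_clauses_over_products_le[where c = 1])
    show "real (card {T\<in>?Y3. card T = t}) * n ^ (k - t - 1) \<le> n ^ (k - 1)" if "t + 1 < k" for t
      by (rule card_sets_of_card_times_power_le[OF _ that]) auto
    show "real (card ((\<lambda>x. {x}) ` X)) \<le> real k"
      using card_image_le[OF finX, of "\<lambda>x. {x}"] assms(3) by linarith
  qed (use finite_V finX assms(1) in auto)
  have "remainder X ` G = (\<lambda>F. (?P1 F \<union> ?P2 F) \<union> ?P3 F) ` G"
    by (rule image_cong[OF refl remainder_decomposition[OF finite_V sub]])
  then have "card (remainder X ` G) \<le> card ((\<lambda>F. ?P1 F \<union> ?P2 F) ` G) * card (?P3 ` G)"
    using card_image_Un_le[OF finG, of "\<lambda>F. ?P1 F \<union> ?P2 F" ?P3] by simp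
  also have "\<dots> \<le> (card (?P1 ` G) * card (?P2 ` G)) * card (?P3 ` G)"
    by (intro mult_right_mono card_image_Un_le[OF finG]) simp
  finally have "real (card (remainder X ` G))
      \<le> real (card (?P1 ` G)) * real (card (?P2 ` G)) * real (card (?P3 ` G))"
    by (simp only: of_nat_mult[symmetric] of_nat_le_iff)
  also have "\<dots> \<le> 2 powr ?E * 2 powr (1 * real k * e * (real k * n ^ (k - 1)))
      * 2 powr (real k * real k * e * n ^ (k - 1))"
    using P1 P2 P3 by (intro mult_mono) auto
  also have "\<dots> = 2 powr ((1 + 2 * real k ^ 2) * ?E)"
    unfolding powr_add[symmetric] by (simp add: power2_eq_square algebra_simps)
  also have "\<dots> \<le> 2 powr (3 * real k ^ 2 * ?E)"
    using k_ge_2 e_pos by (intro powr_mono mult_right_mono) (auto simp: one_le_power)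
  finally show ?thesis by (simp add: mult.assoc)
qed

lemma card_le_deletion_bound:
  assumes "G \<subseteq> sparse_forms k V s" "X \<subseteq> V" "card X \<le> k"
    and "\<And>F0. real (card ((\<lambda>F. (pos_links_at X F, neg_links_at X F)) ` {F\<in>G. core X F = F0}))
      \<le> 2 powr (r * real (card V choose (k - 1)) - \<delta> * n ^ (k - 1))"
  shows "real (card G) \<le> deletion_bound k (card V) (card X) r (\<delta> - 3 * real k ^ 2 * e)"
proof -
  let ?links = "2 powr (r * real (card V choose (k - 1)) - \<delta> * n ^ (k - 1))"
  have "G \<subseteq> minimal_forms k V" using assms(1) sparse_forms_minimal_forms by blast
  then have "real (card G) \<le> real (card (minimal_formulae k (card V - card X))) * ?links
      * real (card (remainder X ` G))"
    using assms(4) by (intro card_forms_le_by_parts[OF finite_V assms(2)]) auto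
  also have "\<dots> \<le> real (card (minimal_formulae k (card V - card X))) * ?links
      * 2 powr (3 * real k ^ 2 * e * n ^ (k - 1))"
    using card_remainder_image_le[OF assms(1-3)] by (intro mult_left_mono) auto
  also have "\<dots> = deletion_bound k (card V) (card X) r (\<delta> - 3 * real k ^ 2 * e)"
    unfolding deletion_bound_def mult.assoc powr_add[symmetric] by (simp add: algebra_simps)
  finally show ?thesis .
qed

lemma card_neg_links_at_image_le:
  assumes "G \<subseteq> sparse_forms k V s" "X \<subseteq> V"
    and thin: "\<And>F x. F \<in> G \<Longrightarrow> x \<in> X \<Longrightarrow> real (card (neg_link F x)) \<le> thin e * n ^ (k - 1)"
  shows "real (card (neg_links_at X ` G)) \<le> 2 powr (real (card X) * (e * n ^ (k - 1)))"
proof -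
  let ?p = "\<lambda>x F. Pair x ` {Q\<in>neg_link F x. Q \<inter> X = {}}"
  let ?thin = "{Y. Y \<subseteq> nsets V (k - 1) \<and> real (card Y) \<le> thin e * n ^ (k - 1)}"
  have finX: "finite X" by (rule finite_subset[OF assms(2) finite_V])
  have each: "real (card (?p x ` G)) \<le> 2 powr (e * n ^ (k - 1))" if x: "x \<in> X" for x
  proof -
    have "?p x ` G \<subseteq> image (Pair x) ` ?thin"
    proof (rule image_subsetI)
      fix F assume F: "F \<in> G"
      have sub: "neg_link F x \<subseteq> nsets V (k - 1)"
        using neg_link_subset[of F k V x] nsets_mono[of "V - {x}" V] assms(1) F sparse_forms_subset by blast
      then have "finite (neg_link F x)" using finite_subset finite_nsets[OF finite_V] by metis
      then have "card {Q\<in>neg_link F x. Q \<inter> X = {}} \<le> card (neg_link F x)" by (intro card_mono) auto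
      then have "{Q\<in>neg_link F x. Q \<inter> X = {}} \<in> ?thin" using thin[OF F x] sub by auto
      then show "?p x F \<in> image (Pair x) ` ?thin" by (rule imageI)
    qed
    then have "real (card (?p x ` G)) \<le> real (card ?thin)"
      using finite_V by (intro real_surj_card_le) auto
    also have "\<dots> \<le> 2 powr (e * n ^ (k - 1))"
      using finite_V real_choose_le_power[of "card V" "k - 1"]
      by (intro card_thin_subsets[OF e_pos]) (simp_all only: card_nsets finite_nsets)
    finally show ?thesis .
  qed
  have "neg_links_at X ` G = (\<lambda>F. \<Union>x\<in>X. ?p x F) ` G"
    by (intro image_cong) (auto simp: neg_links_at_def)
  then have "real (card (neg_links_at X ` G)) \<le> real (\<Prod>x\<in>X. card (?p x ` G))"
    using card_image_UN_le[OF finX sparse_forms_finite[OF assms(1)], of ?p] by (simp only: of_nat_le_iff)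
  also have "\<dots> \<le> (\<Prod>x\<in>X. 2 powr (e * n ^ (k - 1)))"
    unfolding of_nat_prod using each by (intro prod_mono) auto
  also have "\<dots> = 2 powr (real (card X) * (e * n ^ (k - 1)))" by (simp add: powr_power mult.commute)
  finally show ?thesis .
qed

lemma card_le_deletion_bound_thin:
  assumes G: "G \<subseteq> sparse_forms k V s" and X: "X \<subseteq> V" "card X \<le> k"
    and thin: "\<And>F x. F \<in> G \<Longrightarrow> x \<in> X \<Longrightarrow> real (card (neg_link F x)) \<le> thin e * n ^ (k - 1)"
    and links: "\<And>F0. real (card (pos_links_at X ` {F\<in>G. core X F = F0}))
      \<le> 2 powr (r * real (card V choose (k - 1)) - \<delta> * n ^ (k - 1))"
  shows "real (card G) \<le> deletion_bound k (card V) (card X) r (\<delta> - 4 * real k ^ 2 * e)"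
proof -
  let ?C = "real (card V choose (k - 1))" and ?E = "e * n ^ (k - 1)"
  have neg: "real (card (neg_links_at X ` G)) \<le> 2 powr (real k ^ 2 * ?E)"
  proof -
    have "real (card X) \<le> real k" using X(2) by simp
    also have "\<dots> \<le> real k ^ 2" using k_ge_2 by (simp add: power2_eq_square)
    finally have "real (card X) * ?E \<le> real k ^ 2 * ?E" using e_pos by (intro mult_right_mono) auto
    then have "2 powr (real (card X) * ?E) \<le> 2 powr (real k ^ 2 * ?E)" by simp
    then show ?thesis using card_neg_links_at_image_le[OF G X(1) thin] by linarith
  qed
  have "real (card ((\<lambda>F. (pos_links_at X F, neg_links_at X F)) ` {F\<in>G. core X F = F0}))
      \<le> 2 powr (r * ?C - (\<delta> - real k ^ 2 * e) * n ^ (k - 1))" for F0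
  proof -
    let ?H = "{F\<in>G. core X F = F0}"
    have "card ((\<lambda>F. (pos_links_at X F, neg_links_at X F)) ` ?H)
        \<le> card (pos_links_at X ` ?H \<times> neg_links_at X ` G)"
      using sparse_forms_finite[OF G] by (intro card_mono) auto
    then have "real (card ((\<lambda>F. (pos_links_at X F, neg_links_at X F)) ` ?H))
        \<le> real (card (pos_links_at X ` ?H)) * real (card (neg_links_at X ` G))"
      by (simp only: card_cartesian_product of_nat_mult[symmetric] of_nat_le_iff)
    also have "\<dots> \<le> 2 powr (r * ?C - \<delta> * n ^ (k - 1)) * 2 powr (real k ^ 2 * ?E)"
      using links neg by (intro mult_mono) auto
    also have "\<dots> = 2 powr (r * ?C - (\<delta> - real k ^ 2 * e) * n ^ (k - 1))"
      unfolding powr_add[symmetric] by (simp add: algebra_simps)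
    finally show ?thesis .
  qed
  then have "real (card G) \<le> deletion_bound k (card V) (card X) r (\<delta> - real k ^ 2 * e - 3 * real k ^ 2 * e)"
    by (rule card_le_deletion_bound[OF G X])
  then show ?thesis by (simp add: algebra_simps)
qed

end

section \<open>Clauses ruled out by a clause with negative literals\<close>

definition excluded :: "nat \<Rightarrow> 'a set \<Rightarrow> 'a set \<Rightarrow> 'a form \<Rightarrow> 'a set set" where
  "excluded k V S F =
     {C\<in>nsets (V - S) k. (\<exists>T\<subseteq>C. (S, T) \<in> F) \<and> (\<forall>x\<in>S. \<exists>Q\<in>pos_link F x. Q \<subseteq> C)}"

lemma excluded_subset: "excluded k V S F \<subseteq> nsets (V - S) k"
  by (auto simp: excluded_def)

lemma finite_excluded [simp]: "finite V \<Longrightarrow> finite (excluded k V S F)"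
  by (simp add: excluded_def)

text \<open>In a witness of the positive clause \<open>C\<close> the positive clauses on \<open>insert x Q\<close> force all \<open>x \<in> S\<close> to be
  zero, which satisfies \<open>(S, T)\<close>.\<close>

lemma excluded_not_pos_clause:
  assumes "F \<in> minimal_forms k V" "S \<noteq> {}" "C \<in> excluded k V S F"
  shows "C \<notin> pos_clauses F"
proof
  assume "C \<in> pos_clauses F"
  then have "({}, C) \<in> F" by (simp add: pos_clauses_def)
  then obtain W where W: "witness_set F ({}, C) W" using assms(1) by (auto simp: minimal_forms_def)
  then have CW: "C \<subseteq> W" by (simp add: witness_set_def satisfied_def)
  obtain T where T: "T \<subseteq> C" "(S, T) \<in> F" using assms(3) by (auto simp: excluded_def)
  have "x \<notin> W" if x: "x \<in> S" for x
  proof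
    assume xW: "x \<in> W"
    obtain Q where Q: "({}, insert x Q) \<in> F" "Q \<subseteq> C"
      using assms(3) x by (auto simp: excluded_def pos_link_def pos_clauses_def)
    have "insert x Q \<noteq> C" using assms(3) x by (auto simp: excluded_def nsets_def)
    then have "\<not> satisfied W ({}, insert x Q)" using W Q(1) by (auto simp: witness_set_def)
    then show False using xW Q(2) CW by (auto simp: satisfied_def)
  qed
  then have "satisfied W (S, T)" using CW T(1) by (auto simp: satisfied_def)
  then show False using W T(2) assms(2) by (auto simp: witness_set_def)
qed

lemma excluded_restrict:
  assumes "F \<subseteq> signed_pairs k V" "S \<noteq> {}"
  shows "excluded k V S (neg_clauses F \<union> Pair {} ` (pos_clauses F \<inter> {C\<in>nsets V k. C \<inter> S \<noteq> {}}))
    = excluded k V S F" (is "excluded k V S ?F = _")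
proof -
  have "(S, T) \<in> ?F \<longleftrightarrow> (S, T) \<in> F" for T using assms(2) by (auto simp: neg_clauses_def)
  moreover have "pos_link ?F x = pos_link F x" if "x \<in> S" for x
    using pos_clauses_subset[OF assms(1)] that by (auto simp: pos_link_def pos_clauses_def neg_clauses_def)
  ultimately show ?thesis unfolding excluded_def by auto
qed

definition excluding_forms :: "nat \<Rightarrow> 'a set \<Rightarrow> real \<Rightarrow> real \<Rightarrow> 'a form set" where
  "excluding_forms k V s \<gamma> = {F\<in>sparse_forms k V s.
     \<exists>S\<subseteq>V. S \<noteq> {} \<and> card S \<le> k \<and> \<gamma> * real (card V) ^ k \<le> real (card (excluded k V S F))}"

context sparse_setting
begin

lemma card_large_excluded_le:
  assumes "S \<noteq> {}"
  shows "real (card {F\<in>sparse_forms k V s. g \<le> real (card (excluded k V S F))})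
    \<le> 2 powr (real (card V choose k) - g + real k * e * n ^ k)"
proof -
  let ?G = "{F\<in>sparse_forms k V s. g \<le> real (card (excluded k V S F))}"
  let ?B = "{C\<in>nsets V k. C \<inter> S \<noteq> {}}"
  let ?ex = "\<lambda>N Y. excluded k V S (N \<union> Pair {} ` Y)"
  have G: "?G \<subseteq> sparse_forms k V s" by auto
  have "real (card ?G) \<le> real (card (neg_clauses ` ?G)) * 2 powr (real (card (nsets V k)) - g)"
  proof (rule card_fibres_le[OF sparse_forms_finite[OF G] inj_neg_clauses_pos_clauses])
    fix N
    let ?Y = "{Y. Y \<subseteq> nsets V k \<and> Y \<inter> ?ex N (Y \<inter> ?B) = {} \<and> g \<le> real (card (?ex N (Y \<inter> ?B)))}"
    have "pos_clauses ` {F\<in>?G. neg_clauses F = N} \<subseteq> ?Y"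
    proof (rule image_subsetI)
      fix F assume F: "F \<in> {F\<in>?G. neg_clauses F = N}"
      then have sub: "F \<subseteq> signed_pairs k V" and "F \<in> minimal_forms k V"
        using sparse_forms_subset sparse_forms_minimal_forms by blast+
      moreover have "?ex N (pos_clauses F \<inter> ?B) = excluded k V S F"
        using excluded_restrict[OF sub assms] F by simp
      ultimately show "pos_clauses F \<in> ?Y"
        using F pos_clauses_subset[OF sub] excluded_not_pos_clause[OF _ assms] by auto
    qed
    then have "real (card (pos_clauses ` {F\<in>?G. neg_clauses F = N})) \<le> real (card ?Y)"
      using finite_V by (intro real_card_mono) auto
    also have "\<dots> \<le> 2 powr (real (card (nsets V k)) - g)"
    proof (rule card_avoiding)
      show "?ex N Z \<subseteq> nsets V k - ?B" for Z using excluded_subset[of k V S] by (fastforce simp: nsets_def)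
    qed (use finite_V in auto)
    finally show "real (card (pos_clauses ` {F\<in>?G. neg_clauses F = N}))
        \<le> 2 powr (real (card (nsets V k)) - g)" .
  qed
  also have "\<dots> \<le> 2 powr (real k * e * n ^ k) * 2 powr (real (card (nsets V k)) - g)"
    using card_neg_clauses_image_le[OF G] by (rule mult_right_mono) simp
  also have "\<dots> = 2 powr (real (card V choose k) - g + real k * e * n ^ k)"
    by (simp add: powr_add[symmetric] algebra_simps)
  finally show ?thesis .
qed

lemma card_excluding_forms_le:
  assumes "\<gamma> > 0" "real k * e \<le> \<gamma> / 4" "real k + real k * log 2 n \<le> \<gamma> / 2 * n"
  shows "real (card (excluding_forms k V s \<gamma>)) \<le> 2 powr ((1 - \<gamma> / 4) * real (card V choose k))"
proof -
  let ?I = "{S. S \<subseteq> V \<and> card S \<le> k} - {{}}"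
  let ?A = "\<lambda>S. {F\<in>sparse_forms k V s. \<gamma> * n ^ k \<le> real (card (excluded k V S F))}"
  let ?b = "2 powr (real (card V choose k) - \<gamma> * n ^ k + real k * e * n ^ k)"
  have few: "real (card ?I) \<le> 2 powr (\<gamma> / 2 * n ^ k)"
  proof -
    have "card ?I \<le> card {S. S \<subseteq> V \<and> card S \<le> k}" using finite_V by (intro card_mono) auto
    also have "\<dots> \<le> (card V + 1) ^ k" by (rule card_subsets_of_card_le[OF finite_V])
    finally have "real (card ?I) \<le> real ((card V + 1) ^ k)" by (simp only: of_nat_le_iff)
    also have "\<dots> = (n + 1) ^ k" by (simp add: add.commute)
    also have "\<dots> \<le> (2 * n) ^ k" using one_le_n by (intro power_mono) auto
    also have "\<dots> = 2 powr (real k + real k * log 2 n)"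
      using power_eq_powr_log[OF one_le_card_V, of k] by (simp add: power_mult_distrib powr_add powr_realpow)
    also have "\<dots> \<le> 2 powr (\<gamma> / 2 * n ^ k)"
    proof (rule powr_mono)
      have "\<gamma> / 2 * n \<le> \<gamma> / 2 * n ^ k" using assms(1) one_le_n k_ge_2
        by (intro mult_left_mono self_le_power) auto
      then show "real k + real k * log 2 n \<le> \<gamma> / 2 * n ^ k" using assms(3) by linarith
    qed simp
    finally show ?thesis .
  qed
  have "excluding_forms k V s \<gamma> = (\<Union>S\<in>?I. ?A S)" by (auto simp: excluding_forms_def)
  then have "real (card (excluding_forms k V s \<gamma>)) = real (card (\<Union>S\<in>?I. ?A S))" by simp
  also have "\<dots> \<le> 2 powr (\<gamma> / 2 * n ^ k) * ?b"
    using finite_V few by (intro real_card_UN_le_mult card_large_excluded_le) auto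
  also have "\<dots> \<le> 2 powr ((1 - \<gamma> / 4) * real (card V choose k))"
    unfolding powr_add[symmetric]
  proof (rule powr_mono)
    have "real k * e * n ^ k \<le> \<gamma> / 4 * n ^ k" using assms(2) by (intro mult_right_mono) auto
    moreover have "\<gamma> / 4 * real (card V choose k) \<le> \<gamma> / 4 * n ^ k"
      using assms(1) real_choose_le_power by (intro mult_left_mono) auto
    ultimately show "\<gamma> / 2 * n ^ k + (real (card V choose k) - \<gamma> * n ^ k + real k * e * n ^ k)
        \<le> (1 - \<gamma> / 4) * real (card V choose k)" by (simp add: left_diff_distrib)
  qed simp
  finally show ?thesis .
qed

end

section \<open>Irregular links\<close>

definition extensions :: "'a set \<Rightarrow> 'a set set \<Rightarrow> 'a set \<Rightarrow> 'a set \<Rightarrow> 'a set set" where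
  "extensions V P S T = {R\<in>nsets (V - S - T) (card S). \<forall>x\<in>S. insert x (R \<union> T) \<in> P}"

definition atypical :: "nat \<Rightarrow> 'a set \<Rightarrow> real \<Rightarrow> 'a set \<Rightarrow> 'a form \<Rightarrow> 'a set set" where
  "atypical k V b S F = {T\<in>nsets (V - S) (k - 1 - card S).
     real (card (extensions V (pos_clauses F) S T)) < b * real (card V) ^ card S}"

definition dense_forms :: "nat \<Rightarrow> 'a set \<Rightarrow> real \<Rightarrow> real \<Rightarrow> 'a form set" where
  "dense_forms k V s d = {F\<in>sparse_forms k V s.
     \<forall>x\<in>V. d * real (card V) ^ (k - 1) \<le> real (card (pos_link F x))}"

definition thin_neg_forms :: "nat \<Rightarrow> 'a set \<Rightarrow> real \<Rightarrow> real \<Rightarrow> real \<Rightarrow> 'a form set" where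
  "thin_neg_forms k V s d t = {F\<in>dense_forms k V s d.
     \<forall>x\<in>V. real (card (neg_link F x)) \<le> t * real (card V) ^ (k - 1)}"

lemma finite_extensions [simp]: "finite V \<Longrightarrow> finite (extensions V P S T)"
  by (simp add: extensions_def)

lemma atypical_subset: "atypical k V b S F \<subseteq> nsets (V - S) (k - 1 - card S)"
  by (auto simp: atypical_def)

lemma dense_forms_subset: "dense_forms k V s d \<subseteq> sparse_forms k V s"
  by (auto simp: dense_forms_def)

lemma thin_neg_forms_subset: "thin_neg_forms k V s d t \<subseteq> sparse_forms k V s"
  by (auto simp: thin_neg_forms_def dense_forms_def)

lemma finite_dense_forms [simp]: "finite V \<Longrightarrow> finite (dense_forms k V s d)"
  by (simp add: dense_forms_def)

lemma pos_link_core: "x \<notin> X \<Longrightarrow> pos_link (core X F) x = {Q\<in>pos_link F x. Q \<inter> X = {}}"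
  by (auto simp: pos_link_def pos_clauses_def core_def)

lemma common_pos_link_core:
  assumes "x \<notin> X" "y \<notin> X" "U \<inter> X = {}"
  shows "common U r (pos_link (core X F) x) (pos_link (core X F) y)
      = common U r (pos_link F x) (pos_link F y)"
proof -
  have "Q \<in> pos_link (core X F) z \<longleftrightarrow> Q \<in> pos_link F z" if "Q \<subseteq> C" "C \<in> nsets U (Suc r)" "z \<notin> X" for Q C z
    using that assms(3) by (subst pos_link_core) (auto simp: nsets_def)
  then show ?thesis unfolding common_def using assms(1,2) by (intro Collect_cong) blast
qed

lemma card_supersets:
  assumes "finite U" "A \<subseteq> nsets U t" "t + i = r"
  shows "card A * ((card U - t) choose i) \<le> 2 ^ r * card {Q\<in>nsets U r. \<exists>T\<in>A. T \<subseteq> Q}"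
proof -
  let ?J = "\<Union>T\<in>A. (\<lambda>R. R \<union> T) ` nsets (U - T) i"
  have finA: "finite A" by (rule finite_subset[OF assms(2) finite_nsets[OF assms(1)]])
  have T: "finite T" "card T = t" "T \<subseteq> U" if "T \<in> A" for T using that assms(2) by (auto simp: nsets_def)
  have join: "R \<inter> T = {} \<and> finite (R \<union> T) \<and> card (R \<union> T) = r \<and> R \<union> T \<subseteq> U"
    if "T \<in> A" "R \<in> nsets (U - T) i" for T R
    using T[OF that(1)] that(2) assms(3) by (auto simp: nsets_def card_Un_disjoint disjoint_iff subset_iff)
  have "card A * ((card U - t) choose i) = (\<Sum>T\<in>A. card (nsets (U - T) i))"
    using T by (simp add: card_Diff_subset)
  also have "\<dots> \<le> 2 ^ r * card ?J"
    using join assms(1) by (intro sum_card_joins_le[OF finA]) auto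
  also have "card ?J \<le> card {Q\<in>nsets U r. \<exists>T\<in>A. T \<subseteq> Q}"
    using join assms(1) by (intro card_mono) (auto simp: nsets_def)
  finally show ?thesis by simp
qed

lemma card_supersets_ge:
  assumes "finite V" "S \<subseteq> V" "card S = i" "1 \<le> i" "i < k" "2 * real k \<le> real (card V)"
    and "A \<subseteq> nsets (V - S) (k - 1 - i)"
  shows "real (card A) * real (card V) ^ i / (4 * real k) ^ k
    \<le> real (card {Q\<in>nsets (V - S) (k - 1). \<exists>T\<in>A. T \<subseteq> Q})"
proof -
  let ?n = "real (card V)" and ?Q = "{Q\<in>nsets (V - S) (k - 1). \<exists>T\<in>A. T \<subseteq> Q}"
  have nk: "card V \<ge> 2 * k" using assms(6) by linarith
  have kp: "real k \<ge> 1" using assms(4,5) by simp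
  have "card (V - S) = card V - i" using assms(1-3) finite_subset[OF assms(2)] by (simp add: card_Diff_subset)
  then have room: "card (V - S) - (k - 1 - i) = card V - (k - 1)" using assms(5) nk by linarith
  have "(?n / (2 * real k)) ^ i \<le> (real (card V - (k - 1)) / real i) ^ i"
  proof (rule power_mono)
    have "?n / 2 \<le> real (card V - (k - 1))" using nk by (simp add: of_nat_diff)
    then have "?n / 2 / real k \<le> real (card V - (k - 1)) / real i" using assms(4,5) by (intro frac_le) auto
    then show "?n / (2 * real k) \<le> real (card V - (k - 1)) / real i" by simp
  qed simp
  also have "\<dots> \<le> real ((card V - (k - 1)) choose i)"
    using nk assms(5) by (intro binomial_ge_n_over_k_pow_k) simp
  finally have choose_ge: "(?n / (2 * real k)) ^ i \<le> real ((card V - (k - 1)) choose i)" .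
  have "card A * ((card (V - S) - (k - 1 - i)) choose i) \<le> 2 ^ (k - 1) * card ?Q"
    by (rule card_supersets) (use assms(1,5,7) in auto)
  then have "real (card A * ((card V - (k - 1)) choose i)) \<le> real (2 ^ (k - 1) * card ?Q)"
    unfolding room by (simp only: of_nat_le_iff)
  then have "real (card A) * (?n / (2 * real k)) ^ i \<le> 2 ^ (k - 1) * real (card ?Q)"
    using mult_left_mono[OF choose_ge, of "real (card A)"] by simp
  then have "real (card A) * ?n ^ i \<le> 2 ^ (k - 1) * (2 * real k) ^ i * real (card ?Q)"
    using kp by (simp add: power_divide divide_simps mult_ac)
  also have "\<dots> \<le> (4 * real k) ^ k * real (card ?Q)"
  proof (rule mult_right_mono)
    have "2 ^ (k - 1) * (2 * real k) ^ i \<le> 2 ^ k * (2 * real k) ^ k"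
      using kp assms(5) by (intro mult_mono power_increasing) auto
    also have "\<dots> = (2 * (2 * real k)) ^ k" by (rule power_mult_distrib[symmetric])
    finally show "2 ^ (k - 1) * (2 * real k) ^ i \<le> (4 * real k) ^ k" by simp
  qed simp
  finally show ?thesis using kp by (simp add: divide_simps mult_ac)
qed

context sparse_setting
begin

lemma n_power_le:
  assumes "j \<le> k - 2" shows "n ^ j \<le> e * n ^ (k - 1)"
proof -
  have "n ^ j \<le> n ^ (k - 2)" using one_le_n assms by (intro power_increasing) auto
  also have "\<dots> \<le> real k ^ 2 * n ^ (k - 2)"
    using mult_right_mono[OF one_le_power[of "real k" 2], of "n ^ (k - 2)"] k_ge_2 by simp
  also have "\<dots> \<le> e * n ^ (k - 1)" by (rule k_square_power_le)
  finally show ?thesis .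
qed

lemma card_pos_link_avoiding_ge:
  assumes "F \<in> dense_forms k V s d" "x \<in> V" "S \<subseteq> V" "card S \<le> k" "2 * real k \<le> d * n"
  shows "d / 2 * n ^ (k - 1) \<le> real (card (pos_link F x \<inter> nsets (V - S) (k - 1)))"
proof -
  let ?away = "pos_link F x \<inter> nsets (V - S) (k - 1)" and ?meeting = "{Q\<in>nsets V (Suc (k - 2)). Q \<inter> S \<noteq> {}}"
  have k_pred: "k - 1 = Suc (k - 2)" using k_ge_2 by simp
  have "F \<subseteq> signed_pairs k V" using assms(1) dense_forms_subset sparse_forms_subset by blast
  then have "pos_link F x \<subseteq> nsets V (k - 1)"
    using pos_link_subset[of F k V x] nsets_mono[of "V - {x}" V] by blast
  then have "pos_link F x \<subseteq> ?away \<union> ?meeting" unfolding k_pred by (auto simp: nsets_def)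
  then have "card (pos_link F x) \<le> card ?away + card ?meeting"
    using finite_V by (intro card_le_card_add) auto
  moreover have "real (card ?meeting) \<le> d / 2 * n ^ (k - 1)"
  proof -
    have "real (card ?meeting) \<le> real (card S) * n ^ (k - 2)"
      by (rule card_nsets_meeting[OF finite_V assms(3)])
    also have "\<dots> \<le> (d / 2 * n) * n ^ (k - 2)" using assms(4,5) by (intro mult_right_mono) auto
    finally show ?thesis by (simp only: power_n_pred mult.assoc)
  qed
  moreover have "d * n ^ (k - 1) \<le> real (card (pos_link F x))" using assms(1,2) by (simp add: dense_forms_def)
  ultimately show ?thesis by linarith
qed

text \<open>The workhorse for links with a thin common intersection: the link tuple of \<open>X\<close> hits a large family \<open>Q\<close>,
  chosen from few candidates once the formula outside \<open>X\<close> is known, in fewer than the typical number of points.\<close>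

lemma card_le_deletion_bound_thin_intersection:
  assumes G: "G \<subseteq> thin_neg_forms k V s d (thin e)" and X: "X \<subseteq> V" "card X \<le> k"
    and finite_candidates: "\<And>F0. finite (\<Q> F0)"
    and few_candidates: "\<And>F0. real (card (\<Q> F0)) \<le> 2 powr (\<epsilon> * n ^ (k - 1))"
    and candidate: "\<And>F. F \<in> G \<Longrightarrow> \<exists>Q\<in>\<Q> (core X F). Q \<subseteq> nsets (V - X) (k - 1) \<and> q * n ^ (k - 1) \<le> real (card Q) \<and>
      real (card {R\<in>Q. \<forall>x\<in>X. R \<in> pos_link F x}) \<le> tuple_gain (card X) * real (card Q)"
  shows "real (card G) \<le> deletion_bound k (card V) (card X) (real (card X))
    (tuple_gain (card X) * q - \<epsilon> - 4 * real k ^ 2 * e)"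
proof (rule card_le_deletion_bound_thin[OF subset_trans[OF G thin_neg_forms_subset] X])
  show "real (card (neg_link F x)) \<le> thin e * n ^ (k - 1)" if "F \<in> G" "x \<in> X" for F x
    using that G X(1) by (auto simp: thin_neg_forms_def)
  fix F0
  let ?K = "nsets (V - X) (k - 1)" and ?g = "tuple_gain (card X)" and ?C = "real (card V choose (k - 1))"
  let ?Y = "\<lambda>Q. {Y. Y \<subseteq> X \<times> ?K \<and> real (card {R\<in>Q. \<forall>x\<in>X. (x, R) \<in> Y}) \<le> ?g * real (card Q)}"
  let ?\<Q> = "{Q\<in>\<Q> F0. Q \<subseteq> ?K \<and> q * n ^ (k - 1) \<le> real (card Q)}"
  have finX: "finite X" by (rule finite_subset[OF X(1) finite_V])
  have "pos_links_at X ` {F\<in>G. core X F = F0} \<subseteq> (\<Union>Q\<in>?\<Q>. ?Y Q)"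
  proof (rule image_subsetI)
    fix F assume "F \<in> {F\<in>G. core X F = F0}"
    then have F: "F \<in> G" "core X F = F0" by auto
    then obtain Q where Q: "Q \<in> ?\<Q>" "real (card {R\<in>Q. \<forall>x\<in>X. R \<in> pos_link F x}) \<le> ?g * real (card Q)"
      using candidate[OF F(1)] by auto
    have sub: "F \<subseteq> signed_pairs k V" using F(1) G thin_neg_forms_subset sparse_forms_subset by blast
    have "R \<inter> X = {}" if "R \<in> Q" for R using Q(1) that by (auto simp: nsets_def)
    then have "{R\<in>Q. \<forall>x\<in>X. (x, R) \<in> pos_links_at X F} = {R\<in>Q. \<forall>x\<in>X. R \<in> pos_link F x}"
      by (auto simp: pos_links_at_def)
    then have "pos_links_at X F \<in> ?Y Q" using Q(2) pos_links_at_subset[OF sub] by auto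
    then show "pos_links_at X F \<in> (\<Union>Q\<in>?\<Q>. ?Y Q)" using Q(1) by blast
  qed
  then have "real (card (pos_links_at X ` {F\<in>G. core X F = F0})) \<le> real (card (\<Union>Q\<in>?\<Q>. ?Y Q))"
    using finX finite_V finite_candidates by (intro real_card_mono) auto
  also have "\<dots> \<le> 2 powr (\<epsilon> * n ^ (k - 1)) * 2 powr (real (card X) * ?C - ?g * (q * n ^ (k - 1)))"
  proof (rule real_card_UN_le_mult)
    fix Q assume Q: "Q \<in> ?\<Q>"
    then have "real (card (?Y Q)) \<le> 2 powr (real (card X) * real (card ?K) - ?g * real (card Q))"
      using finX finite_V by (intro card_thin_intersections) auto
    also have "\<dots> \<le> 2 powr (real (card X) * ?C - ?g * (q * n ^ (k - 1)))"
    proof (intro powr_mono diff_mono mult_left_mono)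
      show "real (card ?K) \<le> ?C" using card_mono[OF finite_V, of "V - X"] by (simp add: binomial_right_mono)
      show "0 \<le> ?g" using tuple_gain_pos[of "card X"] by simp
    qed (use Q in auto)
    finally show "real (card (?Y Q)) \<le> 2 powr (real (card X) * ?C - ?g * (q * n ^ (k - 1)))" .
  next
    have "real (card ?\<Q>) \<le> real (card (\<Q> F0))" using finite_candidates by (intro real_card_mono) auto
    then show "real (card ?\<Q>) \<le> 2 powr (\<epsilon> * n ^ (k - 1))" using few_candidates[of F0] by linarith
  qed (use finite_candidates in auto)
  also have "\<dots> = 2 powr (real (card X) * ?C - (?g * q - \<epsilon>) * n ^ (k - 1))"
    unfolding powr_add[symmetric] by (simp add: algebra_simps)
  finally show "real (card (pos_links_at X ` {F\<in>G. core X F = F0}))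
    \<le> 2 powr (real (card X) * ?C - (?g * q - \<epsilon>) * n ^ (k - 1))" .
qed

lemma card_common_link_supersets_le:
  assumes "S \<subseteq> V" "card S = i" "i < k" "finite A" "A \<subseteq> nsets (V - S) (k - 1 - i)"
  shows "card {Q\<in>nsets (V - S) (k - 1). (\<exists>T\<in>A. T \<subseteq> Q) \<and> (\<forall>x\<in>S. Q \<in> pos_link F x)}
    \<le> (\<Sum>T\<in>A. card (extensions V (pos_clauses F) S T))"
proof -
  let ?L = "{Q\<in>nsets (V - S) (k - 1). (\<exists>T\<in>A. T \<subseteq> Q) \<and> (\<forall>x\<in>S. Q \<in> pos_link F x)}"
  have "?L \<subseteq> (\<Union>T\<in>A. (\<lambda>R. R \<union> T) ` extensions V (pos_clauses F) S T)"
  proof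
    fix Q assume Q: "Q \<in> ?L"
    then obtain T where T: "T \<in> A" "T \<subseteq> Q" by blast
    have "finite T" "card T = k - 1 - i" using T(1) assms(5) by (auto simp: nsets_def)
    then have "Q - T \<in> nsets (V - S - T) i" using Q T(2) assms(3) by (auto simp: nsets_def card_Diff_subset)
    moreover have union: "Q - T \<union> T = Q" using T(2) by auto
    moreover have "insert x Q \<in> pos_clauses F" if "x \<in> S" for x using Q that by (auto simp: pos_link_def)
    ultimately have "Q - T \<in> extensions V (pos_clauses F) S T" by (simp add: extensions_def assms(2))
    then show "Q \<in> (\<Union>T\<in>A. (\<lambda>R. R \<union> T) ` extensions V (pos_clauses F) S T)"
      using T(1) union by (intro UN_I[of T] image_eqI[of _ _ "Q - T"]) auto
  qed
  then have "card ?L \<le> card (\<Union>T\<in>A. (\<lambda>R. R \<union> T) ` extensions V (pos_clauses F) S T)"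
    using assms(4) finite_V by (intro card_mono) auto
  also have "\<dots> \<le> (\<Sum>T\<in>A. card ((\<lambda>R. R \<union> T) ` extensions V (pos_clauses F) S T))"
    by (rule card_UN_le[OF assms(4)])
  also have "\<dots> \<le> (\<Sum>T\<in>A. card (extensions V (pos_clauses F) S T))"
    using finite_V by (intro sum_mono card_image_le) simp
  finally show ?thesis .
qed

lemma card_many_atypical_le:
  assumes S: "S \<subseteq> V" "card S = i" and i: "1 \<le> i" "i + 2 \<le> k" and large: "2 * real k \<le> n"
    and b: "b \<le> tuple_gain i / (4 * real k) ^ k"
  shows "real (card {F\<in>thin_neg_forms k V s d (thin e). \<xi> * n ^ (k - 1 - i)
      \<le> real (card (atypical k V b S F))})
    \<le> deletion_bound k (card V) i (real i) (tuple_gain i * (\<xi> / (4 * real k) ^ k) - e - 4 * real k ^ 2 * e)"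
    (is "real (card ?G) \<le> _")
proof -
  let ?above = "\<lambda>A. {Q\<in>nsets (V - S) (k - 1). \<exists>T\<in>A. T \<subseteq> Q}"
  have above_ge: "real (card A) * n ^ i / (4 * real k) ^ k \<le> real (card (?above A))"
    if "A \<subseteq> nsets (V - S) (k - 1 - i)" for A
    using i by (intro card_supersets_ge[OF finite_V S _ _ large that]) auto
  have "real (card ?G) \<le> deletion_bound k (card V) (card S) (real (card S))
      (tuple_gain (card S) * (\<xi> / (4 * real k) ^ k) - e - 4 * real k ^ 2 * e)"
  proof (rule card_le_deletion_bound_thin_intersection)
    fix F0 :: "'a form"
    show "finite (?above ` Pow (nsets (V - S) (k - 1 - i)))" using finite_V by simp
    have "card (?above ` Pow (nsets (V - S) (k - 1 - i))) \<le> card (Pow (nsets (V - S) (k - 1 - i)))"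
      using finite_V by (intro card_image_le) simp
    also have "real \<dots> \<le> 2 powr (e * n ^ (k - 1))"
    proof (rule real_card_le_Pow[OF _ order_refl])
      have "real (card (nsets (V - S) (k - 1 - i))) \<le> n ^ (k - 1 - i)"
        by (rule real_card_nsets_subset_le[OF finite_V nsets_mono]) auto
      also have "\<dots> \<le> e * n ^ (k - 1)" using i by (intro n_power_le) simp
      finally show "real (card (nsets (V - S) (k - 1 - i))) \<le> e * n ^ (k - 1)" .
    qed (use finite_V in simp)
    finally show "real (card (?above ` Pow (nsets (V - S) (k - 1 - i)))) \<le> 2 powr (e * n ^ (k - 1))" by simp
  next
    fix F assume F: "F \<in> ?G"
    define A where "A = atypical k V b S F"
    have A: "A \<subseteq> nsets (V - S) (k - 1 - i)" using atypical_subset[of k V b S F] by (simp add: A_def S(2))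
    have finA: "finite A" using finite_subset[OF A] finite_V by simp
    have "\<xi> / (4 * real k) ^ k * n ^ (k - 1) = \<xi> * n ^ (k - 1 - i) * n ^ i / (4 * real k) ^ k"
      using i by (simp add: power_add[symmetric])
    also have "\<dots> \<le> real (card A) * n ^ i / (4 * real k) ^ k"
      using F by (intro divide_right_mono mult_right_mono) (auto simp: A_def)
    finally have many: "\<xi> / (4 * real k) ^ k * n ^ (k - 1) \<le> real (card (?above A))"
      using above_ge[OF A] by linarith
    have "{R\<in>?above A. \<forall>x\<in>S. R \<in> pos_link F x}
        = {Q\<in>nsets (V - S) (k - 1). (\<exists>T\<in>A. T \<subseteq> Q) \<and> (\<forall>x\<in>S. Q \<in> pos_link F x)}" by auto
    then have "real (card {R\<in>?above A. \<forall>x\<in>S. R \<in> pos_link F x})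
        \<le> (\<Sum>T\<in>A. real (card (extensions V (pos_clauses F) S T)))"
      using card_common_link_supersets_le[OF S _ finA A, of F] i by (simp flip: of_nat_sum)
    also have "\<dots> \<le> real (card A) * (b * n ^ i)"
      by (intro sum_bounded_above) (auto simp: A_def atypical_def S(2))
    also have "\<dots> \<le> real (card A) * (tuple_gain i / (4 * real k) ^ k * n ^ i)"
      using b by (intro mult_left_mono mult_right_mono) auto
    also have "\<dots> = tuple_gain i * (real (card A) * n ^ i / (4 * real k) ^ k)" by simp
    also have "\<dots> \<le> tuple_gain i * real (card (?above A))"
      using above_ge[OF A] tuple_gain_pos[of i] by (intro mult_left_mono) auto
    finally show "\<exists>Q\<in>?above ` Pow (nsets (V - S) (k - 1 - i)). Q \<subseteq> nsets (V - S) (k - 1) \<and>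
        \<xi> / (4 * real k) ^ k * n ^ (k - 1) \<le> real (card Q) \<and>
        real (card {R\<in>Q. \<forall>x\<in>S. R \<in> pos_link F x}) \<le> tuple_gain (card S) * real (card Q)"
      using A many S(2) by (intro bexI[of _ "?above A"]) auto
  qed (use S i in auto)
  then show ?thesis by (simp add: S(2))
qed

lemma card_le_deletion_bound_thin_intersection_core:
  assumes G: "G \<subseteq> thin_neg_forms k V s d (thin e)" and X: "X \<subseteq> V" "card X \<le> k"
    and Q: "\<And>F. F \<in> G \<Longrightarrow> Q (core X F) \<subseteq> nsets (V - X) (k - 1)"
    and many: "\<And>F. F \<in> G \<Longrightarrow> q * n ^ (k - 1) \<le> real (card (Q (core X F)))"
    and thin: "\<And>F. F \<in> G \<Longrightarrow> real (card {R\<in>Q (core X F). \<forall>x\<in>X. R \<in> pos_link F x})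
      \<le> tuple_gain (card X) * (q * n ^ (k - 1))"
  shows "real (card G) \<le> deletion_bound k (card V) (card X) (real (card X)) (tuple_gain (card X) * q
      - 4 * real k ^ 2 * e)"
proof -
  have "real (card G) \<le> deletion_bound k (card V) (card X) (real (card X)) (tuple_gain (card X) * q - 0
      - 4 * real k ^ 2 * e)"
  proof (rule card_le_deletion_bound_thin_intersection[OF G X, where \<Q> = "\<lambda>F0. {Q F0}"])
    fix F assume F: "F \<in> G"
    have "tuple_gain (card X) * (q * n ^ (k - 1)) \<le> tuple_gain (card X) * real (card (Q (core X F)))"
      using many[OF F] tuple_gain_pos[of "card X"] by (intro mult_left_mono) auto
    then show "\<exists>Q\<in>{Q (core X F)}. Q \<subseteq> nsets (V - X) (k - 1) \<and> q * n ^ (k - 1) \<le> real (card Q) \<and>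
        real (card {R\<in>Q. \<forall>x\<in>X. R \<in> pos_link F x}) \<le> tuple_gain (card X) * real (card Q)"
      using Q[OF F] many[OF F] thin[OF F] by simp
  qed auto
  then show ?thesis by simp
qed

lemma card_atypical_full_le:
  assumes S: "S \<subseteq> V" "card S = k - 1" and large: "2 * real k \<le> d * n"
    and b: "b \<le> tuple_gain (k - 2) * (d / 2)"
  shows "real (card {F\<in>thin_neg_forms k V s d (thin e). atypical k V b S F \<noteq> {}})
    \<le> deletion_bound k (card V) (k - 2) (real (k - 2)) (tuple_gain (k - 2) * (d / 2) - 4 * real k ^ 2 * e)"
    (is "real (card ?G) \<le> _")
proof -
  have finS: "finite S" by (rule finite_subset[OF S(1) finite_V])
  obtain x where x: "x \<in> S" using S(2) k_ge_2 by fastforce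
  define X where "X = S - {x}"
  have X: "X \<subseteq> V" "card X = k - 2" "x \<notin> X" using S x finS by (auto simp: X_def)
  let ?Q = "\<lambda>F. pos_link F x \<inter> nsets (V - S) (k - 1)"
  have Q_core: "?Q (core X F) = ?Q F" for F
    unfolding pos_link_core[OF X(3)] by (auto simp: nsets_def X_def)
  have "real (card ?G) \<le> deletion_bound k (card V) (card X) (real (card X)) (tuple_gain (card X) * (d / 2)
      - 4 * real k ^ 2 * e)"
  proof (rule card_le_deletion_bound_thin_intersection_core[where Q = ?Q])
    fix F assume F: "F \<in> ?G"
    show "?Q (core X F) \<subseteq> nsets (V - X) (k - 1)" by (auto simp: nsets_def X_def)
    show "d / 2 * n ^ (k - 1) \<le> real (card (?Q (core X F)))"
      unfolding Q_core using F S x k_ge_2 large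
      by (intro card_pos_link_avoiding_ge) (auto simp: thin_neg_forms_def)
    have "{} \<in> atypical k V b S F" using F atypical_subset[of k V b S F] S(2) by (auto simp: nsets_def)
    then have few: "real (card (extensions V (pos_clauses F) S {})) < b * n ^ (k - 1)"
      by (simp add: atypical_def S(2))
    have "{R\<in>?Q F. \<forall>x\<in>X. R \<in> pos_link F x} \<subseteq> extensions V (pos_clauses F) S {}"
      by (auto simp: extensions_def pos_link_def S(2) X_def)
    then have "real (card {R\<in>?Q F. \<forall>x\<in>X. R \<in> pos_link F x}) \<le> real (card (extensions V (pos_clauses F) S {}))"
      using finite_V by (intro real_card_mono) auto
    also have "\<dots> \<le> b * n ^ (k - 1)" using few by simp
    also have "\<dots> \<le> tuple_gain (k - 2) * (d / 2) * n ^ (k - 1)" using b by (intro mult_right_mono) auto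
    finally show "real (card {R\<in>?Q (core X F). \<forall>x\<in>X. R \<in> pos_link F x})
        \<le> tuple_gain (card X) * (d / 2 * n ^ (k - 1))"
      unfolding Q_core X(2) by (simp add: mult.assoc)
  qed (use X in auto)
  then show ?thesis by (simp add: X(2))
qed

lemma nbrs_common_subset_excluded:
  assumes "(S, {}) \<in> F" "R \<subseteq> V - S" "\<forall>x\<in>S - {x1, x2}. R \<in> pos_link F x"
  shows "nbrs (V - S) (common (V - S) (k - 1) (pos_link F x1) (pos_link F x2)) R
      \<subseteq> nbrs (V - S) (excluded k V S F) R"
proof
  let ?E = "common (V - S) (k - 1) (pos_link F x1) (pos_link F x2)"
  fix v assume "v \<in> nbrs (V - S) ?E R"
  then have v: "v \<in> V - S - R" "insert v R \<in> ?E" by (auto simp: nbrs_def)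
  have "\<exists>Q\<in>pos_link F x. Q \<subseteq> insert v R" if "x \<in> S" for x
  proof (cases "x = x1 \<or> x = x2")
    case True
    then show ?thesis using v(2) by (auto simp: common_def)
  next
    case False
    then show ?thesis using assms(3) that by blast
  qed
  moreover have "insert v R \<in> nsets (V - S) k" using v(2) k_ge_2 by (simp add: common_def)
  ultimately have "insert v R \<in> excluded k V S F" using assms(1) by (auto simp: excluded_def)
  then show "v \<in> nbrs (V - S) (excluded k V S F) R" using v(1) by (simp add: nbrs_def)
qed

lemma card_common_thin_intersection_le:
  assumes "(S, {}) \<in> F" "0 \<le> t"
  shows "real (card {R\<in>nsets (V - S) (k - 1).
      t < real (deg (V - S) (common (V - S) (k - 1) (pos_link F x1) (pos_link F x2)) R) \<and>
      (\<forall>x\<in>S - {x1, x2}. R \<in> pos_link F x)}) * t \<le> real k * real (card (excluded k V S F))"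
    (is "real (card ?thin) * t \<le> _")
proof -
  let ?U = "V - S"
  let ?E = "common ?U (k - 1) (pos_link F x1) (pos_link F x2)"
  have finU: "finite ?U" and k_pred: "Suc (k - 1) = k" using finite_V k_ge_2 by auto
  have "?thin \<subseteq> {R\<in>nsets ?U (k - 1). t < real (deg ?U (excluded k V S F) R)}"
  proof
    fix R assume R: "R \<in> ?thin"
    then have "deg ?U ?E R \<le> deg ?U (excluded k V S F) R"
      using finU assms(1) by (intro card_mono nbrs_common_subset_excluded) (auto simp: nsets_def)
    then show "R \<in> {R\<in>nsets ?U (k - 1). t < real (deg ?U (excluded k V S F) R)}" using R by auto
  qed
  then have "real (card ?thin) * t \<le> real (card {R\<in>nsets ?U (k - 1). t < real (deg ?U (excluded k V S F) R)})
      * t"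
    using finU assms(2) by (intro mult_right_mono real_card_mono) auto
  also have "\<dots> \<le> real (Suc (k - 1)) * real (card (excluded k V S F))"
    using excluded_subset[of k V S F] k_pred by (intro card_high_deg[OF finU]) simp
  finally show ?thesis by (simp only: k_pred)
qed

lemma card_negative_clause_common_le:
  assumes S: "S \<subseteq> V" "card S = k" and x: "x1 \<in> S" "x2 \<in> S" "x1 \<noteq> x2" and c: "c > 0"
    and \<gamma>: "\<gamma> \<le> tuple_gain (k - 2) * c\<^sup>2 / real k"
  shows "real (card {F\<in>thin_neg_forms k V s d (thin e). (S, {}) \<in> F \<and>
      real (card (excluded k V S F)) \<le> \<gamma> * n ^ k \<and>
      c * n ^ k \<le> real (card (common (V - S) (k - 1) (pos_link F x1) (pos_link F x2)))})
    \<le> deletion_bound k (card V) (k - 2) (real (k - 2)) (tuple_gain (k - 2) * c - 4 * real k ^ 2 * e)"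
    (is "real (card ?G) \<le> _")
proof -
  let ?U = "V - S"
  define X where "X = S - {x1, x2}"
  have finS: "finite S" by (rule finite_subset[OF S(1) finite_V])
  have X: "X \<subseteq> V" "card X = k - 2" using S x finS by (auto simp: X_def card_Diff_subset)
  have n_pow: "n ^ k = n ^ (k - 1) * n" and k_pred: "Suc (k - 1) = k" using k_ge_2 by (auto simp: power_eq_if)
  define E where "E F = common ?U (k - 1) (pos_link F x1) (pos_link F x2)" for F
  define Q where "Q F = {Y\<in>nsets ?U (k - 1). c * n < real (deg ?U (E F) Y)}" for F
  have "E (core X F) = E F" for F unfolding E_def by (rule common_pos_link_core) (auto simp: X_def)
  then have Q_core: "Q (core X F) = Q F" for F by (simp add: Q_def)
  have "real (card ?G) \<le> deletion_bound k (card V) (card X) (real (card X)) (tuple_gain (card X) * c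
      - 4 * real k ^ 2 * e)"
  proof (rule card_le_deletion_bound_thin_intersection_core[where Q = Q])
    fix F assume F: "F \<in> ?G"
    show "Q (core X F) \<subseteq> nsets (V - X) (k - 1)" by (auto simp: Q_def nsets_def X_def)
    have "2 * (c * n ^ k) \<le> real k * real (card (E F))"
      using F k_ge_2 c by (intro mult_mono) (auto simp: E_def)
    then have "c * n ^ (k - 1) \<le> real (card {Y\<in>nsets ?U (k - 1). c * n < real (deg ?U (E F) Y)})"
      using c one_le_n k_pred finite_V
      by (intro card_high_deg_ge) (auto simp: E_def common_def card_mono mult.assoc)
    then show "c * n ^ (k - 1) \<le> real (card (Q (core X F)))" unfolding Q_core by (simp add: Q_def)
    let ?thin = "{R\<in>Q F. \<forall>x\<in>X. R \<in> pos_link F x}"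
    have "real (card ?thin) * (c * n) \<le> real k * real (card (excluded k V S F))"
      using card_common_thin_intersection_le[of S F "c * n" x1 x2] F c
      by (simp add: Q_def E_def X_def conj_assoc)
    also have "\<dots> \<le> real k * (tuple_gain (k - 2) * c\<^sup>2 / real k * n ^ k)"
    proof (rule mult_left_mono)
      have "\<gamma> * n ^ k \<le> tuple_gain (k - 2) * c\<^sup>2 / real k * n ^ k" using \<gamma> by (intro mult_right_mono) auto
      then show "real (card (excluded k V S F)) \<le> tuple_gain (k - 2) * c\<^sup>2 / real k * n ^ k" using F by auto
    qed simp
    also have "\<dots> = (tuple_gain (k - 2) * c * n ^ (k - 1)) * (c * n)"
      using k_ge_2 by (simp add: power2_eq_square n_pow)
    finally have "real (card ?thin) \<le> tuple_gain (k - 2) * c * n ^ (k - 1)"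
      using one_le_n c by (simp only: mult_le_cancel_right) auto
    then show "real (card {R\<in>Q (core X F). \<forall>x\<in>X. R \<in> pos_link F x}) \<le> tuple_gain (card X) * (c * n ^ (k - 1))"
      unfolding Q_core X(2) by (simp add: mult.assoc)
  qed (use X in auto)
  then show ?thesis by (simp add: X(2))
qed

lemma card_large_neg_link_le:
  assumes "x \<in> V" "d' \<le> d" "d' \<le> t"
    and few_pairs: "real (card (dense_pairs (V - {x}) (k - 1) (d' * n ^ (k - 1)) (\<gamma> * n ^ k)))
      \<le> 2 powr (real (card V choose (k - 1)) - \<delta> * n ^ (k - 1))"
  shows "real (card {F\<in>dense_forms k V s d. t * n ^ (k - 1) \<le> real (card (neg_link F x)) \<and>
      real (card (excluded k V {x} F)) \<le> \<gamma> * n ^ k})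
    \<le> deletion_bound k (card V) 1 1 (\<delta> - 3 * real k ^ 2 * e)" (is "real (card ?G) \<le> _")
proof -
  let ?D = "dense_pairs (V - {x}) (k - 1) (d' * n ^ (k - 1)) (\<gamma> * n ^ k)"
  have "real (card ?G) \<le> deletion_bound k (card V) (card {x}) 1 (\<delta> - 3 * real k ^ 2 * e)"
  proof (rule card_le_deletion_bound)
    fix F0
    have "(\<lambda>F. (pos_links_at {x} F, neg_links_at {x} F)) ` {F\<in>?G. core {x} F = F0}
        \<subseteq> (\<lambda>(L, L'). (Pair x ` L, Pair x ` L')) ` ?D"
    proof (rule image_subsetI)
      fix F assume "F \<in> {F\<in>?G. core {x} F = F0}"
      then have F: "F \<in> ?G" by simp
      have sub: "F \<subseteq> signed_pairs k V" using F dense_forms_subset sparse_forms_subset by blast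
      have links: "pos_link F x \<subseteq> nsets (V - {x}) (k - 1)" "neg_link F x \<subseteq> nsets (V - {x}) (k - 1)"
        using pos_link_subset[OF sub] neg_link_subset[OF sub] by auto
      have "d' * n ^ (k - 1) \<le> d * n ^ (k - 1)" "d' * n ^ (k - 1) \<le> t * n ^ (k - 1)"
        using assms(2,3) by (auto intro: mult_right_mono)
      moreover have "common (V - {x}) (k - 1) (pos_link F x) (neg_link F x) = excluded k V {x} F"
        using k_ge_2 by (auto simp: common_def excluded_def neg_link_def)
      ultimately have "(pos_link F x, neg_link F x) \<in> ?D"
        using F links assms(1) by (auto simp: dense_pairs_def dense_forms_def)
      moreover have "Q \<inter> {x} = {}" if "Q \<in> pos_link F x \<union> neg_link F x" for Q
        using that links by (auto simp: nsets_def)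
      then have "pos_links_at {x} F = Pair x ` pos_link F x" "neg_links_at {x} F = Pair x ` neg_link F x"
        by (auto simp: pos_links_at_def neg_links_at_def)
      ultimately show "(pos_links_at {x} F, neg_links_at {x} F) \<in> (\<lambda>(L, L'). (Pair x ` L, Pair x ` L')) ` ?D"
        by (intro image_eqI[of _ _ "(pos_link F x, neg_link F x)"]) auto
    qed
    then have "real (card ((\<lambda>F. (pos_links_at {x} F, neg_links_at {x} F)) ` {F\<in>?G. core {x} F = F0}))
        \<le> real (card ?D)"
      using finite_V by (intro real_surj_card_le) auto
    then show "real (card ((\<lambda>F. (pos_links_at {x} F, neg_links_at {x} F)) ` {F\<in>?G. core {x} F = F0}))
        \<le> 2 powr (1 * real (card V choose (k - 1)) - \<delta> * n ^ (k - 1))" using few_pairs by simp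
  qed (use assms(1) k_ge_2 dense_forms_subset[of k V s d] in auto)
  then show ?thesis by simp
qed

lemma card_tuples_of_dense_pairs_le:
  assumes "finite S" "card S = k"
    and few_pairs: "real (card (dense_pairs (V - S) (k - 1) a b)) \<le> 2 powr (C - \<delta> * n ^ (k - 1))"
  shows "real (card (related_tuples S (Pow (nsets (V - S) (k - 1))) (dense_pairs (V - S) (k - 1) a b)))
    \<le> 2 powr (real k / 2 * C - (real k / 2 * \<delta> - e) * n ^ (k - 1))"
proof -
  let ?D = "dense_pairs (V - S) (k - 1) a b"
  have "real (card (related_tuples S (Pow (nsets (V - S) (k - 1))) ?D))
      \<le> 2 * real (card ?D) powr (real (card S) / 2)"
    using finite_V assms(1,2) k_ge_2 by (intro card_related_tuples dense_pairs_subset) auto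
  also have "\<dots> \<le> 2 * (2 powr (C - \<delta> * n ^ (k - 1))) powr (real k / 2)"
    unfolding assms(2) using few_pairs by (intro mult_left_mono powr_mono2) auto
  also have "\<dots> = 2 powr (1 + real k / 2 * (C - \<delta> * n ^ (k - 1)))"
    by (simp add: powr_powr powr_add mult.commute)
  also have "\<dots> \<le> 2 powr (real k / 2 * C - (real k / 2 * \<delta> - e) * n ^ (k - 1))"
    using n_power_le[of 0] by (intro powr_mono) (auto simp: algebra_simps)
  finally show ?thesis .
qed

lemma card_links_pairwise_sparse_le:
  assumes S: "S \<subseteq> V" "card S = k" and large: "2 * real k \<le> d * n"
    and few_pairs: "real (card (dense_pairs (V - S) (k - 1) (d / 2 * n ^ (k - 1)) (\<gamma> * n ^ k)))
      \<le> 2 powr (real (card V choose (k - 1)) - \<delta> * n ^ (k - 1))"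
  shows "real (card {F\<in>thin_neg_forms k V s d (thin e). \<forall>x\<in>S. \<forall>y\<in>S. x \<noteq> y \<longrightarrow>
      real (card (common (V - S) (k - 1) (pos_link F x) (pos_link F y))) \<le> \<gamma> * n ^ k})
    \<le> deletion_bound k (card V) k (real k / 2) (real k / 2 * \<delta> - e - 4 * real k ^ 2 * e)"
      (is "real (card ?G) \<le> _")
proof -
  let ?K = "nsets (V - S) (k - 1)" and ?C = "real (card V choose (k - 1))"
  let ?D = "dense_pairs (V - S) (k - 1) (d / 2 * n ^ (k - 1)) (\<gamma> * n ^ k)"
  let ?tuples = "related_tuples S (Pow ?K) ?D"
  have finS: "finite S" by (rule finite_subset[OF S(1) finite_V])
  define L where "L F x = pos_link F x \<inter> ?K" for F x
  have G: "?G \<subseteq> thin_neg_forms k V s d (thin e)" by auto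
  have L_tuple: "restrict (L F) S \<in> ?tuples" if F: "F \<in> ?G" for F
  proof -
    have dense: "d / 2 * n ^ (k - 1) \<le> real (card (L F x))" if "x \<in> S" for x
      unfolding L_def using F S that large
      by (intro card_pos_link_avoiding_ge) (auto simp: thin_neg_forms_def)
    have "real (card (common (V - S) (k - 1) (L F x) (L F y))) \<le> \<gamma> * n ^ k" if "x \<in> S" "y \<in> S" "x \<noteq> y" for x y
    proof -
      have "real (card (common (V - S) (k - 1) (L F x) (L F y)))
          \<le> real (card (common (V - S) (k - 1) (pos_link F x) (pos_link F y)))"
        using finite_V by (intro real_card_mono) (auto simp: common_def L_def)
      then show ?thesis using F that by force
    qed
    then have "(L F x, L F y) \<in> ?D" if "x \<in> S" "y \<in> S" "x \<noteq> y" for x y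
      using dense that by (auto simp: dense_pairs_def L_def)
    then show ?thesis by (auto simp: related_tuples_def pairwise_def L_def)
  qed
  have "real (card ?G) \<le> deletion_bound k (card V) (card S) (real k / 2) (real k / 2 * \<delta> - e
      - 4 * real k ^ 2 * e)"
  proof (rule card_le_deletion_bound_thin)
    show "?G \<subseteq> sparse_forms k V s" using G thin_neg_forms_subset by blast
    show "real (card (neg_link F x)) \<le> thin e * n ^ (k - 1)" if "F \<in> ?G" "x \<in> S" for F x
      using that S(1) by (auto simp: thin_neg_forms_def)
    fix F0
    have "pos_links_at S ` {F\<in>?G. core S F = F0} \<subseteq> (\<lambda>f. \<Union>x\<in>S. Pair x ` f x) ` ?tuples"
    proof (rule image_subsetI)
      fix F assume "F \<in> {F\<in>?G. core S F = F0}"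
      then have F: "F \<in> ?G" by simp
      then have "F \<subseteq> signed_pairs k V" using thin_neg_forms_subset sparse_forms_subset by blast
      then have "pos_links_at S F = pos_links_at S F \<inter> S \<times> ?K"
        using pos_links_at_subset[of F k V S] by (simp add: Int_absorb2)
      also have "\<dots> = (\<Union>x\<in>S. Pair x ` restrict (L F) S x)"
        by (auto simp: pos_links_at_def L_def nsets_def)
      finally show "pos_links_at S F \<in> (\<lambda>f. \<Union>x\<in>S. Pair x ` f x) ` ?tuples"
        using L_tuple[OF F] by (rule image_eqI)
    qed
    then have "real (card (pos_links_at S ` {F\<in>?G. core S F = F0})) \<le> real (card ?tuples)"
      using finS finite_V by (intro real_surj_card_le finite_related_tuples) auto
    then show "real (card (pos_links_at S ` {F\<in>?G. core S F = F0}))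
        \<le> 2 powr (real k / 2 * ?C - (real k / 2 * \<delta> - e) * n ^ (k - 1))"
      using card_tuples_of_dense_pairs_le[OF finS S(2) few_pairs] by linarith
  qed (use S in auto)
  then show ?thesis by (simp add: S(2))
qed

end

section \<open>Savings from typical and atypical clauses\<close>

definition link_pairs :: "nat \<Rightarrow> 'a set \<Rightarrow> nat \<Rightarrow> ('a set \<times> 'a set) set" where
  "link_pairs k V i = (SIGMA S:nsets V i. nsets (V - S) (k - 1 - i))"

definition clash :: "'a set \<times> 'a set \<Rightarrow> 'a set \<times> 'a set \<Rightarrow> bool" where
  "clash p q \<longleftrightarrow> (\<exists>x\<in>fst p. \<exists>y\<in>fst q. insert x (snd p) = insert y (snd q))"

definition block :: "'a set \<Rightarrow> nat \<Rightarrow> 'a set \<times> 'a set \<Rightarrow> 'a set set" where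
  "block U i p = (\<lambda>(x, R). insert x (R \<union> snd p)) ` (fst p \<times> nsets U i)"

lemma finite_link_pairs [simp]: "finite V \<Longrightarrow> finite (link_pairs k V i)"
  by (simp add: link_pairs_def)

lemma link_pairsD:
  assumes "p \<in> link_pairs k V i"
  shows "finite (fst p)" "finite (snd p)" "card (fst p) = i" "card (snd p) = k - 1 - i"
    "fst p \<subseteq> V" "snd p \<subseteq> V" "fst p \<inter> snd p = {}"
  using assms by (auto simp: link_pairs_def nsets_def)

lemma card_clash_le:
  assumes "finite V" "i < k" "p \<in> link_pairs k V i"
  shows "card {q\<in>link_pairs k V i. clash p q} \<le> k * k * card V ^ (i - 1)"
proof -
  note p = link_pairsD[OF assms(3)]
  let ?C = "SIGMA x:fst p. insert x (snd p)"
  let ?q = "\<lambda>((x, y), Z). (insert y Z, insert x (snd p) - {y})"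
  have "{q\<in>link_pairs k V i. clash p q} \<subseteq> ?q ` (?C \<times> nsets V (i - 1))"
  proof
    fix q assume "q \<in> {q\<in>link_pairs k V i. clash p q}"
    then obtain x y where xy: "x \<in> fst p" "y \<in> fst q" "insert x (snd p) = insert y (snd q)"
      and "q \<in> link_pairs k V i" by (auto simp: clash_def)
    note q = link_pairsD[OF this(4)]
    have "y \<notin> snd q" using q(7) xy(2) by auto
    then have "q = ?q ((x, y), fst q - {y})" using xy by (auto simp: prod_eq_iff)
    moreover have "((x, y), fst q - {y}) \<in> ?C \<times> nsets V (i - 1)" using xy q by (auto simp: nsets_def)
    ultimately show "q \<in> ?q ` (?C \<times> nsets V (i - 1))" by (rule image_eqI)
  qed
  then have "card {q\<in>link_pairs k V i. clash p q} \<le> card (?C \<times> nsets V (i - 1))"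
    using p(1,2) assms(1) by (intro surj_card_le) auto
  also have "\<dots> = (\<Sum>x\<in>fst p. card (insert x (snd p))) * (card V choose (i - 1))"
    using p(1,2) by (simp add: card_cartesian_product card_SigmaI)
  also have "\<dots> \<le> k * k * card V ^ (i - 1)"
  proof (intro mult_mono choose_le_power)
    have "card (insert x (snd p)) \<le> k" for x
    proof -
      have "card (insert x (snd p)) \<le> Suc (card (snd p))" using p(2) by (simp add: card_insert_if)
      then show ?thesis using p(4) assms(2) by linarith
    qed
    then have "(\<Sum>x\<in>fst p. card (insert x (snd p))) \<le> card (fst p) * k"
      using sum_bounded_above[of "fst p" "\<lambda>x. card (insert x (snd p))" k] by simp
    also have "\<dots> \<le> k * k" using p(3) assms(2) by simp
    finally show "(\<Sum>x\<in>fst p. card (insert x (snd p))) \<le> k * k" .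
  qed auto
  finally show ?thesis .
qed

lemma exists_clash_free:
  assumes "finite V" "1 \<le> i" "i < k" "2 * real k \<le> real (card V)" "A \<subseteq> link_pairs k V i" "A \<noteq> {}"
  shows "\<exists>W\<subseteq>V. \<exists>I\<subseteq>A. (\<forall>p\<in>I. fst p \<union> snd p \<subseteq> W) \<and> (\<forall>p\<in>I. \<forall>q\<in>I. p \<noteq> q \<longrightarrow> \<not> clash p q) \<and>
    real (card V) / 2 ^ (k + 1) \<le> real (card (V - W)) \<and>
    real (card A) / 2 ^ (k + 1) \<le> real k ^ 2 * real (card V) ^ (i - 1) * real (card I)"
proof -
  have finA: "finite A" by (rule finite_subset[OF assms(5)]) (simp add: assms(1))
  have k_succ: "k - 1 + 2 = k + 1" using assms(3) by simp
  have "\<exists>W\<subseteq>V. real (card A) / 2 ^ (k - 1 + 2) \<le> real (card {p\<in>A. fst p \<union> snd p \<subseteq> W}) \<and>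
      real (card V) / 2 ^ (k - 1 + 2) \<le> real (card (V - W))"
  proof (rule exists_containing[OF assms(1) finA assms(6)])
    fix p assume "p \<in> A"
    then have "p \<in> link_pairs k V i" using assms(5) by blast
    note p = link_pairsD[OF this]
    have "card (fst p \<union> snd p) = i + (k - 1 - i)" using p by (simp add: card_Un_disjoint)
    then show "fst p \<union> snd p \<subseteq> V \<and> card (fst p \<union> snd p) = k - 1" using p(5,6) assms(3) by simp
  qed (use assms(3,4) in auto)
  then obtain W where W: "W \<subseteq> V" "real (card V) / 2 ^ (k + 1) \<le> real (card (V - W))"
    and card_W: "real (card A) / 2 ^ (k + 1) \<le> real (card {p\<in>A. fst p \<union> snd p \<subseteq> W})"
    unfolding k_succ by blast
  let ?AW = "{p\<in>A. fst p \<union> snd p \<subseteq> W}"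
  have "\<exists>I\<subseteq>?AW. (\<forall>p\<in>I. \<forall>q\<in>I. p \<noteq> q \<longrightarrow> \<not> clash p q) \<and> card ?AW \<le> k * k * card V ^ (i - 1) * card I"
  proof (rule greedy_independent_set)
    show "clash q p" if "clash p q" for p q :: "'a set \<times> 'a set" using that unfolding clash_def by metis
    fix p assume "p \<in> ?AW"
    then have p: "p \<in> link_pairs k V i" using assms(5) by blast
    have "fst p \<noteq> {}" using link_pairsD(3)[OF p] assms(2) by auto
    then show "clash p p" by (auto simp: clash_def)
    have "card {q\<in>?AW. clash p q} \<le> card {q\<in>link_pairs k V i. clash p q}"
      using assms(1,5) by (intro card_mono) auto
    then show "card {q\<in>?AW. clash p q} \<le> k * k * card V ^ (i - 1)"
      using card_clash_le[OF assms(1,3) p] by linarith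
  qed (use finA in simp)
  then obtain I where I: "I \<subseteq> ?AW" "\<forall>p\<in>I. \<forall>q\<in>I. p \<noteq> q \<longrightarrow> \<not> clash p q"
    and card_I: "card ?AW \<le> k * k * card V ^ (i - 1) * card I" by blast
  have "real (card ?AW) \<le> real (k * k * card V ^ (i - 1) * card I)" using card_I by (simp only: of_nat_le_iff)
  then have "real (card A) / 2 ^ (k + 1) \<le> real k ^ 2 * real (card V) ^ (i - 1) * real (card I)"
    using card_W by (simp add: power2_eq_square)
  moreover have "I \<subseteq> A" "\<forall>p\<in>I. fst p \<union> snd p \<subseteq> W" using I(1) by auto
  ultimately show ?thesis using W I(2) by blast
qed

lemma inj_on_block:
  assumes "fst p \<inter> snd p = {}" "(fst p \<union> snd p) \<inter> U = {}"
  shows "inj_on (\<lambda>(x, R). insert x (R \<union> snd p)) (fst p \<times> nsets U i)"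
proof (rule inj_onI, clarsimp)
  fix x R y R'
  assume xy: "x \<in> fst p" "y \<in> fst p" "R \<in> nsets U i" "R' \<in> nsets U i"
    and eq: "insert x (R \<union> snd p) = insert y (R' \<union> snd p)"
  have R: "R \<subseteq> U" "R' \<subseteq> U" using xy by (auto simp: nsets_def)
  have "insert x (R \<union> snd p) \<inter> U = R" "insert y (R' \<union> snd p) \<inter> U = R'" using assms(2) R xy by auto
  moreover have "insert x (R \<union> snd p) \<inter> fst p = {x}" "insert y (R' \<union> snd p) \<inter> fst p = {y}"
    using assms R xy by auto
  ultimately show "x = y \<and> R = R'" using eq by auto
qed

lemma block_subset:
  assumes "i < k" "p \<in> link_pairs k V i" "U \<subseteq> V" "(fst p \<union> snd p) \<inter> U = {}"
  shows "block U i p \<subseteq> nsets V k"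
proof -
  note p = link_pairsD[OF assms(2)]
  have "insert x (R \<union> snd p) \<in> nsets V k" if x: "x \<in> fst p" and R: "R \<in> nsets U i" for x R
  proof -
    have "card (R \<union> snd p) = i + (k - 1 - i)"
      using R p(2,4) assms(4) by (subst card_Un_disjoint) (auto simp: nsets_def)
    moreover have "x \<notin> R \<union> snd p" using x R p(7) assms(4) by (auto simp: nsets_def)
    ultimately have "card (insert x (R \<union> snd p)) = k" using R p(2) assms(1) by (simp add: nsets_def)
    then show ?thesis using x R p(2,5,6) assms(3) by (auto simp: nsets_def)
  qed
  then show ?thesis by (auto simp: block_def)
qed

lemma block_disjoint:
  assumes "(fst p \<union> snd p) \<inter> U = {}" "(fst q \<union> snd q) \<inter> U = {}" "\<not> clash p q"
  shows "block U i p \<inter> block U i q = {}"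
proof -
  have "\<exists>x\<in>fst r. C - U = insert x (snd r)"
    if r: "C \<in> block U i r" "(fst r \<union> snd r) \<inter> U = {}" for C and r :: "'a set \<times> 'a set"
  proof -
    obtain x R where x: "x \<in> fst r" "R \<subseteq> U" "C = insert x (R \<union> snd r)"
      using r(1) by (auto simp: block_def nsets_def)
    then have "C - U = insert x (snd r)" using r(2) by auto
    then show ?thesis using x(1) by blast
  qed
  then show ?thesis using assms unfolding clash_def by (metis disjoint_iff)
qed

lemma card_block_few_extensions_le:
  assumes "finite (fst p)" "finite U" "fst p \<inter> snd p = {}" "(fst p \<union> snd p) \<inter> U = {}"
  shows "real (card {Y. Y \<subseteq> block U i p \<and>
      real (card {R\<in>nsets U i. \<forall>x\<in>fst p. insert x (R \<union> snd p) \<in> Y})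
        \<le> tuple_gain (card (fst p)) * real (card (nsets U i))})
    \<le> 2 powr (real (card (block U i p)) - tuple_gain (card (fst p)) * real (card (nsets U i)))"
proof -
  let ?K = "nsets U i" and ?h = "\<lambda>(x, R). insert x (R \<union> snd p)" and ?S = "fst p"
  let ?few = "\<lambda>Y. real (card {R\<in>?K. \<forall>x\<in>?S. insert x (R \<union> snd p) \<in> Y}) \<le> tuple_gain (card ?S) * real (card ?K)"
  let ?Z = "{Z. Z \<subseteq> ?S \<times> ?K \<and> real (card {R\<in>?K. \<forall>x\<in>?S. (x, R) \<in> Z}) \<le> tuple_gain (card ?S) * real (card ?K)}"
  have "{Y. Y \<subseteq> block U i p \<and> ?few Y} \<subseteq> image ?h ` ?Z"
  proof
    fix Y assume Y: "Y \<in> {Y. Y \<subseteq> block U i p \<and> ?few Y}"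
    let ?X = "{u\<in>?S \<times> ?K. ?h u \<in> Y}"
    have "Y = ?h ` ?X" using Y by (auto simp: block_def)
    moreover have "{R\<in>?K. \<forall>x\<in>?S. (x, R) \<in> ?X} = {R\<in>?K. \<forall>x\<in>?S. insert x (R \<union> snd p) \<in> Y}" by auto
    then have "?X \<in> ?Z" using Y by auto
    ultimately show "Y \<in> image ?h ` ?Z" by (rule image_eqI)
  qed
  then have "real (card {Y. Y \<subseteq> block U i p \<and> ?few Y}) \<le> real (card ?Z)"
    using assms(1,2) by (intro real_surj_card_le) (auto intro: finite_subset[of _ "Pow (?S \<times> ?K)"])
  also have "\<dots> \<le> 2 powr (real (card ?S) * real (card ?K) - tuple_gain (card ?S) * real (card ?K))"
    using assms(1,2) by (intro card_thin_intersections) auto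
  also have "real (card ?S) * real (card ?K) = real (card (block U i p))"
    unfolding block_def card_image[OF inj_on_block[OF assms(3,4)]] by (simp add: card_cartesian_product)
  finally show ?thesis .
qed

definition extension_rate :: "nat \<Rightarrow> real" where
  "extension_rate k = (1 / (real k * 2 ^ (k + 1))) ^ k"

lemma extension_rate_le_card_nsets:
  assumes "finite U" "1 \<le> i" "i < k" "real k * 2 ^ (k + 1) \<le> n" "n / 2 ^ (k + 1) \<le> real (card U)"
  shows "extension_rate k * n ^ i \<le> real (card (nsets U i))"
proof -
  have kp: "real k \<ge> 1" using assms(2,3) by simp
  have n: "n \<ge> 0" using assms(4) by (meson mult_nonneg_nonneg of_nat_0_le_iff order_trans zero_le_numeral
    zero_le_power)
  have "real i \<le> real k * 2 ^ (k + 1) / 2 ^ (k + 1)" using assms(3) by simp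
  also have "\<dots> \<le> n / 2 ^ (k + 1)" using assms(4) by (intro divide_right_mono) auto
  also have "\<dots> \<le> real (card U)" by (rule assms(5))
  finally have i: "i \<le> card U" by simp
  have "extension_rate k * n ^ i \<le> (1 / (real k * 2 ^ (k + 1))) ^ i * n ^ i"
  proof (rule mult_right_mono)
    have "1 * 1 \<le> real k * 2 ^ (k + 1)" using kp by (intro mult_mono one_le_power) auto
    then show "extension_rate k \<le> (1 / (real k * 2 ^ (k + 1))) ^ i"
      unfolding extension_rate_def using assms(3) by (intro power_decreasing) auto
  qed (use n in simp)
  also have "\<dots> = ((n / 2 ^ (k + 1)) / real k) ^ i" by (simp add: power_divide power_mult_distrib)
  also have "\<dots> \<le> (real (card U) / real i) ^ i"
    using assms(2,3,5) n by (intro power_mono frac_le) auto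
  also have "\<dots> \<le> real (card U choose i)" by (rule binomial_ge_n_over_k_pow_k[OF i])
  finally show ?thesis by simp
qed

text \<open>The constraints for different pairs concern the sets \<open>insert x (R \<union> T)\<close> with \<open>R\<close> inside \<open>U\<close>.
  These have trace \<open>insert x T\<close> outside \<open>U\<close>, so they are disjoint for pairs that do not clash.\<close>

lemma card_few_extensions_clash_free_le:
  assumes "finite V" "i < k" "U \<subseteq> V" "I \<subseteq> link_pairs k V i"
    and disjoint: "\<And>p. p \<in> I \<Longrightarrow> (fst p \<union> snd p) \<inter> U = {}"
    and clash_free: "\<And>p q. p \<in> I \<Longrightarrow> q \<in> I \<Longrightarrow> p \<noteq> q \<Longrightarrow> \<not> clash p q"
  shows "real (card {P. P \<subseteq> nsets V k \<and>
      (\<forall>p\<in>I. real (card (extensions V P (fst p) (snd p))) \<le> tuple_gain i * real (card (nsets U i)))})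
    \<le> 2 powr (real (card V choose k) - tuple_gain i * real (card (nsets U i)) * real (card I))"
proof -
  let ?K = "nsets U i" and ?B = "block U i"
  let ?few = "\<lambda>p Y. real (card {R\<in>?K. \<forall>x\<in>fst p. insert x (R \<union> snd p) \<in> Y}) \<le> tuple_gain i * real (card ?K)"
  have finU: "finite U" by (rule finite_subset[OF assms(3,1)])
  have pair: "p \<in> link_pairs k V i" if "p \<in> I" for p using that assms(4) by blast
  have few: "?few p (P \<inter> ?B p)"
    if p: "p \<in> I" and "real (card (extensions V P (fst p) (snd p))) \<le> tuple_gain i * real (card ?K)" for p P
  proof -
    have "{R\<in>?K. \<forall>x\<in>fst p. insert x (R \<union> snd p) \<in> P \<inter> ?B p} \<subseteq> extensions V P (fst p) (snd p)"
      using disjoint[OF p] link_pairsD(3)[OF pair[OF p]] assms(3) by (auto simp: extensions_def nsets_def)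
    then have "card {R\<in>?K. \<forall>x\<in>fst p. insert x (R \<union> snd p) \<in> P \<inter> ?B p} \<le> card (extensions V P (fst p) (snd p))"
      using assms(1) by (intro card_mono) auto
    then show ?thesis using that(2) by linarith
  qed
  have "real (card {P. P \<subseteq> nsets V k \<and>
        (\<forall>p\<in>I. real (card (extensions V P (fst p) (snd p))) \<le> tuple_gain i * real (card ?K))})
      \<le> real (card {P. P \<subseteq> nsets V k \<and> (\<forall>p\<in>I. ?few p (P \<inter> ?B p))})"
    using assms(1) few by (intro real_card_mono Collect_mono) auto
  also have "\<dots> \<le> 2 powr (real (card (nsets V k)) - tuple_gain i * real (card ?K) * real (card I))"
  proof (rule card_block_constraints)
    show "finite I" by (rule finite_subset[OF assms(4)]) (simp add: assms(1))
    show "\<forall>p\<in>I. ?B p \<subseteq> nsets V k" using pair disjoint assms(2,3) by (intro ballI block_subset) auto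
    show "disjoint_family_on ?B I"
      unfolding disjoint_family_on_def using disjoint clash_free by (intro ballI impI block_disjoint) auto
    show "\<forall>p\<in>I. real (card {Y. Y \<subseteq> ?B p \<and> ?few p Y})
        \<le> 2 powr (real (card (?B p)) - tuple_gain i * real (card ?K))"
    proof
      fix p assume p: "p \<in> I"
      note q = link_pairsD[OF pair[OF p]]
      show "real (card {Y. Y \<subseteq> ?B p \<and> ?few p Y})
          \<le> 2 powr (real (card (?B p)) - tuple_gain i * real (card ?K))"
        using card_block_few_extensions_le[OF q(1) finU q(7) disjoint[OF p], of i] unfolding q(3) by simp
    qed
  qed (use assms(1) in simp)
  finally show ?thesis by simp
qed

lemma card_few_extensions_le:
  assumes "finite V" "1 \<le> i" "i < k" "real k * 2 ^ (k + 1) \<le> real (card V)" "A \<subseteq> link_pairs k V i"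
    and b: "0 \<le> b" "b \<le> tuple_gain i * extension_rate k"
  shows "real (card {P. P \<subseteq> nsets V k \<and>
      (\<forall>p\<in>A. real (card (extensions V P (fst p) (snd p))) < b * real (card V) ^ i)})
    \<le> 2 powr (real (card V choose k) - b / (2 ^ (k + 1) * real k ^ 2) * (real (card V) * real (card A)))"
proof (cases "A = {}")
  case True
  then show ?thesis using assms(1) by (simp add: card_Pow[unfolded Pow_def] powr_realpow)
next
  case False
  let ?n = "real (card V)" and ?g = "tuple_gain i"
  have "real k * 2 \<le> real k * 2 ^ (k + 1)" by (intro mult_left_mono) auto
  then have "2 * real k \<le> ?n" using assms(4) by linarith
  then obtain W I where W: "W \<subseteq> V" "?n / 2 ^ (k + 1) \<le> real (card (V - W))"
    and I: "I \<subseteq> A" "\<forall>p\<in>I. fst p \<union> snd p \<subseteq> W" "\<forall>p\<in>I. \<forall>q\<in>I. p \<noteq> q \<longrightarrow> \<not> clash p q"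
    and card_I: "real (card A) / 2 ^ (k + 1) \<le> real k ^ 2 * ?n ^ (i - 1) * real (card I)"
    using exists_clash_free[OF assms(1-3) _ assms(5) False] by blast
  let ?K = "nsets (V - W) i"
  have "b * ?n ^ i \<le> ?g * (extension_rate k * ?n ^ i)"
    unfolding mult.assoc[symmetric] using b(2) by (intro mult_right_mono) auto
  also have "\<dots> \<le> ?g * real (card ?K)"
    using assms(1-4) W(2) tuple_gain_pos[of i]
    by (intro mult_left_mono extension_rate_le_card_nsets) auto
  finally have card_K: "b * ?n ^ i \<le> ?g * real (card ?K)" .
  have "real (card (extensions V P (fst p) (snd p))) \<le> ?g * real (card ?K)"
    if "\<forall>p\<in>A. real (card (extensions V P (fst p) (snd p))) < b * ?n ^ i" "p \<in> I" for P p
    using that I(1) card_K by fastforce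
  then have "real (card {P. P \<subseteq> nsets V k \<and>
      (\<forall>p\<in>A. real (card (extensions V P (fst p) (snd p))) < b * ?n ^ i)})
      \<le> real (card {P. P \<subseteq> nsets V k \<and>
        (\<forall>p\<in>I. real (card (extensions V P (fst p) (snd p))) \<le> ?g * real (card ?K))})"
    using assms(1) by (intro real_card_mono Collect_mono) auto
  also have "\<dots> \<le> 2 powr (real (card V choose k) - ?g * real (card ?K) * real (card I))"
    using assms(1,3,5) I by (intro card_few_extensions_clash_free_le) blast+
  also have "\<dots> \<le> 2 powr (real (card V choose k) - b / (2 ^ (k + 1) * real k ^ 2) * (?n * real (card A)))"
  proof (intro powr_mono diff_left_mono)
    have "b / (2 ^ (k + 1) * real k ^ 2) * (?n * real (card A))
        = b * ?n / real k ^ 2 * (real (card A) / 2 ^ (k + 1))"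
      by (simp add: mult_ac)
    also have "\<dots> \<le> b * ?n / real k ^ 2 * (real k ^ 2 * ?n ^ (i - 1) * real (card I))"
      using card_I b(1) by (intro mult_left_mono) auto
    also have "\<dots> = b * (?n * ?n ^ (i - 1)) * real (card I)" using assms(3) by simp
    also have "?n * ?n ^ (i - 1) = ?n ^ i" using assms(2) by (simp flip: power_Suc)
    also have "b * ?n ^ i * real (card I) \<le> ?g * real (card ?K) * real (card I)"
      using card_K by (intro mult_right_mono) auto
    finally show "b / (2 ^ (k + 1) * real k ^ 2) * (?n * real (card A))
        \<le> ?g * real (card ?K) * real (card I)" .
  qed simp
  finally show ?thesis .
qed

definition forced_extensions :: "'a set \<Rightarrow> 'a set set \<Rightarrow> 'a set \<Rightarrow> 'a set \<Rightarrow> 'a \<Rightarrow> 'a set set" where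
  "forced_extensions V P S T t = {R\<in>extensions V P S (T - {t}). t \<notin> R}"

lemma finite_forced_extensions [simp]: "finite V \<Longrightarrow> finite (forced_extensions V P S T t)"
  by (simp add: forced_extensions_def)

lemma forced_extensionsD:
  assumes "R \<in> forced_extensions V P S T t"
  shows "finite R" "R \<subseteq> V" "card R = card S" "R \<inter> T = {}" "R \<inter> S = {}"
  using assms by (auto simp: forced_extensions_def extensions_def nsets_def)

lemma forced_extensions_traces:
  assumes "finite V" "T \<in> nsets V (k - i)" "S \<in> nsets V i" "S \<inter> T = {}" "t \<in> T" "i < k" "T \<subseteq> A" "S \<inter> A = {}"
    and "R \<in> forced_extensions V P S T t"
  shows "R \<union> T \<in> nsets V k" "card ((R \<union> T) \<inter> A) = k - i + card (R \<inter> A)"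
    "x \<in> S \<Longrightarrow> card (insert x (R \<union> (T - {t})) \<inter> A) \<noteq> k - i + card (R \<inter> A)"
proof -
  note R = forced_extensionsD[OF assms(9)]
  have T: "finite T" "card T = k - i" "T \<subseteq> V" and S: "card S = i" using assms(2,3) by (auto simp: nsets_def)
  have "card (R \<union> T) = k" using R T S assms(6) by (subst card_Un_disjoint) auto
  then show "R \<union> T \<in> nsets V k" using R T by (auto simp: nsets_def)
  have "(R \<union> T) \<inter> A = (R \<inter> A) \<union> T" using assms(7) by auto
  also have "card \<dots> = card (R \<inter> A) + card T" using R T by (intro card_Un_disjoint) auto
  finally show "card ((R \<union> T) \<inter> A) = k - i + card (R \<inter> A)" using T by simp
  assume "x \<in> S"
  then have "insert x (R \<union> (T - {t})) \<inter> A = (R \<inter> A) \<union> (T - {t})" using assms(7,8) by auto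
  also have "card \<dots> = card (R \<inter> A) + card (T - {t})" using R T by (intro card_Un_disjoint) auto
  also have "\<dots> \<noteq> k - i + card (R \<inter> A)" using T assms(5,6) by simp
  finally show "card (insert x (R \<union> (T - {t})) \<inter> A) \<noteq> k - i + card (R \<inter> A)" .
qed

lemma forced_extensions_Int_other_layers:
  assumes "finite V" "T \<in> nsets V (k - i)" "S \<in> nsets V i" "S \<inter> T = {}" "t \<in> T" "i < k" "T \<subseteq> A" "S \<inter> A = {}"
  shows "{R\<in>forced_extensions V (P \<inter> {C. card (C \<inter> A) \<noteq> k - i + a}) S T t. card (R \<inter> A) = a}
    = {R\<in>forced_extensions V P S T t. card (R \<inter> A) = a}"
proof -
  have "card (insert x (R \<union> (T - {t})) \<inter> A) \<noteq> k - i + a"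
    if "R \<in> forced_extensions V P S T t" "card (R \<inter> A) = a" "x \<in> S" for R x
    using forced_extensions_traces(3)[OF assms that(1,3)] that(2) by simp
  then show ?thesis by (auto simp: forced_extensions_def extensions_def)
qed

lemma exists_heavy_forced_layer:
  fixes m :: real
  assumes "finite V" "i < k" "m \<ge> 0" "Ts \<subseteq> nsets V (k - i)"
    and \<sigma>: "\<And>T. T \<in> Ts \<Longrightarrow> \<sigma> T \<in> nsets V i"
    and large: "\<And>T. T \<in> Ts \<Longrightarrow> m \<le> real (card (forced_extensions V P (\<sigma> T) T (\<tau> T)))"
  shows "\<exists>a\<le>i. m * real (card Ts) / (real k * 2 ^ k)
    \<le> real (card (\<Union>T\<in>Ts. (\<lambda>R. R \<union> T) ` {R\<in>forced_extensions V P (\<sigma> T) T (\<tau> T). card (R \<inter> A) = a}))"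
proof -
  let ?layer = "\<lambda>a T. {R\<in>forced_extensions V P (\<sigma> T) T (\<tau> T). card (R \<inter> A) = a}"
  let ?U = "\<lambda>a. \<Union>T\<in>Ts. (\<lambda>R. R \<union> T) ` ?layer a T" and ?g = "m * real (card Ts) / (real k * 2 ^ k)"
  have finTs: "finite Ts" by (rule finite_subset[OF assms(4)]) (simp add: assms(1))
  have T: "finite T" "card T = k - i" if "T \<in> Ts" for T using that assms(4) by (auto simp: nsets_def)
  have R: "finite R" "card R = i" "R \<inter> T = {}" if "T \<in> Ts" "R \<in> forced_extensions V P (\<sigma> T) T (\<tau> T)" for T R
    using forced_extensionsD[OF that(2)] \<sigma>[OF that(1)] by (auto simp: nsets_def)
  have "card (R \<inter> A) \<le> i" if "T \<in> Ts" "R \<in> forced_extensions V P (\<sigma> T) T (\<tau> T)" for T R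
    using card_mono[of R "R \<inter> A"] R[OF that] by simp
  then obtain a where a: "a \<le> i" "real (card Ts) * m / real (Suc i) \<le> real (\<Sum>T\<in>Ts. card (?layer a T))"
    using exists_heavy_layer[of Ts "\<lambda>T. forced_extensions V P (\<sigma> T) T (\<tau> T)" "\<lambda>R. card (R \<inter> A)" i m]
      finTs large assms(1) by auto
  have join: "finite (R \<union> T) \<and> card (R \<union> T) = k \<and> R \<inter> T = {}" if "T \<in> Ts" "R \<in> ?layer a T" for T R
    using R[of T R] T[OF that(1)] that assms(2) by (auto simp: card_Un_disjoint)
  have "2 ^ k * ?g = real (card Ts) * m / real k" by simp
  also have "\<dots> \<le> real (card Ts) * m / real (Suc i)" using assms(2,3) by (intro divide_left_mono) auto
  also note a(2)
  also have "(\<Sum>T\<in>Ts. card (?layer a T)) \<le> 2 ^ k * card (?U a)"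
  proof (rule sum_card_joins_le[OF finTs])
    show "finite (?layer a T)" if "T \<in> Ts" for T using assms(1) by simp
  qed (use join in blast)+
  finally have "2 ^ k * ?g \<le> 2 ^ k * real (card (?U a))"
    by (simp only: of_nat_mult of_nat_power of_nat_numeral)
  then have "?g \<le> real (card (?U a))" by (rule mult_left_le_imp_le) simp
  then show ?thesis using a(1) by blast
qed

text \<open>If \<open>A\<close> contains \<open>T\<close> and avoids \<open>\<sigma> T\<close>, the excluded set \<open>R \<union> T\<close> has one more element in \<open>A\<close> than
  the sets that exclude it. So for each value of \<open>card (R \<inter> A)\<close> the excluded sets of one layer are
  determined by the sets outside this layer.\<close>

lemma card_avoiding_separated_forced_extensions_le:
  fixes m :: real
  assumes "finite V" "i < k" "m \<ge> 0" "Ts \<subseteq> nsets V (k - i)"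
    and Ts: "\<And>T. T \<in> Ts \<Longrightarrow> \<sigma> T \<in> nsets V i \<and> \<sigma> T \<inter> T = {} \<and> \<tau> T \<in> T \<and> T \<subseteq> A \<and> \<sigma> T \<inter> A = {}"
    and G: "\<And>T P. G T P = forced_extensions V P (\<sigma> T) T (\<tau> T)"
  shows "real (card {P. P \<subseteq> nsets V k \<and> (\<forall>T\<in>Ts. m \<le> real (card (G T P)) \<and> (\<forall>R\<in>G T P. R \<union> T \<notin> P))})
    \<le> real k * 2 powr (real (card V choose k) - m * real (card Ts) / (real k * 2 ^ k))"
proof -
  let ?X = "nsets V k" and ?g = "m * real (card Ts) / (real k * 2 ^ k)"
  define layer where "layer a T P = {R\<in>G T P. card (R \<inter> A) = a}" for a T P
  define other where "other a = {C\<in>?X. card (C \<inter> A) \<noteq> k - i + a}" for a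
  define f where "f a P = (\<Union>T\<in>Ts. (\<lambda>R. R \<union> T) ` layer a T P)" for a P
  let ?Z = "\<lambda>a. {P. P \<subseteq> ?X \<and> P \<inter> f a (P \<inter> other a) = {} \<and> ?g \<le> real (card (f a (P \<inter> other a)))}"
  have join: "R \<union> T \<in> ?X - other a" if "T \<in> Ts" "R \<in> layer a T P" for R T a P
    using that Ts[of T] assms(4) forced_extensions_traces(1,2)[OF assms(1) _ _ _ _ assms(2), of T "\<sigma> T"
      "\<tau> T" A R P]
    by (auto simp: layer_def other_def G)
  have f_other: "f a (P \<inter> other a) = f a P" if "P \<subseteq> ?X" for a P
  proof -
    have "P \<inter> other a = P \<inter> {C. card (C \<inter> A) \<noteq> k - i + a}" using that by (auto simp: other_def)
    then have "layer a T (P \<inter> other a) = layer a T P" if "T \<in> Ts" for T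
      using forced_extensions_Int_other_layers[OF assms(1) _ _ _ _ assms(2), of T "\<sigma> T"
        "\<tau> T" A P a] Ts[OF that] that assms(4)
      by (auto simp: layer_def G)
    then show ?thesis by (simp add: f_def)
  qed
  have "{P. P \<subseteq> ?X \<and> (\<forall>T\<in>Ts. m \<le> real (card (G T P)) \<and> (\<forall>R\<in>G T P. R \<union> T \<notin> P))} \<subseteq> (\<Union>a\<in>{..i}. ?Z a)"
  proof
    fix P assume "P \<in> {P. P \<subseteq> ?X \<and> (\<forall>T\<in>Ts. m \<le> real (card (G T P)) \<and> (\<forall>R\<in>G T P. R \<union> T \<notin> P))}"
    then have P: "P \<subseteq> ?X" and large: "\<And>T. T \<in> Ts \<Longrightarrow> m \<le> real (card (G T P))"
      and avoid: "\<And>T R. T \<in> Ts \<Longrightarrow> R \<in> G T P \<Longrightarrow> R \<union> T \<notin> P" by auto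
    have "\<exists>a\<le>i. ?g \<le> real (card (f a P))"
      unfolding f_def layer_def G using Ts large
      by (intro exists_heavy_forced_layer[OF assms(1-4)]) (auto simp: G)
    then obtain a where "a \<le> i" "?g \<le> real (card (f a P))" by blast
    moreover have "P \<inter> f a P = {}" using avoid by (auto simp: f_def layer_def)
    ultimately show "P \<in> (\<Union>a\<in>{..i}. ?Z a)" using P f_other[OF P] by auto
  qed
  then have "real (card {P. P \<subseteq> ?X \<and> (\<forall>T\<in>Ts. m \<le> real (card (G T P)) \<and> (\<forall>R\<in>G T P. R \<union> T \<notin> P))})
      \<le> real (card (\<Union>a\<in>{..i}. ?Z a))"
    using assms(1) by (intro real_card_mono) auto
  also have "\<dots> \<le> real k * 2 powr (real (card ?X) - ?g)"
  proof (rule real_card_UN_le_mult)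
    show "real (card (?Z a)) \<le> 2 powr (real (card ?X) - ?g)" for a
      using assms(1) join by (intro card_avoiding) (auto simp: other_def f_def)
  qed (use assms(2) in auto)
  finally show ?thesis by simp
qed

lemma card_avoiding_forced_extensions_le:
  assumes "finite V" "i < k" "b \<ge> 0" "Ts \<subseteq> nsets V (k - i)"
    and Ts: "\<And>T. T \<in> Ts \<Longrightarrow> \<sigma> T \<in> nsets V i \<and> \<sigma> T \<inter> T = {} \<and> \<tau> T \<in> T"
    and "\<And>T P. G T P = forced_extensions V P (\<sigma> T) T (\<tau> T)"
  shows "real (card {P. P \<subseteq> nsets V k \<and>
      (\<forall>T\<in>Ts. b * real (card V) ^ i \<le> real (card (G T P)) \<and> (\<forall>R\<in>G T P. R \<union> T \<notin> P))})
    \<le> real k * 2 powr (real (card V choose k) - b / (real k * 4 ^ k) * (real (card V) ^ i * real (card Ts)))"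
proof -
  let ?n = "real (card V)"
  let ?avoid = "\<lambda>Ts. {P. P \<subseteq> nsets V k \<and>
    (\<forall>T\<in>Ts. b * ?n ^ i \<le> real (card (G T P)) \<and> (\<forall>R\<in>G T P. R \<union> T \<notin> P))}"
  have finTs: "finite Ts" by (rule finite_subset[OF assms(4)]) (simp add: assms(1))
  have "\<exists>A\<subseteq>V. real (card Ts) / 2 ^ k \<le> real (card {T\<in>Ts. T \<subseteq> A \<and> \<sigma> T \<inter> A = {}})"
  proof (rule exists_separating[OF assms(1) finTs])
    show "T \<subseteq> V \<and> \<sigma> T \<subseteq> V \<and> \<sigma> T \<inter> T = {} \<and> card T + card (\<sigma> T) = k" if "T \<in> Ts" for T
      using Ts[OF that] subsetD[OF assms(4) that] assms(2) by (auto simp: nsets_def)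
  qed
  then obtain A where A: "real (card Ts) / 2 ^ k \<le> real (card {T\<in>Ts. T \<subseteq> A \<and> \<sigma> T \<inter> A = {}})" by blast
  let ?TA = "{T\<in>Ts. T \<subseteq> A \<and> \<sigma> T \<inter> A = {}}"
  have "real (card (?avoid Ts)) \<le> real (card (?avoid ?TA))"
    using assms(1) by (intro real_card_mono) auto
  also have "\<dots> \<le> real k * 2 powr (real (card V choose k) - b * ?n ^ i * real (card ?TA) / (real k * 2 ^ k))"
    using assms by (intro card_avoiding_separated_forced_extensions_le[where A = A]) auto
  also have "\<dots> \<le> real k * 2 powr (real (card V choose k) - b / (real k * 4 ^ k) * (?n ^ i * real (card Ts)))"
  proof (intro mult_left_mono powr_mono diff_left_mono)
    have "(4::real) ^ k = 2 ^ k * 2 ^ k" by (subst power_mult_distrib[symmetric]) simp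
    then have "b / (real k * 4 ^ k) * (?n ^ i * real (card Ts))
        = b * ?n ^ i / (real k * 2 ^ k) * (real (card Ts) / 2 ^ k)"
      by simp
    also have "\<dots> \<le> b * ?n ^ i / (real k * 2 ^ k) * real (card ?TA)"
      using A assms(3) by (intro mult_left_mono) auto
    finally show "b / (real k * 4 ^ k) * (?n ^ i * real (card Ts))
        \<le> b * ?n ^ i * real (card ?TA) / (real k * 2 ^ k)"
      by simp
  qed auto
  finally show ?thesis .
qed

section \<open>Formulae without large irregularities\<close>

definition proper_subsets :: "nat \<Rightarrow> 'a set \<Rightarrow> 'a set set" where
  "proper_subsets k V = {S. S \<subseteq> V \<and> S \<noteq> {} \<and> card S < k}"

definition typical_sets :: "nat \<Rightarrow> 'a set \<Rightarrow> real \<Rightarrow> 'a form \<Rightarrow> 'a set set" where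
  "typical_sets k V b F = {T. \<exists>S t. (S, T) \<in> F \<and> S \<noteq> {} \<and> t \<in> T \<and> T - {t} \<notin> atypical k V b S F}"

definition atypical_pairs :: "nat \<Rightarrow> 'a set \<Rightarrow> real \<Rightarrow> 'a form \<Rightarrow> ('a set \<times> 'a set) set" where
  "atypical_pairs k V b F = (SIGMA S:proper_subsets k V. atypical k V b S F)"

definition clique_pairs :: "nat \<Rightarrow> 'a set \<Rightarrow> ('a set \<times> 'a set) set \<Rightarrow> ('a set \<times> 'a set) set" where
  "clique_pairs k V A = (SIGMA S:proper_subsets k V. cliques V (A `` {S}) (k - card S))"

definition residual :: "nat \<Rightarrow> 'a set \<Rightarrow> real \<Rightarrow> real \<Rightarrow> real \<Rightarrow> 'a form set" where
  "residual k V s b \<xi> = {F\<in>sparse_forms k V s. neg_clauses F \<noteq> {} \<and> (\<forall>S. (S, {}) \<notin> F) \<and>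
     (\<forall>S\<in>proper_subsets k V. real (card (atypical k V b S F)) \<le> \<xi> * real (card V) ^ (k - 1 - card S))}"

text \<open>Up to constants, \<open>n ^ card S\<close> and \<open>n\<close> are what a typical set \<open>T\<close> of a clause \<open>(S, T)\<close> and an
  atypical pair save.\<close>

definition weight :: "nat \<Rightarrow> 'a set \<Rightarrow> 'a set set \<Rightarrow> ('a set \<times> 'a set) set \<Rightarrow> real" where
  "weight k V Ts A = (\<Sum>T\<in>Ts. real (card V) ^ (k - card T)) + real (card V) * real (card A)"

lemma finite_proper_subsets [simp]: "finite V \<Longrightarrow> finite (proper_subsets k V)"
  by (simp add: proper_subsets_def)

lemma finite_atypical [simp]: "finite V \<Longrightarrow> finite (atypical k V b S F)"
  by (simp add: atypical_def)

lemma finite_atypical_pairs [simp]: "finite V \<Longrightarrow> finite (atypical_pairs k V b F)"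
  by (auto simp: atypical_pairs_def)

lemma residual_subset: "residual k V s b \<xi> \<subseteq> sparse_forms k V s"
  by (auto simp: residual_def)

lemma residual_pos_clauses_subset: "F \<in> residual k V s b \<xi> \<Longrightarrow> pos_clauses F \<subseteq> nsets V k"
  by (rule pos_clauses_subset[OF sparse_forms_subset[OF subsetD[OF residual_subset]]])

lemma proper_subsetsD:
  assumes "S \<in> proper_subsets k V" "finite V" shows "finite S" "S \<subseteq> V" "card S \<in> {1..<k}"
  using assms finite_subset[OF _ assms(2)] by (auto simp: proper_subsets_def Suc_le_eq card_gt_0_iff)

lemma residual_clauseD:
  assumes "F \<in> residual k V s b \<xi>" "(S, T) \<in> F" "S \<noteq> {}"
  shows "S \<in> proper_subsets k V" "T \<in> proper_subsets k V" "T \<in> nsets V (k - card S)"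
    "S \<inter> T = {}" "card S + card T = k"
proof -
  have "T \<noteq> {}" using assms(1,2) by (auto simp: residual_def)
  moreover have "F \<subseteq> signed_pairs k V" using assms(1) residual_subset sparse_forms_subset by blast
  note ST = signed_pairsD[OF subsetD[OF this assms(2)]]
  moreover have "card S > 0" using ST assms(3) by (simp add: card_gt_0_iff)
  moreover have "card T > 0" using ST \<open>T \<noteq> {}\<close> by (simp add: card_gt_0_iff)
  ultimately show "S \<in> proper_subsets k V" "T \<in> proper_subsets k V" "T \<in> nsets V (k - card S)"
    "S \<inter> T = {}" "card S + card T = k"
    using assms(3) by (auto simp: proper_subsets_def nsets_def)
qed

lemma typical_sets_subset:
  assumes "F \<in> residual k V s b \<xi>" shows "typical_sets k V b F \<subseteq> proper_subsets k V"
  using residual_clauseD(2)[OF assms] by (auto simp: typical_sets_def)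

lemma card_clique_pairs_le:
  assumes "finite V" "F \<in> residual k V s b \<xi>" "clique_bound V k e \<xi>"
  shows "real (card (clique_pairs k V (atypical_pairs k V b F)))
      \<le> e * real (card V) * real (card (atypical_pairs k V b F))"
proof -
  let ?I = "proper_subsets k V" and ?A = "\<lambda>S. atypical k V b S F"
  have bound: "real (card (cliques V (?A S) (k - card S))) \<le> e * real (card V) * real (card (?A S))"
    if S: "S \<in> ?I" for S
  proof -
    have "k - card S = Suc (k - 1 - card S)" "k - 1 - card S < k" using S by (auto simp: proper_subsets_def)
    moreover have "real (card (?A S)) \<le> \<xi> * real (card V) ^ (k - 1 - card S)"
      using assms(2) S by (simp add: residual_def)
    moreover have "?A S \<subseteq> nsets V (k - 1 - card S)" using atypical_subset nsets_mono[of "V - S" V] by blast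
    ultimately show ?thesis using assms(3) unfolding clique_bound_def by metis
  qed
  have "clique_pairs k V (atypical_pairs k V b F) = (SIGMA S:?I. cliques V (?A S) (k - card S))"
    by (auto simp: clique_pairs_def atypical_pairs_def Image_def)
  then have "real (card (clique_pairs k V (atypical_pairs k V b F)))
      = (\<Sum>S\<in>?I. real (card (cliques V (?A S) (k - card S))))"
    using assms(1) by (simp add: card_SigmaI finite_cliques)
  also have "\<dots> \<le> (\<Sum>S\<in>?I. e * real (card V) * real (card (?A S)))" using bound by (intro sum_mono)
  also have "\<dots> = e * real (card V) * real (card (atypical_pairs k V b F))"
    unfolding atypical_pairs_def using assms(1) by (simp add: card_SigmaI sum_distrib_left)
  finally show ?thesis .
qed

lemma weight_ge:
  assumes "finite V" "card V \<ge> 1" "F \<in> residual k V s b \<xi>"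
  shows "real (card V) \<le> weight k V (typical_sets k V b F) (atypical_pairs k V b F)"
proof -
  let ?n = "real (card V)" and ?Ts = "typical_sets k V b F" and ?A = "atypical_pairs k V b F"
  obtain S T where ST: "(S, T) \<in> F" "S \<noteq> {}" using assms(3) by (auto simp: residual_def neg_clauses_def)
  note clause = residual_clauseD[OF assms(3) ST]
  have finTs: "finite ?Ts" using finite_subset[OF typical_sets_subset[OF assms(3)]] assms(1) by simp
  show ?thesis
  proof (cases "T \<in> ?Ts")
    case True
    have "?n \<le> ?n ^ (k - card T)"
      using proper_subsetsD(3)[OF clause(2) assms(1)] assms(2) by (intro self_le_power) auto
    also have "\<dots> \<le> (\<Sum>T\<in>?Ts. ?n ^ (k - card T))" using True finTs by (intro member_le_sum) auto
    finally show ?thesis unfolding weight_def by (simp add: add_increasing2)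
  next
    case False
    obtain t where "t \<in> T" using clause(2) by (auto simp: proper_subsets_def)
    then have "(S, T - {t}) \<in> ?A" using False clause(1) ST by (auto simp: typical_sets_def atypical_pairs_def)
    then have "card ?A \<ge> 1" using assms(1) by (auto simp: Suc_le_eq card_gt_0_iff)
    then have "?n * 1 \<le> ?n * real (card ?A)" by (intro mult_left_mono) auto
    then show ?thesis unfolding weight_def by (simp add: add_increasing sum_nonneg)
  qed
qed

lemma neg_clauses_outside_typical_sets:
  assumes "F \<in> residual k V s b \<xi>"
  shows "{p\<in>neg_clauses F. snd p \<notin> typical_sets k V b F} \<subseteq> clique_pairs k V (atypical_pairs k V b F)"
proof clarify
  fix S T assume ST: "(S, T) \<in> neg_clauses F" "snd (S, T) \<notin> typical_sets k V b F"
  then have F: "(S, T) \<in> F" "S \<noteq> {}" by (auto simp: neg_clauses_def)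
  note clause = residual_clauseD[OF assms F]
  have "T - {t} \<in> atypical_pairs k V b F `` {S}" if "t \<in> T" for t
    using ST(2) F that clause(1) by (auto simp: typical_sets_def atypical_pairs_def)
  then show "(S, T) \<in> clique_pairs k V (atypical_pairs k V b F)"
    using clause(1,3) by (simp add: clique_pairs_def cliques_def)
qed

lemma exists_heavy_part:
  assumes "finite Ts" "finite A" "\<And>T. T \<in> Ts \<Longrightarrow> card T \<in> {1..<k}" "\<And>p. p \<in> A \<Longrightarrow> card (fst p) \<in> {1..<k}" "2 \<le> k"
  shows "\<exists>i\<in>{1..<k}. weight k V Ts A \<le> 2 * real k * (real (card V) ^ i * real (card {T\<in>Ts. card T = k - i})) \<or>
    weight k V Ts A \<le> 2 * real k * (real (card V) * real (card {p\<in>A. card (fst p) = i}))"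
proof -
  let ?n = "real (card V)" and ?w = "weight k V Ts A"
  let ?t = "\<lambda>i. ?n ^ i * real (card {T\<in>Ts. card T = k - i})"
    and ?a = "\<lambda>i. ?n * real (card {p\<in>A. card (fst p) = i})"
  have "(\<Sum>T\<in>Ts. ?n ^ (k - card T)) = (\<Sum>i\<in>{1..<k}. \<Sum>T\<in>{T\<in>Ts. k - card T = i}. ?n ^ (k - card T))"
    using assms(1,3) by (intro sum.group[symmetric]) force+
  also have "\<dots> = (\<Sum>i\<in>{1..<k}. ?t i)"
  proof (rule sum.cong)
    fix i assume "i \<in> {1..<k}"
    then have "{T\<in>Ts. k - card T = i} = {T\<in>Ts. card T = k - i}" using assms(3) by fastforce
    then show "(\<Sum>T\<in>{T\<in>Ts. k - card T = i}. ?n ^ (k - card T)) = ?t i" using \<open>i \<in> {1..<k}\<close> by simp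
  qed simp
  finally have "?w = (\<Sum>i\<in>{1..<k}. ?t i) + ?n * real (card A)" by (simp add: weight_def)
  also have "card A = (\<Sum>i\<in>{1..<k}. card {p\<in>A. card (fst p) = i})"
    using assms(2,4) by (intro card_eq_sum_fibres) auto
  finally have w: "?w = (\<Sum>i\<in>{1..<k}. ?t i + ?a i)" by (simp add: sum.distrib sum_distrib_left)
  have "?w \<ge> 0" unfolding weight_def by (intro add_nonneg_nonneg sum_nonneg) auto
  then have "real (card {1..<k}) * (?w / real k) \<le> real k * (?w / real k)" by (intro mult_right_mono) auto
  also have "\<dots> = (\<Sum>i\<in>{1..<k}. ?t i + ?a i)" using assms(5) w by simp
  finally obtain i where i: "i \<in> {1..<k}" "?w / real k \<le> ?t i + ?a i"
    using exists_ge_average[of "{1..<k}" "?w / real k" "\<lambda>i. ?t i + ?a i"] assms(5) by auto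
  have "?w \<le> real k * (?t i + ?a i)" using i assms(5) by (simp add: divide_le_eq mult.commute)
  then have "?w \<le> 2 * real k * ?t i \<or> ?w \<le> 2 * real k * ?a i"
    by (cases "?t i \<le> ?a i") (auto simp: distrib_left mult.assoc dest: mult_left_mono[of _ _ "real k"])
  then show ?thesis using i(1) by blast
qed

lemma forced_extension_excluded:
  assumes "F \<subseteq> signed_pairs k V" "(S, T) \<in> F" "t \<in> T" "R \<in> forced_extensions V (pos_clauses F) S T t"
  shows "R \<union> T \<in> excluded k V S F"
proof -
  note R = forced_extensionsD[OF assms(4)] and ST = signed_pairsD[OF subsetD[OF assms(1,2)]]
  have "card (R \<union> T) = k" using R ST by (subst card_Un_disjoint) auto
  then have "R \<union> T \<in> nsets (V - S) k" using R ST by (auto simp: nsets_def)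
  moreover have "\<exists>Q\<in>pos_link F x. Q \<subseteq> R \<union> T" if "x \<in> S" for x
  proof
    show "R \<union> (T - {t}) \<in> pos_link F x"
      using that R(5) ST(5) assms(4) by (auto simp: forced_extensions_def extensions_def pos_link_def)
  qed auto
  moreover have "\<exists>T'\<subseteq>R \<union> T. (S, T') \<in> F" using assms(2) by (intro exI[of _ T]) simp
  ultimately show ?thesis by (simp add: excluded_def)
qed

lemma card_forced_extensions_ge:
  assumes "finite V" "F \<subseteq> signed_pairs k V" "(S, T) \<in> F" "S \<noteq> {}" "t \<in> T" "T - {t} \<notin> atypical k V b S F"
    and "0 < b" "2 / b \<le> real (card V)"
  shows "b / 2 * real (card V) ^ card S \<le> real (card (forced_extensions V (pos_clauses F) S T t))"
proof -
  let ?n = "real (card V)" and ?E = "extensions V (pos_clauses F) S (T - {t})"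
  note ST = signed_pairsD[OF subsetD[OF assms(2,3)]]
  obtain i where i: "card S = Suc i" using assms(4) ST(3) by (metis card_0_eq not0_implies_Suc)
  let ?D = "{R\<in>nsets V (Suc i). R \<inter> {t} \<noteq> {}}"
  have "T - {t} \<in> nsets (V - S) (k - 1 - card S)" using ST assms(5) by (auto simp: nsets_def)
  then have "b * ?n ^ card S \<le> real (card ?E)" using assms(6) by (simp add: atypical_def)
  moreover have "?E \<subseteq> forced_extensions V (pos_clauses F) S T t \<union> ?D"
    using i by (auto simp: forced_extensions_def extensions_def nsets_def)
  then have "card ?E \<le> card (forced_extensions V (pos_clauses F) S T t) + card ?D"
    using assms(1) by (intro card_le_card_add) auto
  then have "real (card ?E) \<le> real (card (forced_extensions V (pos_clauses F) S T t)) + real (card ?D)"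
    by (simp only: of_nat_add[symmetric] of_nat_le_iff)
  moreover have "real (card ?D) \<le> real (card {t}) * ?n ^ i"
    using ST(2) assms(1,5) by (intro card_nsets_meeting) auto
  moreover have "real (card {t}) * ?n ^ i \<le> b / 2 * ?n * ?n ^ i"
    using assms(7,8) by (intro mult_right_mono) (auto simp: field_simps)
  moreover have "b / 2 * ?n * ?n ^ i = b / 2 * ?n ^ card S" by (simp add: i)
  ultimately show ?thesis by linarith
qed

context sparse_setting
begin

lemma card_neg_clauses_fixed_profile_le:
  assumes "clique_bound V k e \<xi>" "H \<subseteq> residual k V s b \<xi>"
    and H: "\<And>F. F \<in> H \<Longrightarrow> typical_sets k V b F = Ts \<and> atypical_pairs k V b F = A"
  shows "real (card (neg_clauses ` H)) \<le> 2 powr (e * weight k V Ts A)"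
proof (cases "H = {}")
  case False
  then obtain F0 where F0: "F0 \<in> H" by auto
  then have res0: "F0 \<in> residual k V s b \<xi>" using assms(2) by blast
  have Ts: "Ts \<subseteq> proper_subsets k V" using typical_sets_subset[OF res0] H[OF F0] by simp
  have finTs: "finite Ts" by (rule finite_subset[OF Ts]) (simp add: finite_V)
  have H_sparse: "H \<subseteq> sparse_forms k V s" using assms(2) residual_subset by blast
  let ?over = "\<lambda>F. \<Union>p\<in>{{}} \<times> Ts. clauses_over F (fst p) (snd p)"
    and ?rest = "\<lambda>F. {p\<in>neg_clauses F. snd p \<notin> Ts}"
  have "neg_clauses F = ?over F \<union> ?rest F" if F: "F \<in> H" for F
  proof -
    have "S \<noteq> {}" if "(S, T) \<in> F" "T \<in> Ts" for S T
      using signed_pairsD(6)[of S T k V] that F H_sparse sparse_forms_subset Ts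
      by (fastforce simp: proper_subsets_def)
    then show ?thesis by (auto simp: clauses_over_def neg_clauses_def)
  qed
  then have "neg_clauses ` H = (\<lambda>F. ?over F \<union> ?rest F) ` H" by (rule image_cong[OF refl])
  then have "real (card (neg_clauses ` H)) \<le> real (card (?over ` H) * card (?rest ` H))"
    using card_image_Un_le[OF sparse_forms_finite[OF H_sparse], of ?over ?rest] by (simp only: of_nat_le_iff)
  also have "\<dots> \<le> 2 powr (e * (\<Sum>T\<in>Ts. n ^ (k - card T))) * 2 powr (e * (n * real (card A)))"
    unfolding of_nat_mult
  proof (rule mult_mono)
    have "real (card (?over ` H)) \<le> 2 powr (\<Sum>p\<in>{{} :: 'a set} \<times> Ts. e * n ^ (k - card (snd p) - card (fst p)))"
      by (rule card_clauses_over_families_le) (use finTs H_sparse Ts in \<open>auto simp: proper_subsets_def\<close>)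
    also have "(\<Sum>p\<in>{{} :: 'a set} \<times> Ts. e * n ^ (k - card (snd p) - card (fst p)))
        = e * (\<Sum>T\<in>Ts. n ^ (k - card T))"
      by (simp add: sum.cartesian_product' sum_distrib_left)
    finally show "real (card (?over ` H)) \<le> 2 powr (e * (\<Sum>T\<in>Ts. n ^ (k - card T)))" .
    have "?rest ` H \<subseteq> Pow (clique_pairs k V A)"
      using neg_clauses_outside_typical_sets assms(2) H by (intro image_subsetI) blast
    moreover have "real (card (clique_pairs k V A)) \<le> e * (n * real (card A))"
      using card_clique_pairs_le[OF finite_V res0 assms(1)] H[OF F0] by (simp add: mult.assoc)
    moreover have "finite (clique_pairs k V A)" using finite_V by (simp add: clique_pairs_def finite_cliques)
    ultimately show "real (card (?rest ` H)) \<le> 2 powr (e * (n * real (card A)))" by (intro real_card_le_Pow)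
  qed auto
  also have "\<dots> = 2 powr (e * weight k V Ts A)" by (simp add: weight_def powr_add distrib_left)
  finally show ?thesis .
qed simp

lemma pos_clauses_typical_choice:
  assumes "F \<in> residual k V s b \<xi>" "Ts \<subseteq> typical_sets k V b F" "Ts \<subseteq> nsets V (k - i)" "i \<in> {1..<k}"
    and "0 < b" "2 / b \<le> n"
  obtains f where "f \<in> Ts \<rightarrow>\<^sub>E nsets V i \<times> V" "\<forall>T\<in>Ts. fst (f T) \<inter> T = {} \<and> snd (f T) \<in> T"
    "\<forall>T\<in>Ts. b / 2 * n ^ i \<le> real (card (forced_extensions V (pos_clauses F) (fst (f T)) T (snd (f T)))) \<and>
      (\<forall>R\<in>forced_extensions V (pos_clauses F) (fst (f T)) T (snd (f T)). R \<union> T \<notin> pos_clauses F)"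
proof -
  have sparse: "F \<in> sparse_forms k V s" using assms(1) residual_subset by blast
  note F = sparse_forms_subset[OF sparse]
  have min: "F \<in> minimal_forms k V" using sparse sparse_forms_minimal_forms by blast
  have "\<exists>p. (fst p, T) \<in> F \<and> fst p \<noteq> {} \<and> snd p \<in> T \<and> T - {snd p} \<notin> atypical k V b (fst p) F"
    if "T \<in> Ts" for T
    using that assms(2) by (auto simp: typical_sets_def subset_iff)
  then obtain f where f: "\<And>T. T \<in> Ts \<Longrightarrow> (fst (f T), T) \<in> F \<and> fst (f T) \<noteq> {} \<and> snd (f T) \<in> T \<and>
      T - {snd (f T)} \<notin> atypical k V b (fst (f T)) F" by metis
  have clause: "fst (f T) \<in> nsets V i" "fst (f T) \<inter> T = {}" "snd (f T) \<in> V" if T: "T \<in> Ts" for T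
  proof -
    have "card T = k - i" "T \<subseteq> V" using T assms(3) by (auto simp: nsets_def)
    then show "fst (f T) \<in> nsets V i" "fst (f T) \<inter> T = {}" "snd (f T) \<in> V"
      using f[OF T] signed_pairsD[OF subsetD[OF F], of "fst (f T)" T] assms(4) by (auto simp: nsets_def)
  qed
  show ?thesis
  proof (rule that[of "restrict f Ts"])
    show "restrict f Ts \<in> Ts \<rightarrow>\<^sub>E nsets V i \<times> V" using clause by (auto simp: mem_Times_iff)
    show "\<forall>T\<in>Ts. fst (restrict f Ts T) \<inter> T = {} \<and> snd (restrict f Ts T) \<in> T" using clause f by auto
    have "b / 2 * n ^ i \<le> real (card (forced_extensions V (pos_clauses F) (fst (f T)) T (snd (f T))))"
      if T: "T \<in> Ts" for T
      using card_forced_extensions_ge[OF finite_V F, of "fst (f T)" T "snd (f T)" b] f[OF T]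
          clause[OF T] assms(5,6)
      by (simp add: nsets_def)
    moreover have "R \<union> T \<notin> pos_clauses F"
      if "T \<in> Ts" "R \<in> forced_extensions V (pos_clauses F) (fst (f T)) T (snd (f T))" for T R
      using excluded_not_pos_clause[OF min _ forced_extension_excluded[OF F _ _ that(2)]] f[OF that(1)]
      by blast
    ultimately show "\<forall>T\<in>Ts. b / 2 * n ^ i
        \<le> real (card (forced_extensions V (pos_clauses F) (fst (restrict f Ts T)) T (snd (restrict f Ts T)))) \<and>
      (\<forall>R\<in>forced_extensions V (pos_clauses F) (fst (restrict f Ts T)) T (snd (restrict f Ts T)).
          R \<union> T \<notin> pos_clauses F)"
      by simp
  qed
qed

lemma card_choices_le:
  assumes "finite Ts" "i \<in> {1..<k}" "real k * log 2 n \<le> e * n"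
  shows "real (card (Ts \<rightarrow>\<^sub>E nsets V i \<times> V)) \<le> 2 powr (e * (n ^ i * real (card Ts)))"
proof -
  have "real (card (Ts \<rightarrow>\<^sub>E nsets V i \<times> V)) = (real (card V choose i) * n) ^ card Ts"
    using assms(1) by (simp add: card_PiE card_cartesian_product)
  also have "\<dots> \<le> (n ^ k) ^ card Ts"
  proof (rule power_mono)
    have "real (card V choose i) * n \<le> n ^ i * n" by (intro mult_right_mono real_choose_le_power) auto
    also have "\<dots> = n ^ Suc i" by simp
    also have "\<dots> \<le> n ^ k" using assms(2) one_le_n by (intro power_increasing) auto
    finally show "real (card V choose i) * n \<le> n ^ k" .
  qed simp
  also have "\<dots> = 2 powr (real k * log 2 n * real (card Ts))"
    by (simp add: power_eq_powr_log[OF one_le_card_V] powr_power mult.commute mult.left_commute)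
  also have "\<dots> \<le> 2 powr (e * (n ^ i * real (card Ts)))"
  proof (rule powr_mono)
    have "real k * log 2 n \<le> e * n ^ i"
      using assms(2,3) e_pos one_le_n by (elim order_trans) (intro mult_left_mono self_le_power, auto)
    then have "real k * log 2 n * real (card Ts) \<le> e * n ^ i * real (card Ts)" by (intro mult_right_mono) auto
    then show "real k * log 2 n * real (card Ts) \<le> e * (n ^ i * real (card Ts))" by (simp add: mult.assoc)
  qed simp
  finally show ?thesis .
qed

lemma card_pos_clauses_typical_le:
  assumes "H \<subseteq> residual k V s b \<xi>" "\<And>F. F \<in> H \<Longrightarrow> Ts \<subseteq> typical_sets k V b F"
    and "Ts \<subseteq> nsets V (k - i)" "i \<in> {1..<k}"
    and "0 < b" "2 / b \<le> n" "real k * log 2 n \<le> e * n"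
  shows "real (card (pos_clauses ` H)) \<le> 2 powr (e * (n ^ i * real (card Ts))) *
    (real k * 2 powr (real (card V choose k) - b / 2 / (real k * 4 ^ k) * (n ^ i * real (card Ts))))"
proof -
  have finTs: "finite Ts" by (rule finite_subset[OF assms(3)]) (simp add: finite_V)
  define choices where "choices = {f\<in>Ts \<rightarrow>\<^sub>E nsets V i \<times> V. \<forall>T\<in>Ts. fst (f T) \<inter> T = {} \<and> snd (f T) \<in> T}"
  define G where "G f T P = forced_extensions V P (fst (f T)) T (snd (f T))" for f :: "'a set \<Rightarrow> 'a set \<times> 'a"
    and T P
  let ?Z = "\<lambda>f. {P. P \<subseteq> nsets V k \<and> (\<forall>T\<in>Ts. b / 2 * n ^ i \<le> real (card (G f T P)) \<and> (\<forall>R\<in>G f T P. R \<union> T \<notin> P))}"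
  have "finite (Ts \<rightarrow>\<^sub>E nsets V i \<times> V)" using finTs finite_V by (intro finite_PiE) auto
  then have fin: "finite choices" "real (card choices) \<le> real (card (Ts \<rightarrow>\<^sub>E nsets V i \<times> V))"
    unfolding choices_def by (auto intro!: card_mono)
  have "pos_clauses ` H \<subseteq> (\<Union>f\<in>choices. ?Z f)"
  proof (rule image_subsetI)
    fix F assume F: "F \<in> H"
    then have res: "F \<in> residual k V s b \<xi>" using assms(1) by blast
    then have "pos_clauses F \<subseteq> nsets V k" by (rule residual_pos_clauses_subset)
    moreover obtain f where "f \<in> Ts \<rightarrow>\<^sub>E nsets V i \<times> V" "\<forall>T\<in>Ts. fst (f T) \<inter> T = {} \<and> snd (f T) \<in> T"
      and "\<forall>T\<in>Ts. b / 2 * n ^ i \<le> real (card (G f T (pos_clauses F))) \<and>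
          (\<forall>R\<in>G f T (pos_clauses F). R \<union> T \<notin> pos_clauses F)"
      using pos_clauses_typical_choice[OF res assms(2)[OF F] assms(3-6)] unfolding G_def by metis
    ultimately show "pos_clauses F \<in> (\<Union>f\<in>choices. ?Z f)"
      by (intro UN_I[of f]) (simp_all add: choices_def)
  qed
  then have "real (card (pos_clauses ` H)) \<le> real (card (\<Union>f\<in>choices. ?Z f))"
    using fin(1) finite_V by (intro real_card_mono) auto
  also have "\<dots> \<le> 2 powr (e * (n ^ i * real (card Ts))) *
      (real k * 2 powr (real (card V choose k) - b / 2 / (real k * 4 ^ k) * (n ^ i * real (card Ts))))"
  proof (rule real_card_UN_le_mult[OF fin(1)])
    show "real (card choices) \<le> 2 powr (e * (n ^ i * real (card Ts)))"
      using fin(2) card_choices_le[OF finTs assms(4,7)] by linarith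
    fix f assume f: "f \<in> choices"
    show "real (card (?Z f)) \<le> real k * 2 powr (real (card V choose k)
        - b / 2 / (real k * 4 ^ k) * (n ^ i * real (card Ts)))"
    proof (rule card_avoiding_forced_extensions_le)
      show "fst (f T) \<in> nsets V i \<and> fst (f T) \<inter> T = {} \<and> snd (f T) \<in> T" if "T \<in> Ts" for T
        using f that by (auto simp: choices_def PiE_iff mem_Times_iff)
    qed (use assms(3-5) finite_V in \<open>auto simp: G_def\<close>)
  qed auto
  finally show ?thesis .
qed

lemma card_pos_clauses_atypical_le:
  assumes "H \<subseteq> residual k V s b \<xi>" "\<And>F. F \<in> H \<Longrightarrow> A \<subseteq> atypical_pairs k V b F"
    and "\<And>p. p \<in> A \<Longrightarrow> p \<in> link_pairs k V i" "i \<in> {1..<k}"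
    and "real k * 2 ^ (k + 1) \<le> n" "0 \<le> b" "b \<le> tuple_gain i * extension_rate k"
  shows "real (card (pos_clauses ` H)) \<le> 2 powr (real (card V choose k)
      - b / (2 ^ (k + 1) * real k ^ 2) * (n * real (card A)))"
proof -
  let ?Z = "{P. P \<subseteq> nsets V k \<and> (\<forall>p\<in>A. real (card (extensions V P (fst p) (snd p))) < b * n ^ i)}"
  have "pos_clauses ` H \<subseteq> ?Z"
  proof (rule image_subsetI, intro CollectI conjI ballI)
    fix F assume F: "F \<in> H"
    then show "pos_clauses F \<subseteq> nsets V k" using assms(1) by (intro residual_pos_clauses_subset) auto
    fix p assume p: "p \<in> A"
    then have "snd p \<in> atypical k V b (fst p) F" using assms(2)[OF F] by (auto simp: atypical_pairs_def)
    moreover have "card (fst p) = i" using link_pairsD(3)[OF assms(3)[OF p]] .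
    ultimately show "real (card (extensions V (pos_clauses F) (fst p) (snd p))) < b * n ^ i"
      by (simp add: atypical_def)
  qed
  then have "real (card (pos_clauses ` H)) \<le> real (card ?Z)" using finite_V by (intro real_card_mono) auto
  also have "\<dots> \<le> 2 powr (real (card V choose k) - b / (2 ^ (k + 1) * real k ^ 2) * (n * real (card A)))"
    using assms(3-7) finite_V by (intro card_few_extensions_le[where i = i]) auto
  finally show ?thesis .
qed

end

definition profile :: "nat \<Rightarrow> 'a set \<Rightarrow> real \<Rightarrow> 'a form \<Rightarrow> 'a set set \<times> ('a set \<times> 'a set) set" where
  "profile k V b F = (typical_sets k V b F, atypical_pairs k V b F)"

definition saving_rate :: "nat \<Rightarrow> real \<Rightarrow> real" where
  "saving_rate k b = b / (2 * real k ^ 2 * 4 ^ k)"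

lemma saving_rate_le:
  assumes "1 \<le> k" "0 \<le> b"
  shows "saving_rate k b \<le> b / 2 / (real k * 4 ^ k)" "saving_rate k b \<le> b / (2 ^ (k + 1) * real k ^ 2)"
proof -
  have k: "real k \<le> real k ^ 2" "real k > 0" using assms(1) by (auto simp: self_le_power)
  have "(2::real) ^ k \<le> 4 ^ k" by (intro power_mono) auto
  then show "saving_rate k b \<le> b / (2 ^ (k + 1) * real k ^ 2)" "saving_rate k b \<le> b / 2 / (real k * 4 ^ k)"
    using k assms(2) unfolding saving_rate_def
    by (auto intro!: divide_left_mono simp: mult.commute mult_left_mono)
qed

context sparse_setting
begin

lemma saving_rate_times_weight_le:
  assumes "w \<le> 2 * real k * y" "saving_rate k b \<le> c" "0 \<le> b" "0 \<le> y"
  shows "saving_rate k b / (2 * real k) * w \<le> c * y"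
proof -
  have "0 \<le> saving_rate k b" using assms(3) by (simp add: saving_rate_def)
  then have "saving_rate k b / (2 * real k) * w \<le> saving_rate k b / (2 * real k) * (2 * real k * y)"
    using assms(1) by (intro mult_left_mono) auto
  also have "\<dots> = saving_rate k b * y" using k_ge_2 by simp
  also have "\<dots> \<le> c * y" using assms(2,4) by (rule mult_right_mono)
  finally show ?thesis .
qed

lemma card_pos_clauses_heavy_typical_le:
  assumes "H \<subseteq> residual k V s b \<xi>" "\<And>F. F \<in> H \<Longrightarrow> typical_sets k V b F = Ts"
    and "Ts \<subseteq> proper_subsets k V" "i \<in> {1..<k}"
    and "0 < b" "2 / b \<le> n" "real k * log 2 n \<le> e * n"
    and heavy: "weight k V Ts A \<le> 2 * real k * (n ^ i * real (card {T\<in>Ts. card T = k - i}))"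
  shows "real (card (pos_clauses ` H))
    \<le> real k * 2 powr (real (card V choose k) - (saving_rate k b / (2 * real k) - e) * weight k V Ts A)"
proof -
  let ?N = "real (card V choose k)" and ?c = "b / 2 / (real k * 4 ^ k)" and ?w = "weight k V Ts A"
  let ?T = "{T\<in>Ts. card T = k - i}"
  let ?y = "n ^ i * real (card ?T)"
  have "?y = (\<Sum>T\<in>?T. n ^ (k - card T))" using assms(4) by simp
  also have "\<dots> \<le> (\<Sum>T\<in>Ts. n ^ (k - card T))"
    using finite_subset[OF assms(3)] finite_V by (intro sum_mono2) auto
  also have "\<dots> \<le> ?w" by (simp add: weight_def)
  finally have "e * ?y \<le> e * ?w" using e_pos by (intro mult_left_mono) auto
  moreover have "saving_rate k b / (2 * real k) * ?w \<le> ?c * ?y"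
    using assms(5) k_ge_2 by (intro saving_rate_times_weight_le[OF heavy saving_rate_le(1)]) auto
  ultimately have exponent: "e * ?y + (?N - ?c * ?y) \<le> ?N - (saving_rate k b / (2 * real k) - e) * ?w"
    by (simp add: left_diff_distrib)
  have "real (card (pos_clauses ` H)) \<le> 2 powr (e * ?y) * (real k * 2 powr (?N - ?c * ?y))"
  proof (rule card_pos_clauses_typical_le[OF assms(1) _ _ assms(4-7)])
    show "?T \<subseteq> typical_sets k V b F" if "F \<in> H" for F using assms(2)[OF that] by auto
    have "T \<in> nsets V (k - i)" if "T \<in> ?T" for T
      using that proper_subsetsD(1,2)[OF _ finite_V, of T] assms(3) by (auto simp: nsets_def)
    then show "?T \<subseteq> nsets V (k - i)" by blast
  qed
  also have "\<dots> = real k * 2 powr (e * ?y + (?N - ?c * ?y))" by (simp add: powr_add)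
  also have "\<dots> \<le> real k * 2 powr (?N - (saving_rate k b / (2 * real k) - e) * ?w)"
    using exponent by (intro mult_left_mono powr_mono) auto
  finally show ?thesis .
qed

lemma card_pos_clauses_heavy_atypical_le:
  assumes "H \<subseteq> residual k V s b \<xi>" "\<And>F. F \<in> H \<Longrightarrow> atypical_pairs k V b F = A" "H \<noteq> {}" "i \<in> {1..<k}"
    and "0 < b" "real k * 2 ^ (k + 1) \<le> n" "b \<le> tuple_gain i * extension_rate k"
    and heavy: "weight k V Ts A \<le> 2 * real k * (n * real (card {p\<in>A. card (fst p) = i}))"
  shows "real (card (pos_clauses ` H))
    \<le> real k * 2 powr (real (card V choose k) - (saving_rate k b / (2 * real k) - e) * weight k V Ts A)"
proof -
  let ?N = "real (card V choose k)" and ?c = "b / (2 ^ (k + 1) * real k ^ 2)" and ?w = "weight k V Ts A"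
  let ?A = "{p\<in>A. card (fst p) = i}"
  let ?y = "n * real (card ?A)"
  obtain F0 where "F0 \<in> H" using assms(3) by blast
  then have A: "A = atypical_pairs k V b F0" using assms(2) by simp
  have "saving_rate k b / (2 * real k) * ?w \<le> ?c * ?y"
    using assms(5) k_ge_2 by (intro saving_rate_times_weight_le[OF heavy saving_rate_le(2)]) auto
  moreover have "0 \<le> e * ?w"
    using e_pos unfolding weight_def by (intro mult_nonneg_nonneg add_nonneg_nonneg sum_nonneg) auto
  ultimately have exponent: "?N - ?c * ?y \<le> ?N - (saving_rate k b / (2 * real k) - e) * ?w"
    by (simp add: left_diff_distrib)
  have "real (card (pos_clauses ` H)) \<le> 2 powr (?N - ?c * ?y)"
  proof (rule card_pos_clauses_atypical_le[OF assms(1) _ _ assms(4,6) _ assms(7)])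
    show "?A \<subseteq> atypical_pairs k V b F" if "F \<in> H" for F using assms(2)[OF that] by auto
    show "p \<in> link_pairs k V i" if "p \<in> ?A" for p
      using that finite_subset[OF _ finite_V, of "fst p"]
      by (auto simp: A atypical_pairs_def link_pairs_def nsets_def atypical_def proper_subsets_def)
  qed (use assms(5) in simp)
  also have "\<dots> \<le> 1 * 2 powr (?N - (saving_rate k b / (2 * real k) - e) * ?w)" using exponent by simp
  also have "\<dots> \<le> real k * 2 powr (?N - (saving_rate k b / (2 * real k) - e) * ?w)"
    using k_ge_2 by (intro mult_right_mono) auto
  finally show ?thesis .
qed

lemma card_pos_clauses_fixed_profile_le:
  assumes "0 < b" "\<And>i. i \<in> {1..<k} \<Longrightarrow> b \<le> tuple_gain i * extension_rate k"
    and n_large: "real k * 2 ^ (k + 1) \<le> n" "2 / b \<le> n" "real k * log 2 n \<le> e * n"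
    and H: "H \<subseteq> residual k V s b \<xi>" "\<And>F. F \<in> H \<Longrightarrow> profile k V b F = (Ts, A)" "H \<noteq> {}"
  shows "real (card (pos_clauses ` H))
    \<le> real k * 2 powr (real (card V choose k) - (saving_rate k b / (2 * real k) - e) * weight k V Ts A)"
proof -
  have profile: "typical_sets k V b F = Ts" "atypical_pairs k V b F = A" if "F \<in> H" for F
    using H(2)[OF that] by (auto simp: profile_def)
  obtain F0 where F0: "F0 \<in> H" using H(3) by blast
  have Ts: "Ts \<subseteq> proper_subsets k V"
    using typical_sets_subset[OF subsetD[OF H(1) F0]] profile(1)[OF F0] by simp
  have A: "A = atypical_pairs k V b F0" using profile(2)[OF F0] by simp
  have "finite Ts" "finite A" using finite_subset[OF Ts] A finite_V by auto
  moreover have "card T \<in> {1..<k}" if "T \<in> Ts" for T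
    using proper_subsetsD(3)[OF subsetD[OF Ts that] finite_V] .
  moreover have "card (fst p) \<in> {1..<k}" if "p \<in> A" for p
    using that proper_subsetsD(3)[OF _ finite_V, of "fst p"] by (auto simp: A atypical_pairs_def)
  ultimately obtain i where i: "i \<in> {1..<k}"
    and heavy: "weight k V Ts A \<le> 2 * real k * (n ^ i * real (card {T\<in>Ts. card T = k - i})) \<or>
      weight k V Ts A \<le> 2 * real k * (n * real (card {p\<in>A. card (fst p) = i}))"
    using exists_heavy_part[OF _ _ _ _ k_ge_2] by blast
  from heavy show ?thesis
  proof
    assume "weight k V Ts A \<le> 2 * real k * (n ^ i * real (card {T\<in>Ts. card T = k - i}))"
    with profile(1) show ?thesis
      by (rule card_pos_clauses_heavy_typical_le[OF H(1) _ Ts i assms(1) n_large(2,3)])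
  next
    assume "weight k V Ts A \<le> 2 * real k * (n * real (card {p\<in>A. card (fst p) = i}))"
    with profile(2) show ?thesis
      by (rule card_pos_clauses_heavy_atypical_le[OF H(1) _ H(3) i assms(1) n_large(1) assms(2)[OF i]])
  qed
qed

lemma card_fixed_profile_le:
  assumes "0 < b" "\<And>i. i \<in> {1..<k} \<Longrightarrow> b \<le> tuple_gain i * extension_rate k" "clique_bound V k e \<xi>"
    and n_large: "real k * 2 ^ (k + 1) \<le> n" "2 / b \<le> n" "real k * log 2 n \<le> e * n"
  shows "real (card {F\<in>residual k V s b \<xi>. profile k V b F = (Ts, A)})
    \<le> real k * 2 powr (real (card V choose k) - (saving_rate k b / (2 * real k) - 2 * e) * weight k V Ts A)"
    (is "real (card ?H) \<le> _")
proof (cases "?H = {}")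
  case True
  show ?thesis unfolding True by simp
next
  case False
  let ?N = "real (card V choose k)" and ?c = "saving_rate k b / (2 * real k)" and ?w = "weight k V Ts A"
  let ?p = "real k * 2 powr (?N - (?c - e) * ?w)"
  have H: "?H \<subseteq> residual k V s b \<xi>" by auto
  have fin: "finite ?H" by (rule sparse_forms_finite) (use H residual_subset in blast)
  have "real (card ?H) \<le> real (card (neg_clauses ` ?H)) * ?p"
  proof (rule card_fibres_le[OF fin inj_neg_clauses_pos_clauses])
    fix N
    have "real (card (pos_clauses ` {F\<in>?H. neg_clauses F = N})) \<le> real (card (pos_clauses ` ?H))"
      using fin by (intro real_card_mono) auto
    also have "\<dots> \<le> ?p"
      using assms(1,2) n_large H False by (intro card_pos_clauses_fixed_profile_le) auto
    finally show "real (card (pos_clauses ` {F\<in>?H. neg_clauses F = N})) \<le> ?p" .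
  qed
  also have "\<dots> \<le> 2 powr (e * ?w) * ?p"
    using card_neg_clauses_fixed_profile_le[OF assms(3) H, of Ts A]
    by (intro mult_right_mono) (auto simp: profile_def)
  also have "\<dots> = real k * 2 powr (e * ?w + (?N - (?c - e) * ?w))" by (simp add: powr_add)
  also have "e * ?w + (?N - (?c - e) * ?w) = ?N - (?c - 2 * e) * ?w" by (simp add: algebra_simps)
  finally show ?thesis .
qed

lemma card_fixed_profile_le_power:
  assumes "0 < b" "\<And>i. i \<in> {1..<k} \<Longrightarrow> b \<le> tuple_gain i * extension_rate k" "clique_bound V k e \<xi>"
    and n_large: "real k * 2 ^ (k + 1) \<le> n" "2 / b \<le> n" "real k * log 2 n \<le> e * n"
    and d: "0 \<le> d" "d = saving_rate k b / (2 * real k) - 2 * e"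
  shows "real (card {F\<in>residual k V s b \<xi>. profile k V b F = (Ts, A)})
    \<le> real k * 2 powr (real (card V choose k) - d / 2 * n)
      * ((2 powr (- d / 2 * n)) ^ card Ts * (2 powr (- d / 2 * n)) ^ card A)"
proof (cases "{F\<in>residual k V s b \<xi>. profile k V b F = (Ts, A)} = {}")
  case True
  show ?thesis unfolding True by simp
next
  case False
  let ?N = "real (card V choose k)" and ?w = "weight k V Ts A"
  obtain F where F: "F \<in> residual k V s b \<xi>" "profile k V b F = (Ts, A)" using False by blast
  have "real (card Ts) * n = (\<Sum>T\<in>Ts. n)" by simp
  also have "\<dots> \<le> (\<Sum>T\<in>Ts. n ^ (k - card T))"
    using F typical_sets_subset one_le_n proper_subsetsD(3)[OF _ finite_V]
    by (intro sum_mono self_le_power) (fastforce simp: profile_def)+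
  finally have "n * (real (card Ts) + real (card A)) \<le> ?w" by (simp add: weight_def distrib_left mult.commute)
  moreover have "n \<le> ?w" using weight_ge[OF finite_V one_le_card_V F(1)] F(2) by (simp add: profile_def)
  ultimately have "d / 2 * (n + n * (real (card Ts) + real (card A))) \<le> d / 2 * (2 * ?w)"
    using d(1) by (intro mult_left_mono) auto
  then have "2 powr (?N - d * ?w) \<le> 2 powr (?N - d / 2 * n
      + (real (card Ts) * (- d / 2 * n) + real (card A) * (- d / 2 * n)))"
    by (intro powr_mono) (auto simp: algebra_simps)
  also have "\<dots> = 2 powr (?N - d / 2 * n)
      * ((2 powr (- d / 2 * n)) ^ card Ts * (2 powr (- d / 2 * n)) ^ card A)"
    by (simp only: powr_add powr_power)
  finally have "real k * 2 powr (?N - d * ?w)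
      \<le> real k * (2 powr (?N - d / 2 * n)
        * ((2 powr (- d / 2 * n)) ^ card Ts * (2 powr (- d / 2 * n)) ^ card A))"
    by (intro mult_left_mono) auto
  then show ?thesis using card_fixed_profile_le[OF assms(1-3) n_large, of Ts A] d(2) by (simp add: mult.assoc)
qed

lemma card_residual_le:
  assumes "0 < b" "\<And>i. i \<in> {1..<k} \<Longrightarrow> b \<le> tuple_gain i * extension_rate k" "clique_bound V k e \<xi>"
    and n_large: "real k * 2 ^ (k + 1) \<le> n" "2 / b \<le> n" "real k * log 2 n \<le> e * n"
    and d: "0 \<le> d" "d = saving_rate k b / (2 * real k) - 2 * e" "(n + 1) ^ (2 * k) * 2 powr (- d / 2 * n) \<le> 1"
  shows "real (card (residual k V s b \<xi>)) \<le> 9 * real k * 2 powr (real (card V choose k) - d / 2 * n)"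
proof -
  let ?x = "2 powr (- d / 2 * n)" and ?b = "real k * 2 powr (real (card V choose k) - d / 2 * n)"
  let ?small = "{S. S \<subseteq> V \<and> card S \<le> k}"
  let ?profiles = "Pow (proper_subsets k V) \<times> Pow (?small \<times> ?small)"
  have small: "real (card ?small) \<le> (n + 1) ^ k"
  proof -
    have "real (card ?small) \<le> real ((card V + 1) ^ k)"
      using card_subsets_of_card_le[OF finite_V] by (simp only: of_nat_le_iff)
    then show ?thesis by (simp add: add.commute)
  qed
  have fin: "finite ?small" using finite_V by simp
  have in_profiles: "profile k V b ` residual k V s b \<xi> \<subseteq> ?profiles"
  proof (rule image_subsetI)
    fix F assume F: "F \<in> residual k V s b \<xi>"
    have "atypical_pairs k V b F \<subseteq> ?small \<times> ?small"
      by (auto simp: atypical_pairs_def proper_subsets_def atypical_def nsets_def)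
    then show "profile k V b F \<in> ?profiles" using typical_sets_subset[OF F] by (simp add: profile_def)
  qed
  have x: "(1 + ?x) ^ m \<le> 3" if "real m \<le> (n + 1) ^ (2 * k)" for m
  proof (rule power_one_plus_le_3)
    have "real m * ?x \<le> (n + 1) ^ (2 * k) * ?x" using that by (intro mult_right_mono) auto
    then show "real m * ?x \<le> 1" using d(3) by linarith
  qed simp
  have "real (card (residual k V s b \<xi>))
      = (\<Sum>p\<in>?profiles. real (card {F\<in>residual k V s b \<xi>. profile k V b F = p}))"
    using card_eq_sum_fibres[OF sparse_forms_finite[OF residual_subset] _ in_profiles] finite_V by simp
  also have "\<dots> \<le> (\<Sum>(Ts, A)\<in>?profiles. ?b * (?x ^ card Ts * ?x ^ card A))"
    by (intro sum_mono) (simp only: split_paired_all case_prod_conv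
      card_fixed_profile_le_power[OF assms(1-8)])
  also have "\<dots> = ?b * ((\<Sum>Ts\<in>Pow (proper_subsets k V). ?x ^ card Ts) * (\<Sum>A\<in>Pow (?small \<times> ?small). ?x ^ card A))"
    unfolding sum_product sum.cartesian_product unfolding sum_distrib_left case_prod_unfold ..
  also have "\<dots> = ?b * ((1 + ?x) ^ card (proper_subsets k V) * (1 + ?x) ^ card (?small \<times> ?small))"
    using finite_V by (simp add: sum_power_card_Pow)
  also have "\<dots> \<le> ?b * (3 * 3)"
  proof (intro mult_left_mono mult_mono x)
    have "real (card (proper_subsets k V)) \<le> real (card ?small)"
      using fin by (intro real_card_mono) (auto simp: proper_subsets_def)
    also have "\<dots> \<le> (n + 1) ^ k" by (rule small)
    also have "\<dots> \<le> (n + 1) ^ (2 * k)" by (intro power_increasing) auto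
    finally show "real (card (proper_subsets k V)) \<le> (n + 1) ^ (2 * k)" .
    have "real (card (?small \<times> ?small)) \<le> (n + 1) ^ k * (n + 1) ^ k"
      unfolding card_cartesian_product of_nat_mult using small by (intro mult_mono) auto
    then show "real (card (?small \<times> ?small)) \<le> (n + 1) ^ (2 * k)" by (simp add: power_add[symmetric] mult_2)
  qed auto
  finally show ?thesis by simp
qed

end

lemma exists_residual_bound:
  assumes "2 \<le> k" "0 < b" "\<And>i. i \<in> {1..<k} \<Longrightarrow> b \<le> tuple_gain i * extension_rate k"
  shows "\<exists>\<xi>>0. \<exists>\<eta>>0. \<forall>\<^sub>F V :: 'a set in large_sets. \<forall>s. sparse_setting k V s \<eta> \<longrightarrow>
    real (card (residual k V s b \<xi>)) \<le> 2 powr (real (card V choose k) - \<eta> * real (card V))"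
proof -
  define \<eta> where "\<eta> = saving_rate k b / (16 * real k)"
  have \<eta>: "\<eta> > 0" using assms(1,2) by (simp add: \<eta>_def saving_rate_def)
  have d: "4 * \<eta> = saving_rate k b / (2 * real k) - 2 * (2 * \<eta>)"
    using assms(1) by (simp add: \<eta>_def field_simps)
  obtain \<xi> where \<xi>: "\<xi> > 0" "\<And>V::'a set. finite V \<Longrightarrow> clique_bound V k (2 * \<eta>) \<xi>"
    using exists_clique_bound[of "2 * \<eta>" k, where ?'a = 'a] \<eta> by auto
  have "\<forall>\<^sub>F n in sequentially. (real n + 1) ^ (2 * k) * 2 powr (- (4 * \<eta>) / 2 * real n) \<le> 1"
    "\<forall>\<^sub>F n in sequentially. 9 * real k \<le> 2 powr (\<eta> * real n)"
    "\<forall>\<^sub>F n in sequentially. real k * log 2 (real n) \<le> 2 * \<eta> * real n"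
    "\<forall>\<^sub>F n in sequentially. real k * 2 ^ (k + 1) \<le> real n" "\<forall>\<^sub>F n in sequentially. 2 / b \<le> real n"
    using \<eta> by real_asymp+
  note large = this[THEN eventually_large_sets_card]
  have "\<forall>\<^sub>F V :: 'a set in large_sets. \<forall>s. sparse_setting k V s \<eta> \<longrightarrow>
    real (card (residual k V s b \<xi>)) \<le> 2 powr (real (card V choose k) - \<eta> * real (card V))"
    using large
  proof eventually_elim
    case (elim V)
    show ?case
    proof (intro allI impI)
      fix s assume "sparse_setting k V s \<eta>"
      then have "sparse_setting k V s (2 * \<eta>)" by (rule sparse_setting_mono) (use \<eta> in simp)
      then interpret sparse_setting k V s "2 * \<eta>" .
      have "real (card (residual k V s b \<xi>)) \<le> 9 * real k * 2 powr (real (card V choose k) - 4 * \<eta> / 2 * n)"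
        using assms(2,3) \<eta> d elim \<xi>(2)[OF finite_V] by (intro card_residual_le) auto
      also have "\<dots> \<le> 2 powr (\<eta> * n) * 2 powr (real (card V choose k) - 4 * \<eta> / 2 * n)"
        using elim(2) by (intro mult_right_mono) auto
      also have "\<dots> = 2 powr (real (card V choose k) - \<eta> * n)" by (simp flip: powr_add)
      finally show "real (card (residual k V s b \<xi>)) \<le> 2 powr (real (card V choose k) - \<eta> * n)" .
    qed
  qed
  then show ?thesis using \<xi>(1) \<eta> by blast
qed

section \<open>The case distinction\<close>

definition large_link_forms :: "nat \<Rightarrow> 'a set \<Rightarrow> real \<Rightarrow> real \<Rightarrow> real \<Rightarrow> real \<Rightarrow> 'a form set" where
  "large_link_forms k V s d t \<gamma> = {F\<in>dense_forms k V s d. \<exists>x\<in>V.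
     t * real (card V) ^ (k - 1) \<le> real (card (neg_link F x)) \<and>
     real (card (excluded k V {x} F)) \<le> \<gamma> * real (card V) ^ k}"

definition atypical_forms :: "nat \<Rightarrow> 'a set \<Rightarrow> real \<Rightarrow> real \<Rightarrow> real \<Rightarrow> real \<Rightarrow> real \<Rightarrow> nat \<Rightarrow> 'a form set" where
  "atypical_forms k V s d t b \<xi> i = {F\<in>thin_neg_forms k V s d t. \<exists>S\<in>nsets V i.
     \<xi> * real (card V) ^ (k - 1 - i) < real (card (atypical k V b S F))}"

definition negative_clause_forms :: "nat \<Rightarrow> 'a set \<Rightarrow> real \<Rightarrow> real \<Rightarrow> real \<Rightarrow> real \<Rightarrow> 'a form set" where
  "negative_clause_forms k V s d t \<gamma> = {F\<in>thin_neg_forms k V s d t. \<exists>S\<in>nsets V k.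
     (S, {}) \<in> F \<and> real (card (excluded k V S F)) \<le> \<gamma> * real (card V) ^ k}"

lemma not_residual_cases:
  assumes "F \<in> sparse_forms k V s" "F \<notin> residual k V s b \<xi>"
  obtains (monotone) "neg_clauses F = {}"
  | (negative_clause) S where "S \<in> nsets V k" "(S, {}) \<in> F"
  | (many_atypical) S where "S \<in> proper_subsets k V"
      "\<xi> * real (card V) ^ (k - 1 - card S) < real (card (atypical k V b S F))"
proof -
  have "S \<in> nsets V k" if "(S, {}) \<in> F" for S
    using signed_pairsD[OF subsetD[OF sparse_forms_subset[OF assms(1)] that]] by (simp add: nsets_def)
  moreover have "neg_clauses F = {} \<or> (\<exists>S. (S, {}) \<in> F) \<or>
      (\<exists>S\<in>proper_subsets k V. \<xi> * real (card V) ^ (k - 1 - card S) < real (card (atypical k V b S F)))"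
    using assms by (simp add: residual_def not_le)
  ultimately show ?thesis using that by metis
qed

lemma excluded_small:
  assumes "F \<in> sparse_forms k V s" "F \<notin> excluding_forms k V s \<gamma>" "S \<subseteq> V" "S \<noteq> {}" "card S \<le> k"
  shows "real (card (excluded k V S F)) \<le> \<gamma> * real (card V) ^ k"
proof (rule ccontr)
  assume "\<not> ?thesis"
  then have "\<gamma> * real (card V) ^ k \<le> real (card (excluded k V S F))" by simp
  then have "F \<in> excluding_forms k V s \<gamma>"
    unfolding excluding_forms_def using assms(1,3-5) by (intro CollectI conjI exI[of _ S])
  then show False using assms(2) by contradiction
qed

lemma dense_forms_cover:
  assumes "finite V" "1 \<le> k"
  shows "dense_forms k V s d \<subseteq> {F\<in>sparse_forms k V s. neg_clauses F = {}} \<union> excluding_forms k V s \<gamma>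
    \<union> residual k V s b \<xi> \<union> large_link_forms k V s d t \<gamma>
    \<union> (\<Union>i\<in>{1..<k}. atypical_forms k V s d t b \<xi> i) \<union> negative_clause_forms k V s d t \<gamma>"
proof (rule subsetI, rule ccontr)
  fix F assume F: "F \<in> dense_forms k V s d"
    and "F \<notin> {F\<in>sparse_forms k V s. neg_clauses F = {}} \<union> excluding_forms k V s \<gamma>
      \<union> residual k V s b \<xi> \<union> large_link_forms k V s d t \<gamma>
      \<union> (\<Union>i\<in>{1..<k}. atypical_forms k V s d t b \<xi> i) \<union> negative_clause_forms k V s d t \<gamma>"
  then have sparse: "F \<in> sparse_forms k V s" and F_not: "neg_clauses F \<noteq> {}" "F \<notin> excluding_forms k V s \<gamma>"
    "F \<notin> residual k V s b \<xi>" "F \<notin> large_link_forms k V s d t \<gamma>"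
    "\<And>i. i \<in> {1..<k} \<Longrightarrow> F \<notin> atypical_forms k V s d t b \<xi> i"
    "F \<notin> negative_clause_forms k V s d t \<gamma>"
    using subsetD[OF dense_forms_subset F] by auto
  note small = excluded_small[OF sparse F_not(2)]
  have "real (card (neg_link F x)) \<le> t * real (card V) ^ (k - 1)" if "x \<in> V" for x
    using F F_not(4) small[of "{x}"] that assms(2) by (force simp: large_link_forms_def)
  then have thin: "F \<in> thin_neg_forms k V s d t" using F by (simp add: thin_neg_forms_def)
  from sparse F_not(3) show False
  proof (cases rule: not_residual_cases)
    case (negative_clause S)
    then have "real (card (excluded k V S F)) \<le> \<gamma> * real (card V) ^ k"
      using assms(2) by (intro small) (auto simp: nsets_def)
    then show False using negative_clause thin F_not(6) by (auto simp: negative_clause_forms_def)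
  next
    case (many_atypical S)
    note S = proper_subsetsD[OF many_atypical(1) assms(1)]
    then have "S \<in> nsets V (card S)" by (simp add: nsets_def)
    then have "F \<in> atypical_forms k V s d t b \<xi> (card S)"
      using many_atypical(2) thin by (auto simp: atypical_forms_def)
    then show False using F_not(5) S(3) by blast
  qed (use F_not(1) in simp)
qed

definition deletion_sum :: "nat \<Rightarrow> nat \<Rightarrow> real \<Rightarrow> real" where
  "deletion_sum k n \<delta> = (\<Sum>i=1..k-2. deletion_bound k n i (real i) \<delta>)"

lemma deletion_bound_le_deletion_sum:
  "i \<in> {1..k-2} \<Longrightarrow> deletion_bound k n i (real i) \<delta> \<le> deletion_sum k n \<delta>"
  unfolding deletion_sum_def by (rule member_le_sum) (auto simp: deletion_bound_nonneg)

lemma deletion_sum_nonneg: "0 \<le> deletion_sum k n \<delta>"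
  unfolding deletion_sum_def by (intro sum_nonneg deletion_bound_nonneg)

context sparse_setting
begin

lemma card_nsets_le_power: "i \<le> k \<Longrightarrow> real (card (nsets V i)) \<le> n ^ k"
  unfolding card_nsets by (rule order_trans[OF real_choose_le_power power_increasing]) (use one_le_n in auto)

lemma card_atypical_forms_le:
  assumes "3 \<le> k" "i \<in> {1..<k}" "0 < d" "0 < \<xi>" "2 * real k \<le> n" "2 * real k \<le> d * n"
    and b: "b \<le> tuple_gain k * (d / 2)" "b \<le> tuple_gain k / (4 * real k) ^ k"
    and \<delta>: "\<delta> \<le> tuple_gain k * (\<xi> / (4 * real k) ^ k) - e - 4 * real k ^ 2 * e"
      "\<delta> \<le> tuple_gain k * (d / 2) - 4 * real k ^ 2 * e"
  shows "real (card (atypical_forms k V s d (thin e) b \<xi> i)) \<le> n ^ k * deletion_sum k (card V) \<delta>"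
proof -
  let ?A = "\<lambda>S. {F\<in>thin_neg_forms k V s d (thin e). \<xi> * n ^ (k - 1 - i) < real (card (atypical k V b S F))}"
  have fin: "finite {F\<in>thin_neg_forms k V s d (thin e). P F}" for P
    by (rule sparse_forms_finite) (use thin_neg_forms_subset in blast)
  have "real (card (?A S)) \<le> deletion_sum k (card V) \<delta>" if S: "S \<in> nsets V i" for S
  proof (cases "i = k - 1")
    case False
    have i: "i \<in> {1..k-2}" "i + 2 \<le> k" using False assms(1,2) by auto
    note gain = tuple_gain_antimono[of i k]
    have gain_mono: "tuple_gain k * x \<le> tuple_gain i * x" if "0 \<le> x" for x
      using i that by (intro mult_right_mono gain) auto
    have "real (card (?A S)) \<le> real (card {F\<in>thin_neg_forms k V s d (thin e). \<xi> * n ^ (k - 1 - i)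
        \<le> real (card (atypical k V b S F))})"
      by (intro real_card_mono fin) auto
    also have "\<dots> \<le> deletion_bound k (card V) i (real i) (tuple_gain i * (\<xi> / (4 * real k) ^ k) - e
        - 4 * real k ^ 2 * e)"
      using S i assms(5) b(2) gain_mono[of "1 / (4 * real k) ^ k"]
      by (intro card_many_atypical_le) (auto simp: nsets_def)
    also have "\<dots> \<le> deletion_bound k (card V) i (real i) \<delta>"
      using \<delta>(1) gain_mono[of "\<xi> / (4 * real k) ^ k"] assms(4) by (intro deletion_bound_antimono) auto
    also have "\<dots> \<le> deletion_sum k (card V) \<delta>" using i(1) by (rule deletion_bound_le_deletion_sum)
    finally show ?thesis .
  next
    case True
    have gain: "tuple_gain k * (d / 2) \<le> tuple_gain (k - 2) * (d / 2)"
      using assms(3) by (intro mult_right_mono tuple_gain_antimono) auto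
    have "?A S \<subseteq> {F\<in>thin_neg_forms k V s d (thin e). atypical k V b S F \<noteq> {}}"
      using assms(4) by (auto simp: True)
    then have "real (card (?A S)) \<le> real (card {F\<in>thin_neg_forms k V s d (thin e). atypical k V b S F \<noteq> {}})"
      by (intro real_card_mono fin)
    also have "\<dots> \<le> deletion_bound k (card V) (k - 2) (real (k - 2)) (tuple_gain (k - 2) * (d / 2)
        - 4 * real k ^ 2 * e)"
      using S assms(6) b(1) gain by (intro card_atypical_full_le) (auto simp: nsets_def True)
    also have "\<dots> \<le> deletion_bound k (card V) (k - 2) (real (k - 2)) \<delta>"
      using \<delta>(2) gain by (intro deletion_bound_antimono) auto
    also have "\<dots> \<le> deletion_sum k (card V) \<delta>" using assms(1) by (intro deletion_bound_le_deletion_sum) auto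
    finally show ?thesis .
  qed
  moreover have "atypical_forms k V s d (thin e) b \<xi> i = (\<Union>S\<in>nsets V i. ?A S)"
    by (auto simp: atypical_forms_def)
  ultimately show ?thesis
    using finite_V assms(2) deletion_sum_nonneg
    by (auto intro!: real_card_UN_le_mult card_nsets_le_power simp del: card_nsets)
qed

lemma card_forms_with_negative_clause_le:
  assumes "3 \<le> k" "0 < c" "2 * real k \<le> d * n" "\<gamma> \<le> tuple_gain k * c\<^sup>2 / real k" and S: "S \<subseteq> V" "card S = k"
    and few_pairs: "real (card (dense_pairs (V - S) (k - 1) (d / 2 * n ^ (k - 1)) (c * n ^ k)))
      \<le> 2 powr (real (card V choose (k - 1)) - \<delta>' * n ^ (k - 1))"
    and \<delta>: "\<delta> \<le> tuple_gain k * c - 4 * real k ^ 2 * e" "\<delta> \<le> real k / 2 * \<delta>' - e - 4 * real k ^ 2 * e"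
  shows "real (card {F\<in>thin_neg_forms k V s d (thin e). (S, {}) \<in> F \<and>
      real (card (excluded k V S F)) \<le> \<gamma> * n ^ k})
    \<le> real k ^ 2 * deletion_sum k (card V) \<delta> + deletion_bound k (card V) k (real k / 2) \<delta>"
      (is "real (card ?G) \<le> _")
proof -
  let ?common = "\<lambda>F x y. real (card (common (V - S) (k - 1) (pos_link F x) (pos_link F y)))"
  let ?dense = "\<lambda>p. {F\<in>thin_neg_forms k V s d (thin e). (S, {}) \<in> F \<and>
      real (card (excluded k V S F)) \<le> \<gamma> * n ^ k \<and>
      c * n ^ k \<le> ?common F (fst p) (snd p)}"
  let ?sparse = "{F\<in>thin_neg_forms k V s d (thin e). \<forall>x\<in>S. \<forall>y\<in>S. x \<noteq> y \<longrightarrow> ?common F x y \<le> c * n ^ k}"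
  let ?pairs = "{p\<in>S \<times> S. fst p \<noteq> snd p}"
  have finS: "finite S" by (rule finite_subset[OF S(1) finite_V])
  have fin: "finite {F\<in>thin_neg_forms k V s d (thin e). P F}" for P
    by (rule sparse_forms_finite) (use thin_neg_forms_subset in blast)
  have gain: "tuple_gain k * x \<le> tuple_gain (k - 2) * x" if "0 \<le> x" for x
    using that by (intro mult_right_mono tuple_gain_antimono) auto
  have "?G \<subseteq> (\<Union>p\<in>?pairs. ?dense p) \<union> ?sparse"
  proof
    fix F assume F: "F \<in> ?G"
    show "F \<in> (\<Union>p\<in>?pairs. ?dense p) \<union> ?sparse"
    proof (cases "F \<in> ?sparse")
      case False
      then obtain x y where "x \<in> S" "y \<in> S" "x \<noteq> y" "c * n ^ k \<le> ?common F x y" using F by (auto simp: not_le)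
      then have "(x, y) \<in> ?pairs" "F \<in> ?dense (x, y)" using F by auto
      then show ?thesis by blast
    qed simp
  qed
  then have "real (card ?G) \<le> real (card ((\<Union>p\<in>?pairs. ?dense p) \<union> ?sparse))"
    using finS by (intro real_card_mono) (auto intro!: fin)
  also have "\<dots> \<le> real (card (\<Union>p\<in>?pairs. ?dense p)) + real (card ?sparse)"
    using card_Un_le[of "\<Union>p\<in>?pairs. ?dense p" ?sparse] by linarith
  also have "real (card (\<Union>p\<in>?pairs. ?dense p)) \<le> real k ^ 2 * deletion_sum k (card V) \<delta>"
  proof (rule real_card_UN_le_mult)
    fix p assume p: "p \<in> ?pairs"
    have "real (card (?dense p)) \<le> deletion_bound k (card V) (k - 2) (real (k - 2)) (tuple_gain (k - 2) * c
        - 4 * real k ^ 2 * e)"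
      using S p assms(2,4) gain[of "c\<^sup>2 / real k"] by (intro card_negative_clause_common_le) auto
    also have "\<dots> \<le> deletion_bound k (card V) (k - 2) (real (k - 2)) \<delta>"
      using \<delta>(1) gain[OF less_imp_le[OF assms(2)]] by (intro deletion_bound_antimono) linarith
    also have "\<dots> \<le> deletion_sum k (card V) \<delta>" using assms(1) by (intro deletion_bound_le_deletion_sum) auto
    finally show "real (card (?dense p)) \<le> deletion_sum k (card V) \<delta>" .
  next
    have "real (card ?pairs) \<le> real (card (S \<times> S))" using finS by (intro real_card_mono) auto
    then show "real (card ?pairs) \<le> real k ^ 2" by (simp add: card_cartesian_product S(2) power2_eq_square)
  qed (use finS deletion_sum_nonneg in auto)
  also have "real (card ?sparse) \<le> deletion_bound k (card V) k (real k / 2) \<delta>"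
    using card_links_pairwise_sparse_le[OF S assms(3) few_pairs] deletion_bound_antimono[OF \<delta>(2)]
    by (rule order_trans)
  finally show ?thesis by simp
qed

lemma card_negative_clause_forms_le:
  assumes "3 \<le> k" "0 < c" "2 * real k \<le> d * n" "\<gamma> \<le> tuple_gain k * c\<^sup>2 / real k"
    and few_pairs: "\<And>S. S \<in> nsets V k \<Longrightarrow>
      real (card (dense_pairs (V - S) (k - 1) (d / 2 * n ^ (k - 1)) (c * n ^ k)))
      \<le> 2 powr (real (card V choose (k - 1)) - \<delta>' * n ^ (k - 1))"
    and \<delta>: "\<delta> \<le> tuple_gain k * c - 4 * real k ^ 2 * e" "\<delta> \<le> real k / 2 * \<delta>' - e - 4 * real k ^ 2 * e"
  shows "real (card (negative_clause_forms k V s d (thin e) \<gamma>))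
    \<le> n ^ k * (real k ^ 2 * deletion_sum k (card V) \<delta> + deletion_bound k (card V) k (real k / 2) \<delta>)"
proof -
  have "negative_clause_forms k V s d (thin e) \<gamma>
      = (\<Union>S\<in>nsets V k. {F\<in>thin_neg_forms k V s d (thin e). (S, {}) \<in> F \<and>
        real (card (excluded k V S F)) \<le> \<gamma> * n ^ k})"
    by (auto simp: negative_clause_forms_def)
  also have "real (card \<dots>)
      \<le> n ^ k * (real k ^ 2 * deletion_sum k (card V) \<delta> + deletion_bound k (card V) k (real k / 2) \<delta>)"
  proof (rule real_card_UN_le_mult)
    fix S assume S: "S \<in> nsets V k"
    then have "S \<subseteq> V" "card S = k" by (auto simp: nsets_def)
    then show "real (card {F\<in>thin_neg_forms k V s d (thin e). (S, {}) \<in> F \<and>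
        real (card (excluded k V S F)) \<le> \<gamma> * n ^ k})
        \<le> real k ^ 2 * deletion_sum k (card V) \<delta> + deletion_bound k (card V) k (real k / 2) \<delta>"
      by (rule card_forms_with_negative_clause_le[OF assms(1-4) _ _ few_pairs[OF S] \<delta>])
  qed (use finite_V deletion_sum_nonneg deletion_bound_nonneg card_nsets_le_power[OF order_refl] in
      \<open>simp_all del: card_nsets of_nat_power\<close>)
  finally show ?thesis .
qed

lemma card_large_link_forms_le:
  assumes "3 \<le> k" "d' \<le> d" "d' \<le> t"
    and few_pairs: "\<And>x. x \<in> V \<Longrightarrow> real (card (dense_pairs (V - {x}) (k - 1) (d' * n ^ (k - 1)) (\<gamma> * n ^ k)))
      \<le> 2 powr (real (card V choose (k - 1)) - \<delta>' * n ^ (k - 1))"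
    and \<delta>: "\<delta> \<le> \<delta>' - 3 * real k ^ 2 * e"
  shows "real (card (large_link_forms k V s d t \<gamma>)) \<le> n ^ k * deletion_sum k (card V) \<delta>"
proof -
  let ?A = "\<lambda>x. {F\<in>dense_forms k V s d. t * n ^ (k - 1) \<le> real (card (neg_link F x)) \<and>
      real (card (excluded k V {x} F)) \<le> \<gamma> * n ^ k}"
  have "large_link_forms k V s d t \<gamma> = (\<Union>x\<in>V. ?A x)" by (auto simp: large_link_forms_def)
  also have "real (card \<dots>) \<le> n ^ k * deletion_sum k (card V) \<delta>"
  proof (rule real_card_UN_le_mult[OF finite_V])
    fix x assume x: "x \<in> V"
    have "real (card (?A x)) \<le> deletion_bound k (card V) 1 1 (\<delta>' - 3 * real k ^ 2 * e)"
      by (rule card_large_neg_link_le[OF x assms(2,3) few_pairs[OF x]])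
    also have "\<dots> \<le> deletion_bound k (card V) 1 (real 1) \<delta>" using deletion_bound_antimono[OF \<delta>] by simp
    also have "\<dots> \<le> deletion_sum k (card V) \<delta>" using assms(1) by (intro deletion_bound_le_deletion_sum) auto
    finally show "real (card (?A x)) \<le> deletion_sum k (card V) \<delta>" .
  next
    show "n \<le> n ^ k" using one_le_n k_ge_2 by (intro self_le_power) auto
  qed (rule deletion_sum_nonneg)
  finally show ?thesis .
qed

end

lemma exists_thin_irregular_bound:
  assumes "3 \<le> k" "0 < d" "0 < \<xi>" "b \<le> tuple_gain k * (d / 2)" "b \<le> tuple_gain k / (4 * real k) ^ k"
  shows "\<exists>\<eta>>0. \<forall>\<^sub>F V :: 'a set in large_sets. \<forall>s \<gamma> \<delta>. sparse_setting k V s \<eta> \<longrightarrow> \<gamma> \<le> \<eta> \<longrightarrow> \<delta> \<le> \<eta> \<longrightarrow>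
    real (card (\<Union>i\<in>{1..<k}. atypical_forms k V s d (thin \<eta>) b \<xi> i))
      \<le> real k * (real (card V) ^ k * deletion_sum k (card V) \<delta>) \<and>
    real (card (negative_clause_forms k V s d (thin \<eta>) \<gamma>))
      \<le> real (card V) ^ k * (real k ^ 2 * deletion_sum k (card V) \<delta>
        + deletion_bound k (card V) k (real k / 2) \<delta>)"
proof -
  let ?g = "tuple_gain k"
  have g: "?g > 0" by (rule tuple_gain_pos)
  have k: "real k \<ge> 1" "Suc (k - 1) = k" "1 \<le> k - 1" using assms(1) by auto
  obtain c \<delta>' where c: "c > 0" and \<delta>': "\<delta>' > 0"
    and few_pairs: "\<forall>\<^sub>F V :: 'a set in large_sets. \<forall>X\<subseteq>V. card X \<le> k \<longrightarrow>
      real (card (dense_pairs (V - X) (k - 1) (d / 2 * real (card V) ^ (k - 1)) (c * real (card V) ^ k)))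
      \<le> 2 powr (real (card V choose (k - 1)) - \<delta>' * real (card V) ^ (k - 1))"
    using exists_few_dense_pairs_Diff[of "d / 2" "k - 1" k, where ?'a = 'a] assms(2) k by auto
  define gap where "gap = Min {?g * (\<xi> / (4 * real k) ^ k), ?g * (d / 2), ?g * c, \<delta>'}"
  define \<eta> where "\<eta> = min (?g * c\<^sup>2 / real k) (gap / (2 + 4 * real k ^ 2))"
  have "(4 * real k) ^ k > 0" and denominator: "2 + 4 * real k ^ 2 > 0"
    using k(1) by (simp_all add: add_pos_nonneg)
  then have gap: "gap > 0" unfolding gap_def using g c \<delta>' assms(2,3) by simp
  have \<eta>: "\<eta> > 0" "\<eta> \<le> ?g * c\<^sup>2 / real k" using g c k(1) gap denominator by (auto simp: \<eta>_def)
  have "\<eta> \<le> gap / (2 + 4 * real k ^ 2)" by (simp add: \<eta>_def)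
  then have "\<eta> * (2 + 4 * real k ^ 2) \<le> gap" using denominator by (simp only: pos_le_divide_eq)
  then have \<eta>_gap: "\<eta> + \<eta> + 4 * real k ^ 2 * \<eta> \<le> gap" by (simp add: distrib_left mult_ac)
  have "gap \<le> \<delta>'" and gaps: "gap \<le> ?g * (\<xi> / (4 * real k) ^ k)" "gap \<le> ?g * (d / 2)" "gap \<le> ?g * c"
    unfolding gap_def by (intro Min_le; simp)+
  moreover have "1 * \<delta>' \<le> real k / 2 * \<delta>'" using \<delta>' assms(1) by (intro mult_right_mono) auto
  ultimately have gap_pairs: "gap \<le> real k / 2 * \<delta>'" by linarith
  have "\<forall>\<^sub>F V :: 'a set in large_sets. \<forall>s \<gamma> \<delta>. sparse_setting k V s \<eta> \<longrightarrow> \<gamma> \<le> \<eta> \<longrightarrow> \<delta> \<le> \<eta> \<longrightarrow>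
    real (card (\<Union>i\<in>{1..<k}. atypical_forms k V s d (thin \<eta>) b \<xi> i))
      \<le> real k * (real (card V) ^ k * deletion_sum k (card V) \<delta>) \<and>
    real (card (negative_clause_forms k V s d (thin \<eta>) \<gamma>))
      \<le> real (card V) ^ k * (real k ^ 2 * deletion_sum k (card V) \<delta>
        + deletion_bound k (card V) k (real k / 2) \<delta>)"
    using few_pairs eventually_large_sets_ge[of "2 * real k"] eventually_large_sets_ge[of "2 * real k / d"]
  proof eventually_elim
    case (elim V)
    have large: "2 * real k \<le> d * real (card V)" using elim(3) assms(2) by (simp add: field_simps)
    show ?case
    proof (intro allI impI conjI)
      fix s \<gamma> \<delta> assume "sparse_setting k V s \<eta>" and small: "\<gamma> \<le> \<eta>" "\<delta> \<le> \<eta>"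
      then interpret sparse_setting k V s \<eta> by simp
      note slack = \<eta>_gap gaps gap_pairs small \<eta>
      show "real (card (\<Union>i\<in>{1..<k}. atypical_forms k V s d (thin \<eta>) b \<xi> i))
          \<le> real k * (n ^ k * deletion_sum k (card V) \<delta>)"
      proof (rule real_card_UN_le_mult)
        show "real (card (atypical_forms k V s d (thin \<eta>) b \<xi> i)) \<le> n ^ k * deletion_sum k (card V) \<delta>"
          if "i \<in> {1..<k}" for i
          by (rule card_atypical_forms_le[OF assms(1) that assms(2,3) elim(2) large assms(4,5)])
            (use slack in linarith)+
      qed (use deletion_sum_nonneg in auto)
      show "real (card (negative_clause_forms k V s d (thin \<eta>) \<gamma>))
          \<le> n ^ k * (real k ^ 2 * deletion_sum k (card V) \<delta> + deletion_bound k (card V) k (real k / 2) \<delta>)"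
      proof (rule card_negative_clause_forms_le[OF assms(1) c large])
        show "real (card (dense_pairs (V - S) (k - 1) (d / 2 * n ^ (k - 1)) (c * n ^ k)))
            \<le> 2 powr (real (card V choose (k - 1)) - \<delta>' * n ^ (k - 1))" if "S \<in> nsets V k" for S
          using elim(1) that by (simp add: nsets_def)
      qed (use slack in linarith)+
    qed
  qed
  then show ?thesis using \<eta>(1) by blast
qed

lemma exists_large_link_bound:
  assumes "3 \<le> k" "0 < d" "0 < t"
  shows "\<exists>\<eta>>0. \<forall>\<^sub>F V :: 'a set in large_sets. \<forall>s \<gamma> \<delta>. sparse_setting k V s \<eta> \<longrightarrow> \<gamma> \<le> \<eta> \<longrightarrow> \<delta> \<le> \<eta> \<longrightarrow>
    real (card (large_link_forms k V s d t \<gamma>)) \<le> real (card V) ^ k * deletion_sum k (card V) \<delta>"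
proof -
  have k: "Suc (k - 1) = k" "1 \<le> k - 1" using assms(1) by auto
  obtain \<gamma>' \<delta>' where \<gamma>': "\<gamma>' > 0" and \<delta>': "\<delta>' > 0"
    and few_pairs: "\<forall>\<^sub>F V :: 'a set in large_sets. \<forall>X\<subseteq>V. card X \<le> 1 \<longrightarrow>
      real (card (dense_pairs (V - X) (k - 1) (min d t * real (card V) ^ (k - 1)) (\<gamma>' * real (card V) ^ k)))
      \<le> 2 powr (real (card V choose (k - 1)) - \<delta>' * real (card V) ^ (k - 1))"
    using exists_few_dense_pairs_Diff[of "min d t" "k - 1" 1, where ?'a = 'a] assms(2,3) k by auto
  define \<eta> where "\<eta> = min \<gamma>' (\<delta>' / (1 + 3 * real k ^ 2))"
  have denominator: "1 + 3 * real k ^ 2 > 0" by (simp add: add_pos_nonneg)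
  then have \<eta>: "\<eta> > 0" "\<eta> \<le> \<gamma>'" using \<gamma>' \<delta>' by (auto simp: \<eta>_def)
  have "\<eta> \<le> \<delta>' / (1 + 3 * real k ^ 2)" by (simp add: \<eta>_def)
  then have "\<eta> * (1 + 3 * real k ^ 2) \<le> \<delta>'" using denominator by (simp only: pos_le_divide_eq)
  then have \<eta>_gap: "\<eta> \<le> \<delta>' - 3 * real k ^ 2 * \<eta>" by (simp add: distrib_left mult_ac)
  have "\<forall>\<^sub>F V :: 'a set in large_sets. \<forall>s \<gamma> \<delta>. sparse_setting k V s \<eta> \<longrightarrow> \<gamma> \<le> \<eta> \<longrightarrow> \<delta> \<le> \<eta> \<longrightarrow>
    real (card (large_link_forms k V s d t \<gamma>)) \<le> real (card V) ^ k * deletion_sum k (card V) \<delta>"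
    using few_pairs
  proof eventually_elim
    case (elim V)
    show ?case
    proof (intro allI impI)
      fix s \<gamma> \<delta> assume "sparse_setting k V s \<eta>" and small: "\<gamma> \<le> \<eta>" "\<delta> \<le> \<eta>"
      then interpret sparse_setting k V s \<eta> by simp
      have "real (card (dense_pairs (V - {x}) (k - 1) (min d t * n ^ (k - 1)) (\<gamma> * n ^ k)))
          \<le> 2 powr (real (card V choose (k - 1)) - \<delta>' * n ^ (k - 1))" if x: "x \<in> V" for x
      proof -
        have "\<gamma> * n ^ k \<le> \<gamma>' * n ^ k" using small(1) \<eta>(2) by (intro mult_right_mono) auto
        then have "real (card (dense_pairs (V - {x}) (k - 1) (min d t * n ^ (k - 1)) (\<gamma> * n ^ k)))
            \<le> real (card (dense_pairs (V - {x}) (k - 1) (min d t * n ^ (k - 1)) (\<gamma>' * n ^ k)))"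
          using finite_V by (intro real_card_mono dense_pairs_mono finite_dense_pairs) auto
        also have "\<dots> \<le> 2 powr (real (card V choose (k - 1)) - \<delta>' * n ^ (k - 1))" using elim x by simp
        finally show ?thesis .
      qed
      then show "real (card (large_link_forms k V s d t \<gamma>)) \<le> n ^ k * deletion_sum k (card V) \<delta>"
        using assms(1) small(2) \<eta>_gap by (intro card_large_link_forms_le[where d' = "min d t"
          and \<delta>' = \<delta>']) auto
    qed
  qed
  then show ?thesis using \<eta>(1) by blast
qed

lemma exists_excluding_bound:
  assumes "2 \<le> k" "0 < \<gamma>"
  shows "\<exists>e>0. \<forall>\<^sub>F V :: 'a set in large_sets. \<forall>s. sparse_setting k V s e \<longrightarrow>
    real (card (excluding_forms k V s \<gamma>)) \<le> 2 powr ((1 - \<gamma> / 4) * real (card V choose k))"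
proof -
  define e where "e = \<gamma> / (4 * real k)"
  have e: "e > 0" "real k * e = \<gamma> / 4" using assms by (auto simp: e_def)
  have "\<forall>\<^sub>F n in sequentially. real k + real k * log 2 (real n) \<le> \<gamma> / 2 * real n" using assms(2) by real_asymp
  then have "\<forall>\<^sub>F V :: 'a set in large_sets. real k + real k * log 2 (real (card V)) \<le> \<gamma> / 2 * real (card V)"
    by (rule eventually_large_sets_card)
  then have "\<forall>\<^sub>F V :: 'a set in large_sets. \<forall>s. sparse_setting k V s e \<longrightarrow>
      real (card (excluding_forms k V s \<gamma>)) \<le> 2 powr ((1 - \<gamma> / 4) * real (card V choose k))"
  proof eventually_elim
    case (elim V)
    show ?case
      using sparse_setting.card_excluding_forms_le[OF _ assms(2) eq_refl[OF e(2)] elim] by blast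
  qed
  then show ?thesis using e(1) by blast
qed

lemma deletion_bound_le_exp2:
  assumes "p \<le> 2 powr (\<delta> / 2 * real n ^ (k - 1))" "0 \<le> r" "0 \<le> c" "r * c \<le> \<delta> / 2"
  shows "p * deletion_bound k n i r \<delta> \<le> exp2 (r * (1 - c) * real (n choose (k - 1)))
      * real (card (minimal_formulae k (n - i)))"
proof -
  let ?C = "real (n choose (k - 1))" and ?N = "real n ^ (k - 1)"
    and ?M = "real (card (minimal_formulae k (n - i)))"
  have "p * deletion_bound k n i r \<delta> \<le> 2 powr (\<delta> / 2 * ?N) * deletion_bound k n i r \<delta>"
    using assms(1) deletion_bound_nonneg by (rule mult_right_mono)
  also have "\<dots> = 2 powr (\<delta> / 2 * ?N + (r * ?C - \<delta> * ?N)) * ?M"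
    by (simp only: deletion_bound_def powr_add mult_ac)
  also have "\<dots> \<le> exp2 (r * (1 - c) * ?C) * ?M"
    unfolding exp2_def
  proof (intro mult_right_mono powr_mono)
    have "0 \<le> r * c" using assms(2,3) by simp
    then have "r * c * ?C \<le> \<delta> / 2 * ?N"
      using assms(4) by (intro mult_mono real_choose_le_power) auto
    then show "\<delta> / 2 * ?N + (r * ?C - \<delta> * ?N) \<le> r * (1 - c) * ?C" by (simp add: algebra_simps)
  qed auto
  finally show ?thesis .
qed

definition bound_ge_3 :: "nat \<Rightarrow> real \<Rightarrow> nat \<Rightarrow> real" where
  "bound_ge_3 k c n = 2 ^ (n choose k)
     + exp2 ((1 - c) * real (n choose k))
     + (\<Sum>i=1..k-2. exp2 (real i * (1 - c) * real (n choose (k - 1))) * real (card (minimal_formulae k (n - i))))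
     + exp2 (real k / 2 * (1 - c) * real (n choose (k - 1))) * real (card (minimal_formulae k (n - k)))
     + exp2 (real (n choose k) - c * real n)"

lemma irregular_bound_absorbed:
  assumes "0 < c" "real k * c \<le> \<delta> / 2" "(1 + real k + real k ^ 2) * real n ^ k \<le> 2 powr (\<delta> / 2 * real n)"
    and "1 \<le> n" "2 \<le> k"
  shows "real n ^ k * ((1 + real k + real k ^ 2) * deletion_sum k n \<delta> + deletion_bound k n k (real k / 2) \<delta>)
    \<le> (\<Sum>i=1..k-2. exp2 (real i * (1 - c) * real (n choose (k - 1))) * real (card (minimal_formulae k (n - i))))
     + exp2 (real k / 2 * (1 - c) * real (n choose (k - 1))) * real (card (minimal_formulae k (n - k)))"
proof -
  let ?p = "(1 + real k + real k ^ 2) * real n ^ k"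
  have "0 \<le> real k * c" using assms(1) by simp
  then have \<delta>: "\<delta> \<ge> 0" using assms(2) by linarith
  have "real n \<le> real n ^ (k - 1)" using assms(4,5) by (intro self_le_power) auto
  then have "2 powr (\<delta> / 2 * real n) \<le> 2 powr (\<delta> / 2 * real n ^ (k - 1))"
    using \<delta> by (intro powr_mono mult_left_mono) auto
  then have p: "?p \<le> 2 powr (\<delta> / 2 * real n ^ (k - 1))" using assms(3) by linarith
  have absorb: "?p * deletion_bound k n i r \<delta>
      \<le> exp2 (r * (1 - c) * real (n choose (k - 1))) * real (card (minimal_formulae k (n - i)))"
    if "0 \<le> r" "r \<le> real k" for i r
  proof (rule deletion_bound_le_exp2[OF p that(1)])
    have "r * c \<le> real k * c" using that(2) assms(1) by (intro mult_right_mono) auto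
    then show "r * c \<le> \<delta> / 2" using assms(2) by linarith
  qed (use assms(1) in simp)
  have "real n ^ k * deletion_bound k n k (real k / 2) \<delta> \<le> ?p * deletion_bound k n k (real k / 2) \<delta>"
    by (intro mult_right_mono deletion_bound_nonneg) (auto simp: distrib_right)
  also have "\<dots> \<le> exp2 (real k / 2 * (1 - c) * real (n choose (k - 1)))
      * real (card (minimal_formulae k (n - k)))"
    by (rule absorb) auto
  finally have "real n ^ k * deletion_bound k n k (real k / 2) \<delta>
      \<le> exp2 (real k / 2 * (1 - c) * real (n choose (k - 1))) * real (card (minimal_formulae k (n - k)))" .
  moreover have "?p * deletion_sum k n \<delta>
      \<le> (\<Sum>i=1..k-2. exp2 (real i * (1 - c) * real (n choose (k - 1)))
        * real (card (minimal_formulae k (n - i))))"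
    unfolding deletion_sum_def sum_distrib_left by (intro sum_mono absorb) auto
  ultimately show ?thesis by (simp add: distrib_left mult_ac)
qed

lemma card_dense_forms_le_parts:
  assumes "finite V" "1 \<le> k"
  shows "real (card (dense_forms k V s d)) \<le> 2 ^ (card V choose k) + real (card (excluding_forms k V s \<gamma>))
    + real (card (residual k V s b \<xi>)) + real (card (large_link_forms k V s d t \<gamma>))
    + real (card (\<Union>i\<in>{1..<k}. atypical_forms k V s d t b \<xi> i))
      + real (card (negative_clause_forms k V s d t \<gamma>))"
proof -
  let ?M = "{F\<in>sparse_forms k V s. neg_clauses F = {}}" and ?E = "excluding_forms k V s \<gamma>"
    and ?R = "residual k V s b \<xi>"
  let ?L = "large_link_forms k V s d t \<gamma>" and ?A = "\<Union>i\<in>{1..<k}. atypical_forms k V s d t b \<xi> i"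
  let ?N = "negative_clause_forms k V s d t \<gamma>"
  have "finite (?M \<union> ?E \<union> ?R \<union> ?L \<union> ?A \<union> ?N)"
    using assms(1) by (simp add: excluding_forms_def residual_def large_link_forms_def atypical_forms_def
      negative_clause_forms_def thin_neg_forms_def)
  then have "card (dense_forms k V s d) \<le> card (?M \<union> ?E \<union> ?R \<union> ?L \<union> ?A \<union> ?N)"
    by (rule card_mono[OF _ dense_forms_cover[OF assms]])
  also have "\<dots> \<le> card ?M + card ?E + card ?R + card ?L + card ?A + card ?N"
    by (intro order_trans[OF card_Un_le] add_mono order_refl)
  also have "card ?M \<le> 2 ^ (card V choose k)" by (rule card_sparse_monotone_forms[OF assms(1)])
  finally have "real (card (dense_forms k V s d))
      \<le> real (2 ^ (card V choose k) + card ?E + card ?R + card ?L + card ?A + card ?N)"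
    by (simp only: of_nat_le_iff)
  then show ?thesis by simp
qed

lemma card_dense_forms_le_bound_ge_3:
  assumes "finite V" "1 \<le> card V" "2 \<le> k" "0 < c" "c \<le> \<gamma> / 4" "c \<le> \<eta>" "real k * c \<le> \<delta> / 2"
    and "(1 + real k + real k ^ 2) * real (card V) ^ k \<le> 2 powr (\<delta> / 2 * real (card V))"
    and excluding: "real (card (excluding_forms k V s \<gamma>)) \<le> 2 powr ((1 - \<gamma> / 4) * real (card V choose k))"
    and residual: "real (card (residual k V s b \<xi>)) \<le> 2 powr (real (card V choose k) - \<eta> * real (card V))"
    and irregular: "real (card (large_link_forms k V s d t \<gamma>))
        \<le> real (card V) ^ k * deletion_sum k (card V) \<delta>"
      "real (card (\<Union>i\<in>{1..<k}. atypical_forms k V s d t b \<xi> i))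
        \<le> real k * (real (card V) ^ k * deletion_sum k (card V) \<delta>)"
      "real (card (negative_clause_forms k V s d t \<gamma>))
        \<le> real (card V) ^ k * (real k ^ 2 * deletion_sum k (card V) \<delta>
          + deletion_bound k (card V) k (real k / 2) \<delta>)"
  shows "real (card (dense_forms k V s d)) \<le> bound_ge_3 k c (card V)"
proof -
  let ?n = "real (card V)" and ?S = "deletion_sum k (card V) \<delta>"
    and ?D = "deletion_bound k (card V) k (real k / 2) \<delta>"
  have "?n ^ k * ?S + real k * (?n ^ k * ?S) + ?n ^ k * (real k ^ 2 * ?S + ?D)
      = ?n ^ k * ((1 + real k + real k ^ 2) * ?S + ?D)" by (simp add: algebra_simps)
  moreover have "2 powr ((1 - \<gamma> / 4) * real (card V choose k)) \<le> exp2 ((1 - c) * real (card V choose k))"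
    unfolding exp2_def using assms(5) by (intro powr_mono mult_right_mono) auto
  moreover have "2 powr (real (card V choose k) - \<eta> * ?n) \<le> exp2 (real (card V choose k) - c * ?n)"
    unfolding exp2_def using assms(6) by (intro powr_mono diff_left_mono mult_right_mono) auto
  ultimately show ?thesis
    using card_dense_forms_le_parts[OF assms(1), of k s d \<gamma> b \<xi> t]
      irregular_bound_absorbed[OF assms(4,7,8,2,3)] excluding residual irregular assms(3)
    unfolding bound_ge_3_def by linarith
qed

lemma exists_atypicality_threshold:
  assumes "1 \<le> k" "0 < d"
  shows "\<exists>b>0. b \<le> d \<and> (\<forall>i\<in>{1..<k}. b \<le> tuple_gain i * extension_rate k)"
proof -
  define b where "b = min d (tuple_gain k * extension_rate k)"
  have rate: "extension_rate k > 0" using assms(1) by (simp add: extension_rate_def)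
  have "b \<le> tuple_gain i * extension_rate k" if "i \<in> {1..<k}" for i
  proof -
    have "tuple_gain k * extension_rate k \<le> tuple_gain i * extension_rate k"
      using that rate by (intro mult_right_mono tuple_gain_antimono) auto
    then show ?thesis by (simp add: b_def)
  qed
  moreover have "b > 0" "b \<le> d" using assms(2) rate tuple_gain_pos by (auto simp: b_def)
  ultimately show ?thesis by blast
qed

lemma exists_card_dense_forms_le:
  assumes "3 \<le> k" "0 < d"
  shows "\<exists>\<zeta>>0. \<exists>c>0. \<forall>\<^sub>F V :: 'a set in large_sets.
    real (card (dense_forms k V (\<zeta> * real (card V)) d)) \<le> bound_ge_3 k c (card V)"
proof -
  let ?g = "tuple_gain k"
  have k: "2 \<le> k" "1 \<le> k" "real k > 0" using assms(1) by auto
  have "0 < min (?g * (d / 2)) (?g / (4 * real k) ^ k)" using assms tuple_gain_pos[of k] by simp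
  from exists_atypicality_threshold[OF k(2) this] obtain b
    where b: "0 < b" "b \<le> ?g * (d / 2)" "b \<le> ?g / (4 * real k) ^ k"
      and b_gain: "\<And>i. i \<in> {1..<k} \<Longrightarrow> b \<le> tuple_gain i * extension_rate k" by auto
  obtain \<xi> \<eta>1 where \<xi>: "\<xi> > 0" and \<eta>1: "\<eta>1 > 0"
    and residual: "\<forall>\<^sub>F V :: 'a set in large_sets. \<forall>s. sparse_setting k V s \<eta>1 \<longrightarrow>
      real (card (residual k V s b \<xi>)) \<le> 2 powr (real (card V choose k) - \<eta>1 * real (card V))"
    using exists_residual_bound[OF k(1) b(1) b_gain, where ?'a = 'a] by auto
  obtain \<eta>2 where \<eta>2: "\<eta>2 > 0"
    and thin_irregular: "\<forall>\<^sub>F V :: 'a set in large_sets. \<forall>s \<gamma> \<delta>. sparse_setting k V s \<eta>2 \<longrightarrow> \<gamma> \<le> \<eta>2 \<longrightarrow> \<delta> \<le> \<eta>2 \<longrightarrow>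
      real (card (\<Union>i\<in>{1..<k}. atypical_forms k V s d (thin \<eta>2) b \<xi> i))
        \<le> real k * (real (card V) ^ k * deletion_sum k (card V) \<delta>) \<and>
      real (card (negative_clause_forms k V s d (thin \<eta>2) \<gamma>))
        \<le> real (card V) ^ k * (real k ^ 2 * deletion_sum k (card V) \<delta>
          + deletion_bound k (card V) k (real k / 2) \<delta>)"
    using exists_thin_irregular_bound[OF assms \<xi> b(2,3)] by blast
  obtain \<eta>3 where \<eta>3: "\<eta>3 > 0"
    and large_link: "\<forall>\<^sub>F V :: 'a set in large_sets. \<forall>s \<gamma> \<delta>. sparse_setting k V s \<eta>3 \<longrightarrow> \<gamma> \<le> \<eta>3 \<longrightarrow> \<delta> \<le> \<eta>3 \<longrightarrow>
      real (card (large_link_forms k V s d (thin \<eta>2) \<gamma>)) \<le> real (card V) ^ k * deletion_sum k (card V) \<delta>"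
    using exists_large_link_bound[OF assms thin_pos[OF \<eta>2]] by blast
  define \<gamma> where "\<gamma> = min \<eta>2 \<eta>3"
  have \<gamma>: "\<gamma> > 0" "\<gamma> \<le> \<eta>2" "\<gamma> \<le> \<eta>3" using \<eta>2 \<eta>3 by (auto simp: \<gamma>_def)
  obtain \<eta>4 where \<eta>4: "\<eta>4 > 0"
    and excluding: "\<forall>\<^sub>F V :: 'a set in large_sets. \<forall>s. sparse_setting k V s \<eta>4 \<longrightarrow>
      real (card (excluding_forms k V s \<gamma>)) \<le> 2 powr ((1 - \<gamma> / 4) * real (card V choose k))"
    using exists_excluding_bound[OF k(1) \<gamma>(1)] by blast
  define e where "e = Min {\<eta>1, \<eta>2, \<eta>3, \<eta>4}"
  have e: "e > 0" "e \<le> \<eta>1" "e \<le> \<eta>2" "e \<le> \<eta>3" "e \<le> \<eta>4" using \<eta>1 \<eta>2 \<eta>3 \<eta>4 by (auto simp: e_def)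
  obtain \<zeta> where \<zeta>: "\<zeta> > 0"
    and setting: "\<forall>\<^sub>F V :: 'a set in large_sets. sparse_setting k V (\<zeta> * real (card V)) e"
    using eventually_sparse_setting[OF e(1) k(1)] by blast
  define c where "c = min \<eta>1 (\<gamma> / (4 * real k))"
  have "\<gamma> / (4 * real k) \<le> \<gamma> / 4" "real k * (\<gamma> / (4 * real k)) \<le> \<gamma> / 2"
    using \<gamma>(1) assms(1) by (auto simp: field_simps)
  moreover have "real k * c \<le> real k * (\<gamma> / (4 * real k))" by (intro mult_left_mono) (auto simp: c_def)
  ultimately have c: "c > 0" "c \<le> \<gamma> / 4" "c \<le> \<eta>1" "real k * c \<le> \<gamma> / 2" using \<eta>1 \<gamma>(1) k by (auto simp: c_def)
  have "\<forall>\<^sub>F n in sequentially. (1 + real k + real k ^ 2) * real n ^ k \<le> 2 powr (\<gamma> / 2 * real n)"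
    using \<gamma>(1) by real_asymp
  then have absorb: "\<forall>\<^sub>F V :: 'a set in large_sets.
      (1 + real k + real k ^ 2) * real (card V) ^ k \<le> 2 powr (\<gamma> / 2 * real (card V))"
    by (rule eventually_large_sets_card)
  have "\<forall>\<^sub>F V :: 'a set in large_sets. real (card (dense_forms k V (\<zeta> * real (card V)) d))
      \<le> bound_ge_3 k c (card V)"
    using residual thin_irregular large_link excluding setting absorb
  proof eventually_elim
    case (elim V)
    interpret sparse_setting k V "\<zeta> * real (card V)" e by (rule elim(5))
    note setting = sparse_setting_mono[OF elim(5)]
    show ?case
      by (rule card_dense_forms_le_bound_ge_3[OF finite_V one_le_card_V k(1) c elim(6)])
        (use elim(1-4) setting[OF e(2)] setting[OF e(3)] setting[OF e(4)] setting[OF e(5)] \<gamma>(2,3) in blast)+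
  qed
  then show ?thesis using \<zeta> c(1) by blast
qed

section \<open>The case of two literals\<close>

context sparse_setting
begin

lemma card_excluded_negative_2_clause_ge:
  assumes "k = 2" "F \<in> dense_forms k V s d" "(S, {}) \<in> F" "0 < d" "8 \<le> d * n"
  shows "d\<^sup>2 / 128 * n ^ k \<le> real (card (excluded k V S F))"
proof -
  have "F \<subseteq> signed_pairs k V" using assms(2) dense_forms_subset sparse_forms_subset by blast
  note S = signed_pairsD[OF subsetD[OF this assms(3)]]
  obtain x y where xy: "S = {x, y}" "x \<noteq> y" using S(6) assms(1) by (auto simp: card_2_iff)
  let ?t = "d / 4 * n" and ?common = "common (V - S) (Suc 0) (pos_link F x) (pos_link F y)"
  have deg: "?t < real (deg (V - S) (pos_link F v) {})" if v: "v \<in> S" for v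
  proof -
    have "pos_link F v \<inter> nsets (V - S) (k - 1) = (\<lambda>u. {u}) ` nbrs (V - S) (pos_link F v) {}"
      using assms(1) by (auto simp: nbrs_def nsets_def card_1_singleton_iff)
    then have "card (pos_link F v \<inter> nsets (V - S) (k - 1)) = deg (V - S) (pos_link F v) {}"
      by (simp add: card_image)
    moreover have "d / 2 * n ^ (k - 1) \<le> real (card (pos_link F v \<inter> nsets (V - S) (k - 1)))"
      using S v assms(1,5) by (intro card_pos_link_avoiding_ge[OF assms(2)]) auto
    moreover have "?t < d / 2 * n" using assms(4) one_le_n by (intro mult_strict_right_mono) auto
    ultimately show ?thesis using assms(1) by simp
  qed
  have "?t\<^sup>2 / 8 \<le> real (card {C\<in>?common. {} \<subseteq> C})"
    using finite_V deg xy assms(5) by (intro card_common_above) (auto simp: nsets_def)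
  also have "\<dots> \<le> real (card (excluded k V S F))"
  proof (rule real_card_mono)
    show "{C\<in>?common. {} \<subseteq> C} \<subseteq> excluded k V S F"
      using assms(1,3) xy(1) by (auto simp: common_def excluded_def numeral_2_eq_2)
  qed (simp add: finite_V)
  also have "?t\<^sup>2 / 8 = d\<^sup>2 / 128 * n ^ k" by (simp add: assms(1) power_mult_distrib power_divide)
  finally show ?thesis .
qed

lemma atypical_singleton_eq_empty:
  assumes "k = 2" "F \<in> dense_forms k V s d" "x \<in> V" "b \<le> d"
  shows "atypical k V b {x} F = {}"
proof (rule ccontr)
  assume "atypical k V b {x} F \<noteq> {}"
  then obtain T where T: "T \<in> atypical k V b {x} F" by blast
  then have "T = {}" using atypical_subset[of k V b "{x}" F] assms(1) by (auto simp: nsets_def)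
  then have few: "real (card (extensions V (pos_clauses F) {x} {})) < b * n"
    using T by (simp add: atypical_def)
  have sub: "F \<subseteq> signed_pairs k V" using assms(2) dense_forms_subset sparse_forms_subset by blast
  have "pos_link F x \<subseteq> extensions V (pos_clauses F) {x} {}"
    using pos_link_subset[OF sub, of x] assms(1) by (auto simp: extensions_def pos_link_def)
  then have "real (card (pos_link F x)) \<le> real (card (extensions V (pos_clauses F) {x} {}))"
    using finite_V by (intro real_card_mono) auto
  moreover have "d * n \<le> real (card (pos_link F x))" using assms(1-3) by (auto simp: dense_forms_def)
  moreover have "b * n \<le> d * n" using assms(4) by (intro mult_right_mono) auto
  ultimately show False using few by linarith
qed

lemma dense_forms_2_cover:
  assumes "k = 2" "0 < d" "b \<le> d" "0 < \<xi>" "8 \<le> d * n"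
  shows "dense_forms k V s d \<subseteq>
    {F\<in>sparse_forms k V s. neg_clauses F = {}} \<union> excluding_forms k V s (d\<^sup>2 / 128) \<union> residual k V s b \<xi>"
proof
  fix F assume F: "F \<in> dense_forms k V s d"
  then have sparse: "F \<in> sparse_forms k V s" using dense_forms_subset by blast
  show "F \<in> {F\<in>sparse_forms k V s. neg_clauses F = {}} \<union> excluding_forms k V s (d\<^sup>2 / 128)
      \<union> residual k V s b \<xi>"
  proof (cases "F \<in> residual k V s b \<xi>")
    case False
    with sparse show ?thesis
    proof (cases rule: not_residual_cases)
      case (negative_clause S)
      then have "d\<^sup>2 / 128 * n ^ k \<le> real (card (excluded k V S F))"
        using F assms by (intro card_excluded_negative_2_clause_ge)
      moreover have "S \<subseteq> V" "S \<noteq> {}" "card S \<le> k" using negative_clause(1) assms(1) by (auto simp: nsets_def)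
      ultimately have "F \<in> excluding_forms k V s (d\<^sup>2 / 128)"
        unfolding excluding_forms_def using sparse by (intro CollectI conjI exI[of _ S])
      then show ?thesis by simp
    next
      case (many_atypical S)
      note S = proper_subsetsD[OF many_atypical(1) finite_V]
      then have "card S = 1" using assms(1) by simp
      then obtain x where "S = {x}" "x \<in> V" using S(2) by (auto simp: card_1_singleton_iff)
      then have "atypical k V b S F = {}" using atypical_singleton_eq_empty[OF assms(1) F _ assms(3)] by simp
      moreover have "0 \<le> \<xi> * n ^ (k - 1 - card S)" using assms(4) by simp
      ultimately show ?thesis using many_atypical(2) by simp
    qed (use sparse in simp)
  qed simp
qed

end

definition sign_graph :: "'a set \<Rightarrow> 'a set set \<Rightarrow> 'a form" where
  "sign_graph U G = (\<lambda>C. (C \<inter> U, C - U)) ` G"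

text \<open>In the assignment true on \<open>C - U\<close> and on \<open>U - C\<close> a signed set \<open>E\<close> is satisfied only if
  \<open>E \<subseteq> C\<close>.\<close>

lemma sign_graph_minimal:
  assumes "G \<subseteq> nsets V k" "U \<subseteq> V" shows "sign_graph U G \<in> minimal_forms k V"
proof -
  have "sign_graph U G \<subseteq> signed_pairs k V"
    using assms(1) by (auto simp: sign_graph_def signed_pairs_def Int_Diff_Un subset_iff)
  moreover have "\<exists>W\<subseteq>V. witness_set (sign_graph U G) p W" if p: "p \<in> sign_graph U G" for p
  proof -
    obtain C where C: "C \<in> G" "p = (C \<inter> U, C - U)" using p by (auto simp: sign_graph_def)
    let ?W = "(C - U) \<union> (U - C)"
    have satisfied_iff: "satisfied ?W (E \<inter> U, E - U) \<longleftrightarrow> E \<subseteq> C" for E by (auto simp: satisfied_def)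
    have "E = C" if "E \<in> G" "E \<subseteq> C" for E
    proof (rule card_subset_eq)
      show "finite C" "card E = card C" using that(1) C(1) assms(1) by (auto simp: nsets_def subset_iff)
    qed (rule that(2))
    then have "witness_set (sign_graph U G) p ?W"
      unfolding witness_set_def C(2) satisfied_iff by (auto simp: sign_graph_def satisfied_iff)
    moreover have "?W \<subseteq> V" using assms C(1) by (auto simp: nsets_def)
    ultimately show ?thesis by blast
  qed
  ultimately show ?thesis by (simp add: minimal_forms_def)
qed

lemma inj_on_sign_graph: "inj_on (\<lambda>(G, U). sign_graph U G) {(G, U). U \<subseteq> \<Union>G}"
proof (rule inj_on_inverseI)
  fix p :: "'a set set \<times> 'a set" assume "p \<in> {(G, U). U \<subseteq> \<Union>G}"
  then obtain G U where p: "p = (G, U)" "U \<subseteq> \<Union>G" by auto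
  have "(\<lambda>q. fst q \<union> snd q) ` sign_graph U G = G" by (simp add: sign_graph_def image_image Int_Diff_Un)
  moreover have "\<Union>(fst ` sign_graph U G) = U" using p(2) by (auto simp: sign_graph_def)
  ultimately show "(\<lambda>F. ((\<lambda>q. fst q \<union> snd q) ` F, \<Union>(fst ` F))) ((\<lambda>(G, U). sign_graph U G) p) = p"
    by (simp add: p(1))
qed

lemma card_graphs_without_isolated_vertices_ge:
  assumes "finite V" "4 \<le> card V"
  shows "2 ^ (card V choose 2) \<le> 2 * card {G. G \<subseteq> nsets V 2 \<and> \<Union>G = V}"
proof -
  let ?m = "card V" and ?Gs = "{G. G \<subseteq> nsets V 2 \<and> \<Union>G = V}"
  have fin: "finite ?Gs" using assms(1) by simp
  have "Pow (nsets V 2) \<subseteq> ?Gs \<union> (\<Union>x\<in>V. Pow (nsets (V - {x}) 2))"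
  proof
    fix G assume G: "G \<in> Pow (nsets V 2)"
    show "G \<in> ?Gs \<union> (\<Union>x\<in>V. Pow (nsets (V - {x}) 2))"
    proof (cases "\<Union>G = V")
      case False
      moreover have "\<Union>G \<subseteq> V" using G by (auto simp: nsets_def)
      ultimately obtain x where "x \<in> V" "\<forall>C\<in>G. x \<notin> C" by blast
      moreover from this have "G \<in> Pow (nsets (V - {x}) 2)" using G by (auto simp: nsets_def)
      ultimately show ?thesis by blast
    qed (use G in simp)
  qed
  then have "card (Pow (nsets V 2)) \<le> card ?Gs + card (\<Union>x\<in>V. Pow (nsets (V - {x}) 2))"
    using fin assms(1) by (intro card_le_card_add) auto
  also have "card (\<Union>x\<in>V. Pow (nsets (V - {x}) 2)) \<le> (\<Sum>x\<in>V. card (Pow (nsets (V - {x}) 2)))"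
    by (rule card_UN_le[OF assms(1)])
  also have "\<dots> = ?m * 2 ^ ((?m - 1) choose 2)" using assms(1) by (simp add: card_Pow)
  finally have graphs: "2 ^ (?m choose 2) \<le> card ?Gs + ?m * 2 ^ ((?m - 1) choose 2)"
    using assms(1) by (simp add: card_Pow)
  have "2 * m \<le> 2 ^ (m - 1)" if "4 \<le> m" for m :: nat
    using that
  proof (induction m rule: nat_induct_at_least)
    case (Suc m)
    have "2 * Suc m \<le> 2 * (2 * m)" using Suc.hyps by simp
    also have "\<dots> \<le> 2 * 2 ^ (m - 1)" using Suc.IH by (rule mult_le_mono2)
    also have "\<dots> = 2 ^ (Suc m - 1)" using Suc.hyps by (simp flip: power_Suc)
    finally show ?case .
  qed simp
  then have "2 * ?m * 2 ^ ((?m - 1) choose 2) \<le> 2 ^ (?m - 1) * 2 ^ ((?m - 1) choose 2)"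
    using assms(2) by (intro mult_right_mono) auto
  also have "\<dots> = 2 ^ ((?m - 1) + ((?m - 1) choose 2))" by (rule power_add[symmetric])
  also have "(?m - 1) + ((?m - 1) choose 2) = ?m choose 2"
    using assms(2) binomial_Suc_Suc[of "?m - 1" 1] by (simp add: numeral_2_eq_2)
  finally show ?thesis using graphs by linarith
qed

lemma card_minimal_formulae_2_ge:
  assumes "4 \<le> m"
  shows "2 powr (real (m choose 2) + real m - 1) \<le> real (card (minimal_formulae 2 m))"
proof -
  let ?V = "{1..m}"
  let ?Gs = "{G. G \<subseteq> nsets ?V 2 \<and> \<Union>G = ?V}"
  have "card ?Gs * 2 ^ m = card (?Gs \<times> Pow ?V)" by (simp add: card_cartesian_product card_Pow)
  also have "\<dots> \<le> card (minimal_forms 2 ?V)"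
  proof (rule card_inj_on_le)
    show "inj_on (\<lambda>(G, U). sign_graph U G) (?Gs \<times> Pow ?V)"
      by (rule inj_on_subset[OF inj_on_sign_graph]) auto
    show "(\<lambda>(G, U). sign_graph U G) ` (?Gs \<times> Pow ?V) \<subseteq> minimal_forms 2 ?V"
      using sign_graph_minimal[of _ ?V 2] by auto
  qed simp
  also have "\<dots> \<le> card (minimal_formulae 2 m)" using card_minimal_forms_le[of ?V 2] by simp
  finally have "2 * card ?Gs * 2 ^ m \<le> 2 * card (minimal_formulae 2 m)" by simp
  moreover have "2 ^ (m choose 2) * 2 ^ m \<le> 2 * card ?Gs * 2 ^ m"
    using card_graphs_without_isolated_vertices_ge[of ?V] assms by (intro mult_right_mono) auto
  ultimately have "real (2 ^ (m choose 2) * 2 ^ m) \<le> real (2 * card (minimal_formulae 2 m))"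
    unfolding of_nat_le_iff by linarith
  then show ?thesis by (simp add: powr_add powr_diff powr_realpow)
qed

definition bound_2 :: "nat \<Rightarrow> real \<Rightarrow> nat \<Rightarrow> real" where
  "bound_2 k c n = 2 ^ (n choose k) + 2 * exp2 ((1 - c) * real (n choose k))
     + exp2 (real k / 2 * (1 - c) * real (n choose (k - 1))) * real (card (minimal_formulae k (n - k)))"

lemma exp2_choose_2_minus_le:
  assumes "6 \<le> n"
  shows "exp2 (real (n choose 2) - c * real n)
      \<le> exp2 ((1 - c) * real n) * real (card (minimal_formulae 2 (n - 2)))"
proof -
  define m where "m = n - 2"
  then have m: "n = Suc (Suc m)" using assms by simp
  have "n choose 2 = (m choose 2) + 2 * m + 1" unfolding m by (simp add: numeral_2_eq_2)
  then have "real (n choose 2) - c * real n = (1 - c) * real n + (real (m choose 2) + real m - 1)"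
    using m by (simp add: algebra_simps)
  then have "exp2 (real (n choose 2) - c * real n)
      = exp2 ((1 - c) * real n) * 2 powr (real (m choose 2) + real m - 1)"
    by (simp only: exp2_def powr_add)
  also have "\<dots> \<le> exp2 ((1 - c) * real n) * real (card (minimal_formulae 2 m))"
    using assms m by (intro mult_left_mono card_minimal_formulae_2_ge) (auto simp: exp2_def)
  finally show ?thesis by (simp add: m)
qed

lemma card_dense_forms_le_bound_2:
  assumes "sparse_setting k V s e" "k = 2" "0 < d" "b \<le> d" "0 < \<xi>" "8 \<le> d * real (card V)" "6 \<le> card V"
    and "c \<le> d\<^sup>2 / 512" "c \<le> \<eta>"
    and excluding: "real (card (excluding_forms k V s (d\<^sup>2 / 128)))
        \<le> 2 powr ((1 - d\<^sup>2 / 512) * real (card V choose k))"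
    and residual: "real (card (residual k V s b \<xi>)) \<le> 2 powr (real (card V choose k) - \<eta> * real (card V))"
  shows "real (card (dense_forms k V s d)) \<le> bound_2 k c (card V)"
proof -
  interpret sparse_setting k V s e by (rule assms(1))
  let ?M = "{F\<in>sparse_forms k V s. neg_clauses F = {}}" and ?E = "excluding_forms k V s (d\<^sup>2 / 128)"
  have "card (dense_forms k V s d) \<le> card (?M \<union> ?E) + card (residual k V s b \<xi>)"
    using dense_forms_2_cover[OF assms(2-6)] finite_V
    by (intro card_le_card_add) (simp_all add: excluding_forms_def residual_def)
  also have "card (?M \<union> ?E) \<le> card ?M + card ?E" by (rule card_Un_le)
  also have "card ?M \<le> 2 ^ (card V choose k)" by (rule card_sparse_monotone_forms[OF finite_V])
  finally have "real (card (dense_forms k V s d))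
      \<le> real (2 ^ (card V choose k) + card ?E + card (residual k V s b \<xi>))"
    by (simp only: of_nat_le_iff)
  moreover have "2 powr ((1 - d\<^sup>2 / 512) * real (card V choose k)) \<le> exp2 ((1 - c) * real (card V choose k))"
    unfolding exp2_def using assms(8) by (intro powr_mono mult_right_mono) auto
  moreover have "2 powr (real (card V choose k) - \<eta> * n) \<le> exp2 (real (card V choose k) - c * n)"
    unfolding exp2_def using assms(9) by (intro powr_mono diff_left_mono mult_right_mono) auto
  moreover have "exp2 (real (card V choose k) - c * n)
      \<le> exp2 (real k / 2 * (1 - c) * real (card V choose (k - 1)))
        * real (card (minimal_formulae k (card V - k)))"
    using exp2_choose_2_minus_le[OF assms(7), of c] assms(2) by simp
  moreover have "0 \<le> exp2 ((1 - c) * real (card V choose k))" by (simp add: exp2_def)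
  ultimately show ?thesis unfolding bound_2_def using excluding residual by simp
qed

lemma exists_card_dense_forms_2_le:
  assumes "k = 2" "0 < d"
  shows "\<exists>\<zeta>>0. \<exists>c>0. \<forall>\<^sub>F V :: 'a set in large_sets.
    real (card (dense_forms k V (\<zeta> * real (card V)) d)) \<le> bound_2 k c (card V)"
proof -
  have k: "2 \<le> k" "1 \<le> k" using assms(1) by auto
  obtain b where b: "0 < b" "b \<le> d" and b_gain: "\<And>i. i \<in> {1..<k} \<Longrightarrow> b \<le> tuple_gain i * extension_rate k"
    using exists_atypicality_threshold[OF k(2) assms(2)] by blast
  obtain \<xi> \<eta>1 where \<xi>: "\<xi> > 0" and \<eta>1: "\<eta>1 > 0"
    and residual: "\<forall>\<^sub>F V :: 'a set in large_sets. \<forall>s. sparse_setting k V s \<eta>1 \<longrightarrow>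
      real (card (residual k V s b \<xi>)) \<le> 2 powr (real (card V choose k) - \<eta>1 * real (card V))"
    using exists_residual_bound[OF k(1) b(1) b_gain, where ?'a = 'a] by auto
  obtain \<eta>2 where \<eta>2: "\<eta>2 > 0"
    and excluding: "\<forall>\<^sub>F V :: 'a set in large_sets. \<forall>s. sparse_setting k V s \<eta>2 \<longrightarrow>
      real (card (excluding_forms k V s (d\<^sup>2 / 128))) \<le> 2 powr ((1 - d\<^sup>2 / 512) * real (card V choose k))"
    using exists_excluding_bound[OF k(1), of "d\<^sup>2 / 128"] assms(2) by auto
  obtain \<zeta> where \<zeta>: "\<zeta> > 0"
    and setting: "\<forall>\<^sub>F V :: 'a set in large_sets. sparse_setting k V (\<zeta> * real (card V)) (min \<eta>1 \<eta>2)"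
    using eventually_sparse_setting[of "min \<eta>1 \<eta>2" k] \<eta>1 \<eta>2 k by auto
  define c where "c = min (d\<^sup>2 / 512) \<eta>1"
  have c: "c > 0" "c \<le> d\<^sup>2 / 512" "c \<le> \<eta>1" using \<eta>1 assms(2) by (auto simp: c_def)
  have "\<forall>\<^sub>F V :: 'a set in large_sets. real (card (dense_forms k V (\<zeta> * real (card V)) d))
      \<le> bound_2 k c (card V)"
    using residual excluding setting eventually_large_sets_ge[of 6] eventually_large_sets_ge[of "8 / d"]
  proof eventually_elim
    case (elim V)
    have setting: "sparse_setting k V (\<zeta> * real (card V)) \<eta>1" "sparse_setting k V (\<zeta> * real (card V)) \<eta>2"
      by (rule sparse_setting_mono[OF elim(3)], simp)+
    have "8 \<le> d * real (card V)" "6 \<le> card V" using elim(4,5) assms(2) by (auto simp: field_simps)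
    then show ?case
      using elim(1,2) setting
      by (intro card_dense_forms_le_bound_2[OF setting(1) assms b(2) \<xi> _ _ c(2,3)]) auto
  qed
  then show ?thesis using \<zeta> c(1) by blast
qed

section \<open>Positive-dominant dense formulae have dense positive links\<close>

lemma card_sets_containing_times_le:
  assumes "finite V" "0 \<le> s" "x \<in> V" "t \<in> {1..<k}"
  shows "real (card {T. T \<subseteq> V \<and> x \<in> T \<and> card T = t}) * (1 + s * real (card V) ^ (k - 1 - t))
    \<le> (1 + s) * real (card V) ^ (k - 2)"
proof -
  let ?n = "real (card V)"
  have n_ge_1: "?n \<ge> 1" using assms(1,3) by (auto simp: Suc_le_eq card_gt_0_iff)
  obtain i where i: "t = Suc i" using assms(4) by (cases t) auto
  have "real (card {T. T \<subseteq> V \<and> x \<in> T \<and> card T = t}) \<le> real (card {T\<in>nsets V (Suc i). T \<inter> {x} \<noteq> {}})"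
    using assms(1) by (intro real_card_mono) (auto simp: nsets_def i dest: finite_subset)
  also have "\<dots> \<le> real (card {x}) * ?n ^ i" using assms(1,3) by (intro card_nsets_meeting) auto
  finally have "real (card {T. T \<subseteq> V \<and> x \<in> T \<and> card T = t}) * (1 + s * ?n ^ (k - 1 - t))
      \<le> ?n ^ i * (1 + s * ?n ^ (k - 1 - t))"
    using assms(2) by (intro mult_right_mono) auto
  also have "\<dots> = ?n ^ i + s * ?n ^ (i + (k - 1 - t))" by (simp add: power_add algebra_simps)
  also have "i + (k - 1 - t) = k - 2" using assms(4) i by auto
  also have "?n ^ i + s * ?n ^ (k - 2) \<le> ?n ^ (k - 2) + s * ?n ^ (k - 2)"
    using assms(4) i n_ge_1 by (intro add_right_mono power_increasing) auto
  also have "\<dots> = (1 + s) * ?n ^ (k - 2)" by (simp add: algebra_simps)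
  finally show ?thesis .
qed

lemma card_neg_clauses_containing_le:
  assumes "finite V" "F \<in> sparse_forms k V s" "0 \<le> s" "x \<in> V" "2 \<le> k"
  shows "real (card {p\<in>neg_clauses F. x \<in> snd p}) \<le> real k * ((1 + s) * real (card V) ^ (k - 2))"
proof -
  let ?n = "real (card V)" and ?J = "{T. T \<subseteq> V \<and> x \<in> T \<and> card T < k}"
  have finJ: "finite ?J" using assms(1) by simp
  have T: "card T \<in> {1..<k}" if "T \<in> ?J" for T
    using that finite_subset[OF _ assms(1), of T] by (auto simp: Suc_le_eq card_gt_0_iff)
  have loose: "neg_sides F {} T \<in> loose_families V (k - card T) s" for T
    using neg_sides_loose[OF assms(2), of "{}" T] by simp
  have fin: "finite (neg_sides F {} T)" for T
    using finite_subset[of "neg_sides F {} T" "nsets V (k - card T)"]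
      loose[of T] assms(1) by (simp add: loose_families_def)
  have "{p\<in>neg_clauses F. x \<in> snd p} \<subseteq> (\<Union>T\<in>?J. (\<lambda>S. (S, T)) ` neg_sides F {} T)"
  proof clarify
    fix S T assume ST: "(S, T) \<in> neg_clauses F" "x \<in> snd (S, T)"
    then have F: "(S, T) \<in> F" "S \<noteq> {}" by (auto simp: neg_clauses_def)
    note clause = signed_pairsD[OF subsetD[OF sparse_forms_subset[OF assms(2)] F(1)]]
    have "card S > 0" using clause(3) F(2) by (simp add: card_gt_0_iff)
    then have "T \<in> ?J" using clause ST(2) by auto
    then show "(S, T) \<in> (\<Union>T\<in>?J. (\<lambda>S. (S, T)) ` neg_sides F {} T)" using F(1) by (auto simp: neg_sides_def)
  qed
  then have "real (card {p\<in>neg_clauses F. x \<in> snd p}) \<le> real (card (\<Union>T\<in>?J. (\<lambda>S. (S, T)) ` neg_sides F {} T))"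
    using finJ fin by (intro real_card_mono) auto
  also have "\<dots> \<le> (\<Sum>T\<in>?J. real (card ((\<lambda>S. (S, T)) ` neg_sides F {} T)))" by (rule real_card_UN_le[OF finJ])
  also have "\<dots> \<le> (\<Sum>T\<in>?J. 1 + s * ?n ^ (k - 1 - card T))"
  proof (rule sum_mono)
    fix T assume "T \<in> ?J"
    then have "k - card T = Suc (k - 1 - card T)" by auto
    then have "real (card (neg_sides F {} T)) \<le> 1 + s * ?n ^ (k - 1 - card T)"
      using loose[of T] by (intro card_loose_family_le[OF assms(1) _ assms(3)]) simp
    moreover have "card ((\<lambda>S. (S, T)) ` neg_sides F {} T) \<le> card (neg_sides F {} T)"
      using fin by (rule card_image_le)
    ultimately show "real (card ((\<lambda>S. (S, T)) ` neg_sides F {} T)) \<le> 1 + s * ?n ^ (k - 1 - card T)"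
      by linarith
  qed
  also have "\<dots> \<le> real (card {1..<k}) * ((1 + s) * ?n ^ (k - 2))"
  proof (rule sum_by_card_le[OF finJ _ T])
    fix t assume t: "t \<in> {1..<k}"
    have "{T\<in>?J. card T = t} = {T. T \<subseteq> V \<and> x \<in> T \<and> card T = t}" using t by auto
    then show "real (card {T\<in>?J. card T = t}) * (1 + s * ?n ^ (k - 1 - t)) \<le> (1 + s) * ?n ^ (k - 2)"
      using card_sets_containing_times_le[OF assms(1,3,4) t] by simp
  qed auto
  also have "\<dots> \<le> real k * ((1 + s) * ?n ^ (k - 2))" using assms(3) by (intro mult_right_mono) auto
  finally show ?thesis .
qed

lemma card_clauses_containing_le:
  assumes "finite V" "F \<subseteq> signed_pairs k V"
  shows "card {p\<in>F. x \<in> snd p} \<le> card (pos_link F x) + card {p\<in>neg_clauses F. x \<in> snd p}"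
proof -
  have fin: "finite F" "finite (pos_link F x)"
    using finite_subset[OF assms(2)] finite_subset[OF pos_link_subset[OF assms(2)]] assms(1) by auto
  have "p \<in> (\<lambda>Q. ({}, insert x Q)) ` pos_link F x" if "p \<in> F" "x \<in> snd p" "fst p = {}" for p
  proof (rule image_eqI)
    show "p = ({}, insert x (snd p - {x}))" using that(2,3) by (auto simp: prod_eq_iff)
    show "snd p - {x} \<in> pos_link F x" using that
      by (cases p) (auto simp: pos_link_def pos_clauses_def insert_absorb)
  qed
  then have "{p\<in>F. x \<in> snd p} \<subseteq> (\<lambda>Q. ({}, insert x Q)) ` pos_link F x \<union> {p\<in>neg_clauses F. x \<in> snd p}"
    by (auto simp: neg_clauses_def)
  then have "card {p\<in>F. x \<in> snd p}
      \<le> card ((\<lambda>Q. ({} :: 'a set, insert x Q)) ` pos_link F x) + card {p\<in>neg_clauses F. x \<in> snd p}"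
    using fin by (intro card_le_card_add) (auto simp: neg_clauses_def)
  moreover have "card ((\<lambda>Q. ({} :: 'a set, insert x Q)) ` pos_link F x) \<le> card (pos_link F x)"
    by (rule card_image_le[OF fin(2)])
  ultimately show ?thesis by linarith
qed

lemma mem_var_image_iff: "x \<in> var ` C \<longleftrightarrow> Pos x \<in> C \<or> Neg x \<in> C"
proof -
  have "x = var l \<longleftrightarrow> l = Pos x \<or> l = Neg x" for l by (cases l) auto
  then show ?thesis by (auto simp: image_iff)
qed

lemma occurrences_Pos_eq_card: "occurrences \<Phi> (Pos x) = card {p\<in>split_clause ` \<Phi>. x \<in> snd p}"
proof -
  have "{p\<in>split_clause ` \<Phi>. x \<in> snd p} = split_clause ` {C\<in>\<Phi>. x \<in> snd (split_clause C)}"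
    by (rule Compr_image_eq)
  also have "{C\<in>\<Phi>. x \<in> snd (split_clause C)} = {C\<in>\<Phi>. Pos x \<in> C}" by (simp add: split_clause_def)
  finally have "{p\<in>split_clause ` \<Phi>. x \<in> snd p} = split_clause ` {C\<in>\<Phi>. Pos x \<in> C}" .
  moreover have "inj_on split_clause {C\<in>\<Phi>. Pos x \<in> C}" by (rule inj_on_subset[OF inj_split_clause]) simp
  ultimately show ?thesis by (simp add: occurrences_def card_image)
qed

lemma occurrences_Pos_ge:
  assumes "\<Phi> \<in> I1_star k n z" "x \<in> {1..n}"
  shows "1 / (20 * real k) * real ((n - 1) choose (k - 1)) \<le> real (occurrences \<Phi> (Pos x))"
proof -
  have "{C\<in>\<Phi>. x \<in> var ` C} = {C\<in>\<Phi>. Pos x \<in> C} \<union> {C\<in>\<Phi>. Neg x \<in> C}" by (auto simp: mem_var_image_iff)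
  then have "card {C\<in>\<Phi>. x \<in> var ` C} \<le> occurrences \<Phi> (Pos x) + occurrences \<Phi> (Neg x)"
    by (simp add: occurrences_def card_Un_le)
  moreover have "occurrences \<Phi> (Neg x) \<le> occurrences \<Phi> (Pos x)"
    using assms by (auto simp: I1_star_def positive_dominant_def)
  moreover have "1 / (10 * real k) * real ((n - 1) choose (k - 1)) \<le> real (card {C\<in>\<Phi>. x \<in> var ` C})"
    using assms by (auto simp: I1_star_def dense_formula_def)
  ultimately show ?thesis by simp
qed

definition density :: "nat \<Rightarrow> real" where
  "density k = 1 / (80 * real k * (2 * real k) ^ (k - 1))"

lemma density_pos: "1 \<le> k \<Longrightarrow> 0 < density k"
  by (simp add: density_def)

lemma density_le_choose:
  assumes "2 \<le> k" "k \<le> n"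
  shows "4 * density k * real n ^ (k - 1) \<le> 1 / (20 * real k) * real ((n - 1) choose (k - 1))"
proof -
  have "(real n / (2 * real k)) ^ (k - 1) \<le> (real (n - 1) / real (k - 1)) ^ (k - 1)"
  proof (rule power_mono)
    have "real n / 2 \<le> real (n - 1)" using assms by (simp add: of_nat_diff)
    then have "real n / 2 / real k \<le> real (n - 1) / real (k - 1)" using assms(1) by (intro frac_le) auto
    then show "real n / (2 * real k) \<le> real (n - 1) / real (k - 1)" by simp
  qed simp
  also have "\<dots> \<le> real ((n - 1) choose (k - 1))" using assms(2) by (intro binomial_ge_n_over_k_pow_k) simp
  finally have "1 / (20 * real k) * (real n / (2 * real k)) ^ (k - 1)
      \<le> 1 / (20 * real k) * real ((n - 1) choose (k - 1))"
    by (intro mult_left_mono) auto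
  then show ?thesis by (simp add: density_def power_divide power_mult_distrib mult_ac)
qed

lemma split_clause_image_dense:
  assumes "\<Phi> \<in> I1_star k n z" "2 \<le> k" "k \<le> n" "0 < z" "real k * z \<le> density k" "real k \<le> density k * real n"
  shows "split_clause ` \<Phi> \<in> dense_forms k {1..n} (z * real n) (density k)"
proof -
  let ?F = "split_clause ` \<Phi>" and ?d = "density k" and ?N = "real n ^ (k - 1)"
  have sparse: "?F \<in> sparse_forms k {1..n} (z * real n)"
    using assms(1) by (intro split_clause_image_sparse) (auto simp: I1_star_def)
  have "?d * ?N \<le> real (card (pos_link ?F x))" if x: "x \<in> {1..n}" for x
  proof -
    have "4 * ?d * ?N \<le> real (card {p\<in>?F. x \<in> snd p})"
      using density_le_choose[OF assms(2,3)] occurrences_Pos_ge[OF assms(1) x]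
      by (simp add: occurrences_Pos_eq_card)
    also have "\<dots> \<le> real (card (pos_link ?F x)) + real (card {p\<in>neg_clauses ?F. x \<in> snd p})"
      using card_clauses_containing_le[OF _ sparse_forms_subset[OF sparse], of x]
      by (simp only: of_nat_add[symmetric] of_nat_le_iff finite_atLeastAtMost)
    also have "real (card {p\<in>neg_clauses ?F. x \<in> snd p}) \<le> real k * ((1 + z * real n) * real n ^ (k - 2))"
      using card_neg_clauses_containing_le[OF _ sparse _ x assms(2)] assms(4) by simp
    also have "\<dots> \<le> 2 * ?d * ?N"
    proof -
      have "k - 1 = Suc (k - 2)" using assms(2) by simp
      then have N: "?N = real n * real n ^ (k - 2)" by (simp only: power_Suc)
      have "real k * real n ^ (k - 2) \<le> ?d * real n * real n ^ (k - 2)"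
        using assms(6) by (intro mult_right_mono) auto
      moreover have "real k * z * ?N \<le> ?d * ?N" using assms(5) by (intro mult_right_mono) auto
      moreover have "real k * ((1 + z * real n) * real n ^ (k - 2))
          = real k * real n ^ (k - 2) + real k * z * ?N"
        unfolding N by (simp add: algebra_simps)
      moreover have "?d * real n * real n ^ (k - 2) = ?d * ?N" unfolding N by simp
      ultimately show ?thesis by linarith
    qed
    finally have "2 * ?d * ?N \<le> real (card (pos_link ?F x))" by simp
    moreover have "0 \<le> ?d * ?N" using density_pos[of k] assms(2) by simp
    ultimately show ?thesis by linarith
  qed
  then show ?thesis using sparse by (simp add: dense_forms_def)
qed

lemma dense_forms_mono: "s \<le> s' \<Longrightarrow> dense_forms k V s d \<subseteq> dense_forms k V s' d"
  using sparse_forms_mono[of s s' k V] by (auto simp: dense_forms_def)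

lemma I1_star_subset_of_small:
  assumes "1 \<le> k" "z * real n \<le> 1" shows "I1_star k n z \<subseteq> {{}}"
proof
  fix \<Phi> assume \<Phi>: "\<Phi> \<in> I1_star k n z"
  then have clauses: "\<Phi> \<subseteq> clauses k n" by (auto simp: I1_star_def minimal_formulae_def formulae_def)
  have in_range: "x \<in> {1..n}" if "C \<in> \<Phi>" "Pos x \<in> C \<or> Neg x \<in> C" for C x
  proof -
    have "var ` C \<subseteq> {1..n}" using that(1) clauses by (auto simp: clauses_def)
    then show ?thesis using that(2) by (auto simp: mem_var_image_iff[symmetric])
  qed
  have no_Pos: "Pos x \<notin> C" if C: "C \<in> \<Phi>" for C x
  proof
    assume x: "Pos x \<in> C"
    obtain a where a: "witness \<Phi> C a" "real (card {x\<in>{1..n}. a x}) < z * real n"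
      using \<Phi> C by (auto simp: I1_star_def sparsely_minimal_def)
    then have "real (card {x\<in>{1..n}. a x}) < 1" using assms(2) by linarith
    then have "{x\<in>{1..n}. a x} = {}" by simp
    moreover have "a x" using a(1) x by (auto simp: witness_def satisfies_def)
    ultimately show False using in_range[OF C] x by blast
  qed
  have "\<Phi> = {}"
  proof (rule ccontr)
    assume "\<Phi> \<noteq> {}"
    then obtain C where C: "C \<in> \<Phi>" by blast
    then have "C \<noteq> {}" using clauses assms(1) by (auto simp: clauses_def)
    then obtain l where "l \<in> C" by blast
    then obtain x where x: "Neg x \<in> C" using no_Pos[OF C] by (cases l) auto
    have "occurrences \<Phi> (Neg x) \<le> occurrences \<Phi> (Pos x)"
      using \<Phi> in_range[OF C] x by (auto simp: I1_star_def positive_dominant_def)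
    moreover have "{D\<in>\<Phi>. Pos x \<in> D} = {}" using no_Pos by auto
    ultimately have "card {D\<in>\<Phi>. Neg x \<in> D} = 0" by (simp add: occurrences_def)
    moreover have "finite \<Phi>" by (rule finite_subset[OF clauses finite_clauses])
    ultimately show False using C x by auto
  qed
  then show "\<Phi> \<in> {{}}" by simp
qed

text \<open>For the finitely many small \<open>n\<close> it suffices to shrink \<open>\<zeta>\<close> below \<open>1 / n\<close>: then witnesses are
  identically zero and only the empty formula is left.\<close>

lemma exists_card_I1_star_le:
  assumes "2 \<le> k" "0 < \<zeta>" and one_le: "\<And>n. 1 \<le> R n"
    and bound: "\<forall>\<^sub>F V :: nat set in large_sets.
      real (card (dense_forms k V (\<zeta> * real (card V)) (density k))) \<le> R (card V)"
  shows "\<exists>\<zeta>'>0. \<forall>n. real (card (I1_star k n \<zeta>')) \<le> R n"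
proof -
  have d: "density k > 0" using assms(1) by (intro density_pos) simp
  obtain N0 where N0: "\<And>V :: nat set. finite V \<Longrightarrow> N0 \<le> card V \<Longrightarrow>
      real (card (dense_forms k V (\<zeta> * real (card V)) (density k))) \<le> R (card V)"
    using bound by (auto simp: eventually_large_sets_iff)
  obtain N1 where N1: "real k / density k \<le> real N1" using real_arch_simple by blast
  define N where "N = Max {N0, N1, k}"
  have N: "N0 \<le> N" "N1 \<le> N" "k \<le> N" by (auto simp: N_def)
  define \<zeta>' where "\<zeta>' = Min {\<zeta>, density k / real k, 1 / (real N + 1)}"
  have \<zeta>': "\<zeta>' > 0" using assms(1,2) d by (simp add: \<zeta>'_def)
  have \<zeta>'_le: "\<zeta>' \<le> \<zeta>" "\<zeta>' \<le> density k / real k" "\<zeta>' \<le> 1 / (real N + 1)" by (auto simp: \<zeta>'_def)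
  have "real (card (I1_star k n \<zeta>')) \<le> R n" for n
  proof (cases "N \<le> n")
    case True
    have "real k / density k \<le> real n" using N1 N(2) True by linarith
    then have n: "real k \<le> density k * real n" using d by (simp add: field_simps)
    have "real k * \<zeta>' \<le> density k" using \<zeta>'_le(2) assms(1) by (simp add: field_simps)
    then have "image split_clause ` I1_star k n \<zeta>' \<subseteq> dense_forms k {1..n} (\<zeta>' * real n) (density k)"
      using True N(3) assms(1) \<zeta>' n by (intro image_subsetI split_clause_image_dense) auto
    also have "\<dots> \<subseteq> dense_forms k {1..n} (\<zeta> * real n) (density k)"
      using \<zeta>'_le(1) by (intro dense_forms_mono mult_right_mono) auto
    finally have "card (I1_star k n \<zeta>') \<le> card (dense_forms k {1..n} (\<zeta> * real n) (density k))"
      by (intro card_inj_on_le[OF inj_on_subset[OF inj_on_image_Pow[OF inj_split_clause]]]) auto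
    then show ?thesis using N0[of "{1..n}"] N(1) True by simp
  next
    case False
    have "\<zeta>' * real n \<le> 1 / (real N + 1) * (real N + 1)" using False \<zeta>'_le(3) by (intro mult_mono) auto
    then have "I1_star k n \<zeta>' \<subseteq> {{}}" using assms(1) by (intro I1_star_subset_of_small) auto
    then have "card (I1_star k n \<zeta>') \<le> card {{} :: formula}" by (intro card_mono) auto
    then show ?thesis using one_le[of n] by simp
  qed
  then show ?thesis using \<zeta>' by blast
qed

lemma one_le_bound_ge_3: "1 \<le> bound_ge_3 k c n"
proof -
  have "1 \<le> (2::real) ^ (n choose k)" by (rule one_le_power) simp
  then show ?thesis
    unfolding bound_ge_3_def add.assoc by (rule add_increasing2[rotated])
      (auto simp: exp2_def intro!: add_nonneg_nonneg sum_nonneg)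
qed

lemma one_le_bound_2: "1 \<le> bound_2 k c n"
proof -
  have "1 \<le> (2::real) ^ (n choose k)" by (rule one_le_power) simp
  then show ?thesis
    unfolding bound_2_def add.assoc by (rule add_increasing2[rotated]) (auto simp: exp2_def)
qed

theorem theorem6p1:
  fixes k :: nat
  shows "(k \<ge> 3 \<longrightarrow> (\<exists>\<zeta>>0. \<exists>c>0. \<forall>n::nat.
           real (card (I1_star k n \<zeta>)) \<le>
             2 ^ (n choose k)
             + exp2 ((1 - c) * real (n choose k))
             + (\<Sum>i=1..k-2. exp2 (real i * (1 - c) * real (n choose (k - 1)))
                              * real (card (minimal_formulae k (n - i))))
             + exp2 (real k / 2 * (1 - c) * real (n choose (k - 1)))
                 * real (card (minimal_formulae k (n - k)))
             + exp2 (real (n choose k) - c * real n)))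
       \<and> (k = 2 \<longrightarrow> (\<exists>\<zeta>>0. \<exists>c>0. \<forall>n::nat.
           real (card (I1_star k n \<zeta>)) \<le>
             2 ^ (n choose k)
             + 2 * exp2 ((1 - c) * real (n choose k))
             + exp2 (real k / 2 * (1 - c) * real (n choose (k - 1)))
                 * real (card (minimal_formulae k (n - k)))))"
  unfolding bound_ge_3_def[symmetric] bound_2_def[symmetric]
proof (intro conjI impI)
  assume k: "k \<ge> 3"
  then have "0 < density k" by (intro density_pos) simp
  then obtain \<zeta> c where "0 < \<zeta>" "0 < c"
    "\<forall>\<^sub>F V :: nat set in large_sets. real (card (dense_forms k V (\<zeta> * real (card V)) (density k)))
        \<le> bound_ge_3 k c (card V)"
    using exists_card_dense_forms_le[OF k] by blast
  then show "\<exists>\<zeta>>0. \<exists>c>0. \<forall>n. real (card (I1_star k n \<zeta>)) \<le> bound_ge_3 k c n"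
    using exists_card_I1_star_le[of k \<zeta> "bound_ge_3 k c"] one_le_bound_ge_3 k by auto
next
  assume k: "k = 2"
  then have "0 < density k" by (intro density_pos) simp
  then obtain \<zeta> c where "0 < \<zeta>" "0 < c"
    "\<forall>\<^sub>F V :: nat set in large_sets. real (card (dense_forms k V (\<zeta> * real (card V)) (density k)))
        \<le> bound_2 k c (card V)"
    using exists_card_dense_forms_2_le[OF k] by blast
  then show "\<exists>\<zeta>>0. \<exists>c>0. \<forall>n. real (card (I1_star k n \<zeta>)) \<le> bound_2 k c n"
    using exists_card_I1_star_le[of k \<zeta> "bound_2 k c"] one_le_bound_2 k by auto
qed

end
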